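(* Let $k\in[0,1)$ and let $\phi\colon\mathbb{R}\to\mathbb{R}$ be a $k$-quasisymmetric map. Let $E\subset\mathbb{R}$ be a set with Hausdorff dimension $\dim E=\delta$. Then $$\Delta(\delta,k)\le \dim\phi(E)\le \Delta^*(\delta,k),$$ where $$\Delta(\delta,k)=\frac{\delta(1-k^2)}{(1+k\sqrt{1-\delta})^2},\qquad \Delta^*(\delta,k)=\Delta\bigl(\delta,-\min\{k,\sqrt{1-\delta}\}\bigr).$$
   Context: A homeomorphism $\phi\colon\Omega\to\Omega'$ between planar domains is $k$-quasiconformal ($0\le k<1$) if $\phi\in W^{1,2}_{\mathrm{loc}}(\Omega)$ and $\bar\partial\phi(z)=\mu(z)\,\partial\phi(z)$ for a.e. $z\in\Omega$, with a measurable coefficient $\mu$ satisfying $\|\mu\|_\infty\le k$. An increasing homeomorphism $\phi\colon\mathbb{R}\to\mathbb{R}$ is called $k$-quasisymmetric if it can be extended to a $k$-quasiconformal map $\mathbb{C}\to\mathbb{C}$ (the extension may, without loss in $k$, be taken symmetric: $\phi(z)=\overline{\phi(\bar z)}$). The function $\Delta(\delta,k)$ is defined by the displayed formula for $\delta\in[0,1]$ and $k\in[-1,1]$, so it may be evaluated at a negative second argument. Here $\dim$ denotes Hausdorff dimension. *)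

theory Defs
  imports "HOL-Analysis.Analysis"
begin

subsection \<open>Hausdorff dimension\<close>

text \<open>The summand \<open>(diam U)\<^sup>s\<close> with the conventions that \<open>(diam {})\<^sup>s = 0\<close> for all \<open>s\<close> and
  \<open>(diam U)\<^sup>0 = 1\<close> for \<open>U\<close> nonempty; these need care because \<open>0 powr 0 = 0\<close>.\<close>

definition hausdorff_gauge :: "real \<Rightarrow> 'a::metric_space set \<Rightarrow> ennreal" where
  "hausdorff_gauge s U =
     (if U = {} then 0 else if s = 0 then 1 else ennreal (diameter U powr s))"

text \<open>Boundedness of the covering sets is required explicitly, since \<^const>\<open>diameter\<close> is
  unspecified on unbounded sets.\<close>

definition hausdorff_premeasure :: "real \<Rightarrow> real \<Rightarrow> 'a::metric_space set \<Rightarrow> ennreal" where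
  "hausdorff_premeasure s r A =
     (INF U \<in> {U :: nat \<Rightarrow> 'a set.
                 (\<forall>i. bounded (U i) \<and> diameter (U i) \<le> r) \<and> A \<subseteq> (\<Union>i. U i)}.
        \<Sum>i. hausdorff_gauge s (U i))"

definition hausdorff_measure :: "real \<Rightarrow> 'a::metric_space set \<Rightarrow> ennreal" where
  "hausdorff_measure s A = (SUP r \<in> {0<..}. hausdorff_premeasure s r A)"

definition hausdorff_dim :: "'a::metric_space set \<Rightarrow> ereal" where
  "hausdorff_dim A = (INF s \<in> {s. 0 \<le> s \<and> hausdorff_measure s A = 0}. ereal s)"


subsection \<open>Local Sobolev functions on planar open sets\<close>

text \<open>\<open>C_diff n f\<close>: \<open>f\<close> is of class \<open>C\<^sup>n\<close> on the plane; \<open>fx\<close> and \<open>fy\<close> are the partial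
  derivatives with respect to the real and the imaginary part.\<close>

primrec C_diff :: "nat \<Rightarrow> (complex \<Rightarrow> real) \<Rightarrow> bool" where
  "C_diff 0 f \<longleftrightarrow> continuous_on UNIV f"
| "C_diff (Suc n) f \<longleftrightarrow>
     (\<exists>fx fy. (\<forall>z. (f has_derivative (\<lambda>h. Re h * fx z + Im h * fy z)) (at z))
              \<and> C_diff n fx \<and> C_diff n fy)"

definition test_function :: "complex set \<Rightarrow> (complex \<Rightarrow> real) \<Rightarrow> bool" where
  "test_function \<Omega> \<psi> \<longleftrightarrow>
     (\<forall>n. C_diff n \<psi>) \<and> compact (closure {z. \<psi> z \<noteq> 0}) \<and> closure {z. \<psi> z \<noteq> 0} \<subseteq> \<Omega>"

definition L2_loc :: "complex set \<Rightarrow> (complex \<Rightarrow> complex) \<Rightarrow> bool" where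
  "L2_loc \<Omega> f \<longleftrightarrow>
     f \<in> borel_measurable (lebesgue_on \<Omega>) \<and>
     (\<forall>K. compact K \<and> K \<subseteq> \<Omega> \<longrightarrow> set_integrable lebesgue K (\<lambda>z. (norm (f z))\<^sup>2))"

text \<open>\<open>g\<close> is the distributional derivative of \<open>f\<close> in direction \<open>e\<close>. For \<open>f\<close> and \<open>g\<close> locally
  square integrable, both integrals exist.\<close>

definition weak_derivative ::
    "complex set \<Rightarrow> complex \<Rightarrow> (complex \<Rightarrow> complex) \<Rightarrow> (complex \<Rightarrow> complex) \<Rightarrow> bool" where
  "weak_derivative \<Omega> e f g \<longleftrightarrow>
     (\<forall>\<psi>. test_function \<Omega> \<psi> \<longrightarrow>
        (LINT z:\<Omega>|lebesgue. frechet_derivative \<psi> (at z) e *\<^sub>R f z)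
          = - (LINT z:\<Omega>|lebesgue. \<psi> z *\<^sub>R g z))"

text \<open>\<open>f\<close> belongs to \<open>W\<^sup>1\<^sup>,\<^sup>2\<close> locally on \<open>\<Omega>\<close>, with weak partial derivatives \<open>fx\<close> and \<open>fy\<close>
  (which are unique up to null sets).\<close>

definition W12_loc ::
    "complex set \<Rightarrow> (complex \<Rightarrow> complex) \<Rightarrow> (complex \<Rightarrow> complex) \<Rightarrow> (complex \<Rightarrow> complex) \<Rightarrow> bool"
  where
  "W12_loc \<Omega> f fx fy \<longleftrightarrow>
     L2_loc \<Omega> f \<and> L2_loc \<Omega> fx \<and> L2_loc \<Omega> fy \<and>
     weak_derivative \<Omega> 1 f fx \<and> weak_derivative \<Omega> \<i> f fy"


subsection \<open>Quasiconformal and quasisymmetric maps\<close>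

definition quasiconformal ::
    "real \<Rightarrow> complex set \<Rightarrow> complex set \<Rightarrow> (complex \<Rightarrow> complex) \<Rightarrow> bool" where
  "quasiconformal k \<Omega> \<Omega>' \<phi> \<longleftrightarrow>
     0 \<le> k \<and> k < 1 \<and>
     open \<Omega> \<and> connected \<Omega> \<and> \<Omega> \<noteq> {} \<and> open \<Omega>' \<and> connected \<Omega>' \<and> \<Omega>' \<noteq> {} \<and>
     (\<exists>g. homeomorphism \<Omega> \<Omega>' \<phi> g) \<and>
     (\<exists>\<phi>x \<phi>y \<mu>.
        W12_loc \<Omega> \<phi> \<phi>x \<phi>y \<and>
        \<mu> \<in> borel_measurable (lebesgue_on \<Omega>) \<and>
        (AE z in lebesgue_on \<Omega>. norm (\<mu> z) \<le> k) \<and>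
        (AE z in lebesgue_on \<Omega>.
           (\<phi>x z + \<i> * \<phi>y z) / 2 = \<mu> z * ((\<phi>x z - \<i> * \<phi>y z) / 2)))"

definition quasisymmetric :: "real \<Rightarrow> (real \<Rightarrow> real) \<Rightarrow> bool" where
  "quasisymmetric k \<phi> \<longleftrightarrow>
     strict_mono \<phi> \<and> (\<exists>g. homeomorphism UNIV UNIV \<phi> g) \<and>
     (\<exists>\<Phi>. quasiconformal k UNIV UNIV \<Phi> \<and> (\<forall>x. \<Phi> (of_real x) = of_real (\<phi> x)))"


subsection \<open>The distortion bounds\<close>

definition Delta :: "real \<Rightarrow> real \<Rightarrow> real" where
  "Delta \<delta> k = \<delta> * (1 - k\<^sup>2) / (1 + k * sqrt (1 - \<delta>))\<^sup>2"

definition Delta_star :: "real \<Rightarrow> real \<Rightarrow> real" where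
  "Delta_star \<delta> k = Delta \<delta> (- min k (sqrt (1 - \<delta>)))"

end

theory Submission
  imports Defs "HOL-Complex_Analysis.Complex_Analysis"
begin

text \<open>After an affine normalisation, a \<open>k\<close>-quasisymmetric map is, for every \<open>k' > k\<close>, the time-\<open>k'\<close>
  value on the real line of a holomorphic motion over the unit disk that is symmetric under conjugation.
  For Beltrami coefficients that are trigonometric polynomials the motion comes from a Neumann series
  whose terms are again trigonometric polynomials; the general case follows by approximation, and
  the limit is identified by applying Weyl's lemma to the quasiconformal extension composed with the
  limit of the inverse motions, which is then affine by reflection.

  Fix weights \<open>p\<^sub>i\<close> on finitely many separated intervals, and let \<open>R\<^sub>i(\<lambda>)\<close> be their moving lengths.
  The areas of disjoint disks and, for real \<open>\<lambda>\<close>, the lengths of disjoint intervals bound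
  \<open>\<Sum> R\<^sub>i(\<lambda>)\<^sup>2\<close> and \<open>\<Sum> R\<^sub>i(\<lambda>)\<close>. By Gibbs' inequality, with \<open>I = - \<Sum> p\<^sub>i ln p\<^sub>i\<close> and
  \<open>\<Lambda>(\<lambda>) = - \<Sum> p\<^sub>i ln R\<^sub>i(\<lambda>)\<close>, the function \<open>2 \<Lambda> / I - 1\<close> is the real part of a holomorphic
  function with values in the right half plane, and it is at least \<open>1\<close> on the real diameter. The
  Schwarz-Pick lemma controls its decay along the diameter, which is the change of dimension
  \<open>1 - l\<^sup>2 \<mapsto> 1 - ((l - k) / (1 - k l))\<^sup>2\<close> of the upper bound. The lower bound is the upper bound for
  the inverse map, which comes from the same motion by a disk involution that exchanges \<open>0\<close> and \<open>k\<close>.\<close>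

section \<open>Trigonometric polynomials and Fourier coefficients\<close>

text \<open>Put f_z = exp g. Then f_zbar = l mu f_z becomes g_zbar = l (mu_z + mu g_z), the
  closedness condition for f_x dx + f_y dy. Solving for g keeps f_z free of zeros from the start, so
  f is a local diffeomorphism and a global inverse theorem makes it bijective. For doubly periodic
  mu the passage from g_zbar to g_z is a Fourier multiplier of modulus one, so Parseval alone makes
  the Neumann series converge for all |l| < 1. The obstacle is the zero frequency, which no
  zbar-derivative can produce.

  Periodic coefficients must then be replaced by arbitrary ones, and the uniform control this takes
  comes from Schottky's theorem: cross-ratios of points in a motion omit 0 and 1, which yields
  boundedness, equicontinuity, properness and the comparison of lengths with constants independent
  of the motion. The gap between k and k' is the room for approximating mu / k' by coefficients of
  norm at most 1. In the coordinate sqrt (1 - dimension) the distortion bounds are hyperbolic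
  translations.\<close>

definition tchar :: "int \<times> int \<Rightarrow> complex \<Rightarrow> complex" where
  "tchar p z = cis (of_int (fst p) * Re z + of_int (snd p) * Im z)"

definition tbox :: "nat \<Rightarrow> (int \<times> int) set" where
  "tbox d = {- int d..int d} \<times> {- int d..int d}"

definition tpoly :: "nat \<Rightarrow> (int \<times> int \<Rightarrow> complex) \<Rightarrow> complex \<Rightarrow> complex" where
  "tpoly d a z = (\<Sum>p\<in>tbox d. a p * tchar p z)"

text \<open>Real differentiability with both partials named, so that algebra and the chain rule act
  on explicit formulas. The Wirtinger derivatives are \<open>(fx - \<i> * fy) / 2\<close> and
  \<open>(fx + \<i> * fy) / 2\<close>.\<close>

definition has_partials :: "(complex \<Rightarrow> complex) \<Rightarrow> (complex \<Rightarrow> complex) \<Rightarrow> (complex \<Rightarrow> complex) \<Rightarrow> bool" where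
  "has_partials f fx fy \<longleftrightarrow>
     (\<forall>z. (f has_derivative (\<lambda>h. of_real (Re h) * fx z + of_real (Im h) * fy z)) (at z))"

text \<open>An iterated integral, so that the fundamental theorem of calculus applies directly in
  the inner variable.\<close>

definition torus_int :: "(complex \<Rightarrow> complex) \<Rightarrow> complex" where
  "torus_int V = integral {0..2*pi} (\<lambda>y. integral {0..2*pi} (\<lambda>x. V (Complex x y)))"

lemma finite_tbox [simp]: "finite (tbox d)" by (simp add: tbox_def)

lemma norm_tchar [simp]: "norm (tchar p z) = 1" by (simp add: tchar_def)

lemma tchar_mult: "tchar p z * tchar q z = tchar (p + q) z"
  by (simp add: tchar_def cis_mult algebra_simps)

lemma cnj_tchar: "cnj (tchar p z) = tchar (- p) z"
  by (simp add: tchar_def cis_cnj)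

lemma has_partials_continuous: "has_partials f fx fy \<Longrightarrow> continuous_on S f"
  unfolding has_partials_def by (meson continuous_at_imp_continuous_on has_derivative_continuous)

lemma has_partials_const: "has_partials (\<lambda>z. c) (\<lambda>z. 0) (\<lambda>z. 0)"
  by (simp add: has_partials_def)

lemma has_partials_add:
  assumes "has_partials f fx fy" "has_partials g gx gy"
  shows "has_partials (\<lambda>z. f z + g z) (\<lambda>z. fx z + gx z) (\<lambda>z. fy z + gy z)"
  unfolding has_partials_def
  by (auto intro!: has_derivative_eq_rhs[OF has_derivative_add[OF assms[unfolded has_partials_def, rule_format]]] simp: algebra_simps)

lemma has_partials_mult:
  assumes "has_partials f fx fy" "has_partials g gx gy"
  shows "has_partials (\<lambda>z. f z * g z) (\<lambda>z. f z * gx z + fx z * g z) (\<lambda>z. f z * gy z + fy z * g z)"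
  unfolding has_partials_def
  by (auto intro!: has_derivative_eq_rhs[OF has_derivative_mult[OF assms[unfolded has_partials_def, rule_format]]] simp: algebra_simps)

lemma has_partials_cmult:
  assumes "has_partials f fx fy"
  shows "has_partials (\<lambda>z. c * f z) (\<lambda>z. c * fx z) (\<lambda>z. c * fy z)"
  using has_partials_mult[OF has_partials_const assms, of c] by simp

lemma has_partials_sum:
  assumes "\<And>i. i \<in> I \<Longrightarrow> has_partials (f i) (fx i) (fy i)"
  shows "has_partials (\<lambda>z. \<Sum>i\<in>I. f i z) (\<lambda>z. \<Sum>i\<in>I. fx i z) (\<lambda>z. \<Sum>i\<in>I. fy i z)"
proof (cases "finite I")
  case True
  from this assms show ?thesis
    by (induction I rule: finite_induct) (auto simp: has_partials_const intro!: has_partials_add)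
qed (simp add: has_partials_const)

lemma has_partials_exp:
  assumes "has_partials f fx fy"
  shows "has_partials (\<lambda>z. exp (f z)) (\<lambda>z. exp (f z) * fx z) (\<lambda>z. exp (f z) * fy z)"
  unfolding has_partials_def
proof
  fix z
  have "((\<lambda>z. exp (f z)) has_derivative (\<lambda>h. exp (f z) * (of_real (Re h) * fx z + of_real (Im h) * fy z))) (at z)"
    using diff_chain_at[OF assms[unfolded has_partials_def, rule_format, of z] DERIV_exp[THEN DERIV_subset[of _ _ _ UNIV], unfolded has_field_derivative_def, OF subset_UNIV]]
    by (simp add: o_def)
  then show "((\<lambda>z. exp (f z)) has_derivative (\<lambda>h. of_real (Re h) * (exp (f z) * fx z) + of_real (Im h) * (exp (f z) * fy z))) (at z)"
    by (rule has_derivative_eq_rhs) (auto simp: algebra_simps)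
qed

lemma has_partials_tchar:
  "has_partials (tchar p) (\<lambda>z. \<i> * of_int (fst p) * tchar p z) (\<lambda>z. \<i> * of_int (snd p) * tchar p z)"
  unfolding has_partials_def
proof
  fix z
  have "has_partials (\<lambda>z. \<i> * (of_int (fst p) * of_real (Re z) + of_int (snd p) * of_real (Im z)))
     (\<lambda>z. \<i> * of_int (fst p)) (\<lambda>z. \<i> * of_int (snd p))"
    unfolding has_partials_def by (auto intro!: derivative_eq_intros simp: algebra_simps)
  from has_partials_exp[OF this]
  show "(tchar p has_derivative (\<lambda>h. of_real (Re h) * (\<i> * of_int (fst p) * tchar p z) + of_real (Im h) * (\<i> * of_int (snd p) * tchar p z))) (at z)"
    unfolding has_partials_def tchar_def[abs_def] cis_conv_exp
    by (auto simp: algebra_simps elim!: has_derivative_eq_rhs allE[of _ z])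
qed

lemma has_partials_tpoly:
  "has_partials (tpoly d a) (tpoly d (\<lambda>p. \<i> * of_int (fst p) * a p)) (tpoly d (\<lambda>p. \<i> * of_int (snd p) * a p))"
  unfolding tpoly_def[abs_def]
  using has_partials_sum[of "tbox d", OF has_partials_cmult[OF has_partials_tchar], of "\<lambda>p. a p" "\<lambda>p. p"]
  by (simp add: mult_ac)

lemma continuous_tpoly: "continuous_on S (tpoly d a)"
  using has_partials_tpoly has_partials_continuous by blast

lemma continuous_tchar: "continuous_on S (tchar p)"
  using has_partials_tchar has_partials_continuous by blast

section \<open>Integration over the period square\<close>

lemma torus_inner_continuous:
  fixes V :: "complex \<Rightarrow> complex"
  assumes "continuous_on UNIV V"
  shows "continuous_on {0..2*pi} (\<lambda>y. integral {0..2*pi} (\<lambda>x. V (Complex x y)))"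
    and "(\<lambda>x. V (Complex x y)) integrable_on {0..2*pi}"
proof -
  have C: "continuous_on UNIV (\<lambda>(y, x). V (Complex x y))"
    unfolding case_prod_unfold Complex_eq
    by (intro continuous_on_compose2[OF assms] continuous_intros) auto
  have "continuous_on {0..2*pi} (\<lambda>y. integral (cbox 0 (2*pi)) (\<lambda>x. V (Complex x y)))"
    by (rule integral_continuous_on_param[of "{0..2*pi}" 0 "2*pi" "\<lambda>y x. V (Complex x y)"])
      (rule continuous_on_subset[OF C], simp)
  then show "continuous_on {0..2*pi} (\<lambda>y. integral {0..2*pi} (\<lambda>x. V (Complex x y)))" by simp
  show "(\<lambda>x. V (Complex x y)) integrable_on {0..2*pi}"
    unfolding Complex_eq
    by (intro integrable_continuous_real continuous_on_compose2[OF assms] continuous_intros) auto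
qed

lemma torus_outer_integrable:
  fixes V :: "complex \<Rightarrow> complex"
  assumes "continuous_on UNIV V"
  shows "(\<lambda>y. integral {0..2*pi} (\<lambda>x. V (Complex x y))) integrable_on {0..2*pi}"
  by (intro integrable_continuous_real torus_inner_continuous assms)

lemma torus_int_add:
  assumes "continuous_on UNIV V" "continuous_on UNIV W"
  shows "torus_int (\<lambda>z. V z + W z) = torus_int V + torus_int W"
  unfolding torus_int_def
  by (simp add: integral_add torus_inner_continuous(2) torus_outer_integrable assms)

lemma torus_int_cmult: "torus_int (\<lambda>z. c * V z) = c * torus_int V"
  unfolding torus_int_def by simp

lemma torus_int_sum:
  assumes "finite I" "\<And>i. i \<in> I \<Longrightarrow> continuous_on UNIV (V i)"
  shows "torus_int (\<lambda>z. \<Sum>i\<in>I. V i z) = (\<Sum>i\<in>I. torus_int (V i))"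
  using assms
proof (induction I rule: finite_induct)
  case empty
  then show ?case by (simp add: torus_int_def)
next
  case (insert i I)
  then show ?case by (simp add: torus_int_add continuous_on_sum)
qed

lemma torus_int_Re_mono:
  assumes "continuous_on UNIV V" "continuous_on UNIV W" "\<And>z. Re (V z) \<le> Re (W z)"
  shows "Re (torus_int V) \<le> Re (torus_int W)"
proof -
  have R: "Re (torus_int V) = integral {0..2*pi} (\<lambda>y. integral {0..2*pi} (\<lambda>x. Re (V (Complex x y))))"
    if "continuous_on UNIV V" for V
  proof -
    have "Re (torus_int V) = integral {0..2*pi} (\<lambda>y. Re (integral {0..2*pi} (\<lambda>x. V (Complex x y))))"
      unfolding torus_int_def
      using integral_linear[OF torus_outer_integrable[OF that] bounded_linear_Re] by (simp add: o_def)
    also have "\<dots> = integral {0..2*pi} (\<lambda>y. integral {0..2*pi} (\<lambda>x. Re (V (Complex x y))))"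
      using integral_linear[OF torus_inner_continuous(2)[OF that] bounded_linear_Re] by (simp add: o_def)
    finally show ?thesis .
  qed
  have i: "(\<lambda>x. Re (V (Complex x y))) integrable_on {0..2*pi}" if "continuous_on UNIV V" for V y
    using integrable_linear[OF torus_inner_continuous(2)[OF that] bounded_linear_Re] by (simp add: o_def)
  have o: "(\<lambda>y. integral {0..2*pi} (\<lambda>x. Re (V (Complex x y)))) integrable_on {0..2*pi}" if "continuous_on UNIV V" for V
    using integrable_linear[OF torus_outer_integrable[OF that] bounded_linear_Re]
      integral_linear[OF torus_inner_continuous(2)[OF that] bounded_linear_Re] by (simp add: o_def)
  show ?thesis unfolding R[OF assms(1)] R[OF assms(2)]
    by (intro integral_le o i assms)
qed

lemma torus_int_norm_le:
  assumes "continuous_on UNIV V" "\<And>z. norm (V z) \<le> B"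
  shows "norm (torus_int V) \<le> 4 * pi\<^sup>2 * B"
proof -
  have inner: "norm (integral {0..2*pi} (\<lambda>x. V (Complex x y))) \<le> B * (2 * pi - 0)" for y
  proof (rule integral_bound)
    show "continuous_on {0..2*pi} (\<lambda>x. V (Complex x y))"
      unfolding Complex_eq by (intro continuous_on_compose2[OF assms(1)] continuous_intros) auto
  qed (use assms in auto)
  have "norm (torus_int V) \<le> (B * (2 * pi - 0)) * (2 * pi - 0)"
    unfolding torus_int_def
    by (rule integral_bound) (use torus_inner_continuous(1)[OF assms(1)] inner in auto)
  then show ?thesis by (simp add: power2_eq_square mult_ac)
qed

text \<open>Periodicity makes the inner integral of a derivative vanish by the fundamental theorem
  of calculus; for the y-derivative the order of integration is swapped first. This is the
  divergence theorem on the torus.\<close>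

lemma torus_int_partial:
  assumes V: "has_partials V Vx Vy" and c: "continuous_on UNIV Vx" "continuous_on UNIV Vy"
    and per: "\<And>x y. V (Complex (2*pi) y) = V (Complex 0 y)" "\<And>x y. V (Complex x (2*pi)) = V (Complex x 0)"
  shows "torus_int Vx = 0" "torus_int Vy = 0"
proof -
  have dx: "((\<lambda>x. V (Complex x y)) has_vector_derivative Vx (Complex x y)) (at x within S)" for x y S
  proof -
    have "((\<lambda>x. Complex x y) has_derivative (\<lambda>h. of_real h)) (at x within S)"
      unfolding Complex_eq by (auto intro!: derivative_eq_intros)
    from has_derivative_compose[OF this V[unfolded has_partials_def, rule_format]]
    show ?thesis by (simp add: has_vector_derivative_def scaleR_conv_of_real)
  qed
  have dy: "((\<lambda>y. V (Complex x y)) has_vector_derivative Vy (Complex x y)) (at y within S)" for x y S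
  proof -
    have "((\<lambda>y. Complex x y) has_derivative (\<lambda>h. \<i> * of_real h)) (at y within S)"
      unfolding Complex_eq by (auto intro!: derivative_eq_intros)
    from has_derivative_compose[OF this V[unfolded has_partials_def, rule_format]]
    show ?thesis by (simp add: has_vector_derivative_def scaleR_conv_of_real)
  qed
  have "integral {0..2*pi} (\<lambda>x. Vx (Complex x y)) = 0" for y
    using fundamental_theorem_of_calculus[of 0 "2*pi", OF _ dx] per(1)
    by (simp add: integral_unique)
  then show "torus_int Vx = 0" by (simp add: torus_int_def)
  have "integral {0..2*pi} (\<lambda>y. Vy (Complex x y)) = 0" for x
    using fundamental_theorem_of_calculus[of 0 "2*pi", OF _ dy] per(2)
    by (simp add: integral_unique)
  moreover have "torus_int Vy = integral {0..2*pi} (\<lambda>x. integral {0..2*pi} (\<lambda>y. Vy (Complex x y)))"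
  proof -
    have "continuous_on (cbox (0, 0) (2*pi, 2*pi)) (\<lambda>(y, x). Vy (Complex x y))"
      unfolding case_prod_unfold Complex_eq
      by (intro continuous_on_compose2[OF c(2)] continuous_intros) auto
    from integral_swap_continuous[OF this] show ?thesis by (simp add: torus_int_def)
  qed
  ultimately show "torus_int Vy = 0" by simp
qed

lemma tchar_periodic: "tchar p (Complex (2*pi) y) = tchar p (Complex 0 y)" "tchar p (Complex x (2*pi)) = tchar p (Complex x 0)"
proof -
  have "cis (of_int n * (2 * pi)) = 1" for n
    using cis_multiple_2pi[of "of_int n"] by (simp add: mult.commute)
  then show "tchar p (Complex (2*pi) y) = tchar p (Complex 0 y)" "tchar p (Complex x (2*pi)) = tchar p (Complex x 0)"
    by (simp_all add: tchar_def cis_mult[symmetric])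
qed

lemma tpoly_periodic: "tpoly d a (Complex (2*pi) y) = tpoly d a (Complex 0 y)" "tpoly d a (Complex x (2*pi)) = tpoly d a (Complex x 0)"
  by (simp_all add: tpoly_def tchar_periodic)

lemma torus_int_tchar: "torus_int (tchar p) = (if p = 0 then 4 * pi\<^sup>2 else 0)"
proof (cases "p = 0")
  case True
  then show ?thesis by (simp add: torus_int_def tchar_def power2_eq_square scaleR_conv_of_real)
next
  case False
  have "torus_int (\<lambda>z. \<i> * of_int (fst p) * tchar p z) = 0" "torus_int (\<lambda>z. \<i> * of_int (snd p) * tchar p z) = 0"
    by (rule torus_int_partial[OF has_partials_tchar]; intro continuous_intros continuous_tchar tchar_periodic)+
  then show ?thesis using False by (auto simp: torus_int_cmult prod_eq_iff)
qed

lemma torus_int_tpoly: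
  fixes a :: "int \<times> int \<Rightarrow> complex"
  shows "torus_int (tpoly d a) = of_real (4 * pi\<^sup>2) * a 0"
proof -
  have "torus_int (tpoly d a) = (\<Sum>p\<in>tbox d. a p * torus_int (tchar p))"
    unfolding tpoly_def by (subst torus_int_sum) (auto intro!: continuous_intros continuous_tchar simp: torus_int_cmult)
  also have "\<dots> = (\<Sum>p\<in>tbox d. if p = 0 then of_real (4 * pi\<^sup>2) * a 0 else 0)"
    by (intro sum.cong) (auto simp: torus_int_tchar)
  also have "\<dots> = of_real (4 * pi\<^sup>2) * a 0" by (simp add: tbox_def zero_prod_def)
  finally show ?thesis .
qed

lemma parseval_tpoly:
  "torus_int (\<lambda>z. of_real ((norm (tpoly d a z))\<^sup>2)) = of_real (4 * pi\<^sup>2 * (\<Sum>p\<in>tbox d. (norm (a p))\<^sup>2))"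
proof -
  have "(\<lambda>z. complex_of_real ((norm (tpoly d a z))\<^sup>2)) = (\<lambda>z. \<Sum>p\<in>tbox d. \<Sum>q\<in>tbox d. a p * cnj (a q) * tchar (p - q) z)"
    unfolding complex_norm_square tpoly_def cnj_sum sum_product
    by (simp add: cnj_tchar mult_ac tchar_mult[symmetric] diff_conv_add_uminus del: add_uminus_conv_diff)
  then have "torus_int (\<lambda>z. of_real ((norm (tpoly d a z))\<^sup>2)) = (\<Sum>p\<in>tbox d. \<Sum>q\<in>tbox d. a p * cnj (a q) * torus_int (tchar (p - q)))"
    by (simp add: torus_int_sum torus_int_cmult continuous_intros continuous_tchar)
  also have "\<dots> = (\<Sum>p\<in>tbox d. \<Sum>q\<in>tbox d. if p = q then 4 * pi\<^sup>2 * (a p * cnj (a p)) else 0)"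
    by (intro sum.cong) (auto simp: torus_int_tchar)
  also have "\<dots> = of_real (4 * pi\<^sup>2 * (\<Sum>p\<in>tbox d. (norm (a p))\<^sup>2))"
    by (simp add: complex_norm_square[symmetric] sum_distrib_left)
  finally show ?thesis .
qed

section \<open>Products of trigonometric polynomials as convolutions of coefficients\<close>

definition tconv :: "nat \<Rightarrow> (int \<times> int \<Rightarrow> complex) \<Rightarrow> (int \<times> int \<Rightarrow> complex) \<Rightarrow> int \<times> int \<Rightarrow> complex" where
  "tconv d m a p = (\<Sum>q\<in>tbox d. m q * a (p - q))"

lemma tpoly_tconv:
  assumes supp: "\<And>p. p \<notin> tbox e \<Longrightarrow> a p = 0"
  shows "tpoly (e + d) (tconv d m a) z = tpoly d m z * tpoly e a z"
    and "p \<notin> tbox (e + d) \<Longrightarrow> tconv d m a p = 0"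
proof -
  have sub: "q + r \<in> tbox (e + d)" if "q \<in> tbox d" "r \<in> tbox e" for q r
    using that by (auto simp: tbox_def)
  have "tpoly (e + d) (tconv d m a) z = (\<Sum>q\<in>tbox d. \<Sum>p\<in>tbox (e + d). m q * a (p - q) * tchar p z)"
    unfolding tpoly_def tconv_def sum_distrib_right by (rule sum.swap)
  also have "\<dots> = (\<Sum>q\<in>tbox d. \<Sum>r\<in>tbox e. m q * a r * tchar (q + r) z)"
  proof (rule sum.cong[OF refl])
    fix q assume q: "q \<in> tbox d"
    have "(\<Sum>p\<in>tbox (e + d). m q * a (p - q) * tchar p z) = (\<Sum>p\<in>(\<lambda>r. q + r) ` tbox e. m q * a (p - q) * tchar p z)"
    proof (rule sum.mono_neutral_right)
      show "\<forall>i\<in>tbox (e + d) - (\<lambda>r. q + r) ` tbox e. m q * a (i - q) * tchar i z = 0"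
      proof
        fix i assume i: "i \<in> tbox (e + d) - (\<lambda>r. q + r) ` tbox e"
        have "i = q + (i - q)" by simp
        then have "i - q \<notin> tbox e" using i by (metis Diff_iff image_eqI)
        then show "m q * a (i - q) * tchar i z = 0" by (simp add: supp)
      qed
      show "(\<lambda>r. q + r) ` tbox e \<subseteq> tbox (e + d)" using sub[OF q] by blast
    qed simp
    also have "\<dots> = (\<Sum>r\<in>tbox e. m q * a r * tchar (q + r) z)"
      by (subst sum.reindex) (auto simp: inj_on_def)
    finally show "(\<Sum>p\<in>tbox (e + d). m q * a (p - q) * tchar p z) = (\<Sum>r\<in>tbox e. m q * a r * tchar (q + r) z)" .
  qed
  also have "\<dots> = tpoly d m z * tpoly e a z"
    unfolding tpoly_def sum_product by (simp add: tchar_mult[symmetric] mult_ac)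
  finally show "tpoly (e + d) (tconv d m a) z = tpoly d m z * tpoly e a z" .
  assume p: "p \<notin> tbox (e + d)"
  have "a (p - q) = 0" if "q \<in> tbox d" for q
  proof (rule supp)
    show "p - q \<notin> tbox e" using sub[OF that, of "p - q"] p by auto
  qed
  then show "tconv d m a p = 0" by (simp add: tconv_def)
qed

text \<open>Parseval converts the pointwise bound on the factor into an l2 bound on coefficients.
  This contraction is the only operator estimate behind the Neumann series and the reason why it
  converges up to parameter norm 1.\<close>

lemma tconv_contraction:
  assumes supp: "\<And>p. p \<notin> tbox e \<Longrightarrow> a p = 0" and m: "\<And>z. norm (tpoly d m z) \<le> 1"
  shows "(\<Sum>p\<in>tbox (e + d). (norm (tconv d m a p))\<^sup>2) \<le> (\<Sum>p\<in>tbox e. (norm (a p))\<^sup>2)"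
proof -
  have "Re (torus_int (\<lambda>z. of_real ((norm (tpoly (e + d) (tconv d m a) z))\<^sup>2))) \<le> Re (torus_int (\<lambda>z. of_real ((norm (tpoly e a z))\<^sup>2)))"
  proof (rule torus_int_Re_mono)
    fix z
    have "norm (tpoly (e + d) (tconv d m a) z) \<le> 1 * norm (tpoly e a z)"
      using tpoly_tconv(1)[of e a d m z, OF supp] mult_right_mono[OF m[of z], of "norm (tpoly e a z)"]
      by (simp add: norm_mult)
    then show "Re (of_real ((norm (tpoly (e + d) (tconv d m a) z))\<^sup>2)) \<le> Re (of_real ((norm (tpoly e a z))\<^sup>2))"
      by (simp add: power_mono)
  qed (intro continuous_intros continuous_tpoly)+
  then show ?thesis unfolding parseval_tpoly by simp
qed

section \<open>The Neumann series for the Beltrami equation\<close>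

text \<open>The frequency as a complex number: on \<open>tchar p\<close> the operators d/dz and
  d/dzbar act as multiplication by \<open>\<i> / 2 * cnj (zeta p)\<close> and
  \<open>\<i> / 2 * zeta p\<close>.\<close>

definition zeta :: "int \<times> int \<Rightarrow> complex" where "zeta p = of_int (fst p) + \<i> * of_int (snd p)"

definition cdz :: "(int \<times> int \<Rightarrow> complex) \<Rightarrow> int \<times> int \<Rightarrow> complex" where
  "cdz a p = \<i> / 2 * cnj (zeta p) * a p"

definition cdzb :: "(int \<times> int \<Rightarrow> complex) \<Rightarrow> int \<times> int \<Rightarrow> complex" where
  "cdzb a p = \<i> / 2 * zeta p * a p"

text \<open>Coefficients of the zbar-derivative of the n-th Neumann term. The first is the
  z-derivative of the polynomial with coefficients \<open>m\<close>; each step applies the periodic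
  Beurling transform, the multiplier \<open>cnj (zeta p) / zeta p\<close>, and multiplies by that
  polynomial. At frequency 0 the quotient is 0 by the convention for division.\<close>

fun gam :: "nat \<Rightarrow> (int \<times> int \<Rightarrow> complex) \<Rightarrow> nat \<Rightarrow> int \<times> int \<Rightarrow> complex" where
  "gam d m 0 = cdz m"
| "gam d m (Suc n) = tconv d m (\<lambda>p. cnj (zeta p) / zeta p * gam d m n p)"

text \<open>Inverts the zbar-derivative frequency by frequency; division by zero sets the mean of
  the primitive to 0.\<close>

definition gco :: "nat \<Rightarrow> (int \<times> int \<Rightarrow> complex) \<Rightarrow> nat \<Rightarrow> int \<times> int \<Rightarrow> complex" where
  "gco d m n p = 2 / (\<i> * zeta p) * gam d m n p"

lemma zeta_eq_0_iff [simp]: "zeta p = 0 \<longleftrightarrow> p = 0"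
  by (cases p) (simp add: zeta_def complex_eq_iff zero_prod_def)

lemma zeta_0 [simp]: "zeta 0 = 0" by simp

text \<open>Nonzero frequencies are lattice points, so inverting the zbar-derivative costs at most a
  factor 2 on coefficients.\<close>

lemma norm_zeta_ge: "p \<noteq> 0 \<Longrightarrow> norm (zeta p) \<ge> 1"
proof -
  assume "p \<noteq> 0"
  then have "(fst p)\<^sup>2 + (snd p)\<^sup>2 \<ge> 1"
    by (metis add_nonneg_eq_0_iff int_one_le_iff_zero_less order_le_less power2_eq_iff_nonneg power_zero_numeral prod_eq_iff sum_power2_ge_zero zero_eq_power2 zero_le_power2 zero_prod_def fst_conv snd_conv)
  then have "real_of_int ((fst p)\<^sup>2 + (snd p)\<^sup>2) \<ge> 1" by (simp only: of_int_1_le_iff)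
  then show ?thesis unfolding zeta_def norm_complex_def by simp
qed

text \<open>The Beltrami coefficients treated here are \<open>l * tpoly d m\<close> with
  \<open>l\<close> in the open unit disk, which is why the sup norm of the polynomial is normalised
  to 1.\<close>

locale trig_coeff =
  fixes d :: nat and m :: "int \<times> int \<Rightarrow> complex"
  assumes supp: "\<And>p. p \<notin> tbox d \<Longrightarrow> m p = 0"
    and bound: "\<And>z. norm (tpoly d m z) \<le> 1"
begin

definition K :: real where "K = sqrt (\<Sum>p\<in>tbox d. (norm (cdz m p))\<^sup>2)"

abbreviation deg :: "nat \<Rightarrow> nat" where "deg n \<equiv> Suc n * d"

lemma K_nonneg: "K \<ge> 0" by (simp add: K_def sum_nonneg)

lemma gam_supp: "p \<notin> tbox (deg n) \<Longrightarrow> gam d m n p = 0"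
proof (induction n arbitrary: p)
  case 0
  then show ?case by (simp add: cdz_def supp)
next
  case (Suc n)
  have "gam d m (Suc n) p = 0"
    unfolding gam.simps
    by (rule tpoly_tconv(2)[of "deg n"]) (use Suc in \<open>auto simp: algebra_simps\<close>)
  then show ?case .
qed

text \<open>The Beurling multiplier has modulus at most 1 and convolution with \<open>m\<close>
  contracts, so one bound serves all n. The degree grows only linearly in n, which later costs a
  polynomial factor and leaves the radius of convergence at 1.\<close>

lemma gam_l2: "(\<Sum>p\<in>tbox (deg n). (norm (gam d m n p))\<^sup>2) \<le> K\<^sup>2"
proof (induction n)
  case 0
  then show ?case by (simp add: K_def sum_nonneg)
next
  case (Suc n)
  have "(\<Sum>p\<in>tbox (deg n + d). (norm (tconv d m (\<lambda>p. cnj (zeta p) / zeta p * gam d m n p) p))\<^sup>2)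
      \<le> (\<Sum>p\<in>tbox (deg n). (norm (cnj (zeta p) / zeta p * gam d m n p))\<^sup>2)"
    by (rule tconv_contraction) (auto simp: gam_supp bound)
  also have "\<dots> \<le> (\<Sum>p\<in>tbox (deg n). (norm (gam d m n p))\<^sup>2)"
    by (intro sum_mono) (auto simp: norm_mult norm_divide)
  also have "\<dots> \<le> K\<^sup>2" by (rule Suc)
  finally show ?case by (simp add: algebra_simps)
qed

lemma gam_norm_le: "norm (gam d m n p) \<le> K"
proof (cases "p \<in> tbox (deg n)")
  case True
  then have "(norm (gam d m n p))\<^sup>2 \<le> (\<Sum>p\<in>tbox (deg n). (norm (gam d m n p))\<^sup>2)"
    by (intro member_le_sum) auto
  then show ?thesis using gam_l2[of n] K_nonneg by (meson order_trans power2_le_imp_le)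
qed (simp add: gam_supp K_nonneg)

lemma gco_norm_le: "norm (gco d m n p) \<le> 2 * K"
proof (cases "p = 0")
  case False
  have "norm (gco d m n p) = 2 / norm (zeta p) * norm (gam d m n p)"
    by (simp add: gco_def norm_mult norm_divide)
  also have "\<dots> \<le> 2 * K"
    using norm_zeta_ge[OF False] gam_norm_le[of n p] K_nonneg by (intro mult_mono) (auto simp: divide_simps)
  finally show ?thesis .
qed (simp add: gco_def K_nonneg)

lemma gco_supp: "p \<notin> tbox (deg n) \<Longrightarrow> gco d m n p = 0"
  by (simp add: gco_def gam_supp)

definition mu :: "complex \<Rightarrow> complex" where "mu = tpoly d m"
definition mux :: "complex \<Rightarrow> complex" where "mux = tpoly d (\<lambda>p. \<i> * of_int (fst p) * m p)"
definition muy :: "complex \<Rightarrow> complex" where "muy = tpoly d (\<lambda>p. \<i> * of_int (snd p) * m p)"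
definition G :: "nat \<Rightarrow> complex \<Rightarrow> complex" where "G n = tpoly (deg n) (gco d m n)"
definition Gx :: "nat \<Rightarrow> complex \<Rightarrow> complex" where "Gx n = tpoly (deg n) (\<lambda>p. \<i> * of_int (fst p) * gco d m n p)"
definition Gy :: "nat \<Rightarrow> complex \<Rightarrow> complex" where "Gy n = tpoly (deg n) (\<lambda>p. \<i> * of_int (snd p) * gco d m n p)"

lemma mu_partials: "has_partials mu mux muy"
  unfolding mu_def mux_def muy_def by (rule has_partials_tpoly)

lemma G_partials: "has_partials (G n) (Gx n) (Gy n)"
  unfolding G_def Gx_def Gy_def by (rule has_partials_tpoly)

lemmas cont_mu = continuous_tpoly[of _ d m, folded mu_def]
lemmas cont_mux = continuous_tpoly[of _ d "\<lambda>p. \<i> * of_int (fst p) * m p", folded mux_def]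
lemmas cont_muy = continuous_tpoly[of _ d "\<lambda>p. \<i> * of_int (snd p) * m p", folded muy_def]

lemma cont_G: "continuous_on S (G n)" "continuous_on S (Gx n)" "continuous_on S (Gy n)"
  by (simp_all add: G_def Gx_def Gy_def continuous_tpoly)

lemma mu_dz: "(mux z - \<i> * muy z) / 2 = tpoly d (cdz m) z"
  unfolding mux_def muy_def tpoly_def sum_distrib_left sum_subtractf[symmetric] sum_divide_distrib
  by (intro sum.cong) (auto simp: cdz_def zeta_def algebra_simps)

lemma G_dz: "(Gx n z - \<i> * Gy n z) / 2 = tpoly (deg n) (\<lambda>p. cnj (zeta p) / zeta p * gam d m n p) z"
  unfolding Gx_def Gy_def tpoly_def sum_distrib_left sum_subtractf[symmetric] sum_divide_distrib
proof (intro sum.cong refl)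
  fix p
  have "(\<i> * of_int (fst p) * gco d m n p * tchar p z - \<i> * (\<i> * of_int (snd p) * gco d m n p * tchar p z)) / 2
     = \<i> / 2 * cnj (zeta p) * gco d m n p * tchar p z"
    by (simp add: zeta_def algebra_simps)
  also have "\<dots> = cnj (zeta p) / zeta p * gam d m n p * tchar p z"
    by (cases "p = 0") (auto simp: gco_def)
  finally show "(\<i> * of_int (fst p) * gco d m n p * tchar p z - \<i> * (\<i> * of_int (snd p) * gco d m n p * tchar p z)) / 2
     = cnj (zeta p) / zeta p * gam d m n p * tchar p z" .
qed

text \<open>The zbar-derivative of a periodic function has mean zero, so the primitive can reproduce
  \<open>gam\<close> only if its zero coefficient vanishes. That this always happens is
  \<open>gam_mean\<close>.\<close>

lemma G_dzb:
  assumes "gam d m n 0 = 0"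
  shows "(Gx n z + \<i> * Gy n z) / 2 = tpoly (deg n) (gam d m n) z"
  unfolding Gx_def Gy_def tpoly_def sum_distrib_left sum.distrib[symmetric] sum_divide_distrib
proof (intro sum.cong refl)
  fix p
  have "(\<i> * of_int (fst p) * gco d m n p * tchar p z + \<i> * (\<i> * of_int (snd p) * gco d m n p * tchar p z)) / 2
     = \<i> / 2 * zeta p * gco d m n p * tchar p z"
    by (simp add: zeta_def algebra_simps diff_divide_distrib)
  also have "\<dots> = gam d m n p * tchar p z"
    using assms by (cases "p = 0") (auto simp: gco_def)
  finally show "(\<i> * of_int (fst p) * gco d m n p * tchar p z + \<i> * (\<i> * of_int (snd p) * gco d m n p * tchar p z)) / 2
     = gam d m n p * tchar p z" .
qed

lemma gam_Suc_tpoly: "tpoly (deg (Suc n)) (gam d m (Suc n)) z = mu z * ((Gx n z - \<i> * Gy n z) / 2)"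
  using tpoly_tconv(1)[of "deg n" "\<lambda>p. cnj (zeta p) / zeta p * gam d m n p" d m z] gam_supp[of _ n]
  by (simp add: G_dz mu_def algebra_simps)

text \<open>The Neumann series is solvable because the right-hand side has mean zero at every order: for
  \<open>P = \<lambda> G\<^sub>0 + \<dots> + \<lambda>\<^sup>n G\<^bsub>n-1\<^esub>\<close> and \<open>U = exp P\<close> the divergence \<open>U\<^bsub>zbar\<^esub> - \<lambda> (\<mu> U)\<^sub>z\<close> has mean zero
  and equals \<open>- \<lambda>\<^bsup>n+1\<^esup> \<mu> (G\<^bsub>n-1\<^esub>)\<^sub>z U\<close>.\<close>

lemma gam_mean: "gam d m n 0 = 0"
proof (induction n rule: less_induct)
  case (less n)
  show ?case
  proof (cases n)
    case 0
    then show ?thesis by (simp add: cdz_def)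
  next
    case (Suc k)
    have dzb0: "(Gx 0 z + \<i> * Gy 0 z) / 2 = (mux z - \<i> * muy z) / 2" for z
      using G_dzb[of 0] less[of 0] Suc by (simp add: mu_dz)
    have dzbS: "(Gx (Suc j) z + \<i> * Gy (Suc j) z) / 2 = mu z * ((Gx j z - \<i> * Gy j z) / 2)" if "j < k" for j z
      using G_dzb[of "Suc j" z] less[of "Suc j"] Suc that gam_Suc_tpoly[of j z] by simp
    define V where "V = (\<lambda>z. mu z * ((Gx k z - \<i> * Gy k z) / 2))"
    define P where "P = (\<lambda>l z. \<Sum>j\<le>k. l ^ Suc j * G j z)"
    define Px where "Px = (\<lambda>l z. \<Sum>j\<le>k. l ^ Suc j * Gx j z)"
    define Py where "Py = (\<lambda>l z. \<Sum>j\<le>k. l ^ Suc j * Gy j z)"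
    have P: "has_partials (P l) (Px l) (Py l)" for l
      unfolding P_def Px_def Py_def by (intro has_partials_sum has_partials_cmult G_partials)
    have contP: "continuous_on UNIV (P l)" "continuous_on UNIV (Px l)" "continuous_on UNIV (Py l)" for l
      unfolding P_def Px_def Py_def by (intro continuous_intros cont_G)+
    have contV: "continuous_on UNIV V" unfolding V_def by (intro continuous_intros cont_G cont_mu) auto
    \<comment> \<open>By the recursion the zbar-derivative of each term cancels mu times the
      z-derivative of its predecessor; only the product formed from the last term survives.\<close>
    have tel: "(Px l z + \<i> * Py l z) / 2 - l * ((mux z - \<i> * muy z) / 2) - l * mu z * ((Px l z - \<i> * Py l z) / 2)
        = - (l ^ (k + 2) * V z)" for l z
    proof -
      have "(Px l z + \<i> * Py l z) / 2 = (\<Sum>j\<le>k. l ^ Suc j * ((Gx j z + \<i> * Gy j z) / 2))"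
        unfolding Px_def Py_def sum_distrib_left sum.distrib[symmetric] sum_divide_distrib
        by (intro sum.cong) (auto simp: algebra_simps add_divide_distrib)
      also have "\<dots> = l * ((mux z - \<i> * muy z) / 2) + (\<Sum>j<k. l ^ Suc (Suc j) * ((Gx (Suc j) z + \<i> * Gy (Suc j) z) / 2))"
        unfolding lessThan_Suc_atMost[symmetric] sum.lessThan_Suc_shift by (simp add: dzb0)
      also have "(\<Sum>j<k. l ^ Suc (Suc j) * ((Gx (Suc j) z + \<i> * Gy (Suc j) z) / 2)) = (\<Sum>j<k. l * mu z * (l ^ Suc j * ((Gx j z - \<i> * Gy j z) / 2)))"
        by (intro sum.cong) (auto simp: dzbS)
      also have "\<dots> = l * mu z * (\<Sum>j<k. l ^ Suc j * ((Gx j z - \<i> * Gy j z) / 2))" by (simp add: sum_distrib_left)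
      also have "(\<Sum>j<k. l ^ Suc j * ((Gx j z - \<i> * Gy j z) / 2)) = (Px l z - \<i> * Py l z) / 2 - l ^ Suc k * ((Gx k z - \<i> * Gy k z) / 2)"
      proof -
        have "(Px l z - \<i> * Py l z) / 2 = (\<Sum>j\<le>k. l ^ Suc j * ((Gx j z - \<i> * Gy j z) / 2))"
          unfolding Px_def Py_def sum_distrib_left sum_subtractf[symmetric] sum_divide_distrib
          by (intro sum.cong) (auto simp: algebra_simps diff_divide_distrib)
        moreover have "(\<Sum>j\<le>k. F j) = (\<Sum>j<k. F j) + F k" for F :: "nat \<Rightarrow> complex"
          by (metis lessThan_Suc_atMost sum.lessThan_Suc)
        ultimately show ?thesis by (metis add_diff_cancel_right')
      qed
      finally show ?thesis by (simp add: V_def algebra_simps)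
    qed
    have zero: "torus_int (\<lambda>z. exp (P l z) * V z) = 0" if l: "l \<noteq> 0" for l
    proof -
      let ?U = "\<lambda>z. exp (P l z)"
      \<comment> \<open>\<open>A\<close> and \<open>B\<close> are the components of a periodic field
        with divergence U_zbar - l (mu U)_z.\<close>
      define A where "A = (\<lambda>z. ?U z * (1 - l * mu z) / 2)"
      define B where "B = (\<lambda>z. \<i> * ?U z * (1 + l * mu z) / 2)"
      define Ax where "Ax = (\<lambda>z. (?U z * Px l z * (1 - l * mu z) - ?U z * (l * mux z)) / 2)"
      define Ay where "Ay = (\<lambda>z. (?U z * Py l z * (1 - l * mu z) - ?U z * (l * muy z)) / 2)"
      define Bx where "Bx = (\<lambda>z. \<i> * (?U z * Px l z * (1 + l * mu z) + ?U z * (l * mux z)) / 2)"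
      define By where "By = (\<lambda>z. \<i> * (?U z * Py l z * (1 + l * mu z) + ?U z * (l * muy z)) / 2)"
      have "has_partials (\<lambda>z. (1/2) * (?U z * (1 + (- l) * mu z))) (\<lambda>z. (1/2) * (?U z * (0 + (- l) * mux z) + ?U z * Px l z * (1 + (- l) * mu z)))
          (\<lambda>z. (1/2) * (?U z * (0 + (- l) * muy z) + ?U z * Py l z * (1 + (- l) * mu z)))"
        by (intro has_partials_cmult has_partials_mult has_partials_add has_partials_const has_partials_exp P mu_partials)
      then have A: "has_partials A Ax Ay" unfolding A_def Ax_def Ay_def
        by (simp add: algebra_simps add_divide_distrib diff_divide_distrib)
      have "has_partials (\<lambda>z. (\<i>/2) * (?U z * (1 + l * mu z))) (\<lambda>z. (\<i>/2) * (?U z * (0 + l * mux z) + ?U z * Px l z * (1 + l * mu z)))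
          (\<lambda>z. (\<i>/2) * (?U z * (0 + l * muy z) + ?U z * Py l z * (1 + l * mu z)))"
        by (intro has_partials_cmult has_partials_mult has_partials_add has_partials_const has_partials_exp P mu_partials)
      then have B: "has_partials B Bx By" unfolding B_def Bx_def By_def
        by (simp add: algebra_simps add_divide_distrib diff_divide_distrib)
      have per: "P l (Complex (2*pi) y) = P l (Complex 0 y)" "P l (Complex x (2*pi)) = P l (Complex x 0)" 
          "mu (Complex (2*pi) y) = mu (Complex 0 y)" "mu (Complex x (2*pi)) = mu (Complex x 0)" for x y
        by (simp_all add: P_def G_def mu_def tpoly_periodic)
      have cont: "continuous_on UNIV Ax" "continuous_on UNIV Ay" "continuous_on UNIV Bx" "continuous_on UNIV By"
        unfolding Ax_def Ay_def Bx_def By_def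
        by (intro continuous_intros contP cont_mu cont_mux cont_muy; simp)+
      have "torus_int Ax = 0"
        by (rule torus_int_partial(1)[OF A cont(1,2)]) (simp_all add: A_def per)
      moreover have "torus_int By = 0"
        by (rule torus_int_partial(2)[OF B cont(3,4)]) (simp_all add: B_def per)
      ultimately have "torus_int (\<lambda>z. Ax z + By z) = 0" using cont by (simp add: torus_int_add)
      moreover have "Ax z + By z = (- (l ^ (k + 2))) * (exp (P l z) * V z)" for z
      proof -
        have "Ax z + By z = ?U z * ((Px l z + \<i> * Py l z) / 2 - l * ((mux z - \<i> * muy z) / 2) - l * mu z * ((Px l z - \<i> * Py l z) / 2))"
          unfolding Ax_def By_def by (simp add: field_simps)
        then show ?thesis unfolding tel by simp
      qed
      ultimately have "(- (l ^ (k + 2))) * torus_int (\<lambda>z. exp (P l z) * V z) = 0"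
        by (simp only: torus_int_cmult)
      then show ?thesis using l by simp
    qed
    \<comment> \<open>The weighted mean of \<open>V\<close> vanishes for every nonzero l, and the
      weight \<open>exp (P l z)\<close> tends to 1 uniformly as l tends to 0.\<close>
    have "torus_int V = 0"
    proof (rule ccontr)
      assume nz: "torus_int V \<noteq> 0"
      define M where "M = (\<Sum>p\<in>tbox d. norm (m p)) * (\<Sum>p\<in>tbox (deg k). norm (cnj (zeta p) / zeta p * gam d m k p))"
      have tn: "norm (tpoly e a z) \<le> (\<Sum>p\<in>tbox e. norm (a p))" for e a z
        unfolding tpoly_def by (rule order_trans[OF norm_sum]) (simp add: norm_mult)
      have M: "norm (V z) \<le> M" for z
        unfolding V_def G_dz mu_def M_def by (subst norm_mult) (intro mult_mono tn norm_ge_zero sum_nonneg)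
      define Q where "Q = (\<Sum>j\<le>k. \<Sum>p\<in>tbox (deg j). norm (gco d m j p))"
      have Q: "norm (P l z) \<le> norm l * Q" if "norm l \<le> 1" for l z
      proof -
        have "norm (P l z) \<le> (\<Sum>j\<le>k. norm l * (\<Sum>p\<in>tbox (deg j). norm (gco d m j p)))"
          unfolding P_def
        proof (intro order_trans[OF norm_sum] sum_mono)
          fix j
          have "norm l ^ Suc j \<le> norm l" using that by (simp add: mult_left_le power_le_one)
          then show "norm (l ^ Suc j * G j z) \<le> norm l * (\<Sum>p\<in>tbox (deg j). norm (gco d m j p))"
            unfolding norm_mult norm_power G_def by (intro mult_mono tn) auto
        qed
        then show ?thesis by (simp add: Q_def sum_distrib_left)
      qed
      have "Q \<ge> 0" "M \<ge> 0" by (auto simp: Q_def M_def intro!: sum_nonneg mult_nonneg_nonneg)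
      \<comment> \<open>Chosen so that replacing the weight by 1 costs at most half of the mean of
        \<open>V\<close>.\<close>
      define e where "e = norm (torus_int V) / (4 * pi\<^sup>2 * (M + 1)) / 2"
      have e: "e > 0" using nz \<open>M \<ge> 0\<close> by (simp add: e_def)
      have "isCont exp (0::complex)" by simp
      then obtain \<delta> where \<delta>: "\<delta> > 0" "\<And>w::complex. norm w < \<delta> \<Longrightarrow> norm (exp w - 1) < e"
        using e unfolding continuous_at_eps_delta dist_norm by (metis diff_zero exp_zero)
      define l where "l = complex_of_real (min 1 (\<delta> / (Q + 1) / 2))"
      have l: "l \<noteq> 0" "norm l \<le> 1" "norm l * Q < \<delta>"
      proof -
        have *: "0 < min 1 (\<delta> / (Q + 1) / 2)" using \<delta> \<open>Q \<ge> 0\<close> by auto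
        then show "l \<noteq> 0" "norm l \<le> 1" by (auto simp: l_def norm_of_real)
        have "norm l * Q \<le> (\<delta> / (Q + 1) / 2) * (Q + 1)"
          using * \<open>Q \<ge> 0\<close> by (intro mult_mono) (auto simp: l_def norm_of_real)
        also have "\<dots> = \<delta> / 2" using \<open>Q \<ge> 0\<close> by (simp add: field_simps)
        also have "\<dots> < \<delta>" using \<delta> by simp
        finally show "norm l * Q < \<delta>" .
      qed
      have "norm (torus_int (\<lambda>z. (exp (P l z) - 1) * V z)) \<le> 4 * pi\<^sup>2 * (e * M)"
      proof (rule torus_int_norm_le)
        show "continuous_on UNIV (\<lambda>z. (exp (P l z) - 1) * V z)" by (intro continuous_intros contP contV)
        fix z
        have "norm (exp (P l z) - 1) \<le> e" using \<delta>(2)[of "P l z"] Q[OF l(2), of z] l(3) by simp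
        then show "norm ((exp (P l z) - 1) * V z) \<le> e * M" unfolding norm_mult using M e by (intro mult_mono) auto
      qed
      moreover have "torus_int (\<lambda>z. exp (P l z) * V z) = torus_int (\<lambda>z. (exp (P l z) - 1) * V z) + torus_int V"
        by (subst torus_int_add[symmetric]) (auto intro!: continuous_intros contP contV simp: algebra_simps)
      ultimately have "norm (torus_int V) \<le> 4 * pi\<^sup>2 * (e * M)" using zero[OF l(1)] by (simp add: add_eq_0_iff)
      also have "\<dots> \<le> 4 * pi\<^sup>2 * (e * (M + 1))" using e by (intro mult_left_mono) auto
      also have "\<dots> = norm (torus_int V) / 2" using \<open>M \<ge> 0\<close> by (simp add: e_def)
      finally show False using nz by simp
    qed
    moreover have "V = tpoly (deg n) (gam d m n)" unfolding V_def Suc by (rule ext) (simp only: gam_Suc_tpoly)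
    ultimately show ?thesis by (simp add: torus_int_tpoly)
  qed
qed

lemma G_dzb_0: "(Gx 0 z + \<i> * Gy 0 z) / 2 = (mux z - \<i> * muy z) / 2"
  using G_dzb[OF gam_mean, of 0] by (simp add: mu_dz)

lemma G_dzb_Suc: "(Gx (Suc n) z + \<i> * Gy (Suc n) z) / 2 = mu z * ((Gx n z - \<i> * Gy n z) / 2)"
  using G_dzb[OF gam_mean, of "Suc n" z] gam_Suc_tpoly[of n z] by simp

end

section \<open>Smooth functions of the plane\<close>

definition power_fun_series :: "(nat \<Rightarrow> complex \<Rightarrow> complex) \<Rightarrow> complex \<Rightarrow> complex \<Rightarrow> complex" where
  "power_fun_series F l z = (\<Sum>n. F n z * l ^ n)"

text \<open>Polynomial growth in n, uniform in z, gives convergence for all |l| < 1 and survives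
  differentiation in the parameter, which only multiplies by n.\<close>

definition poly_growth :: "(nat \<Rightarrow> complex \<Rightarrow> complex) \<Rightarrow> bool" where
  "poly_growth F \<longleftrightarrow> (\<forall>n. continuous_on UNIV (F n)) \<and> (\<exists>C M. \<forall>n z. norm (F n z) \<le> C * real (n + 1) ^ M)"

lemma summable_poly_geometric:
  fixes r :: real assumes r: "0 \<le> r" "r < 1"
  shows "summable (\<lambda>n. C * real (n + 1) ^ M * r ^ n)"
proof -
  have "((\<lambda>n. (real (n + 2) / real (n + 1)) ^ M * r) \<longlongrightarrow> 1 ^ M * r) sequentially"
    by (intro tendsto_intros) real_asymp
  moreover have "1 ^ M * r < (1 + r) / 2" using r by simp
  ultimately have "\<forall>\<^sub>F n in sequentially. (real (n + 2) / real (n + 1)) ^ M * r < (1 + r) / 2"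
    by (rule order_tendstoD)
  then obtain N where N: "\<And>n. n \<ge> N \<Longrightarrow> (real (n + 2) / real (n + 1)) ^ M * r < (1 + r) / 2"
    by (auto simp: eventually_sequentially)
  have "summable (\<lambda>n. real (n + 1) ^ M * r ^ n)"
  proof (rule summable_ratio_test[of "(1 + r) / 2" N])
    fix n assume n: "N \<le> n"
    have "real (Suc n + 1) ^ M * r ^ Suc n = ((real (n + 2) / real (n + 1)) ^ M * r) * (real (n + 1) ^ M * r ^ n)"
      by (simp add: power_divide)
    also have "\<dots> \<le> (1 + r) / 2 * (real (n + 1) ^ M * r ^ n)"
      using N[OF n] r by (intro mult_right_mono) auto
    finally show "norm (real (Suc n + 1) ^ M * r ^ Suc n) \<le> (1 + r) / 2 * norm (real (n + 1) ^ M * r ^ n)"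
      using r by simp
  qed (use r in auto)
  from summable_mult[OF this, of C] show ?thesis by (simp add: mult.assoc)
qed

lemma poly_growth_bound:
  assumes "poly_growth F"
  obtains B where "\<And>r. 0 \<le> r \<Longrightarrow> r < 1 \<Longrightarrow> summable (\<lambda>n. B n * r ^ n)" "\<And>n z. norm (F n z) \<le> B n" "\<And>n. B n \<ge> 0"
proof -
  obtain C M where C: "\<And>n z. norm (F n z) \<le> C * real (n + 1) ^ M" using assms unfolding poly_growth_def by blast
  show thesis
  proof (rule that[of "\<lambda>n. C * real (n + 1) ^ M"])
    show "0 \<le> C * real (n + 1) ^ M" for n using C[of n 0] norm_ge_zero order_trans by blast
  qed (use C summable_poly_geometric in auto)
qed

lemma power_fun_series_summable:
  assumes "poly_growth F" "norm l < 1"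
  shows "summable (\<lambda>n. F n z * l ^ n)"
proof -
  obtain B where B: "\<And>r. 0 \<le> r \<Longrightarrow> r < 1 \<Longrightarrow> summable (\<lambda>n. B n * r ^ n)" "\<And>n z. norm (F n z) \<le> B n"
    using poly_growth_bound[OF assms(1)] by metis
  show ?thesis
    by (rule summable_comparison_test[OF _ B(1)[of "norm l"]])
      (use assms B in \<open>auto simp: norm_mult norm_power intro!: mult_right_mono\<close>)
qed

lemma power_fun_series_uniform:
  assumes "poly_growth F" "0 \<le> r" "r < 1"
  shows "uniform_limit (cball 0 r \<times> UNIV) (\<lambda>n (l, z). \<Sum>i<n. F i z * l ^ i) (\<lambda>(l, z). power_fun_series F l z) sequentially"
proof -
  obtain B where B: "\<And>r. 0 \<le> r \<Longrightarrow> r < 1 \<Longrightarrow> summable (\<lambda>n. B n * r ^ n)" "\<And>n z. norm (F n z) \<le> B n" "\<And>n. B n \<ge> 0"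
    using poly_growth_bound[OF assms(1)] by metis
  have "uniform_limit (cball 0 r \<times> UNIV) (\<lambda>n x. \<Sum>i<n. F i (snd x) * fst x ^ i) (\<lambda>x. \<Sum>i. F i (snd x) * fst x ^ i) sequentially"
  proof (rule Weierstrass_m_test[OF _ B(1)[OF assms(2,3)]])
    fix n and x :: "complex \<times> complex" assume "x \<in> cball 0 r \<times> UNIV"
    then have "norm (fst x) \<le> r" by (auto simp: mem_Times_iff)
    then have "norm (fst x) ^ n \<le> r ^ n" by (rule power_mono) simp
    then have "norm (F n (snd x)) * norm (fst x) ^ n \<le> B n * r ^ n" by (rule mult_mono[OF B(2) _ B(3)]) simp
    then show "norm (F n (snd x) * fst x ^ n) \<le> B n * r ^ n" by (simp add: norm_mult norm_power)
  qed
  then show ?thesis by (simp add: case_prod_unfold power_fun_series_def)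
qed

lemma power_fun_series_continuous:
  assumes "poly_growth F"
  shows "continuous_on (ball 0 1 \<times> UNIV) (\<lambda>(l, z). power_fun_series F l z)"
proof -
  have c: "continuous_on (cball 0 r \<times> UNIV) (\<lambda>(l, z). power_fun_series F l z)" if "0 \<le> r" "r < 1" for r
  proof (rule uniform_limit_theorem[OF _ power_fun_series_uniform[OF assms that]])
    have *: "continuous_on (cball 0 r \<times> UNIV) (\<lambda>x. F i (snd x))" for i
      by (rule continuous_on_compose2[of UNIV "F i" _ snd])
        (use assms in \<open>auto simp: poly_growth_def intro: continuous_on_snd continuous_on_id\<close>)
    show "\<forall>\<^sub>F n in sequentially. continuous_on (cball 0 r \<times> UNIV) (\<lambda>(l, z). \<Sum>i<n. F i z * l ^ i)"
      by (intro always_eventually allI) (auto simp: case_prod_unfold intro!: continuous_intros *)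
  qed simp
  have "isCont (\<lambda>(l, z). power_fun_series F l z) x" if x: "x \<in> ball 0 1 \<times> UNIV" for x
  proof -
    obtain r where r: "norm (fst x) < r" "r < 1" using x dense by (auto simp: mem_Times_iff)
    then have "0 \<le> r" using norm_ge_zero[of "fst x"] by linarith
    have "continuous_on (ball 0 r \<times> UNIV) (\<lambda>(l, z). power_fun_series F l z)"
      by (rule continuous_on_subset[OF c[OF \<open>0 \<le> r\<close> r(2)]]) auto
    then show ?thesis using r
      by (intro continuous_on_interior) (auto simp: interior_open open_Times mem_Times_iff)
  qed
  then show ?thesis by (simp add: continuous_at_imp_continuous_on)
qed

lemma power_fun_series_bound:
  assumes "poly_growth F" "norm l < 1"
  obtains B where "B \<ge> 0" "\<And>z. norm (power_fun_series F l z) \<le> B"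
proof -
  obtain B where B: "\<And>r. 0 \<le> r \<Longrightarrow> r < 1 \<Longrightarrow> summable (\<lambda>n. B n * r ^ n)" "\<And>n z. norm (F n z) \<le> B n" "\<And>n. B n \<ge> 0"
    using poly_growth_bound[OF assms(1)] by metis
  have "norm (power_fun_series F l z) \<le> (\<Sum>n. B n * norm l ^ n)" for z
    unfolding power_fun_series_def
    by (rule norm_suminf_le[OF _ B(1)]) (use assms B in \<open>auto simp: norm_mult norm_power intro!: mult_right_mono\<close>)
  moreover have "(\<Sum>n. B n * norm l ^ n) \<ge> 0" using B assms by (intro suminf_nonneg) auto
  ultimately show thesis using that by blast
qed

lemma power_fun_series_deriv:
  assumes "poly_growth F" "norm l < 1"
  shows "((\<lambda>l. power_fun_series F l z) has_field_derivative power_fun_series (\<lambda>n z. of_nat (Suc n) * F (Suc n) z) l z) (at l)"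
proof -
  have "((\<lambda>l. \<Sum>n. F n z * l ^ n) has_field_derivative (\<Sum>n. diffs (\<lambda>n. F n z) n * l ^ n)) (at l)"
    by (rule termdiffs_strong'[of 1]) (use assms power_fun_series_summable in auto)
  then show ?thesis by (simp add: power_fun_series_def diffs_def)
qed

lemma poly_growth_Suc:
  assumes "poly_growth F"
  shows "poly_growth (\<lambda>n z. of_nat (Suc n) * F (Suc n) z)"
proof -
  obtain C M where C: "\<And>n z. norm (F n z) \<le> C * real (n + 1) ^ M" using assms unfolding poly_growth_def by blast
  have "norm (F 0 0) \<le> C" using C[of 0 0] by simp
  then have C0: "C \<ge> 0" using norm_ge_zero[of "F 0 0"] by linarith
  have "norm (of_nat (Suc n) * F (Suc n) z) \<le> (C * 2 ^ M) * real (n + 1) ^ (M + 1)" for n z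
  proof -
    have "norm (F (Suc n) z) \<le> C * real (Suc n + 1) ^ M" by (rule C)
    also have "\<dots> \<le> C * (2 * real (n + 1)) ^ M" using C0 by (intro mult_left_mono power_mono) auto
    finally have "norm (F (Suc n) z) \<le> C * 2 ^ M * real (n + 1) ^ M" by (simp only: power_mult_distrib mult.assoc)
    then have "real (n + 1) * norm (F (Suc n) z) \<le> real (n + 1) * (C * 2 ^ M * real (n + 1) ^ M)"
      by (rule mult_left_mono) simp
    moreover have "norm (of_nat (Suc n) * F (Suc n) z) = real (n + 1) * norm (F (Suc n) z)"
      unfolding norm_mult norm_of_nat by simp
    ultimately show ?thesis by (simp add: mult_ac)
  qed
  then have "\<exists>C M. \<forall>n z. norm (of_nat (Suc n) * F (Suc n) z) \<le> C * real (n + 1) ^ M" by blast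
  moreover have "continuous_on UNIV (\<lambda>z. of_nat (Suc n) * F (Suc n) z)" for n
    using assms unfolding poly_growth_def by (intro continuous_intros) auto
  ultimately show ?thesis unfolding poly_growth_def by blast
qed

text \<open>The series of partials converge uniformly in z at fixed \<open>l\<close>, which permits
  termwise differentiation.\<close>

lemma power_fun_series_partials:
  assumes g: "poly_growth F" "poly_growth Fx" "poly_growth Fy"
    and d: "\<And>n. has_partials (F n) (Fx n) (Fy n)" and l: "norm l < 1"
  shows "has_partials (power_fun_series F l) (power_fun_series Fx l) (power_fun_series Fy l)"
  unfolding has_partials_def
proof
  fix z0
  have u: "\<forall>\<^sub>F n in sequentially. \<forall>z. norm ((\<Sum>i<n. F i z * l ^ i) - power_fun_series F l z) < e"
    if "poly_growth F" "e > 0" for F e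
  proof -
    have "\<forall>\<^sub>F n in sequentially. \<forall>x\<in>cball 0 (norm l) \<times> UNIV.
       dist (case x of (l, z) \<Rightarrow> \<Sum>i<n. F i z * l ^ i) (case x of (l, z) \<Rightarrow> power_fun_series F l z) < e"
      using uniform_limitD[OF power_fun_series_uniform[OF that(1), of "norm l"] that(2)] l by simp
    then show ?thesis by eventually_elim (auto simp: dist_norm)
  qed
  have "\<exists>g. \<forall>z\<in>UNIV. (\<lambda>n. F n z * l ^ n) sums g z \<and> (g has_derivative
      (\<lambda>h. of_real (Re h) * power_fun_series Fx l z + of_real (Im h) * power_fun_series Fy l z)) (at z within UNIV)"
  proof (rule has_derivative_series[where f' = "\<lambda>n z h. l ^ n * (of_real (Re h) * Fx n z + of_real (Im h) * Fy n z)"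
        and f = "\<lambda>n z. F n z * l ^ n" and S = UNIV and x = 0 and l = "power_fun_series F l 0"
        and g' = "\<lambda>z h. of_real (Re h) * power_fun_series Fx l z + of_real (Im h) * power_fun_series Fy l z"])
    fix n z
    show "((\<lambda>z. F n z * l ^ n) has_derivative (\<lambda>h. l ^ n * (of_real (Re h) * Fx n z + of_real (Im h) * Fy n z))) (at z within UNIV)"
      by (rule has_derivative_eq_rhs[OF has_derivative_at_withinI[OF has_derivative_mult_left[OF d[unfolded has_partials_def, rule_format]]]])
        (simp add: mult.commute)
  next
    fix e :: real assume e: "e > 0"
    have "\<forall>\<^sub>F n in sequentially. (\<forall>z. norm ((\<Sum>i<n. Fx i z * l ^ i) - power_fun_series Fx l z) < e / 2) \<and>
        (\<forall>z. norm ((\<Sum>i<n. Fy i z * l ^ i) - power_fun_series Fy l z) < e / 2)"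
      using e by (intro eventually_conj u g) auto
    then show "\<forall>\<^sub>F n in sequentially. \<forall>z\<in>UNIV. \<forall>h. norm ((\<Sum>i<n. l ^ i * (of_real (Re h) * Fx i z + of_real (Im h) * Fy i z)) -
       (of_real (Re h) * power_fun_series Fx l z + of_real (Im h) * power_fun_series Fy l z)) \<le> e * norm h"
    proof eventually_elim
      case (elim n)
      show ?case
      proof (intro ballI allI)
        fix z h
        let ?a = "(\<Sum>i<n. Fx i z * l ^ i) - power_fun_series Fx l z" and ?b = "(\<Sum>i<n. Fy i z * l ^ i) - power_fun_series Fy l z"
        have "(\<Sum>i<n. l ^ i * (of_real (Re h) * Fx i z + of_real (Im h) * Fy i z)) -
          (of_real (Re h) * power_fun_series Fx l z + of_real (Im h) * power_fun_series Fy l z) = of_real (Re h) * ?a + of_real (Im h) * ?b"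
          by (simp add: sum.distrib sum_distrib_left algebra_simps)
        also have "norm \<dots> \<le> norm (of_real (Re h) * ?a) + norm (of_real (Im h) * ?b)" by (rule norm_triangle_ineq)
        also have "\<dots> \<le> norm h * (e / 2) + norm h * (e / 2)"
          unfolding norm_mult norm_of_real using elim
          by (intro add_mono mult_mono abs_Re_le_cmod abs_Im_le_cmod norm_ge_zero) (auto intro: less_imp_le)
        finally show "norm ((\<Sum>i<n. l ^ i * (of_real (Re h) * Fx i z + of_real (Im h) * Fy i z)) -
          (of_real (Re h) * power_fun_series Fx l z + of_real (Im h) * power_fun_series Fy l z)) \<le> e * norm h"
          by (simp add: mult.commute)
      qed
    qed
  next
    show "(\<lambda>n. F n 0 * l ^ n) sums power_fun_series F l 0"
      unfolding power_fun_series_def by (rule summable_sums[OF power_fun_series_summable[OF g(1) l]])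
  qed auto
  then obtain g where g': "\<And>z. (\<lambda>n. F n z * l ^ n) sums g z" "\<And>z. (g has_derivative
      (\<lambda>h. of_real (Re h) * power_fun_series Fx l z + of_real (Im h) * power_fun_series Fy l z)) (at z)" by auto
  have "g = power_fun_series F l" using g'(1) by (auto simp: power_fun_series_def sums_iff)
  then show "(power_fun_series F l has_derivative
      (\<lambda>h. of_real (Re h) * power_fun_series Fx l z0 + of_real (Im h) * power_fun_series Fy l z0)) (at z0)"
    using g'(2) by simp
qed

text \<open>Mirrors \<open>C_diff\<close> for complex values. The class is closed under sums,
  products, exponentials and compositions, so the smooth test functions demanded by
  \<open>weak_derivative\<close> can be assembled from the solutions.\<close>

primrec Cd :: "nat \<Rightarrow> (complex \<Rightarrow> complex) \<Rightarrow> bool" where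
  "Cd 0 f \<longleftrightarrow> continuous_on UNIV f"
| "Cd (Suc n) f \<longleftrightarrow> (\<exists>fx fy. has_partials f fx fy \<and> Cd n fx \<and> Cd n fy)"

lemma Cd_SucD: "Cd (Suc n) f \<Longrightarrow> Cd n f"
proof (induction n arbitrary: f)
  case 0
  then show ?case using has_partials_continuous by auto
next
  case (Suc n)
  then obtain fx fy where "has_partials f fx fy" "Cd (Suc n) fx" "Cd (Suc n) fy" unfolding Cd.simps by blast
  then show ?case using Suc.IH unfolding Cd.simps(2)[of n] by blast
qed

lemma Cd_continuous: "Cd n f \<Longrightarrow> continuous_on UNIV f"
  by (cases n) (auto intro: has_partials_continuous)

lemma Cd_const: "Cd n (\<lambda>z. c)"
  by (induction n arbitrary: c) (use has_partials_const in auto)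

lemma Cd_add: "Cd n f \<Longrightarrow> Cd n g \<Longrightarrow> Cd n (\<lambda>z. f z + g z)"
proof (induction n arbitrary: f g)
  case (Suc n)
  then obtain fx fy gx gy where f: "has_partials f fx fy" "Cd n fx" "Cd n fy" and g: "has_partials g gx gy" "Cd n gx" "Cd n gy"
    unfolding Cd.simps by blast
  then show ?case using has_partials_add[OF f(1) g(1)] Suc.IH unfolding Cd.simps by blast
qed (auto intro!: continuous_intros)

lemma Cd_mult: "Cd n f \<Longrightarrow> Cd n g \<Longrightarrow> Cd n (\<lambda>z. f z * g z)"
proof (induction n arbitrary: f g)
  case (Suc n)
  then obtain fx fy gx gy where f: "has_partials f fx fy" "Cd n fx" "Cd n fy" and g: "has_partials g gx gy" "Cd n gx" "Cd n gy"
    unfolding Cd.simps by blast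
  have fg: "Cd n f" "Cd n g" using Suc.prems Cd_SucD by blast+
  have "Cd n (\<lambda>z. f z * gx z + fx z * g z)" "Cd n (\<lambda>z. f z * gy z + fy z * g z)"
    by (intro Cd_add Suc.IH f g fg)+
  then show ?case using has_partials_mult[OF f(1) g(1)] unfolding Cd.simps by blast
qed (auto intro!: continuous_intros)

lemma Cd_cmult: "Cd n f \<Longrightarrow> Cd n (\<lambda>z. c * f z)"
  by (intro Cd_mult Cd_const)

lemma Cd_diff: "Cd n f \<Longrightarrow> Cd n g \<Longrightarrow> Cd n (\<lambda>z. f z - g z)"
  using Cd_add[of n f "\<lambda>z. (-1) * g z"] Cd_cmult[of n g "-1"] by simp

lemma Cd_exp: "Cd n f \<Longrightarrow> Cd n (\<lambda>z. exp (f z))"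
proof (induction n arbitrary: f)
  case (Suc n)
  then obtain fx fy where f: "has_partials f fx fy" "Cd n fx" "Cd n fy" unfolding Cd.simps by blast
  have fn: "Cd n f" using Suc.prems Cd_SucD by blast
  have "Cd n (\<lambda>z. exp (f z) * fx z)" "Cd n (\<lambda>z. exp (f z) * fy z)" by (intro Cd_mult Suc.IH f fn)+
  then show ?case using has_partials_exp[OF f(1)] unfolding Cd.simps by blast
qed (auto intro!: continuous_intros)

lemma Cd_Re: "Cd n f \<Longrightarrow> Cd n (\<lambda>z. of_real (Re (f z)))"
proof (induction n arbitrary: f)
  case (Suc n)
  then obtain fx fy where f: "has_partials f fx fy" "Cd n fx" "Cd n fy" unfolding Cd.simps by blast
  have "has_partials (\<lambda>z. of_real (Re (f z))) (\<lambda>z. of_real (Re (fx z))) (\<lambda>z. of_real (Re (fy z)))"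
    unfolding has_partials_def
    by (intro allI has_derivative_eq_rhs[OF has_derivative_of_real[OF has_derivative_Re[OF f(1)[unfolded has_partials_def, rule_format]]]]) simp
  then show ?case using f(2,3) Suc.IH unfolding Cd.simps by blast
qed (auto intro!: continuous_intros)

lemma Cd_Im: "Cd n f \<Longrightarrow> Cd n (\<lambda>z. of_real (Im (f z)))"
proof -
  assume "Cd n f"
  then have "Cd n (\<lambda>z. of_real (Re ((- \<i>) * f z)))" by (intro Cd_Re Cd_cmult)
  then show ?thesis by simp
qed

lemma Cd_imp_C_diff: "Cd n f \<Longrightarrow> C_diff n (\<lambda>z. Re (f z))"
proof (induction n arbitrary: f)
  case (Suc n)
  then obtain fx fy where f: "has_partials f fx fy" "Cd n fx" "Cd n fy" unfolding Cd.simps by blast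
  have "((\<lambda>z. Re (f z)) has_derivative (\<lambda>h. Re h * Re (fx z) + Im h * Re (fy z))) (at z)" for z
    by (intro has_derivative_eq_rhs[OF has_derivative_Re[OF f(1)[unfolded has_partials_def, rule_format]]]) simp
  moreover have "C_diff n (\<lambda>z. Re (fx z))" "C_diff n (\<lambda>z. Re (fy z))" using Suc.IH f by blast+
  ultimately show ?case unfolding C_diff.simps
    by (intro exI[of _ "\<lambda>z. Re (fx z)"] exI[of _ "\<lambda>z. Re (fy z)"]) blast
qed (auto intro!: continuous_intros)

text \<open>The chain rule produces first partials of \<psi> composed with the same
  \<open>f\<close>, so the induction varies \<psi> and keeps \<open>f\<close> fixed. It makes the
  pullback of a bump function by a solution a legitimate test function.\<close>

lemma Cd_compose: "C_diff n \<psi> \<Longrightarrow> Cd n f \<Longrightarrow> Cd n (\<lambda>z. of_real (\<psi> (f z)))"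
proof (induction n arbitrary: \<psi>)
  case 0
  then have "continuous_on UNIV (\<lambda>z. \<psi> (f z))" using continuous_on_compose2[of UNIV \<psi> UNIV f] by simp
  then show ?case by (simp add: continuous_on_of_real)
next
  case (Suc n)
  then obtain fx fy where f: "has_partials f fx fy" "Cd n fx" "Cd n fy" unfolding Cd.simps by blast
  obtain px py where p: "\<And>z. (\<psi> has_derivative (\<lambda>h. Re h * px z + Im h * py z)) (at z)" "C_diff n px" "C_diff n py"
    using Suc.prems unfolding C_diff.simps by blast
  have "((\<lambda>z. \<psi> (f z)) has_derivative (\<lambda>h. Re h * (Re (fx z) * px (f z) + Im (fx z) * py (f z)) + Im h * (Re (fy z) * px (f z) + Im (fy z) * py (f z)))) (at z)" for z
    using has_derivative_compose[OF f(1)[unfolded has_partials_def, rule_format] p(1)]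
    by (rule has_derivative_eq_rhs) (auto simp: algebra_simps)
  then have "has_partials (\<lambda>z. of_real (\<psi> (f z))) (\<lambda>z. of_real (Re (fx z)) * of_real (px (f z)) + of_real (Im (fx z)) * of_real (py (f z)))
     (\<lambda>z. of_real (Re (fy z)) * of_real (px (f z)) + of_real (Im (fy z)) * of_real (py (f z)))"
    unfolding has_partials_def
  proof (intro allI)
    fix z
    assume *: "\<And>z. ((\<lambda>z. \<psi> (f z)) has_derivative (\<lambda>h. Re h * (Re (fx z) * px (f z) + Im (fx z) * py (f z)) + Im h * (Re (fy z) * px (f z) + Im (fy z) * py (f z)))) (at z)"
    show "((\<lambda>z. complex_of_real (\<psi> (f z))) has_derivative
         (\<lambda>h. of_real (Re h) * (of_real (Re (fx z)) * of_real (px (f z)) + of_real (Im (fx z)) * of_real (py (f z))) +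
              of_real (Im h) * (of_real (Re (fy z)) * of_real (px (f z)) + of_real (Im (fy z)) * of_real (py (f z))))) (at z)"
      using has_derivative_of_real[OF *[of z]] by (rule has_derivative_eq_rhs) simp
  qed
  moreover have "Cd n f" using Suc.prems Cd_SucD by blast
  then have pp: "Cd n (\<lambda>z. of_real (px (f z)))" "Cd n (\<lambda>z. of_real (py (f z)))" using Suc.IH p by blast+
  have "Cd n (\<lambda>z. of_real (Re (fx z)) * of_real (px (f z)) + of_real (Im (fx z)) * of_real (py (f z)))"
     "Cd n (\<lambda>z. of_real (Re (fy z)) * of_real (px (f z)) + of_real (Im (fy z)) * of_real (py (f z)))"
    by (intro Cd_add Cd_mult Cd_Re Cd_Im f pp)+
  ultimately show ?case unfolding Cd.simps by blast
qed

lemma Cd_id: "Cd n (\<lambda>z. z)"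
proof (cases n)
  case (Suc k)
  have "has_partials (\<lambda>z. z) (\<lambda>z. 1) (\<lambda>z. \<i>)"
    unfolding has_partials_def by (auto intro!: derivative_eq_intros simp: complex_eq_iff)
  then show ?thesis using Suc Cd_const[of k] unfolding Suc Cd.simps by blast
qed (auto intro: continuous_on_id)

lemma Cd_of_partials: "has_partials f fx fy \<Longrightarrow> (\<And>n. Cd n fx) \<Longrightarrow> (\<And>n. Cd n fy) \<Longrightarrow> Cd n f"
  by (cases n) (auto intro: has_partials_continuous)

section \<open>A global inverse function theorem\<close>

text \<open>Two partials bundled as a bounded operator, the form in which differentiation under the
  integral sign takes its derivative.\<close>

definition partials_blinfun :: "complex \<Rightarrow> complex \<Rightarrow> (complex \<Rightarrow>\<^sub>L complex)" where
  "partials_blinfun a b = (blinfun_mult_left a o\<^sub>L Blinfun (\<lambda>h. of_real (Re h))) + (blinfun_mult_left b o\<^sub>L Blinfun (\<lambda>h. of_real (Im h)))"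

lemma partials_blinfun_apply: "blinfun_apply (partials_blinfun a b) h = of_real (Re h) * a + of_real (Im h) * b"
proof -
  have "bounded_linear (\<lambda>h. complex_of_real (Re h))" "bounded_linear (\<lambda>h. complex_of_real (Im h))"
    using bounded_linear_compose[OF bounded_linear_of_real bounded_linear_Re]
      bounded_linear_compose[OF bounded_linear_of_real bounded_linear_Im] by simp_all
  then show ?thesis
    by (simp add: partials_blinfun_def plus_blinfun.rep_eq bounded_linear_Blinfun_apply)
qed

lemma continuous_partials_blinfun:
  assumes "continuous_on S a" "continuous_on S b"
  shows "continuous_on S (\<lambda>x. partials_blinfun (a x) (b x))"
  unfolding partials_blinfun_def
  by (intro continuous_intros assms bounded_linear.continuous_on[OF bounded_linear_blinfun_mult_left])

lemma leibniz_partials: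
  fixes F Fx Fy :: "complex \<Rightarrow> 'a::euclidean_space \<Rightarrow> complex"
  assumes der: "\<And>t. t \<in> cbox a b \<Longrightarrow> has_partials (\<lambda>z. F z t) (\<lambda>z. Fx z t) (\<lambda>z. Fy z t)"
    and int: "\<And>z. F z integrable_on cbox a b"
    and cont: "continuous_on (UNIV \<times> cbox a b) (\<lambda>(z, t). Fx z t)" "continuous_on (UNIV \<times> cbox a b) (\<lambda>(z, t). Fy z t)"
  shows "has_partials (\<lambda>z. integral (cbox a b) (F z)) (\<lambda>z. integral (cbox a b) (Fx z)) (\<lambda>z. integral (cbox a b) (Fy z))"
  unfolding has_partials_def
proof
  fix z
  let ?D = "\<lambda>z t. partials_blinfun (Fx z t) (Fy z t)"
  have contD: "continuous_on (UNIV \<times> cbox a b) (\<lambda>(z, t). ?D z t)"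
    using continuous_partials_blinfun[OF cont[unfolded case_prod_unfold]] by (simp add: case_prod_unfold)
  have c: "continuous_on (cbox a b) (G z)" if "continuous_on (UNIV \<times> cbox a b) (\<lambda>(z, t). G z t)" for G :: "complex \<Rightarrow> 'a \<Rightarrow> 'b::real_normed_vector"
    using continuous_on_compose2[OF that, of "cbox a b" "\<lambda>t. (z, t)"] by (simp add: continuous_intros image_subset_iff)
  have "((\<lambda>z. integral (cbox a b) (F z)) has_derivative blinfun_apply (integral (cbox a b) (?D z))) (at z within UNIV)"
    by (rule leibniz_rule[OF _ int contD]) (use der[unfolded has_partials_def] in \<open>auto simp: partials_blinfun_apply[abs_def]\<close>)
  moreover have "blinfun_apply (integral (cbox a b) (?D z)) h = of_real (Re h) * integral (cbox a b) (Fx z) + of_real (Im h) * integral (cbox a b) (Fy z)" for h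
  proof -
    have "?D z integrable_on cbox a b" by (rule integrable_continuous[OF c[OF contD]])
    from integral_linear[OF this blinfun.bounded_linear_left[of h]]
    have "blinfun_apply (integral (cbox a b) (?D z)) h = integral (cbox a b) (\<lambda>t. of_real (Re h) * Fx z t + of_real (Im h) * Fy z t)"
      by (simp add: o_def partials_blinfun_apply)
    also have "\<dots> = of_real (Re h) * integral (cbox a b) (Fx z) + of_real (Im h) * integral (cbox a b) (Fy z)"
      using integrable_continuous[OF c[OF cont(1)]] integrable_continuous[OF c[OF cont(2)]]
      by (subst integral_add) (auto intro: integrable_on_mult_right)
    finally show ?thesis .
  qed
  ultimately show "((\<lambda>z. integral (cbox a b) (F z)) has_derivative
      (\<lambda>h. of_real (Re h) * integral (cbox a b) (Fx z) + of_real (Im h) * integral (cbox a b) (Fy z))) (at z)"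
    by (auto elim!: has_derivative_eq_rhs)
qed

lemma has_partials_ray:
  assumes "has_partials A Ax Ay"
  shows "has_partials (\<lambda>z. A (of_real t * z)) (\<lambda>z. of_real t * Ax (of_real t * z)) (\<lambda>z. of_real t * Ay (of_real t * z))"
  unfolding has_partials_def
proof
  fix z
  have "((\<lambda>z. of_real t * z) has_derivative (\<lambda>h. complex_of_real t * h)) (at z)" by (auto intro!: derivative_eq_intros)
  from has_derivative_compose[OF this assms[unfolded has_partials_def, rule_format]]
  show "((\<lambda>z. A (of_real t * z)) has_derivative (\<lambda>h. of_real (Re h) * (of_real t * Ax (of_real t * z)) + of_real (Im h) * (of_real t * Ay (of_real t * z)))) (at z)"
    by (rule has_derivative_eq_rhs) (auto simp: algebra_simps)
qed

text \<open>The closed form A dx + B dy is integrated along rays from 0. Closedness turns the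
  x-partial of the integrand into the t-derivative of t A(tz), and the y-partial into that of t
  B(tz), so the fundamental theorem returns A and B.\<close>

lemma poincare_lemma:
  assumes A: "has_partials A Ax Ay" and B: "has_partials B Bx By"
    and c: "continuous_on UNIV Ax" "continuous_on UNIV Ay" "continuous_on UNIV Bx" "continuous_on UNIV By"
    and closed: "\<And>z. Ay z = Bx z"
  shows "has_partials (\<lambda>z. integral (cbox 0 1) (\<lambda>t::real. A (of_real t * z) * of_real (Re z) + B (of_real t * z) * of_real (Im z))) A B"
proof -
  define F where "F = (\<lambda>z (t::real). A (of_real t * z) * of_real (Re z) + B (of_real t * z) * of_real (Im z))"
  define Fx where "Fx = (\<lambda>z (t::real). (A (of_real t * z) + (of_real t * Ax (of_real t * z)) * of_real (Re z)) + (of_real t * Bx (of_real t * z)) * of_real (Im z))"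
  define Fy where "Fy = (\<lambda>z (t::real). (of_real t * Ay (of_real t * z)) * of_real (Re z) + (B (of_real t * z) + (of_real t * By (of_real t * z)) * of_real (Im z)))"
  have RI: "has_partials (\<lambda>z. of_real (Re z)) (\<lambda>z. 1) (\<lambda>z. 0)" "has_partials (\<lambda>z. of_real (Im z)) (\<lambda>z. 0) (\<lambda>z. 1)"
    unfolding has_partials_def by (auto intro!: derivative_eq_intros)
  have der: "has_partials (\<lambda>z. F z t) (\<lambda>z. Fx z t) (\<lambda>z. Fy z t)" for t
    using has_partials_add[OF has_partials_mult[OF has_partials_ray[OF A, of t] RI(1)] has_partials_mult[OF has_partials_ray[OF B, of t] RI(2)]]
    by (simp add: F_def Fx_def Fy_def)
  have cc: "continuous_on S (\<lambda>x. G (of_real (snd x) * fst x))" if "continuous_on UNIV G" for G :: "complex \<Rightarrow> complex" and S :: "(complex \<times> real) set"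
    by (intro continuous_on_compose2[OF that] continuous_intros) auto
  have cA: "continuous_on UNIV A" and cB: "continuous_on UNIV B" using A B has_partials_continuous by auto
  have contF: "continuous_on S (\<lambda>(z, t). F z t)" "continuous_on S (\<lambda>(z, t). Fx z t)" "continuous_on S (\<lambda>(z, t). Fy z t)" for S
    unfolding F_def Fx_def Fy_def case_prod_unfold by (intro continuous_intros cc c cA cB)+
  have c1: "continuous_on T (F z)" for z T
    using continuous_on_compose2[OF contF(1)[of UNIV], of T "\<lambda>t. (z, t)"] by (simp add: continuous_intros)
  have P: "has_partials (\<lambda>z. integral (cbox 0 1) (F z)) (\<lambda>z. integral (cbox 0 1) (Fx z)) (\<lambda>z. integral (cbox 0 1) (Fy z))"
    by (rule leibniz_partials[OF der _ contF(2,3)]) (rule integrable_continuous[OF c1])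
  have ray: "((\<lambda>t. of_real t * G (of_real t * z)) has_vector_derivative (G (of_real t * z) + of_real t * (of_real (Re z) * Gx (of_real t * z) + of_real (Im z) * Gy (of_real t * z)))) (at t within S)"
    if "has_partials G Gx Gy" for G Gx Gy z t S
  proof -
    have "((\<lambda>t. of_real t * z) has_derivative (\<lambda>h. of_real h * z)) (at t within S)" by (auto intro!: derivative_eq_intros)
    from has_derivative_compose[OF this that[unfolded has_partials_def, rule_format]]
    have "((\<lambda>t. G (of_real t * z)) has_vector_derivative (of_real (Re z) * Gx (of_real t * z) + of_real (Im z) * Gy (of_real t * z))) (at t within S)"
      unfolding has_vector_derivative_def by (rule has_derivative_eq_rhs) (auto simp: algebra_simps scaleR_conv_of_real)
    moreover have "(of_real has_vector_derivative (1::complex)) (at t within S)" 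
      unfolding has_vector_derivative_def by (auto intro!: derivative_eq_intros simp: scaleR_conv_of_real)
    ultimately show ?thesis by (auto intro!: derivative_eq_intros)
  qed
  have "integral (cbox 0 1) (Fx z) = A z" for z
  proof -
    have "((\<lambda>t. Fx z t) has_integral (of_real 1 * A (of_real 1 * z) - of_real 0 * A (of_real 0 * z))) {0..1}"
    proof (rule fundamental_theorem_of_calculus)
      fix t show "((\<lambda>t. of_real t * A (of_real t * z)) has_vector_derivative Fx z t) (at t within {0..1})"
        using ray[OF A, of z t "{0..1}"] by (simp add: Fx_def closed algebra_simps)
    qed simp
    then show ?thesis by (simp add: integral_unique)
  qed
  moreover have "integral (cbox 0 1) (Fy z) = B z" for z
  proof -
    have "((\<lambda>t. Fy z t) has_integral (of_real 1 * B (of_real 1 * z) - of_real 0 * B (of_real 0 * z))) {0..1}"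
    proof (rule fundamental_theorem_of_calculus)
      fix t show "((\<lambda>t. of_real t * B (of_real t * z)) has_vector_derivative Fy z t) (at t within {0..1})"
        using ray[OF B, of z t "{0..1}"] by (simp add: Fy_def closed algebra_simps)
    qed simp
    then show ?thesis by (simp add: integral_unique)
  qed
  ultimately show ?thesis using P by (simp add: F_def)
qed

text \<open>The lower bound and the Lipschitz bound give balls of one fixed size on which f is
  injective and whose images contain balls of one fixed size. So f is a covering of the plane, and
  simple connectivity lets the identity lift to a continuous inverse.\<close>

lemma hadamard_global_inverse:
  assumes f: "has_partials f fx fy" and c: "c > 0" and L: "L > 0"
    and lip: "\<And>z w. norm (fx z - fx w) \<le> L * norm (z - w)" "\<And>z w. norm (fy z - fy w) \<le> L * norm (z - w)"
    and low: "\<And>z h. norm (of_real (Re h) * fx z + of_real (Im h) * fy z) \<ge> c * norm h"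
  shows "bij f"
proof -
  \<comment> \<open>Within this distance the derivative moves by at most 2 L \<rho> = c / 2, half of
    its lower bound.\<close>
  define \<rho> where "\<rho> = c / (4 * L)"
  have \<rho>: "\<rho> > 0" using c L by (simp add: \<rho>_def)
  let ?D = "\<lambda>z h. of_real (Re h) * fx z + of_real (Im h) * fy z"
  have bl: "bounded_linear (?D z)" for z
    using blinfun.bounded_linear_right[of "partials_blinfun (fx z) (fy z)"] by (simp add: partials_blinfun_apply)
  have step1: "norm (f w - f z) \<ge> c / 2 * norm (w - z)" if "norm (w - z) \<le> \<rho>" for z w
  proof -
    have "norm ((f w - ?D z w) - (f z - ?D z z)) \<le> (c / 2) * norm (w - z)"
    proof (rule differentiable_bound[where S = "cball z \<rho>" and f' = "\<lambda>y h. ?D y h - ?D z h"])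
      fix y assume y: "y \<in> cball z \<rho>"
      show "((\<lambda>w. f w - ?D z w) has_derivative (\<lambda>h. ?D y h - ?D z h)) (at y within cball z \<rho>)"
        by (intro has_derivative_diff has_derivative_at_withinI[OF f[unfolded has_partials_def, rule_format]]
            bounded_linear_imp_has_derivative bl)
      show "onorm (\<lambda>h. ?D y h - ?D z h) \<le> c / 2"
      proof (rule onorm_le)
        fix h
        have "?D y h - ?D z h = of_real (Re h) * (fx y - fx z) + of_real (Im h) * (fy y - fy z)" by (simp add: algebra_simps)
        also have "norm \<dots> \<le> norm (of_real (Re h) * (fx y - fx z)) + norm (of_real (Im h) * (fy y - fy z))" by (rule norm_triangle_ineq)
        also have "\<dots> \<le> norm h * (L * \<rho>) + norm h * (L * \<rho>)"
        proof -
          have "L * norm (y - z) \<le> L * \<rho>" using y L by (intro mult_left_mono) (auto simp: dist_norm norm_minus_commute)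
          then have "norm (fx y - fx z) \<le> L * \<rho>" "norm (fy y - fy z) \<le> L * \<rho>" using lip[of y z] by linarith+
          then show ?thesis unfolding norm_mult norm_of_real
            by (intro add_mono mult_mono abs_Re_le_cmod abs_Im_le_cmod norm_ge_zero)
        qed
        also have "\<dots> = c / 2 * norm h" using L by (simp add: \<rho>_def)
        finally show "norm (?D y h - ?D z h) \<le> c / 2 * norm h" .
      qed
    qed (use that \<rho> in \<open>auto simp: dist_norm norm_minus_commute\<close>)
    moreover have "(f w - ?D z w) - (f z - ?D z z) = (f w - f z) - ?D z (w - z)" by (simp add: algebra_simps)
    ultimately have "norm ((f w - f z) - ?D z (w - z)) \<le> c / 2 * norm (w - z)" by simp
    moreover have "norm (?D z (w - z)) \<le> norm (f w - f z) + norm ((f w - f z) - ?D z (w - z))"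
      using norm_triangle_ineq4[of "f w - f z" "(f w - f z) - ?D z (w - z)"] by simp
    ultimately show ?thesis using low[of "w - z" z] by simp
  qed
  define r1 where "r1 = \<rho> / 2"
  have r1: "r1 > 0" using \<rho> by (simp add: r1_def)
  have contf: "continuous_on S f" for S using f by (rule has_partials_continuous)
  have apart: "z = w" if "f z = f w" "norm (z - w) \<le> \<rho>" for z w
    using step1[of z w] that c by (auto simp: mult_le_0_iff)
  have inj: "inj_on f (ball x r1)" for x
  proof (rule inj_onI)
    fix z w assume zw: "z \<in> ball x r1" "w \<in> ball x r1" "f z = f w"
    have "norm (z - w) \<le> \<rho>" using zw(1,2) dist_triangle2[of z w x] by (simp add: r1_def dist_norm norm_minus_commute)
    then show "z = w" using apart zw by blast
  qed
  have openf: "open (f ` S)" if "open S" "S \<subseteq> ball x r1" for S x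
    by (rule invariance_of_domain[OF contf that(1)]) (use inj that in \<open>blast intro: inj_on_subset\<close>)
  \<comment> \<open>The boundary circle is mapped outside the target ball, so the image of the open
    disk meets that ball in a set that is both open and closed in it.\<close>
  have step2: "ball (f z) (c / 2 * s) \<subseteq> f ` ball z s" if s: "0 < s" "s \<le> r1" for z s
  proof -
    let ?B = "ball (f z) (c / 2 * s)"
    have eq: "?B \<inter> f ` ball z s = ?B \<inter> f ` cball z s"
    proof -
      have False if "norm (w - z) = s" "f w \<in> ?B" for w
        using step1[of w z] that s by (simp add: dist_norm norm_minus_commute r1_def)
      then show ?thesis by (fastforce simp: dist_norm norm_minus_commute order_less_le)
    qed
    have "openin (top_of_set ?B) (?B \<inter> f ` ball z s)"
      by (rule openin_open_Int) (rule openf[of _ z]; use s in auto)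
    moreover have "closedin (top_of_set ?B) (?B \<inter> f ` ball z s)"
      unfolding eq by (rule closedin_closed_Int) (intro compact_imp_closed compact_continuous_image contf compact_cball)
    moreover have "f z \<in> ?B \<inter> f ` ball z s" using s c by auto
    ultimately have "?B \<inter> f ` ball z s = ?B"
      using connected_clopen[of ?B] by (metis connected_ball empty_iff)
    then show ?thesis by blast
  qed
  have surj: "f ` UNIV = UNIV"
  proof -
    have "open (f ` UNIV)"
    proof (rule openI)
      fix y assume "y \<in> f ` UNIV"
      then obtain z where "y = f z" by blast
      then show "\<exists>e>0. ball y e \<subseteq> f ` UNIV" using step2[of r1 z] r1 c by (intro exI[of _ "c / 2 * r1"]) auto
    qed
    moreover have "closed (f ` UNIV)"
      unfolding closed_limpt islimpt_approachable
    proof (intro allI impI)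
      fix y assume "\<forall>e>0. \<exists>x'\<in>range f. x' \<noteq> y \<and> dist x' y < e"
      then obtain z where "dist (f z) y < c / 2 * r1" using r1 c by (metis rangeE mult_pos_pos half_gt_zero)
      then show "y \<in> range f" using step2[of r1 z] r1 by auto
    qed
    ultimately show ?thesis using connected_clopen[of "UNIV::complex set"] by auto
  qed
  have "covering_space UNIV f UNIV"
    unfolding covering_space_def
  proof (intro conjI ballI)
    fix y :: complex
    \<comment> \<open>Every point mapped into \<open>ball y r\<close> then lies within
      \<open>r1 / 4\<close> of a preimage of y, and distinct preimages of y are more than
      \<open>2 * r1\<close> apart, so the sheets around them are disjoint and exhaust the
      preimage.\<close>
    define r where "r = c / 2 * (r1 / 4)"
    have r: "r > 0" using c r1 by (simp add: r_def)
    define sh where "sh = (\<lambda>x. ball x r1 \<inter> f -` ball y r)"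
    define v where "v = sh ` {x. f x = y}"
    have opsh: "open (sh x)" for x unfolding sh_def by (intro open_Int open_ball open_vimage contf)
    show "\<exists>T. y \<in> T \<and> openin (top_of_set UNIV) T \<and> (\<exists>v. \<Union> v = UNIV \<inter> f -` T \<and> (\<forall>u\<in>v. openin (top_of_set UNIV) u) \<and> disjoint v \<and> (\<forall>u\<in>v. \<exists>q. homeomorphism u T f q))"
    proof (intro exI[of _ "ball y r"] conjI exI[of _ v])
      show "\<Union> v = UNIV \<inter> f -` ball y r"
      proof
        show "UNIV \<inter> f -` ball y r \<subseteq> \<Union> v"
        proof
          fix z assume "z \<in> UNIV \<inter> f -` ball y r"
          then have z: "dist y (f z) < r" by simp
          then have "y \<in> ball (f z) (c / 2 * (r1 / 4))" by (simp add: r_def dist_commute)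
          then obtain x where x: "x \<in> ball z (r1 / 4)" "f x = y" using step2[of "r1 / 4" z] r1 by auto
          then have "z \<in> sh x" using z r1 by (auto simp: sh_def dist_commute)
          then show "z \<in> \<Union> v" using x by (auto simp: v_def)
        qed
      qed (auto simp: v_def sh_def)
      show "\<forall>u\<in>v. openin (top_of_set UNIV) u" by (auto simp: v_def opsh)
      show "disjoint v"
      proof (rule pairwiseI)
        fix u u' assume u: "u \<in> v" "u' \<in> v" "u \<noteq> u'"
        then obtain x x' where x: "u = sh x" "u' = sh x'" "f x = y" "f x' = y" by (auto simp: v_def)
        have "\<not> norm (x - x') \<le> \<rho>" using apart[of x x'] x u by auto
        then have "disjnt (ball x r1) (ball x' r1)"
          unfolding disjnt_def by (subst disjoint_ballI) (auto simp: r1_def dist_norm)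
        then show "disjnt u u'" using x by (auto simp: sh_def disjnt_def)
      qed
      show "\<forall>u\<in>v. \<exists>q. homeomorphism u (ball y r) f q"
      proof
        fix u assume "u \<in> v"
        then obtain x where x: "u = sh x" "f x = y" by (auto simp: v_def)
        have i: "inj_on f u" using inj[of x] x by (auto simp: sh_def intro: inj_on_subset)
        have im: "f ` u = ball y r"
        proof
          show "ball y r \<subseteq> f ` u"
          proof
            fix w assume w: "w \<in> ball y r"
            then have "w \<in> ball (f x) (c / 2 * (r1 / 4))" by (simp add: r_def x)
            then obtain z where "z \<in> ball x (r1 / 4)" "w = f z" using step2[of "r1 / 4" x] r1 by auto
            then show "w \<in> f ` u" using w r1 by (auto simp: x sh_def)
          qed
        qed (auto simp: x sh_def)
        obtain q where "homeomorphism u (f ` u) f q"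
          using invariance_of_domain_homeomorphism[OF _ contf _ i] opsh x by (metis order_refl)
        then show "\<exists>q. homeomorphism u (ball y r) f q" using im by auto
      qed
    qed (use r in auto)
  qed (use contf surj in auto)
  then obtain g where g: "continuous_on UNIV g" "\<And>y. f (g y) = y"
    by (rule covering_space_lift[of UNIV f UNIV UNIV "\<lambda>x. x"])
      (auto simp: convex_imp_simply_connected convex_imp_locally_path_connected)
  \<comment> \<open>So far the lift is only a right inverse. Its range is open by invariance of
    domain and closed as the set where \<open>g (f z) = z\<close>, hence everything.\<close>
  have "range g = UNIV"
  proof -
    have "inj g" by (metis g(2) injI)
    then have "open (range g)" using invariance_of_domain[OF g(1)] by simp
    moreover have "range g = {z. g (f z) = z}" using g(2) by (auto intro: sym)
    then have "closed (range g)"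
      using closed_Collect_eq[of "\<lambda>z. g (f z)" "\<lambda>z. z"] continuous_on_compose2[OF g(1) contf] by simp
    ultimately show ?thesis using connected_clopen[of "UNIV::complex set"] by auto
  qed
  then have "inj f" by (metis g(2) injI rangeE UNIV_I)
  then show ?thesis using surj by (simp add: bij_def)
qed

section \<open>The holomorphic family of Beltrami solutions\<close>

lemma tpoly_norm_sum: "norm (tpoly e a z) \<le> (\<Sum>p\<in>tbox e. norm (a p))"
  unfolding tpoly_def by (rule order_trans[OF norm_sum]) (simp add: norm_mult)

text \<open>The box of degree (n+1) d holds a number of frequencies quadratic in n, which raises the
  exponent by 2.\<close>

lemma poly_growth_tpoly:
  assumes "\<And>n p. norm (a n p) \<le> C * real (n + 1) ^ N"
  shows "poly_growth (\<lambda>n. tpoly (Suc n * d) (a n))"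
proof -
  have "norm (a 0 0) \<le> C" using assms[of 0 0] by simp
  then have C: "C \<ge> 0" using norm_ge_zero[of "a 0 0"] by linarith
  have "norm (tpoly (Suc n * d) (a n) z) \<le> (C * real (2 * d + 1) ^ 2) * real (n + 1) ^ (N + 2)" for n z
  proof -
    have "norm (tpoly (Suc n * d) (a n) z) \<le> (\<Sum>p\<in>tbox (Suc n * d). C * real (n + 1) ^ N)"
      by (rule order_trans[OF tpoly_norm_sum]) (intro sum_mono assms)
    also have "\<dots> = real (2 * (Suc n * d) + 1) ^ 2 * (C * real (n + 1) ^ N)"
      by (simp add: tbox_def card_cartesian_product nat_add_distrib power2_eq_square algebra_simps)
    also have "\<dots> \<le> (real (2 * d + 1) * real (n + 1)) ^ 2 * (C * real (n + 1) ^ N)"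
    proof (intro mult_right_mono power_mono)
      have "2 * (Suc n * d) + 1 \<le> (2 * d + 1) * (n + 1)" by (simp add: algebra_simps)
      then show "real (2 * (Suc n * d) + 1) \<le> real (2 * d + 1) * real (n + 1)"
        unfolding of_nat_mult[symmetric] by (simp only: of_nat_le_iff)
    qed (use C in auto)
    also have "\<dots> = (C * real (2 * d + 1) ^ 2) * real (n + 1) ^ (N + 2)"
      by (simp only: power_mult_distrib power_add mult_ac)
    finally show ?thesis .
  qed
  then show ?thesis unfolding poly_growth_def using continuous_tpoly by blast
qed

text \<open>A partial derivative multiplies a coefficient by a frequency of size at most (n+1) d, so
  polynomially growing coefficients stay polynomially growing.\<close>

lemma growth_index_mult:
  assumes a: "\<And>n p. norm (a n p) \<le> C * real (n + 1) ^ N" and supp: "\<And>n p. p \<notin> tbox (Suc n * d) \<Longrightarrow> a n p = 0"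
  shows "norm (\<i> * of_int (fst p) * a n p) \<le> (C * real d) * real (n + 1) ^ (N + 1)"
    and "norm (\<i> * of_int (snd p) * a n p) \<le> (C * real d) * real (n + 1) ^ (N + 1)"
proof -
  have "norm (a 0 0) \<le> C" using a[of 0 0] by simp
  then have C: "C \<ge> 0" using norm_ge_zero[of "a 0 0"] by linarith
  have *: "real_of_int \<bar>k\<bar> * norm (a n p) \<le> (C * real d) * real (n + 1) ^ (N + 1)"
    if "p \<in> tbox (Suc n * d) \<Longrightarrow> \<bar>k\<bar> \<le> int (Suc n * d)" for k
  proof (cases "p \<in> tbox (Suc n * d)")
    case True
    then have "real_of_int \<bar>k\<bar> \<le> real (Suc n * d)" using that by (metis of_int_le_iff of_int_of_nat_eq)
    then have "real_of_int \<bar>k\<bar> * norm (a n p) \<le> real (Suc n * d) * (C * real (n + 1) ^ N)"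
      using a[of n p] by (intro mult_mono) auto
    also have "\<dots> = (C * real d) * real (n + 1) ^ (N + 1)" by (simp add: algebra_simps)
    finally show ?thesis .
  next
    case False
    then show ?thesis using supp C by simp
  qed
  have "real_of_int \<bar>fst p\<bar> * norm (a n p) \<le> (C * real d) * real (n + 1) ^ (N + 1)"
    "real_of_int \<bar>snd p\<bar> * norm (a n p) \<le> (C * real d) * real (n + 1) ^ (N + 1)"
    by (rule *; auto simp: tbox_def abs_le_iff mem_Times_iff)+
  then show "norm (\<i> * of_int (fst p) * a n p) \<le> (C * real d) * real (n + 1) ^ (N + 1)"
    and "norm (\<i> * of_int (snd p) * a n p) \<le> (C * real d) * real (n + 1) ^ (N + 1)"
    by (simp_all add: norm_mult)
qed

lemma Cd_tpoly: "Cd k (tpoly d a)"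
proof (induction k arbitrary: a)
  case 0
  then show ?case by (simp add: continuous_tpoly)
next
  case (Suc k)
  then show ?case unfolding Cd.simps using has_partials_tpoly by blast
qed

text \<open>Partials of such a series are series of the same kind with larger growth constants, so
  the induction on k must generalise over \<open>a\<close>, \<open>C\<close> and
  \<open>N\<close>.\<close>

lemma Cd_power_fun_series:
  assumes a: "\<And>n p. norm (a n p) \<le> C * real (n + 1) ^ N" and supp: "\<And>n p. p \<notin> tbox (Suc n * d) \<Longrightarrow> a n p = 0"
    and l: "norm l < 1"
  shows "Cd k (power_fun_series (\<lambda>n. tpoly (Suc n * d) (a n)) l)"
  using a supp
proof (induction k arbitrary: a C N)
  case (0 a C N)
  have g: "poly_growth (\<lambda>n. tpoly (Suc n * d) (a n))" using 0 by (intro poly_growth_tpoly) blast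
  have "continuous_on UNIV (\<lambda>z. case (l, z) of (l, z) \<Rightarrow> power_fun_series (\<lambda>n. tpoly (Suc n * d) (a n)) l z)"
    by (rule continuous_on_compose2[OF power_fun_series_continuous[OF g]])
      (use l in \<open>auto intro!: continuous_on_Pair continuous_on_const continuous_on_id\<close>)
  then show ?case by simp
next
  case (Suc k a C N)
  let ?ax = "\<lambda>n p. \<i> * of_int (fst p) * a n p" and ?ay = "\<lambda>n p. \<i> * of_int (snd p) * a n p"
  have gr: "norm (?ax n p) \<le> (C * real d) * real (n + 1) ^ (N + 1)" "norm (?ay n p) \<le> (C * real d) * real (n + 1) ^ (N + 1)" for n p
    using growth_index_mult[of a C N d, OF Suc.prems] by blast+
  have sp: "?ax n p = 0" "?ay n p = 0" if "p \<notin> tbox (Suc n * d)" for n p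
    using Suc.prems(2)[OF that] by simp_all
  have "has_partials (power_fun_series (\<lambda>n. tpoly (Suc n * d) (a n)) l)
      (power_fun_series (\<lambda>n. tpoly (Suc n * d) (?ax n)) l) (power_fun_series (\<lambda>n. tpoly (Suc n * d) (?ay n)) l)"
    by (rule power_fun_series_partials[OF poly_growth_tpoly[OF Suc.prems(1)] poly_growth_tpoly[OF gr(1)] poly_growth_tpoly[OF gr(2)] has_partials_tpoly l])
  moreover have "Cd k (power_fun_series (\<lambda>n. tpoly (Suc n * d) (?ax n)) l)"
    by (rule Suc.IH[OF gr(1) sp(1)])
  moreover have "Cd k (power_fun_series (\<lambda>n. tpoly (Suc n * d) (?ay n)) l)"
    by (rule Suc.IH[OF gr(2) sp(2)])
  ultimately show ?case unfolding Cd.simps by blast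
qed

lemma has_partials_lipschitz:
  assumes f: "has_partials f fx fy" and b: "\<And>z. norm (fx z) \<le> M" "\<And>z. norm (fy z) \<le> M"
  shows "norm (f z - f w) \<le> 2 * M * norm (z - w)"
proof (rule differentiable_bound[where S = UNIV and f' = "\<lambda>z h. of_real (Re h) * fx z + of_real (Im h) * fy z"])
  fix x
  show "(f has_derivative (\<lambda>h. of_real (Re h) * fx x + of_real (Im h) * fy x)) (at x within UNIV)"
    using f by (simp add: has_partials_def)
  show "onorm (\<lambda>h. of_real (Re h) * fx x + of_real (Im h) * fy x) \<le> 2 * M"
  proof (rule onorm_le)
    fix h
    have "norm (of_real (Re h) * fx x + of_real (Im h) * fy x) \<le> norm (of_real (Re h) * fx x) + norm (of_real (Im h) * fy x)"
      by (rule norm_triangle_ineq)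
    also have "\<dots> \<le> norm h * M + norm h * M"
      unfolding norm_mult norm_of_real by (intro add_mono mult_mono abs_Re_le_cmod abs_Im_le_cmod b norm_ge_zero)
    finally show "norm (of_real (Re h) * fx x + of_real (Im h) * fy x) \<le> 2 * M * norm h" by simp
  qed
qed auto

context trig_coeff
begin

text \<open>The extra factor \<open>l\<close> shifts the exponents: the n-th Neumann term carries
  l^(n+1).\<close>

definition g :: "complex \<Rightarrow> complex \<Rightarrow> complex" where "g l z = l * power_fun_series G l z"
definition gx :: "complex \<Rightarrow> complex \<Rightarrow> complex" where "gx l z = l * power_fun_series Gx l z"
definition gy :: "complex \<Rightarrow> complex \<Rightarrow> complex" where "gy l z = l * power_fun_series Gy l z"
definition U :: "complex \<Rightarrow> complex \<Rightarrow> complex" where "U l z = exp (g l z)"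
text \<open>With \<open>U\<close> as z-derivative and \<open>l * mu * U\<close> as zbar-derivative,
  their sum is the x-partial of the solution, and \<i> times their difference is the y-partial,
  which is \<open>B\<close>.\<close>

definition A :: "complex \<Rightarrow> complex \<Rightarrow> complex" where "A l z = U l z * (1 + l * mu z)"
definition B :: "complex \<Rightarrow> complex \<Rightarrow> complex" where "B l z = \<i> * (U l z * (1 - l * mu z))"
definition sol :: "complex \<Rightarrow> complex \<Rightarrow> complex" where
  "sol l z = integral (cbox 0 1) (\<lambda>t::real. A l (of_real t * z) * of_real (Re z) + B l (of_real t * z) * of_real (Im z))"

lemma gco_bound: "norm (gco d m n p) \<le> (2 * K) * real (n + 1) ^ 0"
  using gco_norm_le by simp

lemma G_growth: "poly_growth G" "poly_growth Gx" "poly_growth Gy"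
  unfolding G_def[abs_def] Gx_def[abs_def] Gy_def[abs_def]
  using poly_growth_tpoly[OF gco_bound] poly_growth_tpoly[OF growth_index_mult(1)[OF gco_bound gco_supp]]
    poly_growth_tpoly[OF growth_index_mult(2)[OF gco_bound gco_supp]] by auto

lemma g_partials: "norm l < 1 \<Longrightarrow> has_partials (g l) (gx l) (gy l)"
  unfolding g_def[abs_def] gx_def[abs_def] gy_def[abs_def]
  by (intro has_partials_cmult power_fun_series_partials G_growth G_partials)

lemma Cd_g: "norm l < 1 \<Longrightarrow> Cd k (g l)"
  unfolding g_def[abs_def] G_def[abs_def]
  by (intro Cd_cmult Cd_power_fun_series[OF gco_bound gco_supp])

lemma g_bounds:
  assumes "norm l < 1"
  obtains M where "M \<ge> 0" "\<And>z. norm (g l z) \<le> M" "\<And>z. norm (gx l z) \<le> M" "\<And>z. norm (gy l z) \<le> M"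
proof -
  have b: "\<exists>B\<ge>0. \<forall>z. norm (l * power_fun_series F l z) \<le> B" if F: "poly_growth F" for F
  proof -
    obtain B where B: "B \<ge> 0" "\<And>z. norm (power_fun_series F l z) \<le> B" using power_fun_series_bound[OF F assms] by blast
    have "norm (l * power_fun_series F l z) \<le> 1 * B" for z
      unfolding norm_mult using assms B by (intro mult_mono) auto
    then show ?thesis using B by auto
  qed
  obtain M1 M2 M3 where M: "M1 \<ge> 0" "M2 \<ge> 0" "M3 \<ge> 0" "\<And>z. norm (g l z) \<le> M1" "\<And>z. norm (gx l z) \<le> M2" "\<And>z. norm (gy l z) \<le> M3"
    unfolding g_def gx_def gy_def using b[OF G_growth(1)] b[OF G_growth(2)] b[OF G_growth(3)] by blast
  show thesis
  proof (rule that[of "M1 + M2 + M3"])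
    show "norm (g l z) \<le> M1 + M2 + M3" "norm (gx l z) \<le> M1 + M2 + M3" "norm (gy l z) \<le> M1 + M2 + M3" for z
      using M(1-3) M(4)[of z] M(5)[of z] M(6)[of z] by linarith+
  qed (use M in simp)
qed

lemma g_equation:
  assumes l: "norm l < 1"
  shows "gx l z + \<i> * gy l z = l * (mux z - \<i> * muy z) + l * mu z * (gx l z - \<i> * gy l z)"
proof -
  have sx: "(\<lambda>n. Gx n z * l ^ n) sums power_fun_series Gx l z" and sy: "(\<lambda>n. Gy n z * l ^ n) sums power_fun_series Gy l z"
    unfolding power_fun_series_def using power_fun_series_summable[OF _ l] G_growth by (auto intro: summable_sums)
  define X where "X = power_fun_series Gx l z"
  define Y where "Y = power_fun_series Gy l z"
  have s1: "(\<lambda>n. (Gx n z + \<i> * Gy n z) * l ^ n) sums (X + \<i> * Y)"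
    using sums_add[OF sx sums_mult[OF sy, of \<i>]] by (simp add: X_def Y_def algebra_simps)
  have s2: "(\<lambda>n. (Gx n z - \<i> * Gy n z) * l ^ n) sums (X - \<i> * Y)"
    using sums_diff[OF sx sums_mult[OF sy, of \<i>]] by (simp add: X_def Y_def algebra_simps)
  have "(\<lambda>n. (Gx (Suc n) z + \<i> * Gy (Suc n) z) * l ^ Suc n) sums (X + \<i> * Y - (mux z - \<i> * muy z))"
  proof -
    have "Gx 0 z + \<i> * Gy 0 z = mux z - \<i> * muy z" using G_dzb_0[of z] by (metis divide_cancel_right zero_neq_numeral)
    then show ?thesis using s1 sums_Suc_iff[of "\<lambda>n. (Gx n z + \<i> * Gy n z) * l ^ n"] by simp
  qed
  moreover have "(\<lambda>n. (Gx (Suc n) z + \<i> * Gy (Suc n) z) * l ^ Suc n) sums (l * mu z * (X - \<i> * Y))"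
  proof -
    have "(Gx (Suc n) z + \<i> * Gy (Suc n) z) * l ^ Suc n = l * mu z * ((Gx n z - \<i> * Gy n z) * l ^ n)" for n
    proof -
      have "Gx (Suc n) z + \<i> * Gy (Suc n) z = mu z * (Gx n z - \<i> * Gy n z)" using G_dzb_Suc[of n z] by (metis divide_cancel_right times_divide_eq_right zero_neq_numeral)
      then show ?thesis by (simp add: mult_ac)
    qed
    then show ?thesis using sums_mult[OF s2, of "l * mu z"] by (simp only:)
  qed
  ultimately have "X + \<i> * Y - (mux z - \<i> * muy z) = l * mu z * (X - \<i> * Y)" by (rule sums_unique2)
  then have "X + \<i> * Y = (mux z - \<i> * muy z) + l * mu z * (X - \<i> * Y)" by (simp add: algebra_simps)
  then have "l * (X + \<i> * Y) = l * ((mux z - \<i> * muy z) + l * mu z * (X - \<i> * Y))" by simp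
  then show ?thesis by (simp add: gx_def gy_def X_def[symmetric] Y_def[symmetric] algebra_simps)
qed

definition Ax where "Ax l z = U l z * (0 + l * mux z) + U l z * gx l z * (1 + l * mu z)"
definition Ay where "Ay l z = U l z * (0 + l * muy z) + U l z * gy l z * (1 + l * mu z)"
definition Bx where "Bx l z = \<i> * (U l z * (0 + (- l) * mux z) + U l z * gx l z * (1 + (- l) * mu z))"
definition By where "By l z = \<i> * (U l z * (0 + (- l) * muy z) + U l z * gy l z * (1 + (- l) * mu z))"

lemma U_partials: "norm l < 1 \<Longrightarrow> has_partials (U l) (\<lambda>z. U l z * gx l z) (\<lambda>z. U l z * gy l z)"
  unfolding U_def[abs_def] by (intro has_partials_exp g_partials)

lemma A_partials: "norm l < 1 \<Longrightarrow> has_partials (A l) (Ax l) (Ay l)"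
  unfolding A_def[abs_def] Ax_def[abs_def] Ay_def[abs_def]
  by (intro has_partials_mult has_partials_add has_partials_const has_partials_cmult U_partials mu_partials)

lemma B_partials: "norm l < 1 \<Longrightarrow> has_partials (B l) (Bx l) (By l)"
proof -
  assume l: "norm l < 1"
  have "has_partials (\<lambda>z. \<i> * (U l z * (1 + (- l) * mu z))) (Bx l) (By l)"
    unfolding Bx_def[abs_def] By_def[abs_def]
    by (intro has_partials_mult has_partials_add has_partials_const has_partials_cmult U_partials mu_partials l)
  then show ?thesis by (simp add: B_def[abs_def])
qed

lemma Cd_U: "norm l < 1 \<Longrightarrow> Cd k (U l)"
  unfolding U_def[abs_def] by (intro Cd_exp Cd_g)

lemma cont_parts:
  assumes "norm l < 1"
  shows "continuous_on S (U l)" "continuous_on S (gx l)" "continuous_on S (gy l)"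
proof -
  have F: "continuous_on UNIV (power_fun_series F l)" if "poly_growth F" for F
  proof -
    have "continuous_on UNIV (\<lambda>z. case (l, z) of (l, z) \<Rightarrow> power_fun_series F l z)"
      by (rule continuous_on_compose2[OF power_fun_series_continuous[OF that]])
        (use assms in \<open>auto intro!: continuous_on_Pair continuous_on_const continuous_on_id\<close>)
    then show ?thesis by simp
  qed
  show "continuous_on S (U l)" using Cd_continuous[OF Cd_U[OF assms, of 0]] continuous_on_subset by blast
  show "continuous_on S (gx l)" "continuous_on S (gy l)"
    unfolding gx_def[abs_def] gy_def[abs_def]
    by (intro continuous_on_mult continuous_on_const continuous_on_subset[OF F[OF G_growth(2)]] continuous_on_subset[OF F[OF G_growth(3)]]; simp)+
qed

lemma cont_AB:
  assumes "norm l < 1"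
  shows "continuous_on S (Ax l)" "continuous_on S (Ay l)" "continuous_on S (Bx l)" "continuous_on S (By l)"
  unfolding Ax_def[abs_def] Ay_def[abs_def] Bx_def[abs_def] By_def[abs_def]
  by (intro continuous_on_mult continuous_on_add continuous_on_const cont_parts[OF assms] cont_mu cont_mux cont_muy)+

text \<open>Closedness of A dx + B dy is \<open>g_equation\<close> multiplied by
  \<open>U\<close>.\<close>

lemma Ay_eq_Bx:
  assumes l: "norm l < 1"
  shows "Ay l z = Bx l z"
proof -
  have "\<i> * (gy l z * (1 + l * mu z) + l * muy z) = \<i> * (\<i> * (gx l z * (1 - l * mu z) - l * mux z))"
    using g_equation[OF l, of z] by (simp add: algebra_simps)
  then have "gy l z * (1 + l * mu z) + l * muy z = \<i> * (gx l z * (1 - l * mu z) - l * mux z)"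
    by (metis mult_cancel_left complex_i_not_zero)
  then have "U l z * (gy l z * (1 + l * mu z) + l * muy z) = U l z * (\<i> * (gx l z * (1 - l * mu z) - l * mux z))" by simp
  then show ?thesis by (simp add: Ay_def Bx_def algebra_simps)
qed

lemma sol_partials:
  assumes l: "norm l < 1"
  shows "has_partials (sol l) (A l) (B l)"
  unfolding sol_def[abs_def]
  by (rule poincare_lemma[OF A_partials[OF l] B_partials[OF l] cont_AB[OF l] Ay_eq_Bx[OF l]])

lemma mu_bound: "norm (mu z) \<le> 1" by (simp add: mu_def bound)

text \<open>Periodicity is what provides global bounds: \<open>g\<close> and its partials are
  bounded on the plane, so \<open>U\<close> stays away from 0 and infinity and all second partials
  of the solution are bounded.\<close>

lemma sol_bij:
  assumes l: "norm l < 1"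
  shows "bij (sol l)"
proof -
  obtain M where M: "M \<ge> 0" "\<And>z. norm (g l z) \<le> M" "\<And>z. norm (gx l z) \<le> M" "\<And>z. norm (gy l z) \<le> M"
    using g_bounds[OF l] by blast
  have Ub: "norm (U l z) \<le> exp M" "norm (U l z) \<ge> exp (- M)" for z
    using M(2)[of z] abs_Re_le_cmod[of "g l z"] by (auto simp: U_def)
  define N where "N = (\<Sum>p\<in>tbox d. norm (\<i> * of_int (fst p) * m p)) + (\<Sum>p\<in>tbox d. norm (\<i> * of_int (snd p) * m p))"
  have N: "N \<ge> 0" "norm (mux z) \<le> N" "norm (muy z) \<le> N" for z
    using tpoly_norm_sum[of d "\<lambda>p. \<i> * of_int (fst p) * m p" z] tpoly_norm_sum[of d "\<lambda>p. \<i> * of_int (snd p) * m p" z]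
      sum_nonneg[of "tbox d" "\<lambda>p. norm (\<i> * of_int (fst p) * m p)"] sum_nonneg[of "tbox d" "\<lambda>p. norm (\<i> * of_int (snd p) * m p)"]
    unfolding N_def mux_def muy_def by auto
  define L where "L = exp M * N + exp M * M * 2 + 1"
  have gen: "norm (U l z * (0 + e * v) + U l z * w * (1 + e * mu z)) \<le> L"
    if "norm e < 1" "norm v \<le> N" "norm w \<le> M" for e v w z
  proof -
    have "norm (e * v) \<le> 1 * N" unfolding norm_mult using that N by (intro mult_mono) auto
    moreover have "norm (1 + e * mu z) \<le> 2"
    proof -
      have "norm (e * mu z) \<le> 1 * 1" unfolding norm_mult using that mu_bound by (intro mult_mono) auto
      then show ?thesis using norm_triangle_ineq[of 1 "e * mu z"] by simp
    qed
    ultimately have "norm (U l z) * norm (0 + e * v) + norm (U l z) * norm w * norm (1 + e * mu z) \<le> exp M * N + exp M * M * 2"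
      using that Ub(1)[of z] M(1) N(1) by (intro add_mono mult_mono) auto
    moreover have "norm (U l z * (0 + e * v) + U l z * w * (1 + e * mu z)) \<le> norm (U l z) * norm (0 + e * v) + norm (U l z) * norm w * norm (1 + e * mu z)"
      using norm_triangle_ineq[of "U l z * (0 + e * v)" "U l z * w * (1 + e * mu z)"] by (simp add: norm_mult)
    ultimately show ?thesis by (simp add: L_def)
  qed
  have L: "norm (Ax l z) \<le> L" "norm (Ay l z) \<le> L" "norm (Bx l z) \<le> L" "norm (By l z) \<le> L" for z
    unfolding Ax_def Ay_def Bx_def By_def
    using gen[of l "mux z" "gx l z" z] gen[of l "muy z" "gy l z" z] gen[of "- l" "mux z" "gx l z" z] gen[of "- l" "muy z" "gy l z" z] l M N
    by (simp_all add: norm_mult)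
  have L0: "L > 0" using M N by (simp add: L_def add_nonneg_pos)
  show ?thesis
  proof (rule hadamard_global_inverse[OF sol_partials[OF l], where c = "exp (- M) * (1 - norm l)" and L = "2 * L"])
    show "norm (A l z - A l w) \<le> 2 * L * norm (z - w)" "norm (B l z - B l w) \<le> 2 * L * norm (z - w)" for z w
      using has_partials_lipschitz[OF A_partials[OF l] L(1,2)] has_partials_lipschitz[OF B_partials[OF l] L(3,4)] by auto
    fix z h
    \<comment> \<open>Wirtinger form of the derivative; its modulus is at least |U| (1 - |l|) |h|
      because mu is bounded by 1.\<close>
    have "of_real (Re h) * A l z + of_real (Im h) * B l z = U l z * (h + l * mu z * cnj h)"
    proof -
      have "of_real (Re h) + \<i> * of_real (Im h) = h" "of_real (Re h) - \<i> * of_real (Im h) = cnj h"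
        by (simp_all add: complex_eq_iff)
      then have "U l z * (h + l * mu z * cnj h) = U l z * ((of_real (Re h) + \<i> * of_real (Im h)) + l * mu z * (of_real (Re h) - \<i> * of_real (Im h)))" by simp
      then show ?thesis by (simp add: A_def B_def algebra_simps)
    qed
    moreover have "norm (h + l * mu z * cnj h) \<ge> (1 - norm l) * norm h"
    proof -
      have "norm (l * mu z * cnj h) \<le> norm l * 1 * norm h"
        unfolding norm_mult using mu_bound by (intro mult_mono) auto
      then show ?thesis using norm_diff_ineq[of h "l * mu z * cnj h"] by (simp add: algebra_simps)
    qed
    ultimately show "exp (- M) * (1 - norm l) * norm h \<le> norm (of_real (Re h) * A l z + of_real (Im h) * B l z)"
      using Ub(2)[of z] l by (simp add: norm_mult mult.assoc mult_mono)
  qed (use l L0 in auto)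
qed

lemma sol_0: "sol l 0 = 0" by (simp add: sol_def)

lemma sol_id: "sol 0 z = z"
  by (simp add: sol_def A_def B_def U_def g_def complex_eq_iff)

text \<open>Dependence on the parameter is a convergent power series, passed through the exponential
  and then through the ray integral by differentiation under the integral sign.\<close>

lemma sol_holomorphic: "(\<lambda>l. sol l z) holomorphic_on ball 0 1"
  unfolding sol_def
proof -
  \<comment> \<open>The parameter derivative of \<open>g\<close>, by the product rule.\<close>
  define P where "P = (\<lambda>l w. power_fun_series G l w + l * power_fun_series (\<lambda>n z. of_nat (Suc n) * G (Suc n) z) l w)"
  define U' where "U' = (\<lambda>l w. U l w * P l w)"
  have dU: "((\<lambda>l. U l w) has_field_derivative U' l w) (at l)" if "norm l < 1" for l w
    unfolding U_def g_def U'_def P_def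
    by (auto intro!: derivative_eq_intros power_fun_series_deriv[OF G_growth(1) that] simp: algebra_simps)
  define I' where "I' = (\<lambda>l (t::real). (U' l (of_real t * z) * (1 + l * mu (of_real t * z)) + U l (of_real t * z) * mu (of_real t * z)) * of_real (Re z) +
      \<i> * (U' l (of_real t * z) * (1 - l * mu (of_real t * z)) - U l (of_real t * z) * mu (of_real t * z)) * of_real (Im z))"
  have ps: "continuous_on (ball 0 1 \<times> cbox 0 1) (\<lambda>x. power_fun_series F (fst x) (of_real (snd x) * z))" if "poly_growth F" for F
  proof -
    have "continuous_on (ball 0 1 \<times> cbox (0::real) 1) (\<lambda>x. case (fst x, of_real (snd x) * z) of (l, z) \<Rightarrow> power_fun_series F l z)"
      by (rule continuous_on_compose2[OF power_fun_series_continuous[OF that]])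
        (auto intro!: continuous_on_Pair continuous_on_mult continuous_on_of_real continuous_on_fst continuous_on_snd continuous_on_const continuous_on_id)
    then show ?thesis by simp
  qed
  have cmu: "continuous_on (ball (0::complex) 1 \<times> cbox (0::real) 1) (\<lambda>x. mu (of_real (snd x) * z))"
    by (rule continuous_on_compose2[OF cont_mu[of UNIV]])
      (auto intro!: continuous_on_mult continuous_on_of_real continuous_on_snd continuous_on_const continuous_on_id)
  note ci = continuous_on_fst[OF continuous_on_id] continuous_on_mult continuous_on_add continuous_on_diff continuous_on_exp continuous_on_const
  have cU: "continuous_on (ball 0 1 \<times> cbox 0 1) (\<lambda>x. U (fst x) (of_real (snd x) * z))"
    unfolding U_def g_def by (intro ci ps G_growth)
  have cI: "continuous_on (ball 0 1 \<times> cbox 0 1) (\<lambda>(l, t). I' l t)"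
    unfolding I'_def U'_def P_def case_prod_unfold
    by (intro ci ps G_growth poly_growth_Suc cU cmu)
  show "(\<lambda>l. integral (cbox 0 1) (\<lambda>t::real. A l (of_real t * z) * of_real (Re z) + B l (of_real t * z) * of_real (Im z))) holomorphic_on ball 0 1"
  proof (rule leibniz_rule_holomorphic[OF _ _ cI])
    fix l and t :: real assume l: "l \<in> ball (0::complex) 1"
    have "((\<lambda>l. U l (of_real t * z)) has_field_derivative U' l (of_real t * z)) (at l within ball 0 1)"
      using dU[of l] l by (simp add: has_field_derivative_at_within)
    then show "((\<lambda>l. A l (of_real t * z) * of_real (Re z) + B l (of_real t * z) * of_real (Im z)) has_field_derivative I' l t) (at l within ball 0 1)"
      unfolding A_def B_def I'_def by (auto intro!: derivative_eq_intros simp: algebra_simps)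
  next
    fix l assume "l \<in> ball (0::complex) 1"
    then have l: "norm l < 1" by simp
    have ray: "continuous_on (cbox (0::real) 1) (\<lambda>t. W (of_real t * z))" if "continuous_on UNIV W" for W :: "complex \<Rightarrow> complex"
      by (rule continuous_on_compose2[OF that]) (auto intro!: continuous_on_mult continuous_on_of_real continuous_on_const continuous_on_id)
    show "(\<lambda>t::real. A l (of_real t * z) * of_real (Re z) + B l (of_real t * z) * of_real (Im z)) integrable_on cbox 0 1"
      by (intro integrable_continuous continuous_on_add continuous_on_mult continuous_on_const
          ray[OF has_partials_continuous[OF A_partials[OF l]]] ray[OF has_partials_continuous[OF B_partials[OF l]]])
  qed simp
qed

end

text \<open>Coefficient form of f (cnj z) = cnj (f z): reflecting z negates the second frequency,
  conjugating a character negates both.\<close>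

definition trig_symmetric :: "(int \<times> int \<Rightarrow> complex) \<Rightarrow> bool" where
  "trig_symmetric a \<longleftrightarrow> (\<forall>p. a (- fst p, snd p) = cnj (a p))"

lemma bij_betw_tbox_reflect: "bij_betw (\<lambda>p. (- fst p, snd p)) (tbox d) (tbox d)"
  by (rule bij_betw_byWitness[of _ "\<lambda>p. (- fst p, snd p)"]) (auto simp: tbox_def)

lemma tpoly_symmetric:
  assumes "trig_symmetric a"
  shows "tpoly d a (cnj z) = cnj (tpoly d a z)"
proof -
  have "tchar p (cnj z) = cnj (tchar (- fst p, snd p) z)" for p
    by (simp add: tchar_def cis_cnj)
  then have "tpoly d a (cnj z) = (\<Sum>p\<in>tbox d. cnj (a (- fst p, snd p) * tchar (- fst p, snd p) z))"
    using assms by (simp add: tpoly_def trig_symmetric_def)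
  also have "\<dots> = (\<Sum>p\<in>tbox d. cnj (a p * tchar p z))"
    by (rule sum.reindex_bij_betw[OF bij_betw_tbox_reflect])
  finally show ?thesis by (simp add: tpoly_def)
qed

locale sym_trig_coeff = trig_coeff +
  assumes sym: "trig_symmetric m"
begin

lemma zeta_reflect: "zeta (- fst p, snd p) = - cnj (zeta p)"
  by (simp add: zeta_def)

text \<open>Reflecting the frequency turns \<open>zeta\<close> into minus its conjugate, so the
  Beurling multiplier goes to its conjugate; the convolution sum is reindexed by the same
  reflection.\<close>

lemma gam_symmetric: "trig_symmetric (gam d m n)"
proof (induction n)
  case 0
  then show ?case using sym by (simp add: trig_symmetric_def cdz_def zeta_reflect)
next
  case (Suc n)
  have "(\<Sum>q\<in>tbox d. m q * (cnj (zeta ((- a, b) - q)) / zeta ((- a, b) - q) * gam d m n ((- a, b) - q))) =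
      cnj (\<Sum>q\<in>tbox d. m q * (cnj (zeta ((a, b) - q)) / zeta ((a, b) - q) * gam d m n ((a, b) - q)))" for a b
  proof -
    have *: "m (- fst q, snd q) * (cnj (zeta ((- a, b) - (- fst q, snd q))) / zeta ((- a, b) - (- fst q, snd q)) * gam d m n ((- a, b) - (- fst q, snd q)))
       = cnj (m q * (cnj (zeta ((a, b) - q)) / zeta ((a, b) - q) * gam d m n ((a, b) - q)))" for q
    proof -
      have e: "(- a, b) - (- fst q, snd q) = (- fst ((a, b) - q), snd ((a, b) - q))" by simp
      show ?thesis unfolding e zeta_reflect
        using sym Suc unfolding trig_symmetric_def by (simp del: fst_diff snd_diff)
    qed
    have "(\<Sum>q\<in>tbox d. m q * (cnj (zeta ((- a, b) - q)) / zeta ((- a, b) - q) * gam d m n ((- a, b) - q))) =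
      (\<Sum>q\<in>tbox d. m (- fst q, snd q) * (cnj (zeta ((- a, b) - (- fst q, snd q))) / zeta ((- a, b) - (- fst q, snd q)) * gam d m n ((- a, b) - (- fst q, snd q))))"
      by (rule sum.reindex_bij_betw[OF bij_betw_tbox_reflect, symmetric])
    then show ?thesis unfolding * cnj_sum .
  qed
  then show ?case unfolding trig_symmetric_def gam.simps tconv_def by (simp del: cnj_sum)
qed

lemma G_symmetric: "G n (cnj z) = cnj (G n z)"
proof -
  have "trig_symmetric (gco d m n)"
    using gam_symmetric[of n] by (simp add: trig_symmetric_def gco_def zeta_reflect)
  then show ?thesis unfolding G_def by (rule tpoly_symmetric)
qed

lemma mu_symmetric: "mu (cnj z) = cnj (mu z)"
  unfolding mu_def by (rule tpoly_symmetric[OF sym])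

lemma g_symmetric:
  assumes "norm l < 1"
  shows "g (cnj l) (cnj z) = cnj (g l z)"
proof -
  have s: "(\<lambda>n. G n z * l ^ n) sums power_fun_series G l z"
    unfolding power_fun_series_def using power_fun_series_summable[OF G_growth(1) assms] by (rule summable_sums)
  have "(\<lambda>n. cnj (G n z * l ^ n)) sums cnj (power_fun_series G l z)"
    using s by (rule sums_cnj[THEN iffD2])
  then have "power_fun_series G (cnj l) (cnj z) = cnj (power_fun_series G l z)"
    unfolding power_fun_series_def by (simp add: G_symmetric sums_iff)
  then show ?thesis by (simp add: g_def)
qed

lemma sol_symmetric:
  assumes l: "norm l < 1"
  shows "sol (cnj l) (cnj z) = cnj (sol l z)"
proof -
  have A: "A (cnj l) (cnj w) = cnj (A l w)" and B: "B (cnj l) (cnj w) = - cnj (B l w)" for w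
    using g_symmetric[OF l, of w] by (simp_all add: A_def B_def U_def mu_symmetric exp_cnj)
  have ray: "continuous_on (cbox (0::real) 1) (\<lambda>t. W (of_real t * z))" if "continuous_on UNIV W" for W :: "complex \<Rightarrow> complex"
    by (rule continuous_on_compose2[OF that]) (auto intro!: continuous_on_mult continuous_on_of_real continuous_on_const continuous_on_id)
  have "(\<lambda>t::real. A l (of_real t * z) * of_real (Re z) + B l (of_real t * z) * of_real (Im z)) integrable_on cbox 0 1"
    by (intro integrable_continuous continuous_on_add continuous_on_mult continuous_on_const
        ray[OF has_partials_continuous[OF A_partials[OF l]]] ray[OF has_partials_continuous[OF B_partials[OF l]]])
  from integral_linear[OF this bounded_linear_cnj]
  have "cnj (sol l z) = integral (cbox 0 1) (\<lambda>t::real. cnj (A l (of_real t * z)) * of_real (Re z) + cnj (B l (of_real t * z)) * of_real (Im z))"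
    by (simp add: sol_def o_def)
  moreover have "A (cnj l) (of_real t * cnj z) = cnj (A l (of_real t * z))" "B (cnj l) (of_real t * cnj z) = - cnj (B l (of_real t * z))" for t
    using A[of "of_real t * z"] B[of "of_real t * z"] by simp_all
  ultimately show ?thesis by (simp add: sol_def)
qed

end

lemma has_partials_scale:
  assumes "has_partials f fx fy"
  shows "has_partials (\<lambda>z. f (of_real h * z) / c) (\<lambda>z. of_real h * fx (of_real h * z) / c) (\<lambda>z. of_real h * fy (of_real h * z) / c)"
  using has_partials_cmult[OF has_partials_ray[OF assms, of h], of "inverse c"] by (simp add: divide_inverse mult.commute)

lemma Cd_scale: "Cd k f \<Longrightarrow> Cd k (\<lambda>z. f (of_real h * z))"
proof (induction k arbitrary: f)
  case 0
  have "continuous_on UNIV (\<lambda>z. f (of_real h * z))"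
    by (rule continuous_on_compose2[of UNIV f]) (use 0 in \<open>auto intro!: continuous_on_mult continuous_on_const continuous_on_id\<close>)
  then show ?case by simp
next
  case (Suc k)
  then obtain fx fy where f: "has_partials f fx fy" "Cd k fx" "Cd k fy" unfolding Cd.simps by blast
  have "Cd k (\<lambda>z. of_real h * fx (of_real h * z))" "Cd k (\<lambda>z. of_real h * fy (of_real h * z))"
    by (intro Cd_cmult Suc.IH f)+
  then show ?case using has_partials_ray[OF f(1), of h] unfolding Cd.simps by blast
qed

text \<open>Scaling by \<open>h\<close> changes the period to 2 pi / h, and division by the value at
  \<open>h\<close> makes the solution fix 1. The shared \<open>Q2\<close> records that mixed second
  partials agree, which integration by parts uses later.\<close>

theorem beltrami_family:
  assumes "sym_trig_coeff d m" and h: "h > 0"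
  defines "M \<equiv> \<lambda>z. tpoly d m (of_real h * z)"
  obtains F P :: "complex \<Rightarrow> complex \<Rightarrow> complex" where
    "\<And>z. (\<lambda>l. F l z) holomorphic_on ball 0 1"
    "\<And>z. F 0 z = z" "\<And>l. norm l < 1 \<Longrightarrow> F l 0 = 0" "\<And>l. norm l < 1 \<Longrightarrow> F l 1 = 1"
    "\<And>l. norm l < 1 \<Longrightarrow> bij (F l)"
    "\<And>l z. norm l < 1 \<Longrightarrow> F (cnj l) (cnj z) = cnj (F l z)"
    "\<And>l. norm l < 1 \<Longrightarrow> has_partials (F l) (\<lambda>z. P l z * (1 + l * M z)) (\<lambda>z. \<i> * P l z * (1 - l * M z))"
    "\<And>l. norm l < 1 \<Longrightarrow> \<exists>Q1 Q2 Q3. has_partials (\<lambda>z. P l z * (1 + l * M z)) Q1 Q2 \<and> has_partials (\<lambda>z. \<i> * P l z * (1 - l * M z)) Q2 Q3"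
    "\<And>l z. norm l < 1 \<Longrightarrow> P l z \<noteq> 0" "\<And>l k. norm l < 1 \<Longrightarrow> Cd k (P l)" "\<And>k. Cd k M"
proof -
  interpret sym_trig_coeff d m by fact
  have inj: "sol l z = sol l w \<longleftrightarrow> z = w" if "norm l < 1" for l z w
    using sol_bij[OF that] by (simp add: bij_def inj_eq)
  have nz: "sol l (of_real h) \<noteq> 0" if "norm l < 1" for l
    using inj[OF that, of "of_real h" 0] h by (simp add: sol_0)
  show thesis
  proof (rule that[of "\<lambda>l z. sol l (of_real h * z) / sol l (of_real h)" "\<lambda>l z. of_real h * U l (of_real h * z) / sol l (of_real h)"])
    show "(\<lambda>l. sol l (of_real h * z) / sol l (of_real h)) holomorphic_on ball 0 1" for z
      by (intro holomorphic_on_divide sol_holomorphic) (use nz in auto)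
    fix l :: complex assume l: "norm l < 1"
    show "bij (\<lambda>z. sol l (of_real h * z) / sol l (of_real h))"
    proof (rule bijI)
      show "inj (\<lambda>z. sol l (of_real h * z) / sol l (of_real h))" using nz[OF l] inj[OF l] h by (auto intro!: injI)
      show "surj (\<lambda>z. sol l (of_real h * z) / sol l (of_real h))"
      proof (rule surjI)
        fix y
        obtain x where "sol l x = y * sol l (of_real h)" using sol_bij[OF l] by (metis bij_pointE)
        then have "inv (sol l) (y * sol l (of_real h)) = x" using sol_bij[OF l] by (metis bij_inv_eq_iff)
        with \<open>sol l x = _\<close> show "sol l (of_real h * (inv (sol l) (y * sol l (of_real h)) / of_real h)) / sol l (of_real h) = y"
          using h nz[OF l] by simp
      qed
    qed
    show "has_partials (\<lambda>z. sol l (of_real h * z) / sol l (of_real h)) (\<lambda>z. of_real h * U l (of_real h * z) / sol l (of_real h) * (1 + l * M z))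
       (\<lambda>z. \<i> * (of_real h * U l (of_real h * z) / sol l (of_real h)) * (1 - l * M z))"
      using has_partials_scale[OF sol_partials[OF l], of h "sol l (of_real h)"]
      by (simp add: A_def B_def M_def mu_def mult_ac)
    have AB: "(\<lambda>z. of_real h * U l (of_real h * z) / sol l (of_real h) * (1 + l * M z)) = (\<lambda>z. of_real h * (A l (of_real h * z) / sol l (of_real h)))"
      "(\<lambda>z. \<i> * (of_real h * U l (of_real h * z) / sol l (of_real h)) * (1 - l * M z)) = (\<lambda>z. of_real h * (B l (of_real h * z) / sol l (of_real h)))"
      by (simp_all add: A_def B_def M_def mu_def mult_ac)
    have Ay_Bx: "Ay l = Bx l" using Ay_eq_Bx[OF l] by blast
    show "\<exists>Q1 Q2 Q3. has_partials (\<lambda>z. of_real h * U l (of_real h * z) / sol l (of_real h) * (1 + l * M z)) Q1 Q2 \<and>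
        has_partials (\<lambda>z. \<i> * (of_real h * U l (of_real h * z) / sol l (of_real h)) * (1 - l * M z)) Q2 Q3"
      unfolding AB
      using has_partials_cmult[OF has_partials_scale[OF A_partials[OF l], of h "sol l (of_real h)"], of "of_real h"]
        has_partials_cmult[OF has_partials_scale[OF B_partials[OF l], of h "sol l (of_real h)"], of "of_real h"]
      unfolding Ay_Bx by blast
    show "of_real h * U l (of_real h * z) / sol l (of_real h) \<noteq> 0" for z using h nz[OF l] by (simp add: U_def)
    show "Cd k (\<lambda>z. of_real h * U l (of_real h * z) / sol l (of_real h))" for k
      using Cd_cmult[OF Cd_scale[OF Cd_U[OF l, of k], of h], of "of_real h / sol l (of_real h)"] by (simp add: mult_ac)
    show "sol (cnj l) (of_real h * cnj z) / sol (cnj l) (of_real h) = cnj (sol l (of_real h * z) / sol l (of_real h))" for z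
      using sol_symmetric[OF l, of "of_real h * z"] sol_symmetric[OF l, of "of_real h"] by simp
  qed (use nz h in \<open>auto simp: sol_0 sol_id M_def intro!: Cd_scale Cd_tpoly\<close>)
qed

section \<open>Distortion of holomorphic motions\<close>

lemma harnack_lower:
  assumes hol: "H holomorphic_on ball 0 1"
    and pos: "\<And>z. z \<in> ball 0 1 \<Longrightarrow> Re (H z) > 0"
    and z: "norm z < 1"
  shows "Re (H z) \<ge> Re (H 0) * ((1 - norm z) / (1 + norm z))"
proof -
  \<comment> \<open>Cayley transform taking \<open>H 0\<close> to 0; the Schwarz lemma bounds it by
    the norm of z, and the rest translates this back.\<close>
  define W where "W = (\<lambda>z. (H z - H 0) / (H z + cnj (H 0)))"
  have p0: "Re (H 0) > 0" using pos[of 0] by simp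
  have den: "H z + cnj (H 0) \<noteq> 0" if "norm z < 1" for z
  proof
    assume "H z + cnj (H 0) = 0"
    then have "Re (H z) + Re (H 0) = 0" by (metis complex_cnj(1) complex_cnj_cancel_iff plus_complex.sel(1) zero_complex.sel(1) cnj.sel(1))
    then show False using pos[of z] p0 that by simp
  qed
  have holW: "W holomorphic_on ball 0 1"
    unfolding W_def using hol den by (intro holomorphic_intros) auto
  have key: "(norm (H z + cnj (H 0)))\<^sup>2 - (norm (H z - H 0))\<^sup>2 = 4 * Re (H z) * Re (H 0)" for z
    unfolding cmod_power2 by (simp add: power2_eq_square algebra_simps)
  have Wlt: "norm (W z) < 1" if "norm z < 1" for z
  proof -
    have "(norm (H z - H 0))\<^sup>2 < (norm (H z + cnj (H 0)))\<^sup>2"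
      using key[of z] mult_pos_pos[OF pos[of z] p0] that by simp
    then have "norm (H z - H 0) < norm (H z + cnj (H 0))"
      using power2_less_imp_less by fastforce
    then show ?thesis unfolding W_def norm_divide using den[OF that]
      by (simp add: divide_less_eq_1)
  qed
  have W0: "W 0 = 0" by (simp add: W_def)
  have Wz: "norm (W z) \<le> norm z" using Schwarz_Lemma(1)[OF holW W0 Wlt z] by simp
  let ?N = "norm (H z + cnj (H 0))" and ?w = "norm (W z)"
  have N: "?N > 0" using den[OF z] by simp
  have "?w * ?N = norm (H z - H 0)" unfolding W_def norm_divide using N by simp
  then have "(?w * ?N)\<^sup>2 = (norm (H z - H 0))\<^sup>2" by simp
  with key[of z] have a: "?N\<^sup>2 * (1 - ?w\<^sup>2) = 4 * Re (H z) * Re (H 0)"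
    by (simp add: power_mult_distrib right_diff_distrib left_diff_distrib mult.commute)
  \<comment> \<open>The quantity 1 - W is inversely proportional to the denominator of
    \<open>W\<close>, which bounds that denominator from below in terms of \<open>H 0\<close>
    alone.\<close>
  have "1 - W z = of_real (2 * Re (H 0)) / (H z + cnj (H 0))"
  proof -
    have "complex_of_real (2 * Re (H 0)) = cnj (H 0) + H 0" by (simp add: complex_eq_iff)
    then show ?thesis unfolding W_def using den[OF z] by (simp add: divide_simps)
  qed
  then have "norm (1 - W z) = 2 * Re (H 0) / ?N"
    using p0 by (simp add: norm_divide norm_mult)
  moreover have "norm (1 - W z) \<le> 1 + ?w" using norm_triangle_ineq4[of 1 "W z"] by simp
  ultimately have b: "2 * Re (H 0) \<le> (1 + ?w) * ?N" using N by (metis pos_divide_le_eq)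
  have w1: "0 \<le> ?w" "?w < 1" using Wlt[OF z] by auto
  have "4 * (Re (H 0))\<^sup>2 \<le> ((1 + ?w) * ?N)\<^sup>2"
    using power_mono[OF b, of 2] p0 by (simp add: power_mult_distrib)
  then have "4 * (Re (H 0))\<^sup>2 * (1 - ?w) \<le> ((1 + ?w) * ?N)\<^sup>2 * (1 - ?w)"
    using w1 by (intro mult_right_mono) auto
  also have "\<dots> = (1 + ?w) * (?N\<^sup>2 * (1 - ?w\<^sup>2))" by (simp add: power2_eq_square algebra_simps)
  also have "\<dots> = (1 + ?w) * (4 * Re (H z) * Re (H 0))" by (simp add: a)
  finally have "(4 * Re (H 0)) * (Re (H 0) * (1 - ?w)) \<le> (4 * Re (H 0)) * ((1 + ?w) * Re (H z))"
    by (simp add: power2_eq_square algebra_simps)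
  then have c: "Re (H 0) * (1 - ?w) \<le> (1 + ?w) * Re (H z)" using p0 by simp
  have "(1 - norm z) / (1 + norm z) \<le> (1 - ?w) / (1 + ?w)"
    using Wz w1 z by (intro frac_le) (auto intro: add_pos_nonneg)
  then have "Re (H 0) * ((1 - norm z) / (1 + norm z)) \<le> Re (H 0) * ((1 - ?w) / (1 + ?w))"
    using p0 by (intro mult_left_mono) auto
  also have "\<dots> \<le> Re (H z)"
    using c w1 by (subst times_divide_eq_right, subst pos_divide_le_eq) (auto simp: mult.commute intro: add_pos_nonneg)
  finally show ?thesis .
qed

text \<open>Scaling by t < 1 makes the bound strict, so that the Mobius quotient is defined, and t
  tends to 1 at the end. The multiplied-out form remains meaningful for a constant of modulus
  1.\<close>

lemma schwarz_pick_zero: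
  assumes hol: "h holomorphic_on ball 0 1"
    and le: "\<And>z. norm z < 1 \<Longrightarrow> norm (h z) \<le> 1" and z: "norm z < 1"
  shows "norm (h z - h 0) \<le> norm z * norm (1 - cnj (h 0) * h z)"
proof -
  have "norm (of_real t * h z - of_real t * h 0) \<le> norm z * norm (1 - cnj (of_real t * h 0) * (of_real t * h z))"
    if t: "0 < t" "t < 1" for t :: real
  proof -
    define g where "g = (\<lambda>z. of_real t * h z)"
    have g1: "norm (g z) < 1" if "norm z < 1" for z
    proof -
      have "norm (g z) = t * norm (h z)" using t by (simp add: g_def norm_mult)
      also have "\<dots> \<le> t * 1" using t le[OF that] by (intro mult_left_mono) auto
      finally show ?thesis using t by simp
    qed
    have hg: "g holomorphic_on ball 0 1" unfolding g_def by (intro holomorphic_intros hol)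
    define m where "m = (\<lambda>z. (g z - g 0) / (1 - cnj (g 0) * g z))"
    have g0: "norm (g 0) < 1" using g1[of 0] by simp
    have den: "1 - cnj (g 0) * g z \<noteq> 0" if "norm z < 1" for z
    proof
      assume "1 - cnj (g 0) * g z = 0"
      then have "norm (cnj (g 0) * g z) = 1" by simp
      moreover have "norm (g 0) * norm (g z) < 1 * 1"
        using g0 g1[OF that] by (intro mult_strict_mono') auto
      ultimately show False by (simp add: norm_mult)
    qed
    have hm: "m holomorphic_on ball 0 1" unfolding m_def using hg den
      by (intro holomorphic_intros) auto
    have mlt: "norm (m z) < 1" if "norm z < 1" for z
    proof -
      have "(norm (1 - cnj (g 0) * g z))\<^sup>2 - (norm (g z - g 0))\<^sup>2 = (1 - (norm (g 0))\<^sup>2) * (1 - (norm (g z))\<^sup>2)"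
        unfolding cmod_power2 by (simp add: power2_eq_square algebra_simps)
      moreover have "\<dots> > 0" using g0 g1[OF that]
        by (intro mult_pos_pos) (auto simp: power_less_one_iff abs_square_less_1)
      ultimately have "(norm (g z - g 0))\<^sup>2 < (norm (1 - cnj (g 0) * g z))\<^sup>2" by simp
      then have "norm (g z - g 0) < norm (1 - cnj (g 0) * g z)" using power2_less_imp_less by fastforce
      then show ?thesis using den[OF that] by (simp add: m_def norm_divide divide_less_eq_1)
    qed
    have "m 0 = 0" by (simp add: m_def)
    from Schwarz_Lemma(1)[OF hm this mlt z] have "norm (m z) \<le> norm z" by simp
    then have "norm (g z - g 0) \<le> norm z * norm (1 - cnj (g 0) * g z)"
      using den[OF z] unfolding m_def norm_divide by (simp add: divide_simps)
    then show ?thesis by (simp add: g_def)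
  qed
  then have ev: "\<forall>\<^sub>F t in at_left 1. norm (of_real t * h z - of_real t * h 0) \<le> norm z * norm (1 - cnj (of_real t * h 0) * (of_real t * h z))"
    by (intro eventually_at_leftI[of 0]) auto
  have A: "((\<lambda>t. norm (of_real t * h z - of_real t * h 0)) \<longlongrightarrow> norm (of_real 1 * h z - of_real 1 * h 0)) (at_left 1)"
    by (intro tendsto_intros)
  have B: "((\<lambda>t. norm z * norm (1 - cnj (of_real t * h 0) * (of_real t * h z))) \<longlongrightarrow> norm z * norm (1 - cnj (of_real 1 * h 0) * (of_real 1 * h z))) (at_left 1)"
    by (intro tendsto_intros)
  show ?thesis using tendsto_le[OF _ B A ev] by (simp add: trivial_limit_at_left_real)
qed

text \<open>The Cayley transform of H is z h(z) with h again bounded by 1. Schwarz-Pick for h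
  compares h(0), which carries the derivative of H, with h(x), while Re H \<ge> 1 at x bounds h(x)
  from below. The classical estimate, which ignores the bound on the diameter, has - 2 Re H(0) on
  the right.\<close>

lemma half_plane_deriv_bound:
  assumes hol: "H holomorphic_on ball 0 1"
    and pos: "\<And>z. z \<in> ball 0 1 \<Longrightarrow> Re (H z) > 0"
    and real: "\<And>x. \<bar>x\<bar> < 1 \<Longrightarrow> H (of_real x) \<in> \<real>"
    and ge1: "\<And>x. \<bar>x\<bar> < 1 \<Longrightarrow> Re (H (of_real x)) \<ge> 1"
  shows "Re (deriv H 0) \<ge> - 2 * sqrt ((Re (H 0))\<^sup>2 - 1)"
proof -
  define M where "M = Re (H 0)"
  have H0: "H 0 = of_real M" using real[of 0] by (simp add: M_def)
  have M1: "M \<ge> 1" using ge1[of 0] by (simp add: M_def)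
  define W where "W = (\<lambda>z. (H z - of_real M) / (H z + of_real M))"
  have den: "H z + of_real M \<noteq> 0" if "norm z < 1" for z
  proof
    assume "H z + of_real M = 0"
    then have "Re (H z) + M = 0" by (metis Re_complex_of_real plus_complex.sel(1) zero_complex.sel(1))
    then show False using pos[of z] M1 that by simp
  qed
  have holW: "W holomorphic_on ball 0 1"
    unfolding W_def using hol den by (intro holomorphic_intros) auto
  have Wlt: "norm (W z) < 1" if "norm z < 1" for z
  proof -
    have "(norm (H z + of_real M))\<^sup>2 - (norm (H z - of_real M))\<^sup>2 = 4 * Re (H z) * M"
      unfolding cmod_power2 by (simp add: power2_eq_square algebra_simps)
    then have "(norm (H z - of_real M))\<^sup>2 < (norm (H z + of_real M))\<^sup>2"
    proof -
      have "Re (H z) * M > 0" using pos[of z] M1 that by (intro mult_pos_pos) auto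
      then show ?thesis using \<open>_ - _ = 4 * Re (H z) * M\<close> by linarith
    qed
    then have "norm (H z - of_real M) < norm (H z + of_real M)" using power2_less_imp_less by fastforce
    then show ?thesis unfolding W_def norm_divide using den[OF that] by (simp add: divide_less_eq_1)
  qed
  have W0: "W 0 = 0" by (simp add: W_def H0)
  obtain h where holh: "h holomorphic_on ball 0 1" and Wh: "\<And>z. norm z < 1 \<Longrightarrow> W z = z * h z"
    and dh: "deriv W 0 = h 0" using Schwarz3[OF holW W0] by metis
  have h1: "norm (h z) \<le> 1" if "norm z < 1" for z
  proof (cases "z = 0")
    case True
    then show ?thesis using Schwarz_Lemma(2)[OF holW W0 Wlt that] dh by simp
  next
    case False
    then show ?thesis using Schwarz_Lemma(1)[OF holW W0 Wlt that] Wh[OF that] by (simp add: norm_mult)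
  qed
  have dH: "(H has_field_derivative deriv H 0) (at 0)"
    using hol by (simp add: holomorphic_derivI)
  have "(W has_field_derivative deriv H 0 / (2 * of_real M)) (at 0)"
    unfolding W_def using M1 by (auto intro!: derivative_eq_intros dH simp: H0 divide_simps)
  then have dW: "h 0 = deriv H 0 / (2 * of_real M)" using dh DERIV_imp_deriv by metis
  have Wr: "W (of_real x) \<in> \<real>" if "\<bar>x\<bar> < 1" for x :: real
    unfolding W_def using real[OF that] by simp
  have hr: "h (of_real x) \<in> \<real>" if "0 < x" "x < 1" for x :: real
  proof -
    have "h (of_real x) = W (of_real x) / of_real x" using Wh[of "of_real x"] that by simp
    then show ?thesis using Wr[of x] that by simp
  qed
  \<comment> \<open>On the positive axis h is a quotient of real numbers, and its value at 0 is the
    limit along that axis.\<close>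
  have h0r: "h 0 \<in> \<real>"
  proof -
    have "isCont h 0"
      using continuous_on_eq_continuous_at[OF open_ball] holomorphic_on_imp_continuous_on[OF holh] by force
    then have "((\<lambda>x::real. h (of_real x)) \<longlongrightarrow> h (of_real 0)) (at_right 0)"
      by (intro tendsto_intros isCont_tendsto_compose[where g=h]) auto
    moreover have "\<forall>\<^sub>F x::real in at_right 0. h (of_real x) \<in> \<real>"
      by (intro eventually_at_rightI[of 0 1]) (auto intro: hr)
    ultimately have "h (of_real 0) \<in> \<real>"
      by (intro Lim_in_closed_set[OF closed_complex_Reals]) auto
    then show ?thesis by simp
  qed
  define v where "v = - Re (h 0)"
  have h0: "h 0 = of_real (- v)" using h0r by (simp add: v_def complex_eq_iff complex_is_Real_iff)
  have v1: "\<bar>v\<bar> \<le> 1" using h1[of 0] h0 by simp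
  have Mv: "Re (deriv H 0) = - 2 * M * v" using dW M1 by (simp add: v_def)
  have "M * v \<le> sqrt (M\<^sup>2 - 1)"
  proof (cases "v > 0")
    case False
    then have "M * v \<le> 0" using M1 by (simp add: mult_nonneg_nonpos)
    also have "0 \<le> sqrt (M\<^sup>2 - 1)" using M1 by simp
    finally show ?thesis .
  next
    case True
    \<comment> \<open>The vertex of the quadratic (1 + M) x^2 - 2 M v x + (M - 1), which the two
      constraints force to be nonnegative; evaluation there gives the strongest conclusion.\<close>
    define x where "x = M * v / (1 + M)"
    have "M * v \<le> M * 1" using True v1 M1 by (intro mult_left_mono) auto
    then have "M * v < 1 + M" by linarith
    then have x: "0 < x" "x < 1" using True M1 by (simp_all add: x_def)
    define a where "a = Re (h (of_real x))"
    have ha: "h (of_real x) = of_real a" using hr[OF x] by (simp add: a_def)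
    have "norm (h (of_real x) - h 0) \<le> norm (of_real x :: complex) * norm (1 - cnj (h 0) * h (of_real x))"
      using x by (intro schwarz_pick_zero holh h1) auto
    then have "norm (complex_of_real (a + v)) \<le> norm (of_real x :: complex) * norm (complex_of_real (1 + v * a))"
      unfolding ha h0 by simp
    then have "\<bar>a + v\<bar> \<le> x * \<bar>1 + v * a\<bar>" using x
      unfolding norm_of_real by simp
    moreover have a1: "\<bar>a\<bar> \<le> 1" using h1[of "of_real x"] x by (simp add: ha)
    moreover have "\<bar>v * a\<bar> \<le> 1" using a1 v1 by (simp add: abs_mult mult_le_one)
    ultimately have A: "a + v \<le> x * (1 + v * a)" by auto
    have "Re (H (of_real x)) \<ge> 1" using ge1[of x] x by simp
    moreover have "H (of_real x) - of_real M = of_real (x * a) * (H (of_real x) + of_real M)"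
    proof -
      have n: "norm (complex_of_real x) < 1" using x by simp
      show ?thesis using Wh[OF n] den[OF n] unfolding W_def ha by (simp add: divide_simps)
    qed
    then have "Re (H (of_real x) - of_real M) = x * a * (Re (H (of_real x)) + M)" by simp
    ultimately obtain Y where Y: "Y \<ge> 1" "Y - M = x * a * (Y + M)" by simp
    have "x * a \<le> x * 1" using a1 x by (intro mult_left_mono) auto
    then have xa: "x * a < 1" using x by linarith
    have "Y * (1 - x * a) = M * (1 + x * a)" using Y(2) by (simp add: algebra_simps)
    moreover have "1 * (1 - x * a) \<le> Y * (1 - x * a)" using Y xa by (intro mult_right_mono) auto
    ultimately have B: "1 - M \<le> (1 + M) * (x * a)" by (simp add: algebra_simps)
    have "v * x \<le> 1 * x" using v1 x by (intro mult_right_mono) auto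
    then have vx: "1 - v * x > 0" using x by linarith
    have "a * (1 - v * x) \<le> x - v" using A by (simp add: algebra_simps)
    then have "(1 + M) * x * (a * (1 - v * x)) \<le> (1 + M) * x * (x - v)"
      using x M1 by (intro mult_left_mono) auto
    moreover have "(1 - M) * (1 - v * x) \<le> (1 + M) * (x * a) * (1 - v * x)"
      using B vx by (intro mult_right_mono) auto
    ultimately have "(1 - M) * (1 - v * x) \<le> (1 + M) * x * (x - v)" by (simp add: algebra_simps)
    then have "0 \<le> (1 + M) * x\<^sup>2 - 2 * M * v * x + (M - 1)"
      by (simp add: power2_eq_square algebra_simps)
    also have "\<dots> = (M - 1) - M\<^sup>2 * v\<^sup>2 / (1 + M)"
      unfolding x_def using M1 by (simp add: divide_simps power2_eq_square)
    finally have "M\<^sup>2 * v\<^sup>2 \<le> (M - 1) * (1 + M)" using M1 by (simp add: divide_simps)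
    then have "(M * v)\<^sup>2 \<le> M\<^sup>2 - 1" by (simp add: power2_eq_square algebra_simps)
    then show ?thesis by (rule real_le_rsqrt)
  qed
  then show ?thesis unfolding Mv M_def[symmetric] by simp
qed


text \<open>Precomposition with the disk automorphism taking 0 to c, which preserves the real
  diameter and has derivative 1 - c^2 at 0.\<close>

lemma half_plane_deriv_bound_at:
  assumes hol: "H holomorphic_on ball 0 1"
    and pos: "\<And>z. z \<in> ball 0 1 \<Longrightarrow> Re (H z) > 0"
    and real: "\<And>x. \<bar>x\<bar> < 1 \<Longrightarrow> H (of_real x) \<in> \<real>"
    and ge1: "\<And>x. \<bar>x\<bar> < 1 \<Longrightarrow> Re (H (of_real x)) \<ge> 1"
    and c: "\<bar>c\<bar> < 1"
  shows "Re (deriv H (of_real c)) * (1 - c\<^sup>2) \<ge> - 2 * sqrt ((Re (H (of_real c)))\<^sup>2 - 1)"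
proof -
  define m where "m = (\<lambda>z::complex. (z + of_real c) / (1 + of_real c * z))"
  have den: "1 + of_real c * z \<noteq> 0" if "norm z < 1" for z :: complex
  proof
    assume "1 + of_real c * z = 0"
    then have "of_real c * z = -1" by (simp add: eq_neg_iff_add_eq_0 add.commute)
    then have "norm (of_real c * z) = 1" by simp
    moreover have "\<bar>c\<bar> * norm z < 1 * 1" using c that by (intro mult_strict_mono') auto
    ultimately show False by (simp add: norm_mult)
  qed
  have mlt: "norm (m z) < 1" if "norm z < 1" for z
  proof -
    have "(norm (1 + of_real c * z))\<^sup>2 - (norm (z + of_real c))\<^sup>2 = (1 - c\<^sup>2) * (1 - (norm z)\<^sup>2)"
      unfolding cmod_power2 by (simp add: power2_eq_square algebra_simps)
    moreover have "\<dots> > 0" using c that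
      by (intro mult_pos_pos) (auto simp: power_less_one_iff abs_square_less_1)
    ultimately have "(norm (z + of_real c))\<^sup>2 < (norm (1 + of_real c * z))\<^sup>2" by simp
    then have "norm (z + of_real c) < norm (1 + of_real c * z)" using power2_less_imp_less by fastforce
    then show ?thesis using den[OF that] by (simp add: m_def norm_divide divide_less_eq_1)
  qed
  have mh: "m holomorphic_on ball 0 1" unfolding m_def using den by (intro holomorphic_intros) auto
  have mr: "m (of_real x) = of_real ((x + c) / (1 + c * x))" for x by (simp add: m_def)
  have mr1: "\<bar>(x + c) / (1 + c * x)\<bar> < 1" if "\<bar>x\<bar> < 1" for x
    using mlt[of "of_real x"] that unfolding mr norm_of_real by simp
  define G where "G = H \<circ> m"
  have holG: "G holomorphic_on ball 0 1"
    unfolding G_def by (rule holomorphic_on_compose_gen[OF mh hol]) (use mlt in auto)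
  have "Re (deriv G 0) \<ge> - 2 * sqrt ((Re (G 0))\<^sup>2 - 1)"
  proof (rule half_plane_deriv_bound[OF holG])
    show "\<And>z. z \<in> ball 0 1 \<Longrightarrow> 0 < Re (G z)" using pos mlt by (simp add: G_def)
    show "\<And>x. \<bar>x\<bar> < 1 \<Longrightarrow> G (of_real x) \<in> \<real>" using real mr1 unfolding G_def o_def mr by blast
    show "\<And>x. \<bar>x\<bar> < 1 \<Longrightarrow> 1 \<le> Re (G (of_real x))" using ge1 mr1 unfolding G_def o_def mr by blast
  qed
  moreover have m0: "m 0 = of_real c" by (simp add: m_def)
  moreover have "deriv G 0 = deriv H (of_real c) * of_real (1 - c\<^sup>2)"
  proof (rule DERIV_imp_deriv)
    have dm: "(m has_field_derivative of_real (1 - c\<^sup>2)) (at 0)"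
      unfolding m_def by (auto intro!: derivative_eq_intros simp: power2_eq_square)
    have "(H has_field_derivative deriv H (m 0)) (at (m 0))"
      using hol c by (intro holomorphic_derivI[of H "ball 0 1"]) (auto simp: m0)
    from DERIV_chain[OF this dm] show "(G has_field_derivative deriv H (of_real c) * of_real (1 - c\<^sup>2)) (at 0)"
      by (simp add: G_def m0)
  qed
  ultimately show ?thesis by (simp add: G_def)
qed

text \<open>The derivative bound says that arcosh of Re H falls at rate at most 2 / (1 - x^2) along
  the diameter, and the integral of this rate from 0 to k is the logarithm on the right.\<close>

lemma half_plane_geodesic_bound:
  assumes hol: "H holomorphic_on ball 0 1"
    and pos: "\<And>z. z \<in> ball 0 1 \<Longrightarrow> Re (H z) > 0"
    and real: "\<And>x. \<bar>x\<bar> < 1 \<Longrightarrow> H (of_real x) \<in> \<real>"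
    and ge1: "\<And>x. \<bar>x\<bar> < 1 \<Longrightarrow> Re (H (of_real x)) \<ge> 1"
    and k: "0 \<le> k" "k < 1"
  shows "arcosh (Re (H (of_real k))) \<ge> arcosh (Re (H 0)) - ln ((1 + k) / (1 - k))"
proof -
  define h where "h = (\<lambda>x::real. Re (H (of_real x)))"
  have dh: "(h has_real_derivative Re (deriv H (of_real x))) (at x)" if "\<bar>x\<bar> < 1" for x
  proof -
    have "(H has_field_derivative deriv H (of_real x)) (at (of_real x))"
      using hol that by (intro holomorphic_derivI[of H "ball 0 1"]) auto
    then have "((\<lambda>x. H (of_real x)) has_vector_derivative deriv H (of_real x)) (at x)"
      by (rule has_vector_derivative_real_field)
    then have "((\<lambda>x. Re (H (of_real x))) has_vector_derivative Re (deriv H (of_real x))) (at x)"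
      by (rule bounded_linear.has_vector_derivative[OF bounded_linear_Re])
    then show ?thesis by (simp add: h_def has_real_derivative_iff_has_vector_derivative)
  qed
  \<comment> \<open>The factor 1 + e keeps the argument above 1, where arcosh is differentiable; e
    tends to 0 afterwards.\<close>
  have E: "arcosh ((1 + e) * h k) \<ge> arcosh ((1 + e) * h 0) - ln ((1 + k) / (1 - k))" if e: "e > 0" for e
  proof -
    define q where "q = (\<lambda>x. arcosh ((1 + e) * h x) + (ln (1 + x) - ln (1 - x)))"
    have big: "(1 + e) * h x > 1" if "\<bar>x\<bar> < 1" for x
    proof -
      have "1 * 1 < (1 + e) * 1" using e by simp
      also have "\<dots> \<le> (1 + e) * h x" using ge1[OF that] e by (intro mult_left_mono) (auto simp: h_def)
      finally show ?thesis by simp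
    qed
    have "q 0 \<le> q k"
    proof (rule DERIV_nonneg_imp_nondecreasing[OF k(1)])
      fix x assume x: "0 \<le> x" "x \<le> k"
      then have x1: "\<bar>x\<bar> < 1" using k by auto
      let ?D = "Re (deriv H (of_real x))"
      have "(q has_real_derivative ((1 + e) * ?D) / sqrt (((1 + e) * h x)\<^sup>2 - 1) + (1 / (1 + x) + 1 / (1 - x))) (at x)"
        unfolding q_def using x x1 big[OF x1] 
        by (auto intro!: derivative_eq_intros dh[OF x1] DERIV_chain2[OF arcosh_real_has_field_derivative] simp: divide_simps)
      moreover have "((1 + e) * ?D) / sqrt (((1 + e) * h x)\<^sup>2 - 1) + (1 / (1 + x) + 1 / (1 - x)) \<ge> 0"
      proof -
        let ?S = "sqrt (((1 + e) * h x)\<^sup>2 - 1)"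
        have S: "?S > 0" using big[OF x1] by simp
        have x2: "1 - x\<^sup>2 > 0" using x1 by (simp add: abs_square_less_1)
        have "?D * (1 - x\<^sup>2) \<ge> - 2 * sqrt ((h x)\<^sup>2 - 1)"
          using half_plane_deriv_bound_at[OF hol pos real ge1 x1] by (simp add: h_def)
        then have "(1 + e) * (?D * (1 - x\<^sup>2)) \<ge> (1 + e) * (- 2 * sqrt ((h x)\<^sup>2 - 1))"
          using e by (intro mult_left_mono) auto
        moreover have "(1 + e) * sqrt ((h x)\<^sup>2 - 1) \<le> ?S"
        proof -
          have "(1 + e) * sqrt ((h x)\<^sup>2 - 1) = sqrt ((1 + e)\<^sup>2 * ((h x)\<^sup>2 - 1))"
            using e by (simp add: real_sqrt_mult)
          also have "\<dots> \<le> ?S"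
          proof (rule real_sqrt_le_mono)
            have "(1 + e)\<^sup>2 \<ge> 1" using e by (simp add: one_le_power)
            then show "(1 + e)\<^sup>2 * ((h x)\<^sup>2 - 1) \<le> ((1 + e) * h x)\<^sup>2 - 1"
              by (simp add: power_mult_distrib right_diff_distrib)
          qed
          finally show ?thesis .
        qed
        ultimately have "(1 + e) * ?D * (1 - x\<^sup>2) \<ge> - 2 * ?S" by (simp add: algebra_simps)
        then have "(1 + e) * ?D \<ge> - 2 * ?S / (1 - x\<^sup>2)" using x2 by (subst pos_divide_le_eq) auto
        then have "(1 + e) * ?D / ?S \<ge> (- 2 * ?S / (1 - x\<^sup>2)) / ?S" using S by (intro divide_right_mono) auto
        moreover have "(- 2 * ?S / (1 - x\<^sup>2)) / ?S = - 2 / (1 - x\<^sup>2)" using S by simp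
        moreover have "1 / (1 + x) + 1 / (1 - x) = 2 / (1 - x\<^sup>2)"
          using x x1 x2 by (simp add: divide_simps power2_eq_square) (simp add: algebra_simps)
        ultimately show ?thesis by simp
      qed
      ultimately show "\<exists>y. (q has_real_derivative y) (at x) \<and> 0 \<le> y" by blast
    qed
    then show ?thesis using k by (simp add: q_def ln_div)
  qed
  have cont: "((\<lambda>e. arcosh ((1 + e) * y)) \<longlongrightarrow> arcosh y) (at_right 0)" if "y \<ge> 1" for y :: real
  proof -
    have "continuous_on {0..1} (\<lambda>e. arcosh ((1 + e) * y))"
      using that by (intro continuous_intros) (auto simp: mult_ge1_I)
    then have "((\<lambda>e. arcosh ((1 + e) * y)) \<longlongrightarrow> arcosh ((1 + 0) * y)) (at 0 within {0..1})"
      unfolding continuous_on_def by (rule bspec) simp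
    then show ?thesis by (simp add: at_within_Icc_at_right)
  qed
  have "arcosh (h k) \<ge> arcosh (h 0) - ln ((1 + k) / (1 - k))"
  proof (rule tendsto_le[of "at_right (0::real)"])
    show "((\<lambda>e. arcosh ((1 + e) * h k)) \<longlongrightarrow> arcosh (h k)) (at_right 0)"
      using k by (intro cont) (auto simp: h_def ge1)
    show "((\<lambda>e. arcosh ((1 + e) * h 0) - ln ((1 + k) / (1 - k))) \<longlongrightarrow> arcosh (h 0) - ln ((1 + k) / (1 - k))) (at_right 0)"
      using ge1[of 0] by (intro tendsto_intros cont) (auto simp: h_def)
    show "\<forall>\<^sub>F e in at_right 0. arcosh ((1 + e) * h 0) - ln ((1 + k) / (1 - k)) \<le> arcosh ((1 + e) * h k)"
      by (intro eventually_at_rightI[of 0 1]) (auto intro: E)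
  qed simp
  then show ?thesis by (simp add: h_def)
qed

text \<open>For the value (1 + l^2) / (1 - l^2), arcosh is the hyperbolic distance ln ((1 + l) / (1
  - l)). Subtracting the distance of k from that of l is the Mobius subtraction that defines
  l'.\<close>

lemma half_plane_two_point_bound:
  assumes hol: "H holomorphic_on ball 0 1"
    and pos: "\<And>z. z \<in> ball 0 1 \<Longrightarrow> Re (H z) > 0"
    and ge1: "\<And>x. \<bar>x\<bar> < 1 \<Longrightarrow> Re (H (of_real x)) \<ge> 1"
    and k: "0 \<le> k" "k < l" "l < 1"
    and H0: "Re (H 0) \<ge> (1 + l\<^sup>2) / (1 - l\<^sup>2)"
    and l': "l' = (l - k) / (1 - k * l)"
  shows "Re (H (of_real k)) \<ge> (1 + l'\<^sup>2) / (1 - l'\<^sup>2)"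
proof -
  \<comment> \<open>Symmetrisation makes the function real on the diameter without changing its real
    part there.\<close>
  define G where "G = (\<lambda>z. (H z + cnj (H (cnj z))) / 2)"
  have "cnj ` ball 0 1 = ball 0 1" by (auto simp: image_cnj_conv_vimage_cnj)
  then have "(cnj \<circ> H \<circ> cnj) holomorphic_on ball 0 1"
    by (intro holomorphic_on_compose_cnj_cnj) (use hol in auto)
  then have h': "(\<lambda>z. cnj (H (cnj z))) holomorphic_on ball 0 1" by (simp add: o_def)
  have Greal: "G (of_real x) = of_real (Re (H (of_real x)))" for x :: real
    by (simp add: G_def complex_eq_iff)
  have G: "arcosh (Re (G (of_real k))) \<ge> arcosh (Re (G 0)) - ln ((1 + k) / (1 - k))"
  proof (rule half_plane_geodesic_bound)
    show "G holomorphic_on ball 0 1" unfolding G_def using hol h' by (intro holomorphic_intros) auto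
    show "0 < Re (G z)" if "z \<in> ball 0 1" for z
      using pos[of z] pos[of "cnj z"] that by (simp add: G_def)
  qed (use k ge1 in \<open>auto simp: Greal\<close>)
  define M where "M = Re (H 0)"
  have l2: "l\<^sup>2 < 1" using k by (simp add: abs_square_less_1)
  have M: "M \<ge> 1" using ge1[of 0] by (simp add: M_def)
  have kl: "k * l < 1" using k by (smt (verit) mult_left_le)
  have arc: "arcosh ((1 + x\<^sup>2) / (1 - x\<^sup>2)) = ln ((1 + x) / (1 - x))" if "0 \<le> x" "x < 1" for x :: real
  proof -
    have x2: "x\<^sup>2 < 1" using that by (simp add: abs_square_less_1)
    have "((1 + x\<^sup>2) / (1 - x\<^sup>2))\<^sup>2 - 1 = (2 * x / (1 - x\<^sup>2))\<^sup>2"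
      using x2 by (simp add: divide_simps power_mult_distrib) (simp add: power2_eq_square algebra_simps)
    then have "sqrt (((1 + x\<^sup>2) / (1 - x\<^sup>2))\<^sup>2 - 1) = 2 * x / (1 - x\<^sup>2)"
      using that x2 by simp
    moreover have "(1 + x\<^sup>2) / (1 - x\<^sup>2) + 2 * x / (1 - x\<^sup>2) = (1 + x) / (1 - x)"
      using that x2 by (simp add: divide_simps) (simp add: power2_eq_square algebra_simps)
    moreover have "(1 + x\<^sup>2) / (1 - x\<^sup>2) \<ge> 1" using x2 by (simp add: divide_simps)
    ultimately show ?thesis by (simp add: arcosh_real_def)
  qed
  have l'1: "0 \<le> l'" "l' < 1"
  proof -
    show "0 \<le> l'" using k kl by (simp add: l')
    have "l - k < 1 - k * l"
    proof -
      have "0 < (1 - l) * (1 + k)" using k by simp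
      then show ?thesis by (simp add: algebra_simps)
    qed
    then show "l' < 1" using kl by (simp add: l')
  qed
  have "(1 + l) / (1 - l) = ((1 + l') / (1 - l')) * ((1 + k) / (1 - k))"
  proof -
    have "1 + l' = ((1 + l) * (1 - k)) / (1 - k * l)" "1 - l' = ((1 - l) * (1 + k)) / (1 - k * l)"
      using kl unfolding l' by (simp_all add: divide_simps) (simp_all add: algebra_simps)
    then show ?thesis using k kl by simp
  qed
  moreover have "(1 + l') / (1 - l') > 0" "(1 + k) / (1 - k) > 0" using l'1 k by auto
  ultimately have L: "ln ((1 + l) / (1 - l)) = ln ((1 + l') / (1 - l')) + ln ((1 + k) / (1 - k))"
    by (simp only: ln_mult_pos)
  have ge: "(1 + x\<^sup>2) / (1 - x\<^sup>2) \<ge> 1" if "0 \<le> x" "x < 1" for x :: real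
  proof -
    have "x\<^sup>2 < 1" using that by (simp add: abs_square_less_1)
    then show ?thesis by (simp add: divide_simps)
  qed
  have "arcosh ((1 + l\<^sup>2) / (1 - l\<^sup>2)) \<le> arcosh M"
    using H0 M ge[of l] k by (auto simp: M_def not_less[symmetric])
  moreover have "Re (G 0) = M" "Re (G (of_real k)) = Re (H (of_real k))"
    using Greal[of 0] Greal[of k] by (simp_all add: M_def)
  ultimately have "arcosh ((1 + l'\<^sup>2) / (1 - l'\<^sup>2)) \<le> arcosh (Re (H (of_real k)))"
    using G L arc[of l] arc[of l'] l'1 k by simp
  then show ?thesis using ge[of l'] l'1 ge1[of k] k by (simp add: not_less[symmetric])
qed



section \<open>Quantitative forms of Schottky's theorem\<close>

definition schottky_bound :: "real \<Rightarrow> real \<Rightarrow> real" where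
  "schottky_bound \<rho> r = exp (pi * exp (pi * (2 + 2 * r + 12 * ((1 + \<rho>) / 2) / (1 - (1 + \<rho>) / 2))))"

lemma schottky_bound_ge_1: "0 < \<rho> \<Longrightarrow> \<rho> < 1 \<Longrightarrow> r \<ge> 0 \<Longrightarrow> schottky_bound \<rho> r \<ge> 1"
  by (simp add: schottky_bound_def)

lemma schottky_bound_mono: "r \<le> s \<Longrightarrow> schottky_bound \<rho> r \<le> schottky_bound \<rho> s"
  by (simp add: schottky_bound_def)

lemma schottky_ball:
  assumes hol: "q holomorphic_on ball 0 1"
    and omit: "\<And>z. z \<in> ball 0 1 \<Longrightarrow> q z \<noteq> 0 \<and> q z \<noteq> 1"
    and q0: "norm (q 0) \<le> r" and \<rho>: "0 < \<rho>" "\<rho> < 1" and z: "norm z \<le> \<rho>"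
  shows "norm (q z) \<le> schottky_bound \<rho> r"
proof -
  \<comment> \<open>One number serves both as the dilation that makes the function holomorphic on
    the closed disk and as the radius in Schottky's theorem; this requires \<rho> \<le> t^2.\<close>
  define t where "t = (1 + \<rho>) / 2"
  define s where "s = 2 * \<rho> / (1 + \<rho>)"
  have t: "0 < t" "t < 1" using \<rho> by (auto simp: t_def)
  have s: "0 < s" "s < 1" "s * t = \<rho>" using \<rho> by (auto simp: s_def t_def)
  have st: "s \<le> t"
  proof -
    have "4 * \<rho> \<le> (1 + \<rho>)\<^sup>2" using sum_squares_ge_zero[of "1 - \<rho>" 0] by (simp add: power2_eq_square algebra_simps)
    then show ?thesis using \<rho> by (simp add: s_def t_def divide_simps power2_eq_square)
  qed
  define p where "p = (\<lambda>z. q (of_real t * z))"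
  have in_ball: "of_real t * w \<in> ball 0 1" if "w \<in> cball 0 1" for w :: complex
  proof -
    have "norm (of_real t * w) \<le> t * 1" unfolding norm_mult norm_of_real using that t by (intro mult_mono) auto
    then show ?thesis using t by simp
  qed
  have "(q \<circ> (\<lambda>w. of_real t * w)) holomorphic_on cball 0 1"
    by (rule holomorphic_on_compose_gen[OF _ hol]) (use in_ball in \<open>auto intro!: holomorphic_intros\<close>)
  then have hp: "p holomorphic_on cball 0 1" by (simp add: p_def o_def)
  have nz: "norm (z / of_real t) \<le> t"
  proof -
    have "norm (z / of_real t) = norm z / t" using t by (simp add: norm_divide)
    also have "\<dots> \<le> \<rho> / t" using z t by (intro divide_right_mono) auto
    also have "\<dots> = s" using s t by (simp add: field_simps)
    finally show ?thesis using st by linarith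
  qed
  have "norm (p (z / of_real t)) \<le> exp (pi * exp (pi * (2 + 2 * r + 12 * t / (1 - t))))"
  proof (rule Schottky[OF hp])
    show "cmod (p 0) \<le> r" using q0 by (simp add: p_def)
    show "\<not> (p w = 0 \<or> p w = 1)" if "w \<in> cball 0 1" for w using omit[OF in_ball[OF that]] by (simp add: p_def)
  qed (use t nz in auto)
  moreover have pz: "p (z / of_real t) = q z" using t by (simp add: p_def)
  ultimately have "norm (q z) \<le> exp (pi * exp (pi * (2 + 2 * r + 12 * t / (1 - t))))" by (simp only: pz)
  then show ?thesis unfolding schottky_bound_def t_def .
qed

text \<open>Harnack's inequality for the positive harmonic function ln M - ln |q|: a small value at
  0 stays small, at the cost of a smaller exponent.\<close>

lemma nonvanishing_harnack:
  assumes hol: "q holomorphic_on ball 0 1" and nz: "\<And>z. z \<in> ball 0 1 \<Longrightarrow> q z \<noteq> 0"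
    and M: "\<And>z. z \<in> ball 0 1 \<Longrightarrow> norm (q z) < M" and \<rho>: "0 \<le> \<rho>" "\<rho> < 1" and z: "norm z \<le> \<rho>"
  shows "norm (q z) \<le> M * (norm (q 0) / M) powr ((1 - \<rho>) / (1 + \<rho>))"
proof -
  obtain L where L: "L holomorphic_on ball 0 1" "\<And>z. z \<in> ball 0 1 \<Longrightarrow> q z = exp (L z)"
    using contractible_imp_holomorphic_log[OF hol convex_imp_contractible[OF convex_ball] nz] by metis
  have z1: "norm z < 1" using z \<rho> by simp
  have M0: "M > 0" using le_less_trans[OF norm_ge_zero M[of 0]] by simp
  define H where "H = (\<lambda>z. of_real (ln M) - L z)"
  define c where "c = (1 - \<rho>) / (1 + \<rho>)"
  have Re: "Re (L z) = ln (norm (q z))" if "z \<in> ball 0 1" for z using L(2)[OF that] by simp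
  have "Re (H z) \<ge> Re (H 0) * ((1 - norm z) / (1 + norm z))"
  proof (rule harnack_lower[OF _ _ z1])
    show "H holomorphic_on ball 0 1" unfolding H_def by (intro holomorphic_intros L)
    show "0 < Re (H z)" if "z \<in> ball 0 1" for z
      using M[OF that] nz[OF that] M0 by (simp add: H_def Re[OF that])
  qed
  moreover have "c \<le> (1 - norm z) / (1 + norm z)"
    unfolding c_def using z \<rho> by (intro frac_le) (auto intro: add_pos_nonneg)
  moreover have H0: "Re (H 0) > 0" using M[of 0] nz[of 0] M0 by (simp add: H_def Re)
  ultimately have "Re (H 0) * c \<le> Re (H z)"
    by (meson less_imp_le mult_left_mono order_trans)
  moreover have "Re (H z) = ln M - ln (norm (q z))" "Re (H 0) = ln M - ln (norm (q 0))"
    using z1 by (simp_all add: H_def Re)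
  ultimately have "ln (norm (q z)) \<le> ln M + c * (ln (norm (q 0)) - ln M)"
    by (simp add: algebra_simps)
  also have "\<dots> = ln (M * (norm (q 0) / M) powr c)"
    using M0 nz[of 0] by (simp add: ln_mult_pos ln_powr ln_div)
  finally show ?thesis unfolding c_def[symmetric] using M0 nz[of 0] nz[of z] z1 by (subst (asm) ln_le_cancel_iff) auto
qed

text \<open>Schottky bounds q on a disk of radius t > \<rho>, and Harnack on that disk carries
  smallness from 0 to radius \<rho>. The threshold is chosen before q, which makes every later
  modulus uniform over all motions.\<close>

lemma schottky_small:
  assumes \<rho>: "0 < \<rho>" "\<rho> < 1" and e: "e > 0"
  obtains \<delta> where "\<delta> > 0" "\<And>q z. q holomorphic_on ball 0 1 \<Longrightarrow> (\<And>z. z \<in> ball 0 1 \<Longrightarrow> q z \<noteq> 0 \<and> q z \<noteq> 1)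
     \<Longrightarrow> norm (q 0) \<le> \<delta> \<Longrightarrow> norm z \<le> \<rho> \<Longrightarrow> norm (q z) \<le> e"
proof -
  define t where "t = (1 + \<rho>) / 2"
  have t: "0 < t" "t < 1" "\<rho> < t" using \<rho> by (auto simp: t_def)
  define M where "M = schottky_bound t 1 + 1"
  define \<sigma> where "\<sigma> = \<rho> / t"
  have \<sigma>: "0 < \<sigma>" "\<sigma> < 1" using \<rho> t by (auto simp: \<sigma>_def)
  define \<alpha> where "\<alpha> = (1 - \<sigma>) / (1 + \<sigma>)"
  have \<alpha>: "\<alpha> > 0" using \<sigma> by (simp add: \<alpha>_def)
  have M: "M > 0" using schottky_bound_ge_1[of t 1] t by (simp add: M_def)
  \<comment> \<open>The second entry solves M (\<delta> / M)^\<alpha> = e; the first permits the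
    Schottky bound with initial value 1.\<close>
  define \<delta> where "\<delta> = min 1 (M * (e / M) powr (1 / \<alpha>))"
  have \<delta>: "\<delta> > 0" using M e by (simp add: \<delta>_def)
  show thesis
  proof (rule that[OF \<delta>])
    fix q :: "complex \<Rightarrow> complex" and z :: complex assume q: "q holomorphic_on ball 0 1" "\<And>z. z \<in> ball 0 1 \<Longrightarrow> q z \<noteq> 0 \<and> q z \<noteq> 1" "norm (q 0) \<le> \<delta>" and z: "norm z \<le> \<rho>"
    define p where "p = (\<lambda>w. q (of_real t * w))"
    have in_ball: "norm (of_real t * w) \<le> t" if "norm w < 1" for w :: complex
    proof -
      have "norm (of_real t * w) \<le> t * 1" unfolding norm_mult norm_of_real using that t by (intro mult_mono) auto
      then show ?thesis by simp
    qed
    have "norm (p (z / of_real t)) \<le> M * (norm (p 0) / M) powr ((1 - \<sigma>) / (1 + \<sigma>))"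
    proof (rule nonvanishing_harnack)
      have "(q \<circ> (\<lambda>w. of_real t * w)) holomorphic_on ball 0 1"
      proof (rule holomorphic_on_compose_gen[OF _ q(1)])
        show "(\<lambda>w. of_real t * w) ` ball 0 1 \<subseteq> ball (0::complex) 1" using in_ball t by fastforce
      qed (auto intro!: holomorphic_intros)
      then show "p holomorphic_on ball 0 1" by (simp add: p_def o_def)
      fix w :: complex assume w: "w \<in> ball 0 1"
      then have tw: "norm (of_real t * w) \<le> t" using in_ball by simp
      then have tw': "of_real t * w \<in> ball 0 1" using t by simp
      show "p w \<noteq> 0" using q(2)[OF tw'] by (simp add: p_def)
      have "norm (q 0) \<le> 1" using q(3) by (simp add: \<delta>_def)
      then have "norm (p w) \<le> schottky_bound t 1" unfolding p_def
        using schottky_ball[OF q(1,2) _ t(1,2) tw, of 1] by blast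
      then show "norm (p w) < M" by (simp add: M_def)
    next
      have "norm (z / of_real t) = norm z / t" using t by (simp add: norm_divide)
      also have "\<dots> \<le> \<sigma>" unfolding \<sigma>_def using z t by (intro divide_right_mono) auto
      finally show "norm (z / of_real t) \<le> \<sigma>" .
    qed (use \<sigma> in auto)
    then have "norm (q z) \<le> M * (norm (q 0) / M) powr \<alpha>" using t by (simp add: p_def \<alpha>_def)
    also have "\<dots> \<le> M * ((e / M) powr (1 / \<alpha>)) powr \<alpha>"
    proof (intro mult_left_mono powr_mono2)
      have "norm (q 0) \<le> M * (e / M) powr (1 / \<alpha>)" using q(3) by (simp add: \<delta>_def)
      then show "norm (q 0) / M \<le> (e / M) powr (1 / \<alpha>)" using M by (simp add: pos_divide_le_eq mult.commute)
    qed (use M \<alpha> in auto)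
    also have "\<dots> = e" using M e \<alpha> by (simp add: powr_powr)
    finally show "norm (q z) \<le> e" .
  qed
qed

text \<open>The first argument of a motion is the moving point, the second one the time parameter.\<close>

definition holo_motion :: "complex set \<Rightarrow> (complex \<Rightarrow> complex \<Rightarrow> complex) \<Rightarrow> bool" where
  "holo_motion X f \<longleftrightarrow> 0 \<in> X \<and> 1 \<in> X \<and> (\<forall>x\<in>X. f x holomorphic_on ball 0 1 \<and> f x 0 = x) \<and>
     (\<forall>l\<in>ball 0 1. f 0 l = 0 \<and> f 1 l = 1 \<and> inj_on (\<lambda>x. f x l) X)"

section \<open>Uniform distortion of motions through cross-ratios\<close>

definition cross_ratio_family where
  "cross_ratio_family f x y z l = (f y l - f x l) / (f z l - f x l)"

text \<open>Injectivity at every time makes the ratio of three distinct moving points finite and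
  different from 0 and 1, the hypothesis of Schottky's theorem.\<close>

lemma cross_ratio_family:
  assumes f: "holo_motion X f" and x: "x \<in> X" "y \<in> X" "z \<in> X" "x \<noteq> y" "x \<noteq> z" "y \<noteq> z"
  shows "cross_ratio_family f x y z holomorphic_on ball 0 1"
    and "\<And>l. l \<in> ball 0 1 \<Longrightarrow> cross_ratio_family f x y z l \<noteq> 0 \<and> cross_ratio_family f x y z l \<noteq> 1"
    and "cross_ratio_family f x y z 0 = (y - x) / (z - x)"
proof -
  have ne: "f a l \<noteq> f b l" if "a \<in> X" "b \<in> X" "a \<noteq> b" "l \<in> ball 0 1" for a b l
    using f that unfolding holo_motion_def inj_on_def by blast
  have h: "f a holomorphic_on ball 0 1" "f a 0 = a" if "a \<in> X" for a using f that unfolding holo_motion_def by auto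
  show "cross_ratio_family f x y z holomorphic_on ball 0 1"
    unfolding cross_ratio_family_def[abs_def]
    by (intro holomorphic_on_divide holomorphic_on_diff h x) (use ne x in auto)
  show "cross_ratio_family f x y z l \<noteq> 0 \<and> cross_ratio_family f x y z l \<noteq> 1" if "l \<in> ball 0 1" for l
    using ne[OF x(1,2,4) that] ne[OF x(1,3,5) that] ne[OF x(2,3,6) that] by (auto simp: cross_ratio_family_def)
  show "cross_ratio_family f x y z 0 = (y - x) / (z - x)" using h x by (simp add: cross_ratio_family_def)
qed

text \<open>Schottky's theorem for the cross-ratio gives a three-point quasisymmetry condition with
  a constant independent of the motion. The degenerate cases are covered because
  \<open>schottky_bound\<close> is at least 1.\<close>

lemma motion_ratio_bound:
  assumes f: "holo_motion X f" and x: "x \<in> X" "y \<in> X" "z \<in> X" "x \<noteq> z"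
    and r: "norm (y - x) \<le> r * norm (z - x)" and \<rho>: "0 < \<rho>" "\<rho> < 1" and l: "norm l \<le> \<rho>"
  shows "norm (f y l - f x l) \<le> schottky_bound \<rho> r * norm (f z l - f x l)"
proof -
  have "0 \<le> r * norm (z - x)" using r norm_ge_zero[of "y - x"] by linarith
  then have r0: "r \<ge> 0" using x(4) by (simp add: zero_le_mult_iff)
  note S = schottky_bound_ge_1[OF \<rho> r0]
  have ne: "f z l \<noteq> f x l" using f x l \<rho> unfolding holo_motion_def inj_on_def by (auto dest: bspec[of _ _ l])
  consider "y = x" | "y = z" | "x \<noteq> y" "y \<noteq> z" by blast
  then show ?thesis
  proof cases
    case 1
    then show ?thesis using S by simp
  next
    case 2
    then show ?thesis using S mult_right_mono[of 1 "schottky_bound \<rho> r" "norm (f z l - f x l)"] by simp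
  next
    case 3
    note C = cross_ratio_family[OF f x(1,2,3) 3(1) x(4) 3(2)]
    have "norm (cross_ratio_family f x y z 0) \<le> r" using r x(4) by (simp add: C(3) norm_divide pos_divide_le_eq)
    from schottky_ball[OF C(1,2) this \<rho> l] show ?thesis
      using ne by (simp add: cross_ratio_family_def norm_divide pos_divide_le_eq)
  qed
qed

lemma motion_bounded:
  assumes f: "holo_motion X f" and x: "x \<in> X" and \<rho>: "0 < \<rho>" "\<rho> < 1" and l: "norm l \<le> \<rho>"
  shows "norm (f x l) \<le> schottky_bound \<rho> (norm x)"
proof -
  have X: "0 \<in> X" "1 \<in> X" "f 0 l = 0" "f 1 l = 1" using f l \<rho> unfolding holo_motion_def by auto
  show ?thesis using motion_ratio_bound[OF f X(1) x X(2), of "norm x" \<rho> l] \<rho> l X by simp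
qed

text \<open>One of the fixed points 0 and 1 is at distance at least 1/2 from the moving x, and the
  ratio bound compares that distance with the one to y. The form without division by the moving
  distance passes to limits of motions.\<close>

lemma motion_lower:
  assumes f: "holo_motion X f" and x: "x \<in> X" "y \<in> X" "x \<noteq> y" and \<rho>: "0 < \<rho>" "\<rho> < 1" and l: "norm l \<le> \<rho>"
  shows "1 \<le> 2 * schottky_bound \<rho> ((norm x + 1) / norm (y - x)) * norm (f y l - f x l)"
proof -
  have X: "0 \<in> X" "1 \<in> X" "f 0 l = 0" "f 1 l = 1" using f l \<rho> unfolding holo_motion_def by auto
  have "\<exists>v\<in>{0,1}. norm (f v l - f x l) \<ge> 1 / 2"
  proof (rule ccontr)
    assume "\<not> ?thesis"
    then have "norm (f x l) < 1 / 2" "norm (1 - f x l) < 1 / 2" using X by (auto simp: norm_minus_commute)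
    then show False using norm_triangle_ineq[of "f x l" "1 - f x l"] by simp
  qed
  then obtain v where v: "v \<in> {0,1}" "norm (f v l - f x l) \<ge> 1 / 2" by blast
  have "norm (v - x) \<le> norm v + norm x" by (rule norm_triangle_ineq4)
  also have "\<dots> \<le> norm x + 1" using v by auto
  finally have "norm (v - x) \<le> ((norm x + 1) / norm (y - x)) * norm (y - x)" using x by simp
  from motion_ratio_bound[OF f x(1) _ x(2,3) this \<rho> l] v X
  have "norm (f v l - f x l) \<le> schottky_bound \<rho> ((norm x + 1) / norm (y - x)) * norm (f y l - f x l)" by auto
  then show ?thesis using v(2) by linarith
qed

text \<open>The comparison point is whichever of 0 and 1 has distance at least 1/2 from x; the
  cross-ratio starts small and stays small. The bound 1/4 keeps y different from that point.\<close>

lemma motion_equicontinuous: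
  assumes \<rho>: "0 < \<rho>" "\<rho> < 1" and e: "e > 0"
  obtains \<delta> where "\<delta> > 0" "\<And>X f x y l. holo_motion X f \<Longrightarrow> x \<in> X \<Longrightarrow> y \<in> X \<Longrightarrow> norm x \<le> R \<Longrightarrow> norm (y - x) \<le> \<delta> \<Longrightarrow> norm l \<le> \<rho>
     \<Longrightarrow> norm (f y l - f x l) \<le> e"
proof -
  define N where "N = 1 + schottky_bound \<rho> R"
  have N: "N > 0" by (simp add: N_def schottky_bound_def add_pos_pos)
  obtain \<delta> where \<delta>: "\<delta> > 0" "\<And>q z. q holomorphic_on ball 0 1 \<Longrightarrow> (\<And>z. z \<in> ball 0 1 \<Longrightarrow> q z \<noteq> 0 \<and> q z \<noteq> 1)
     \<Longrightarrow> norm (q 0) \<le> \<delta> \<Longrightarrow> norm z \<le> \<rho> \<Longrightarrow> norm (q z) \<le> e / N"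
    using schottky_small[OF \<rho>, of "e / N"] e N by (metis divide_pos_pos)
  show thesis
  proof (rule that[of "min (1/4) (\<delta> / 2)"])
    fix X f and x y l :: complex
    assume f: "holo_motion X f" and x: "x \<in> X" "y \<in> X" and xR: "norm x \<le> R" and d: "norm (y - x) \<le> min (1/4) (\<delta> / 2)" and l: "norm l \<le> \<rho>"
    have X: "0 \<in> X" "1 \<in> X" "f 0 l = 0" "f 1 l = 1" using f l \<rho> unfolding holo_motion_def by auto
    show "norm (f y l - f x l) \<le> e"
    proof (cases "x = y")
      case False
      have "\<exists>v\<in>{0,1}. norm (v - x) \<ge> 1 / 2"
      proof (rule ccontr)
        assume "\<not> ?thesis"
        then have "norm x < 1 / 2" "norm (1 - x) < 1 / 2" by (auto simp: norm_minus_commute)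
        then show False using norm_triangle_ineq[of x "1 - x"] by simp
      qed
      then obtain v where v: "v \<in> {0,1}" "norm (v - x) \<ge> 1 / 2" by blast
      have vx: "v \<in> X" "x \<noteq> v" "y \<noteq> v" "f v l = v" using v X d by auto
      note C = cross_ratio_family[OF f x vx(1) False vx(2,3)]
      have "norm (cross_ratio_family f x y v 0) \<le> \<delta>"
      proof -
        have "norm (y - x) \<le> \<delta> * (1 / 2)" using d by simp
        also have "\<dots> \<le> \<delta> * norm (v - x)" using v \<delta> by (intro mult_left_mono) auto
        finally show ?thesis using vx by (simp add: C(3) norm_divide pos_divide_le_eq)
      qed
      from \<delta>(2)[OF C(1,2) this l] have "norm (cross_ratio_family f x y v l) \<le> e / N" .
      moreover have ne: "f v l \<noteq> f x l" using f x vx l \<rho> unfolding holo_motion_def inj_on_def by (auto dest: bspec[of _ _ l])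
      ultimately have "norm (f y l - f x l) \<le> e / N * norm (f v l - f x l)"
        by (simp add: cross_ratio_family_def norm_divide pos_divide_le_eq)
      also have "\<dots> \<le> e / N * N"
      proof (intro mult_left_mono)
        have "norm (f v l - f x l) \<le> norm v + norm (f x l)" unfolding vx(4) by (rule norm_triangle_ineq4)
        also have "\<dots> \<le> N" using motion_bounded[OF f x(1) \<rho> l] schottky_bound_mono[OF xR, of \<rho>] v by (auto simp: N_def)
        finally show "norm (f v l - f x l) \<le> N" .
      qed (use e N in auto)
      finally show ?thesis using N by simp
    qed (use e in simp)
  qed (use \<delta> in auto)
qed

text \<open>For the triple 0, 1, x the cross-ratio is the reciprocal of the moving point. It starts
  small when x is large and therefore stays small.\<close>

lemma motion_proper:
  assumes \<rho>: "0 < \<rho>" "\<rho> < 1"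
  obtains R' where "\<And>X f x l. holo_motion X f \<Longrightarrow> x \<in> X \<Longrightarrow> norm l \<le> \<rho> \<Longrightarrow> norm (f x l) \<le> R \<Longrightarrow> norm x \<le> R'"
proof -
  have "1 / (\<bar>R\<bar> + 1) > 0" by (simp add: add_nonneg_pos)
  then obtain \<delta> where \<delta>: "\<delta> > 0" "\<And>q z. q holomorphic_on ball 0 1 \<Longrightarrow> (\<And>z. z \<in> ball 0 1 \<Longrightarrow> q z \<noteq> 0 \<and> q z \<noteq> 1)
     \<Longrightarrow> norm (q 0) \<le> \<delta> \<Longrightarrow> norm z \<le> \<rho> \<Longrightarrow> norm (q z) \<le> 1 / (\<bar>R\<bar> + 1) / 2"
    using schottky_small[OF \<rho>] by (metis half_gt_zero)
  show thesis
  proof (rule that[of "1 + 1 / \<delta>"])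
    fix X f and x l :: complex assume f: "holo_motion X f" and x: "x \<in> X" and l: "norm l \<le> \<rho>" and R: "norm (f x l) \<le> R"
    have X: "0 \<in> X" "1 \<in> X" "f 0 l = 0" "f 1 l = 1" using f l \<rho> unfolding holo_motion_def by auto
    show "norm x \<le> 1 + 1 / \<delta>"
    proof (rule ccontr)
      assume "\<not> ?thesis"
      then have big: "norm x > 1 + 1 / \<delta>" by simp
      have "1 / \<delta> > 0" using \<delta> by simp
      then have "norm x > 1" using big by linarith
      then have x01: "x \<noteq> 0" "x \<noteq> 1" by auto
      have "norm (cross_ratio_family f 0 1 x 0) \<le> \<delta>"
      proof -
        have "1 \<le> \<delta> * norm x" using big \<delta> by (simp add: field_simps)
        then show ?thesis using cross_ratio_family(3)[OF f X(1,2) x] x01 by (simp add: norm_divide pos_divide_le_eq)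
      qed
      from \<delta>(2)[OF cross_ratio_family(1,2)[OF f X(1,2) x _ _ _] this l] x01
      have "norm (cross_ratio_family f 0 1 x l) \<le> 1 / (\<bar>R\<bar> + 1) / 2" by auto
      moreover have "f x l \<noteq> 0" using f x X x01 l \<rho> unfolding holo_motion_def inj_on_def by (auto dest: bspec[of _ _ l])
      ultimately have "1 \<le> 1 / (\<bar>R\<bar> + 1) / 2 * norm (f x l)"
        using X by (simp add: cross_ratio_family_def norm_divide pos_divide_le_eq)
      also have "\<dots> \<le> 1 / (\<bar>R\<bar> + 1) / 2 * (\<bar>R\<bar> + 1)" using R by (intro mult_left_mono) auto
      finally show False by (simp add: add_nonneg_eq_0_iff)
    qed
  qed
qed

section \<open>Packing estimates\<close>

lemma gibbs_inequality:
  fixes p a :: "'i \<Rightarrow> real"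
  assumes I: "finite I" and p: "\<And>i. i \<in> I \<Longrightarrow> p i > 0" "(\<Sum>i\<in>I. p i) = 1" and a: "\<And>i. i \<in> I \<Longrightarrow> a i > 0"
  shows "(\<Sum>i\<in>I. p i * (ln (a i) - ln (p i))) \<le> (\<Sum>i\<in>I. a i) - 1"
proof -
  have "(\<Sum>i\<in>I. p i * (ln (a i) - ln (p i))) \<le> (\<Sum>i\<in>I. a i - p i)"
  proof (rule sum_mono)
    fix i assume i: "i \<in> I"
    have "ln (a i / p i) \<le> a i / p i - 1" using p(1)[OF i] a[OF i] by (intro ln_le_minus_one) simp
    then have "p i * (ln (a i) - ln (p i)) \<le> p i * (a i / p i - 1)"
      using p(1)[OF i] a[OF i] by (intro mult_left_mono) (auto simp: ln_div)
    then show "p i * (ln (a i) - ln (p i)) \<le> a i - p i" using p(1)[OF i] by (simp add: right_diff_distrib)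
  qed
  then show ?thesis by (simp add: sum_subtractf p)
qed

text \<open>Meant for sets of real points, which then stay real at real times.\<close>

definition cnj_symmetric :: "complex set \<Rightarrow> (complex \<Rightarrow> complex \<Rightarrow> complex) \<Rightarrow> bool" where
  "cnj_symmetric X f \<longleftrightarrow> (\<forall>x\<in>X. \<forall>l\<in>ball 0 1. f x (cnj l) = cnj (f x l))"

text \<open>The intervals are disjoint subsets of one interval. The absolute value covers an empty
  index set, for which N may be negative.\<close>

lemma sum_real_interval_lengths:
  fixes c R :: "'i \<Rightarrow> real"
  assumes I: "finite I" and R: "\<And>i. i \<in> I \<Longrightarrow> R i \<ge> 0" 
    and disj: "\<And>i j. i \<in> I \<Longrightarrow> j \<in> I \<Longrightarrow> i \<noteq> j \<Longrightarrow> \<bar>c i - c j\<bar> \<ge> R i + R j"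
    and sub: "\<And>i. i \<in> I \<Longrightarrow> \<bar>c i\<bar> + R i \<le> N"
  shows "(\<Sum>i\<in>I. R i) \<le> \<bar>N\<bar>"
proof -
  have "(\<Sum>i\<in>I. measure lborel (ball (c i) (R i))) = measure lborel (\<Union>i\<in>I. ball (c i) (R i))"
  proof (rule measure_finite_Union[symmetric, OF I])
    show "disjoint_family_on (\<lambda>i. ball (c i) (R i)) I"
      unfolding disjoint_family_on_def using disj by (fastforce intro!: disjoint_ballI simp: dist_real_def)
    show "\<And>i. i \<in> I \<Longrightarrow> emeasure lborel (ball (c i) (R i)) \<noteq> \<infinity>"
      using emeasure_bounded_finite[OF bounded_ball] by (metis infinity_ennreal_def order_less_irrefl)
  qed auto
  also have "\<dots> \<le> measure lborel (ball (0::real) \<bar>N\<bar>)"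
  proof (rule measure_mono_fmeasurable)
    show "(\<Union>i\<in>I. ball (c i) (R i)) \<subseteq> ball 0 \<bar>N\<bar>"
    proof
      fix x assume "x \<in> (\<Union>i\<in>I. ball (c i) (R i))"
      then obtain i where "i \<in> I" "\<bar>c i - x\<bar> < R i" by (auto simp: dist_real_def)
      then show "x \<in> ball 0 \<bar>N\<bar>" using sub[of i] by (simp add: dist_real_def)
    qed
    show "ball 0 \<bar>N\<bar> \<in> fmeasurable lborel"
      using emeasure_bounded_finite[OF bounded_ball] by (intro fmeasurableI) auto
    show "(\<Union>i\<in>I. ball (c i) (R i)) \<in> sets lborel" by (simp add: borel_open open_UN)
  qed
  finally have "(\<Sum>i\<in>I. 2 * R i) \<le> 2 * \<bar>N\<bar>"
    using R by (simp add: content_ball unit_ball_vol_1 cong: sum.cong)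
  then show ?thesis by (simp add: sum_distrib_left[symmetric])
qed

lemma sum_disk_areas:
  fixes c :: "'i \<Rightarrow> complex"
  assumes I: "finite I" and R: "\<And>i. i \<in> I \<Longrightarrow> R i \<ge> 0" 
    and disj: "\<And>i j. i \<in> I \<Longrightarrow> j \<in> I \<Longrightarrow> i \<noteq> j \<Longrightarrow> norm (c i - c j) \<ge> R i + R j"
    and sub: "\<And>i. i \<in> I \<Longrightarrow> norm (c i) + R i \<le> N"
  shows "(\<Sum>i\<in>I. (R i)\<^sup>2) \<le> N\<^sup>2"
proof -
  have "(\<Sum>i\<in>I. measure lborel (ball (c i) (R i))) = measure lborel (\<Union>i\<in>I. ball (c i) (R i))"
  proof (rule measure_finite_Union[symmetric, OF I])
    show "disjoint_family_on (\<lambda>i. ball (c i) (R i)) I"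
      unfolding disjoint_family_on_def using disj by (fastforce intro!: disjoint_ballI simp: dist_norm)
    show "\<And>i. i \<in> I \<Longrightarrow> emeasure lborel (ball (c i) (R i)) \<noteq> \<infinity>"
      using emeasure_bounded_finite[OF bounded_ball] by (metis infinity_ennreal_def order_less_irrefl)
  qed auto
  also have "\<dots> \<le> measure lborel (ball (0::complex) \<bar>N\<bar>)"
  proof (rule measure_mono_fmeasurable)
    show "(\<Union>i\<in>I. ball (c i) (R i)) \<subseteq> ball 0 \<bar>N\<bar>"
    proof
      fix x assume "x \<in> (\<Union>i\<in>I. ball (c i) (R i))"
      then obtain i where "i \<in> I" "norm (c i - x) < R i" by (auto simp: dist_norm)
      then show "x \<in> ball 0 \<bar>N\<bar>" using sub[of i] norm_triangle_ineq2[of x "c i"] by (simp add: norm_minus_commute)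
    qed
    show "ball 0 \<bar>N\<bar> \<in> fmeasurable lborel"
      using emeasure_bounded_finite[OF bounded_ball] by (intro fmeasurableI) auto
    show "(\<Union>i\<in>I. ball (c i) (R i)) \<in> sets lborel" by (simp add: borel_open open_UN)
  qed
  finally have "(\<Sum>i\<in>I. pi * (R i)\<^sup>2) \<le> pi * \<bar>N\<bar>\<^sup>2"
    using R by (simp add: content_ball unit_ball_vol_2 DIM_complex cong: sum.cong)
  then show ?thesis by (simp add: sum_distrib_left[symmetric])
qed

text \<open>By the ratio bound, balls around the moving centres with radius (moving length) / (2 S)
  are disjoint, and all lie in a fixed ball. At real times of a symmetric motion the centres are
  real and lengths replace areas, which improves the exponent from 2 to 1.\<close>

lemma motion_packing:
  assumes \<rho>: "0 < \<rho>" "\<rho> < 1" and m: "m \<ge> 0"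
  obtains C where "C > 0"
    "\<And>X f I c r l. holo_motion (of_real ` X) f \<Longrightarrow> finite I \<Longrightarrow> (\<And>i. i \<in> I \<Longrightarrow> c i \<in> X \<and> c i + r i \<in> X \<and> 0 < r i \<and> \<bar>c i\<bar> \<le> m \<and> r i \<le> 1)
      \<Longrightarrow> (\<And>i j. i \<in> I \<Longrightarrow> j \<in> I \<Longrightarrow> i \<noteq> j \<Longrightarrow> \<bar>c i - c j\<bar> > r i + r j) \<Longrightarrow> norm l \<le> \<rho>
      \<Longrightarrow> (\<Sum>i\<in>I. (norm (f (of_real (c i + r i)) l - f (of_real (c i)) l) / C)\<^sup>2) < 1
        \<and> (cnj_symmetric (of_real ` X) f \<longrightarrow> l \<in> \<real> \<longrightarrow> (\<Sum>i\<in>(I::nat set). norm (f (of_real (c i + r i)) l - f (of_real (c i)) l) / C) < 1)"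
proof -
  define S where "S = schottky_bound \<rho> 1"
  define S' where "S' = schottky_bound \<rho> (m + 1)"
  have S: "S \<ge> 1" "S' \<ge> 1" using schottky_bound_ge_1[OF \<rho>] m by (auto simp: S_def S'_def)
  \<comment> \<open>Twice what the packing needs, so that both sums are strictly below 1; the
    strictness later puts the values into the open half plane.\<close>
  define C where "C = 8 * S * S'"
  have C: "C > 0" using S by (simp add: C_def)
  show thesis
  proof (rule that[OF C])
    fix X f I c r l
    assume f: "holo_motion (of_real ` X) f" and I: "finite (I::nat set)"
      and cr: "\<And>i. i \<in> I \<Longrightarrow> c i \<in> X \<and> c i + r i \<in> X \<and> 0 < r i \<and> \<bar>c i\<bar> \<le> m \<and> r i \<le> (1::real)"
      and disj: "\<And>i j. i \<in> I \<Longrightarrow> j \<in> I \<Longrightarrow> i \<noteq> j \<Longrightarrow> \<bar>c i - c j\<bar> > r i + r j" and l: "norm (l::complex) \<le> \<rho>"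
    define z where "z i = f (of_real (c i)) l" for i
    define R where "R i = norm (f (of_real (c i + r i)) l - f (of_real (c i)) l)" for i
    have bd: "norm (f (of_real x) l) \<le> S'" if "x \<in> X" "\<bar>x\<bar> \<le> m + 1" for x
      using motion_bounded[OF f imageI[OF that(1)] \<rho> l] schottky_bound_mono[of "norm (complex_of_real x)" "m + 1" \<rho>] that(2)
      unfolding S'_def norm_of_real by linarith
    have sep: "norm (z i - z j) \<ge> R i / (2 * S) + R j / (2 * S)" if ij: "i \<in> I" "j \<in> I" "i \<noteq> j" for i j
    proof -
      have half: "R i \<le> S * norm (z j - z i)" if "i \<in> I" "j \<in> I" "i \<noteq> j" for i j
      proof -
        have "r i + r j < \<bar>c i - c j\<bar>" "0 < r i" "0 < r j" using disj[OF that] cr[OF that(1)] cr[OF that(2)] by auto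
        then have "r i \<le> \<bar>c j - c i\<bar>" by linarith
        then have "norm (complex_of_real (c i + r i) - of_real (c i)) \<le> 1 * norm (complex_of_real (c j) - of_real (c i))"
          using cr[OF that(1)] by (simp add: norm_of_real flip: of_real_diff)
        moreover have "complex_of_real (c i) \<noteq> of_real (c j)" using disj[OF that] cr[OF that(1)] cr[OF that(2)] by auto
        ultimately show ?thesis
          unfolding R_def z_def S_def using cr[OF that(1)] cr[OF that(2)] by (intro motion_ratio_bound[OF f imageI imageI imageI _ _ \<rho> l]) auto
      qed
      have "R i \<le> S * norm (z i - z j)" "R j \<le> S * norm (z i - z j)"
        using half[OF ij] half[of j i] ij by (auto simp: norm_minus_commute)
      then have "R i / (2 * S) + R j / (2 * S) \<le> (S * norm (z i - z j)) / (2 * S) + (S * norm (z i - z j)) / (2 * S)"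
        using S by (intro add_mono divide_right_mono) auto
      then show ?thesis using S by simp
    qed
    have R0: "R i \<ge> 0" for i by (simp add: R_def)
    have Rb: "norm (z i) + R i / (2 * S) \<le> 2 * S'" if i: "i \<in> I" for i
    proof -
      have "norm (z i) \<le> S'" "norm (f (of_real (c i + r i)) l) \<le> S'"
        using bd[of "c i"] bd[of "c i + r i"] cr[OF i] by (auto simp: z_def)
      then have "R i \<le> 2 * S'" unfolding R_def z_def using norm_triangle_ineq4[of "f (of_real (c i + r i)) l" "f (of_real (c i)) l"] by linarith
      then have "R i / (2 * S) \<le> (2 * S') / (2 * 1)" using S R0 by (intro frac_le) auto
      then show ?thesis using \<open>norm (z i) \<le> S'\<close> by simp
    qed
    have "(\<Sum>i\<in>I. (R i / (2 * S))\<^sup>2) \<le> (2 * S')\<^sup>2"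
      by (rule sum_disk_areas[OF I _ sep Rb]) (use R0 S in auto)
    moreover have "(\<Sum>i\<in>I. (R i / C)\<^sup>2) = (\<Sum>i\<in>I. (R i / (2 * S))\<^sup>2) / (4 * S')\<^sup>2"
      unfolding sum_divide_distrib using S by (intro sum.cong) (auto simp: C_def power2_eq_square)
    ultimately have "(\<Sum>i\<in>I. (R i / C)\<^sup>2) \<le> (2 * S')\<^sup>2 / (4 * S')\<^sup>2" by (simp add: divide_right_mono)
    also have "\<dots> < 1" using S by (simp add: power2_eq_square)
    finally have 1: "(\<Sum>i\<in>I. (R i / C)\<^sup>2) < 1" .
    have 2: "(\<Sum>i\<in>I. R i / C) < 1" if sym: "cnj_symmetric (of_real ` X) f" and lr: "l \<in> \<real>"
    proof -
      have zr: "z i = of_real (Re (z i))" if "i \<in> I" for i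
      proof -
        have "f (of_real (c i)) (cnj l) = cnj (f (of_real (c i)) l)"
          using sym cr[OF that] l \<rho> unfolding cnj_symmetric_def by auto
        moreover have "cnj l = l" using lr by (simp add: Reals_cnj_iff)
        ultimately show ?thesis by (simp add: z_def complex_eq_iff)
      qed
      have nr: "norm (z i) = \<bar>Re (z i)\<bar>" "norm (z i - z j) = \<bar>Re (z i) - Re (z j)\<bar>" if "i \<in> I" "j \<in> I" for i j
        by (metis zr[OF that(1)] norm_of_real, metis zr[OF that(1)] zr[OF that(2)] norm_of_real of_real_diff)
      have "(\<Sum>i\<in>I. R i / (2 * S)) \<le> \<bar>2 * S'\<bar>"
        by (rule sum_real_interval_lengths[OF I, where c = "\<lambda>i. Re (z i)"]) (use R0 S sep Rb nr in auto)
      moreover have "(\<Sum>i\<in>I. R i / C) = (\<Sum>i\<in>I. R i / (2 * S)) / (4 * S')"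
        unfolding sum_divide_distrib using S by (intro sum.cong) (auto simp: C_def)
      ultimately have "(\<Sum>i\<in>I. R i / C) \<le> (2 * S') / (4 * S')" using S by (simp add: divide_right_mono)
      also have "\<dots> < 1" using S by simp
      finally show ?thesis .
    qed
    show "(\<Sum>i\<in>I. (norm (f (of_real (c i + r i)) l - f (of_real (c i)) l) / C)\<^sup>2) < 1
        \<and> (cnj_symmetric (of_real ` X) f \<longrightarrow> l \<in> \<real> \<longrightarrow> (\<Sum>i\<in>I. norm (f (of_real (c i + r i)) l - f (of_real (c i)) l) / C) < 1)"
      using 1 2 by (auto simp: R_def)
  qed
qed

text \<open>Gibbs' inequality is an equality at time \<open>k\<close> and exponent \<open>1 - l'\<^sup>2\<close> when the weights are proportional
  to the lengths at time \<open>k\<close> raised to that exponent.\<close>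

lemma motion_sum_bound:
  assumes k: "0 \<le> k" "k < \<rho>" "\<rho> < 1" and m: "m \<ge> 0" and l: "k / \<rho> < l" "l < 1"
    and l': "l' = (l - k / \<rho>) / (1 - k / \<rho> * l)"
  obtains C where "C > 0"
    "\<And>X f I c r. holo_motion (of_real ` X) f \<Longrightarrow> cnj_symmetric (of_real ` X) f \<Longrightarrow> finite (I::nat set)
      \<Longrightarrow> (\<And>i. i \<in> I \<Longrightarrow> c i \<in> X \<and> c i + r i \<in> X \<and> 0 < r i \<and> \<bar>c i\<bar> \<le> m \<and> r i \<le> 1)
      \<Longrightarrow> (\<And>i j. i \<in> I \<Longrightarrow> j \<in> I \<Longrightarrow> i \<noteq> j \<Longrightarrow> \<bar>c i - c j\<bar> > r i + r j)
      \<Longrightarrow> (\<Sum>i\<in>I. (r i / C) powr (1 - l\<^sup>2)) \<le> 1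
      \<Longrightarrow> (\<Sum>i\<in>I. (norm (f (of_real (c i + r i)) (of_real k) - f (of_real (c i)) (of_real k)) / C) powr (1 - l'\<^sup>2)) \<le> 1"
proof -
  have \<rho>: "0 < \<rho>" "\<rho> < 1" using k by auto
  obtain C where C: "C > 0"
    "\<And>X f I c r l. holo_motion (of_real ` X) f \<Longrightarrow> finite I \<Longrightarrow> (\<And>i. i \<in> I \<Longrightarrow> c i \<in> X \<and> c i + r i \<in> X \<and> 0 < r i \<and> \<bar>c i\<bar> \<le> m \<and> r i \<le> 1)
      \<Longrightarrow> (\<And>i j. i \<in> I \<Longrightarrow> j \<in> I \<Longrightarrow> i \<noteq> j \<Longrightarrow> \<bar>c i - c j\<bar> > r i + r j) \<Longrightarrow> norm l \<le> \<rho>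
      \<Longrightarrow> (\<Sum>i\<in>I. (norm (f (of_real (c i + r i)) l - f (of_real (c i)) l) / C)\<^sup>2) < 1
        \<and> (cnj_symmetric (of_real ` X) f \<longrightarrow> l \<in> \<real> \<longrightarrow> (\<Sum>i\<in>(I::nat set). norm (f (of_real (c i + r i)) l - f (of_real (c i)) l) / C) < 1)"
    using motion_packing[OF \<rho> m] by blast
  \<comment> \<open>The packing bounds hold on the disk of radius \<rho>; rescaling it to the unit
    disk moves time k to k / \<rho>.\<close>
  define \<kappa> where "\<kappa> = k / \<rho>"
  have \<kappa>: "0 \<le> \<kappa>" "\<kappa> < l" "\<kappa> < 1" using k l by (auto simp: \<kappa>_def)
  show thesis
  proof (rule that[OF C(1)])
    fix X f I c r
    assume f: "holo_motion (of_real ` X) f" and sym: "cnj_symmetric (of_real ` X) f" and I: "finite (I::nat set)"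
      and cr: "\<And>i. i \<in> I \<Longrightarrow> c i \<in> X \<and> c i + r i \<in> X \<and> 0 < r i \<and> \<bar>c i\<bar> \<le> m \<and> r i \<le> (1::real)"
      and disj: "\<And>i j. i \<in> I \<Longrightarrow> j \<in> I \<Longrightarrow> i \<noteq> j \<Longrightarrow> \<bar>c i - c j\<bar> > r i + r j"
      and s1: "(\<Sum>i\<in>I. (r i / C) powr (1 - l\<^sup>2)) \<le> 1"
    have pack: "(\<Sum>i\<in>I. (norm (f (of_real (c i + r i)) w - f (of_real (c i)) w) / C)\<^sup>2) < 1
        \<and> (cnj_symmetric (of_real ` X) f \<longrightarrow> w \<in> \<real> \<longrightarrow> (\<Sum>i\<in>I. norm (f (of_real (c i + r i)) w - f (of_real (c i)) w) / C) < 1)"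
      if "norm w \<le> \<rho>" for w
      by (rule C(2)[OF f I]) (use cr disj that in blast)+
    define s where "s = 1 - l\<^sup>2"
    define t where "t = 1 - l'\<^sup>2"
    define R where "R i w = norm (f (of_real (c i + r i)) w - f (of_real (c i)) w) / C" for i w
    have l'01: "0 \<le> l'" "l' < 1"
    proof -
      have "\<kappa> * l \<le> \<kappa> * 1" using \<kappa> l by (intro mult_left_mono) auto
      then have d: "1 - \<kappa> * l > 0" using \<kappa> by linarith
      have "0 < (1 - l) * (1 + \<kappa>)" using \<kappa> l by simp
      then have "l - \<kappa> < 1 - \<kappa> * l" by (simp add: algebra_simps)
      then show "0 \<le> l'" "l' < 1" using \<kappa> d unfolding l' \<kappa>_def[symmetric] by auto
    qed
    have st: "0 < s" "0 < t" using \<kappa> l l'01 by (auto simp: s_def t_def abs_square_less_1)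
    have ne: "f (of_real (c i + r i)) w \<noteq> f (of_real (c i)) w" if "i \<in> I" "w \<in> ball 0 1" for i w
      using f cr[OF that(1)] that(2) unfolding holo_motion_def inj_on_def
      by (metis add_cancel_left_right imageI less_irrefl of_real_eq_iff)
    have Rpos: "R i w > 0" if "i \<in> I" "w \<in> ball 0 1" for i w using ne[OF that] C(1) by (simp add: R_def)
    have f0: "f (of_real x) 0 = of_real x" if "x \<in> X" for x using f that unfolding holo_motion_def by blast
    have R0: "R i 0 = r i / C" if "i \<in> I" for i
    proof -
      have "f (of_real (c i + r i)) 0 - f (of_real (c i)) 0 = of_real (r i)"
        using f0[of "c i"] f0[of "c i + r i"] cr[OF that] by simp
      then show ?thesis using cr[OF that] by (simp only: R_def norm_of_real abs_of_pos)
    qed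
    show "(\<Sum>i\<in>I. (norm (f (of_real (c i + r i)) (of_real k) - f (of_real (c i)) (of_real k)) / C) powr (1 - l'\<^sup>2)) \<le> 1"
    proof (rule ccontr)
      assume "\<not> ?thesis"
      then have Z: "(\<Sum>i\<in>I. R i (of_real k) powr t) > 1" by (simp add: R_def t_def)
      define Z where "Z = (\<Sum>i\<in>I. R i (of_real k) powr t)"
      have Z1: "Z > 1" using Z by (simp add: Z_def)
      have kb: "complex_of_real k \<in> ball 0 1" using k by simp
      define p where "p i = R i (of_real k) powr t / Z" for i
      have p: "p i > 0" if "i \<in> I" for i using Rpos[OF that kb] Z1 by (simp add: p_def)
      have psum: "(\<Sum>i\<in>I. p i) = 1" using Z1 unfolding p_def sum_divide_distrib[symmetric] Z_def by simp
      have p1: "p i \<le> 1" if "i \<in> I" for i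
        using member_le_sum[of i I p] that I p psum by (simp add: less_imp_le)
      define H0 where "H0 = (\<Sum>i\<in>I. - (p i * ln (p i)))"
      define \<Lambda> where "\<Lambda> w = (\<Sum>i\<in>I. - (p i * ln (R i w)))" for w
      have gibbs: "H0 - a * \<Lambda> w \<le> (\<Sum>i\<in>I. R i w powr a) - 1" if w: "w \<in> ball 0 1" for a w
      proof -
        have "H0 - a * \<Lambda> w = (\<Sum>i\<in>I. p i * (ln (R i w powr a) - ln (p i)))"
          unfolding H0_def \<Lambda>_def sum_distrib_left sum_subtractf[symmetric]
          by (intro sum.cong) (use Rpos w in \<open>auto simp: ln_powr algebra_simps\<close>)
        also have "\<dots> \<le> (\<Sum>i\<in>I. R i w powr a) - 1"
          by (rule gibbs_inequality[OF I p psum]) (use Rpos w in force)+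
        finally show ?thesis .
      qed
      \<comment> \<open>The equality case of Gibbs' inequality; the contradiction will be that the
        left side is at most 0 while Z > 1.\<close>
      have lnZ: "H0 - t * \<Lambda> (of_real k) = ln Z"
      proof -
        have "H0 - t * \<Lambda> (of_real k) = (\<Sum>i\<in>I. p i * ln Z)"
          unfolding H0_def \<Lambda>_def sum_distrib_left sum_subtractf[symmetric]
        proof (intro sum.cong refl)
          fix i assume i: "i \<in> I"
          have "ln (p i) = t * ln (R i (of_real k)) - ln Z"
            using Rpos[OF i kb] Z1 by (simp add: p_def ln_div ln_powr)
          then have "p i * ln (p i) = p i * (t * ln (R i (of_real k)) - ln Z)" by simp
          then show "- (p i * ln (p i)) - t * - (p i * ln (R i (complex_of_real k))) = p i * ln Z"
            by (simp add: algebra_simps)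
        qed
        then show ?thesis by (simp add: sum_distrib_right[symmetric] psum)
      qed
      have H0nn: "H0 \<ge> 0" unfolding H0_def
        by (intro sum_nonneg) (use p p1 in \<open>auto simp: mult_le_0_iff ln_le_zero_iff less_imp_le\<close>)
      \<comment> \<open>Exponent 2 with the area bound is positivity of the real part of
        \<open>H\<close>; exponent 1 with the length bound, which follows, is the lower bound 1 on
        the diameter.\<close>
      have bound2: "H0 < 2 * \<Lambda> w" if "norm w \<le> \<rho>" for w
      proof -
        have wb: "w \<in> ball 0 1" using that \<rho> by simp
        have "R i w powr 2 = (R i w)\<^sup>2" if "i \<in> I" for i
          using Rpos[OF that wb] powr_realpow[of "R i w" 2] by simp
        then have "(\<Sum>i\<in>I. R i w powr 2) = (\<Sum>i\<in>I. (R i w)\<^sup>2)" by (rule sum.cong[OF refl])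
        then have "(\<Sum>i\<in>I. R i w powr 2) < 1" using pack[OF that] by (simp add: R_def)
        then show ?thesis using gibbs[OF wb, of 2] by simp
      qed
      have bound1: "H0 < \<Lambda> w" if "norm w \<le> \<rho>" "w \<in> \<real>" for w
      proof -
        have wb: "w \<in> ball 0 1" using that \<rho> by simp
        have "R i w powr 1 = R i w" if "i \<in> I" for i
          using Rpos[OF that wb] by simp
        then have "(\<Sum>i\<in>I. R i w powr 1) = (\<Sum>i\<in>I. R i w)" by (rule sum.cong[OF refl])
        then have "(\<Sum>i\<in>I. R i w powr 1) < 1" using pack[OF that(1)] sym that(2) by (simp add: R_def)
        then show ?thesis using gibbs[OF wb, of 1] by simp
      qed
      \<comment> \<open>The entropy is about to become a denominator. It vanishes for a single
        interval, but then the length bound alone contradicts Z > 1.\<close>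
      have H0pos: "H0 > 0"
      proof (rule ccontr)
        assume "\<not> H0 > 0"
        then have "H0 = 0" using H0nn by simp
        moreover have "H0 < \<Lambda> (of_real k)" using bound1[of "of_real k"] k by simp
        ultimately have "t * \<Lambda> (of_real k) > 0" using st by simp
        then show False using lnZ \<open>H0 = 0\<close> Z1 ln_gt_zero[of Z] by linarith
      qed
      \<comment> \<open>The end points of an interval never collide, so each moving length is the
        modulus of a zero-free holomorphic function and its logarithm is harmonic.\<close>
      have "\<exists>L. L holomorphic_on ball 0 1 \<and> (\<forall>w\<in>ball 0 1. f (of_real (c i + r i)) w - f (of_real (c i)) w = exp (L w))" if "i \<in> I" for i
      proof -
        have "(\<lambda>w. f (of_real (c i + r i)) w - f (of_real (c i)) w) holomorphic_on ball 0 1"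
          using f cr[OF that] unfolding holo_motion_def by (intro holomorphic_on_diff) auto
        from contractible_imp_holomorphic_log[OF this convex_imp_contractible[OF convex_ball]] ne[OF that]
        show ?thesis by (metis right_minus_eq)
      qed
      then obtain L where L: "\<And>i. i \<in> I \<Longrightarrow> L i holomorphic_on ball 0 1"
        "\<And>i w. i \<in> I \<Longrightarrow> w \<in> ball 0 1 \<Longrightarrow> f (of_real (c i + r i)) w - f (of_real (c i)) w = exp (L i w)" by metis
      define \<Lambda>c where "\<Lambda>c w = (\<Sum>i\<in>I. of_real (p i) * (of_real (ln C) - L i w))" for w
      have hol\<Lambda>: "\<Lambda>c holomorphic_on ball 0 1" unfolding \<Lambda>c_def[abs_def] by (intro holomorphic_intros L)
      have Re\<Lambda>: "Re (\<Lambda>c w) = \<Lambda> w" if w: "w \<in> ball 0 1" for w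
      proof -
        have "Re (L i w) = ln (R i w) + ln C" if "i \<in> I" for i
        proof -
          have "R i w = exp (Re (L i w)) / C" unfolding R_def L(2)[OF that w] by simp
          then show ?thesis using C(1) by (simp add: ln_div)
        qed
        then show ?thesis unfolding \<Lambda>c_def \<Lambda>_def Re_sum by (intro sum.cong) auto
      qed
      \<comment> \<open>Normalised so that H0 = s \<Lambda> corresponds to the value 2 / s - 1,
        which is (1 + l^2) / (1 - l^2) for the exponent s = 1 - l^2.\<close>
      define H where "H w = of_real (2 / H0) * \<Lambda>c (of_real \<rho> * w) - 1" for w
      have inb: "of_real \<rho> * w \<in> ball 0 1 \<and> norm (of_real \<rho> * w) \<le> \<rho>" if "w \<in> ball 0 1" for w :: complex
      proof -
        have "norm (of_real \<rho> * w) \<le> \<rho> * 1" unfolding norm_mult norm_of_real using that \<rho> by (intro mult_mono) auto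
        then show ?thesis using \<rho> by simp
      qed
      have ReH: "Re (H w) = 2 / H0 * \<Lambda> (of_real \<rho> * w) - 1" if "w \<in> ball 0 1" for w
        using Re\<Lambda>[of "of_real \<rho> * w"] inb[OF that] by (simp add: H_def)
      have "Re (H (of_real \<kappa>)) \<ge> (1 + l'\<^sup>2) / (1 - l'\<^sup>2)"
      proof (rule half_plane_two_point_bound[where l = l])
        have "(\<Lambda>c \<circ> (\<lambda>w. of_real \<rho> * w)) holomorphic_on ball 0 1"
          by (rule holomorphic_on_compose_gen[OF _ hol\<Lambda>]) (use inb in \<open>auto intro!: holomorphic_intros\<close>)
        then show "H holomorphic_on ball 0 1" unfolding H_def[abs_def] by (intro holomorphic_intros) (simp add: o_def)
        fix w :: complex assume w: "w \<in> ball 0 1"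
        show "0 < Re (H w)" unfolding ReH[OF w] using bound2[of "of_real \<rho> * w"] inb[OF w] H0pos by (simp add: field_simps)
      next
        fix x :: real assume x: "\<bar>x\<bar> < 1"
        then have xb: "complex_of_real x \<in> ball 0 1" by simp
        show "1 \<le> Re (H (of_real x))" unfolding ReH[OF xb] using bound1[of "of_real \<rho> * of_real x"] inb[OF xb] H0pos by (simp add: field_simps)
      next
        have "(\<Sum>i\<in>I. R i 0 powr s) \<le> 1" using s1 R0 by (simp add: s_def cong: sum.cong)
        then have "H0 \<le> s * \<Lambda> 0" using gibbs[of 0 s] by simp
        then have "1 / s \<le> \<Lambda> 0 / H0" using st H0pos by (simp add: field_simps)
        then have "2 / s - 1 \<le> Re (H 0)" using ReH[of 0] by simp
        moreover have "(1 + l\<^sup>2) / (1 - l\<^sup>2) = 2 / s - 1" using st by (simp add: s_def field_simps)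
        ultimately show "(1 + l\<^sup>2) / (1 - l\<^sup>2) \<le> Re (H 0)" by simp
      qed (use \<kappa> l l' \<kappa>_def in auto)
      moreover have "(1 + l'\<^sup>2) / (1 - l'\<^sup>2) = 2 / t - 1" using st by (simp add: t_def field_simps)
      moreover have "Re (H (of_real \<kappa>)) = 2 / H0 * \<Lambda> (of_real k) - 1"
      proof -
        have "complex_of_real \<rho> * of_real \<kappa> = of_real k" using \<rho> by (simp add: \<kappa>_def)
        then show ?thesis using ReH[of "of_real \<kappa>"] \<kappa> by simp
      qed
      ultimately have "1 / t \<le> \<Lambda> (of_real k) / H0" by simp
      then have "H0 \<le> t * \<Lambda> (of_real k)" using st H0pos by (simp add: field_simps)
      then show False using lnZ Z1 ln_gt_zero[of Z] by linarith
    qed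
  qed
qed

section \<open>Hausdorff measure of images\<close>

text \<open>The motion may depend on the finite set, since it arises as a Montel limit for that set;
  each later estimate involves only finitely many points at a time.\<close>

definition qs_motion :: "real \<Rightarrow> (real \<Rightarrow> real) \<Rightarrow> bool" where
  "qs_motion k \<phi> \<longleftrightarrow> (\<forall>X. finite X \<longrightarrow> 0 \<in> X \<longrightarrow> 1 \<in> X \<longrightarrow>
     (\<exists>f. holo_motion (of_real ` X) f \<and> cnj_symmetric (of_real ` X) f \<and> (\<forall>x\<in>X. f (of_real x) (of_real k) = of_real (\<phi> x))))"

lemma qs_motionD:
  assumes "qs_motion k \<phi>" "finite X"
  obtains f where "holo_motion (of_real ` (insert 0 (insert 1 X))) f" "cnj_symmetric (of_real ` (insert 0 (insert 1 X))) f"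
    "\<And>x. x \<in> insert 0 (insert 1 X) \<Longrightarrow> f (of_real x) (of_real k) = of_real (\<phi> x)"
  using assms unfolding qs_motion_def
  by (metis finite_insert insertI1 insertI2)

definition disk_inv :: "real \<Rightarrow> complex \<Rightarrow> complex" where
  "disk_inv k l = (of_real k - l) / (1 - of_real k * l)"

lemma disk_inv:
  assumes "\<bar>k\<bar> < 1"
  shows "disk_inv k holomorphic_on ball 0 1" "\<And>l. l \<in> ball 0 1 \<Longrightarrow> disk_inv k l \<in> ball 0 1"
    "disk_inv k 0 = of_real k" "disk_inv k (of_real k) = 0" "disk_inv k (cnj l) = cnj (disk_inv k l)"
proof -
  have den: "1 - of_real k * z \<noteq> 0" if "norm z < 1" for z :: complex
  proof
    assume "1 - of_real k * z = 0"
    then have "norm (of_real k * z) = 1" by simp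
    moreover have "\<bar>k\<bar> * norm z < 1 * 1" using assms(1) that by (intro mult_strict_mono') auto
    ultimately show False by (simp add: norm_mult)
  qed
  show "disk_inv k holomorphic_on ball 0 1" unfolding disk_inv_def[abs_def] using den by (intro holomorphic_intros) auto
  show "disk_inv k z \<in> ball 0 1" if "z \<in> ball 0 1" for z
  proof -
    have z: "norm z < 1" using that by simp
    have "(norm (1 - of_real k * z))\<^sup>2 - (norm (of_real k - z))\<^sup>2 = (1 - k\<^sup>2) * (1 - (norm z)\<^sup>2)"
      unfolding cmod_power2 by (simp add: power2_eq_square algebra_simps)
    moreover have "\<dots> > 0" using assms(1) z
      by (intro mult_pos_pos) (auto simp: power_less_one_iff abs_square_less_1)
    ultimately have "(norm (of_real k - z))\<^sup>2 < (norm (1 - of_real k * z))\<^sup>2" by simp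
    then have "norm (of_real k - z) < norm (1 - of_real k * z)" using power2_less_imp_less by fastforce
    then show ?thesis using den[OF z] by (simp add: disk_inv_def norm_divide divide_less_eq_1)
  qed
qed (simp_all add: disk_inv_def)

text \<open>With time run through the involution, the old position at time k becomes the starting
  point and the old starting point is reached at time k.\<close>

lemma qs_motion_inverse:
  assumes q: "qs_motion k \<phi>" and k: "\<bar>k\<bar> < 1" and bij: "bij \<phi>"
  shows "qs_motion k (inv \<phi>)"
  unfolding qs_motion_def
proof (intro allI impI)
  fix Y :: "real set" assume Y: "finite Y" "0 \<in> Y" "1 \<in> Y"
  have inv: "\<phi> (inv \<phi> y) = y" "inv \<phi> (\<phi> x) = x" for x y using bij by (simp_all add: bij_def surj_f_inv_f)
  define X where "X = insert 0 (insert 1 (inv \<phi> ` Y))"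
  obtain f where f: "holo_motion (of_real ` X) f" "cnj_symmetric (of_real ` X) f" "\<And>x. x \<in> X \<Longrightarrow> f (of_real x) (of_real k) = of_real (\<phi> x)"
    using qs_motionD[OF q, of "inv \<phi> ` Y"] Y(1) unfolding X_def by blast
  have kb: "complex_of_real k \<in> ball 0 1" using k by simp
  have phi01: "\<phi> 0 = 0" "\<phi> 1 = 1"
    using f(1) f(3)[of 0] f(3)[of 1] kb unfolding holo_motion_def by (auto simp: X_def)
  then have inv01: "inv \<phi> 0 = 0" "inv \<phi> 1 = 1" using inv(2)[of 0] inv(2)[of 1] by simp_all
  define m where "m = disk_inv k"
  note m = disk_inv[OF k, folded m_def]
  \<comment> \<open>Points of a motion are complex; \<open>Re\<close> recovers the real label to
    which the inverse map applies.\<close>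
  define g where "g y l = f (of_real (inv \<phi> (Re y))) (m l)" for y l
  have gy: "g (of_real y) l = f (of_real (inv \<phi> y)) (m l)" for y l by (simp add: g_def)
  have inX: "inv \<phi> y \<in> X" if "y \<in> Y" for y using that by (simp add: X_def)
  show "\<exists>f. holo_motion (of_real ` Y) f \<and> cnj_symmetric (of_real ` Y) f \<and> (\<forall>x\<in>Y. f (of_real x) (of_real k) = of_real (inv \<phi> x))"
  proof (intro exI[of _ g] conjI ballI)
    show "holo_motion (of_real ` Y) g"
      unfolding holo_motion_def
    proof (intro conjI ballI)
      show "0 \<in> complex_of_real ` Y" "1 \<in> complex_of_real ` Y" using Y by (force simp: image_iff)+
      fix z assume "z \<in> complex_of_real ` Y"
      then obtain y where y: "y \<in> Y" "z = of_real y" by blast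
      have "f (of_real (inv \<phi> y)) holomorphic_on ball 0 1" using f(1) inX[OF y(1)] unfolding holo_motion_def by blast
      then have "(f (of_real (inv \<phi> y)) \<circ> m) holomorphic_on ball 0 1"
        by (intro holomorphic_on_compose_gen[OF m(1)]) (use m(2) in auto)
      then show "g z holomorphic_on ball 0 1" by (simp add: y(2) gy[abs_def] o_def)
      show "g z 0 = z" using f(3)[OF inX[OF y(1)]] by (simp add: y(2) gy m inv)
    next
      fix l :: complex assume l: "l \<in> ball 0 1"
      have "\<forall>l\<in>ball 0 1. f 0 l = 0 \<and> f 1 l = 1" using f(1) unfolding holo_motion_def by blast
      then show "g 0 l = 0" "g 1 l = 1" using m(2)[OF l] gy[of 0 l] gy[of 1 l] inv01 by auto
      show "inj_on (\<lambda>x. g x l) (complex_of_real ` Y)"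
      proof (rule inj_onI)
        fix z w assume "z \<in> complex_of_real ` Y" "w \<in> complex_of_real ` Y" and e: "g z l = g w l"
        then obtain a b where ab: "a \<in> Y" "z = of_real a" "b \<in> Y" "w = of_real b" by blast
        have "inj_on (\<lambda>x. f x (m l)) (complex_of_real ` X)" using f(1) m(2)[OF l] unfolding holo_motion_def by blast
        then have "complex_of_real (inv \<phi> a) = of_real (inv \<phi> b)"
          using e inX ab by (auto simp: gy dest: inj_onD)
        then show "z = w" using inv(1) ab by (metis of_real_eq_iff)
      qed
    qed
    show "cnj_symmetric (of_real ` Y) g"
      using f(2) inX m(2) unfolding cnj_symmetric_def by (auto simp: gy m(5))
    fix y assume "y \<in> Y"
    then have "f (of_real (inv \<phi> y)) 0 = of_real (inv \<phi> y)" using f(1) inX unfolding holo_motion_def by blast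
    then show "g (of_real y) (of_real k) = of_real (inv \<phi> y)" by (simp add: gy m)
  qed
qed

section \<open>Null sets of Hausdorff measures and dimension on the line\<close>

lemma hausdorff_null_iff:
  "hausdorff_measure s A = 0 \<longleftrightarrow> (\<forall>r>0. \<forall>e>0. \<exists>U :: nat \<Rightarrow> 'a::metric_space set.
     (\<forall>i. bounded (U i) \<and> diameter (U i) \<le> r) \<and> A \<subseteq> (\<Union>i. U i) \<and> (\<Sum>i. hausdorff_gauge s (U i)) < ennreal e)"
proof -
  have "hausdorff_premeasure s r A = 0 \<longleftrightarrow> (\<forall>e>0. \<exists>U :: nat \<Rightarrow> 'a set.
     (\<forall>i. bounded (U i) \<and> diameter (U i) \<le> r) \<and> A \<subseteq> (\<Union>i. U i) \<and> (\<Sum>i. hausdorff_gauge s (U i)) < ennreal e)" (is "?L \<longleftrightarrow> ?R") for r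
  proof
    assume L: ?L
    show ?R
    proof (intro allI impI)
      fix e :: real assume "e > 0"
      then have "hausdorff_premeasure s r A < ennreal e" using L by simp
      then show "\<exists>U :: nat \<Rightarrow> 'a set. (\<forall>i. bounded (U i) \<and> diameter (U i) \<le> r) \<and> A \<subseteq> (\<Union>i. U i) \<and> (\<Sum>i. hausdorff_gauge s (U i)) < ennreal e"
        unfolding hausdorff_premeasure_def INF_less_iff by blast
    qed
  next
    assume R: ?R
    have "hausdorff_premeasure s r A \<le> 0 + ennreal e" if e: "e > 0" for e
    proof -
      obtain U :: "nat \<Rightarrow> 'a set" where U: "\<forall>i. bounded (U i) \<and> diameter (U i) \<le> r" "A \<subseteq> (\<Union>i. U i)" "(\<Sum>i. hausdorff_gauge s (U i)) < ennreal e"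
        using R[rule_format, OF e] by blast
      have "hausdorff_premeasure s r A \<le> (\<Sum>i. hausdorff_gauge s (U i))"
        unfolding hausdorff_premeasure_def by (rule INF_lower) (use U in auto)
      then show ?thesis using U(3) by simp
    qed
    then show ?L by (metis ennreal_le_epsilon le_zero_eq)
  qed
  then show ?thesis unfolding hausdorff_measure_def SUP_bot_conv(1)[where 'a = ennreal, unfolded bot_ennreal] by auto
qed

lemma hausdorff_gauge_pos: "s > 0 \<Longrightarrow> hausdorff_gauge s U = ennreal (diameter U powr s)"
  by (simp add: hausdorff_gauge_def)

lemma diameter_nonneg: "diameter U \<ge> 0" if "bounded U" for U :: "'a::metric_space set"
proof (cases "U = {}")
  case False
  then obtain x where "x \<in> U" by blast
  then show ?thesis using diameter_bounded_bound[OF that, of x x] by simp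
qed simp

text \<open>Covers by sets of diameter at most 1 are enough, and for these a larger exponent gives a
  smaller summand; for s = 0 the comparison is with the value 1 on nonempty sets.\<close>

lemma hausdorff_null_mono:
  assumes A: "hausdorff_measure s A = 0" and s: "0 \<le> s" "s \<le> t"
  shows "hausdorff_measure t A = 0"
  unfolding hausdorff_null_iff
proof (intro allI impI)
  fix r e :: real assume re: "r > 0" "e > 0"
  then have "0 < min r 1" by simp
  then obtain U where U: "\<And>i. bounded (U i) \<and> diameter (U i) \<le> min r 1" "A \<subseteq> (\<Union>i::nat. U i)" "(\<Sum>i. hausdorff_gauge s (U i)) < ennreal e"
    using A re unfolding hausdorff_null_iff by meson
  have "hausdorff_gauge t (U i) \<le> hausdorff_gauge s (U i)" for i
  proof -
    have d: "0 \<le> diameter (U i)" "diameter (U i) \<le> 1" using U(1)[of i] diameter_nonneg by auto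
    have "diameter (U i) powr t \<le> 1" using d s by (intro powr_le1) auto
    moreover have "diameter (U i) powr t \<le> diameter (U i) powr s" using d s by (intro powr_mono') auto
    ultimately show ?thesis using s by (auto simp: hausdorff_gauge_def ennreal_leI ennreal_le_1)
  qed
  then have "(\<Sum>i. hausdorff_gauge t (U i)) \<le> (\<Sum>i. hausdorff_gauge s (U i))" by (intro suminf_le summableI) auto
  then show "\<exists>U. (\<forall>i. bounded (U i) \<and> diameter (U i) \<le> r) \<and> A \<subseteq> (\<Union>i::nat. U i) \<and> (\<Sum>i. hausdorff_gauge t (U i)) < ennreal e"
    using U by (intro exI[of _ U]) (auto intro: le_less_trans)
qed

lemma hausdorff_null_subset: "hausdorff_measure s B = 0 \<Longrightarrow> A \<subseteq> B \<Longrightarrow> hausdorff_measure s A = 0"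
  unfolding hausdorff_null_iff by (meson order_trans)

text \<open>The n-th piece receives the share e / 2^(n+2), and the double family of covers is
  enumerated by pairs.\<close>

lemma hausdorff_null_UN:
  assumes A: "\<And>n::nat. hausdorff_measure s (A n) = 0"
  shows "hausdorff_measure s (\<Union>n. A n) = 0"
  unfolding hausdorff_null_iff
proof (intro allI impI)
  fix r e :: real assume re: "r > 0" "e > 0"
  have "\<exists>U. (\<forall>i. bounded (U i) \<and> diameter (U i) \<le> r) \<and> A n \<subseteq> (\<Union>i::nat. U i) \<and> (\<Sum>i. hausdorff_gauge s (U i)) < ennreal (e / 2 * (1 / 2) ^ Suc n)" for n
    using A[of n] re unfolding hausdorff_null_iff by simp
  then obtain U where U: "\<And>n i. bounded (U n i) \<and> diameter (U n i) \<le> r" "\<And>n. A n \<subseteq> (\<Union>i::nat. U n i)"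
     "\<And>n. (\<Sum>i. hausdorff_gauge s (U n i)) < ennreal (e / 2 * (1 / 2) ^ Suc n)" by metis
  define V where "V j = U (fst (prod_decode j)) (snd (prod_decode j))" for j
  have "(\<Sum>j. hausdorff_gauge s (V j)) = (\<Sum>n. \<Sum>i. hausdorff_gauge s (U n i))"
    unfolding V_def using suminf_ennreal_2dimen[of "\<lambda>n. \<Sum>i. hausdorff_gauge s (U n i)" "\<lambda>p. hausdorff_gauge s (U (fst p) (snd p))"]
    by (simp add: o_def)
  also have "\<dots> \<le> (\<Sum>n. ennreal (e / 2 * (1 / 2) ^ Suc n))" by (intro suminf_le summableI) (use U(3) less_imp_le in blast)
  also have "\<dots> = ennreal (e / 2)"
    using sums_mult[OF power_half_series, of "e / 2"] re by (intro suminf_ennreal_eq) auto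
  also have "\<dots> < ennreal e" using re by (simp add: ennreal_less_iff)
  finally have "(\<Sum>j. hausdorff_gauge s (V j)) < ennreal e" .
  moreover have "(\<Union>n. A n) \<subseteq> (\<Union>j. V j)"
  proof
    fix x assume "x \<in> (\<Union>n. A n)"
    then obtain n i where "x \<in> U n i" using U(2) by blast
    then have "x \<in> V (prod_encode (n, i))" by (simp add: V_def)
    then show "x \<in> (\<Union>j. V j)" by blast
  qed
  ultimately show "\<exists>U. (\<forall>i. bounded (U i) \<and> diameter (U i) \<le> r) \<and> (\<Union>n. A n) \<subseteq> (\<Union>i::nat. U i) \<and> (\<Sum>i. hausdorff_gauge s (U i)) < ennreal e"
    using U(1) by (intro exI[of _ V]) (auto simp: V_def)
qed

lemma hausdorff_dim_le: "0 \<le> s \<Longrightarrow> hausdorff_measure s A = 0 \<Longrightarrow> hausdorff_dim A \<le> ereal s"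
  unfolding hausdorff_dim_def by (rule INF_lower) simp

lemma hausdorff_dim_less_null:
  assumes "hausdorff_dim A < ereal s" shows "hausdorff_measure s A = 0"
proof -
  obtain t where "0 \<le> t" "hausdorff_measure t A = 0" "ereal t < ereal s"
    using assms unfolding hausdorff_dim_def INF_less_iff by auto
  then show ?thesis using hausdorff_null_mono[of t A s] by simp
qed

lemma hausdorff_dim_nonneg: "hausdorff_dim A \<ge> 0"
  unfolding hausdorff_dim_def by (rule INF_greatest) auto

text \<open>For s > 1, N intervals of length proportional to 1/N have an s-sum tending to 0. This is
  what places the dimension in the range where sqrt (1 - \<delta>) is a point of [0, 1].\<close>

lemma hausdorff_dim_real_le_1: "hausdorff_dim (A::real set) \<le> 1"
proof -
  have null: "hausdorff_measure s (UNIV::real set) = 0" if s: "s > 1" for s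
  proof -
    have "hausdorff_measure s {- real n..real n} = 0" for n
      unfolding hausdorff_null_iff
    proof (intro allI impI)
      fix r e :: real assume re: "r > 0" "e > 0"
      have "((\<lambda>N. (2 * real n + 1) powr s * real N powr (1 - s)) \<longlongrightarrow> (2 * real n + 1) powr s * 0) sequentially"
        by (intro tendsto_mult tendsto_const tendsto_neg_powr filterlim_real_sequentially) (use s in simp)
      from order_tendstoD(2)[OF this, of e] re
      have "\<forall>\<^sub>F N in sequentially. (2 * real n + 1) powr s * real N powr (1 - s) < e" by simp
      moreover have "\<forall>\<^sub>F N in sequentially. real N > (2 * real n + 1) / r"
        using filterlim_at_top_dense filterlim_real_sequentially by blast
      ultimately have "\<forall>\<^sub>F N in sequentially. (2 * real n + 1) powr s * real N powr (1 - s) < e \<and> real N > (2 * real n + 1) / r \<and> N > 0"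
        by (intro eventually_conj eventually_gt_at_top)
      then obtain N where N: "(2 * real n + 1) powr s * real N powr (1 - s) < e" "real N > (2 * real n + 1) / r" "N > 0"
        using eventually_happens trivial_limit_sequentially by blast
      \<comment> \<open>The total length 2 n is enlarged by 1 so that w > 0 also for n = 0 and the N
        intervals strictly overshoot the right end.\<close>
      define w where "w = (2 * real n + 1) / real N"
      have w: "w > 0" "w \<le> r" using N re by (auto simp: w_def field_simps)
      define U where "U i = (if i < N then {- real n + real i * w..- real n + real (Suc i) * w} else {})" for i
      have dU: "diameter (U i) = (if i < N then w else 0)" for i
        using w by (auto simp: U_def diameter_closed_interval algebra_simps)
      have "(\<Sum>i. hausdorff_gauge s (U i)) = (\<Sum>i<N. hausdorff_gauge s (U i))"
        by (rule suminf_finite) (auto simp: U_def hausdorff_gauge_def)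
      also have "\<dots> = ennreal (real N * w powr s)"
        using s w by (simp add: hausdorff_gauge_pos dU ennreal_of_nat_eq_real_of_nat ennreal_mult)
      also have "real N * w powr s = (2 * real n + 1) powr s * real N powr (1 - s)"
        using N by (simp add: w_def powr_divide powr_diff)
      finally have "(\<Sum>i. hausdorff_gauge s (U i)) < ennreal e" using N re by (simp add: ennreal_less_iff)
      moreover have "{- real n..real n} \<subseteq> (\<Union>i. U i)"
      proof
        fix x assume x: "x \<in> {- real n..real n}"
        define i where "i = nat \<lfloor>(x + real n) / w\<rfloor>"
        have q: "0 \<le> (x + real n) / w" using x w by simp
        have i: "real i \<le> (x + real n) / w" "(x + real n) / w < real i + 1"
          using q by (auto simp: i_def of_nat_nat)
        have "(x + real n) / w \<le> (2 * real n) / w" using x w by (intro divide_right_mono) auto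
        also have "\<dots> < real N" using N w by (simp add: w_def field_simps)
        finally have "i < N" using i by linarith
        moreover have "real i * w \<le> x + real n" "x + real n \<le> (real i + 1) * w"
          using i w by (simp_all add: pos_le_divide_eq pos_divide_less_eq)
        ultimately have "x \<in> U i" by (auto simp: U_def algebra_simps)
        then show "x \<in> (\<Union>i. U i)" by blast
      qed
      moreover have "bounded (U i) \<and> diameter (U i) \<le> r" for i using w re by (auto simp: dU) (auto simp: U_def)
      ultimately show "\<exists>U. (\<forall>i. bounded (U i) \<and> diameter (U i) \<le> r) \<and> {- real n..real n} \<subseteq> (\<Union>i::nat. U i) \<and> (\<Sum>i. hausdorff_gauge s (U i)) < ennreal e"
        by blast
    qed
    then have "hausdorff_measure s (\<Union>n. {- real n..real n}) = 0" by (rule hausdorff_null_UN)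
    moreover have "(\<Union>n. {- real n..real n}) = UNIV"
    proof -
      have "\<exists>n. x \<in> {- real n..real n}" for x
      proof -
        obtain n where "\<bar>x\<bar> \<le> real n" using real_arch_simple by blast
        then have "- real n \<le> x \<and> x \<le> real n" by linarith
        then show ?thesis by auto
      qed
      then show ?thesis by blast
    qed
    ultimately show ?thesis by simp
  qed
  have "hausdorff_dim A \<le> ereal s" if "s > 1" for s
    using hausdorff_dim_le[of s A] hausdorff_null_subset[OF null[OF that], of A] that by simp
  then have "hausdorff_dim A \<le> 1 + ereal e" if "e > 0" for e
    using that by (metis less_add_same_cancel1 one_ereal_def plus_ereal.simps(1))
  then show ?thesis using ereal_le_epsilon2[of "hausdorff_dim A" 1] by blast
qed

text \<open>\<open>motion_sum_bound\<close> only keeps the t-sum of the image lengths bounded; the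
  excess t' - t turns this into smallness because the image diameters are uniformly small. Vitali's
  lemma supplies the separated intervals that the bound requires.\<close>

lemma image_null:
  assumes q: "qs_motion k \<phi>" and cont: "continuous_on UNIV \<phi>"
    and k: "0 \<le> k" "k < \<rho>" "\<rho> < 1" and l: "k / \<rho> < l" "l < 1" 
    and l': "l' = (l - k / \<rho>) / (1 - k / \<rho> * l)"
    and E: "hausdorff_measure (1 - l\<^sup>2) E = 0" and t': "t' > 1 - l'\<^sup>2"
  shows "hausdorff_measure t' (\<phi> ` E) = 0"
proof -
  define s where "s = 1 - l\<^sup>2"
  define t where "t = 1 - l'\<^sup>2"
  define \<kappa> where "\<kappa> = k / \<rho>"
  have \<rho>: "0 < \<rho>" "\<rho> < 1" using k by auto
  have \<kappa>: "0 \<le> \<kappa>" "\<kappa> < l" "\<kappa> < 1" using k l by (auto simp: \<kappa>_def)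
  have l'01: "0 \<le> l'" "l' < 1"
  proof -
    have "\<kappa> * l \<le> \<kappa> * 1" using \<kappa> l by (intro mult_left_mono) auto
    then have d: "1 - \<kappa> * l > 0" using \<kappa> by linarith
    have "0 < (1 - l) * (1 + \<kappa>)" using \<kappa> l by simp
    then have "l - \<kappa> < 1 - \<kappa> * l" by (simp add: algebra_simps)
    then show "0 \<le> l'" "l' < 1" using \<kappa> d unfolding l' \<kappa>_def[symmetric] by auto
  qed
  have st: "0 < s" "0 < t" "t < t'" using \<kappa> l l'01 t' by (auto simp: s_def t_def abs_square_less_1)
  have kb: "norm (complex_of_real k) \<le> \<rho>" using k by simp
  have "hausdorff_measure t' (\<phi> ` (E \<inter> {- real m..real m})) = 0" for m
    unfolding hausdorff_null_iff
  proof (intro allI impI)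
    fix r e :: real assume re: "r > 0" "e > 0"
    have m0: "real m \<ge> 0" by simp
    obtain C where C: "C > 0"
      "\<And>X f I c r. holo_motion (of_real ` X) f \<Longrightarrow> cnj_symmetric (of_real ` X) f \<Longrightarrow> finite (I::nat set)
      \<Longrightarrow> (\<And>i. i \<in> I \<Longrightarrow> c i \<in> X \<and> c i + r i \<in> X \<and> 0 < r i \<and> \<bar>c i\<bar> \<le> real m \<and> r i \<le> 1)
      \<Longrightarrow> (\<And>i j. i \<in> I \<Longrightarrow> j \<in> I \<Longrightarrow> i \<noteq> j \<Longrightarrow> \<bar>c i - c j\<bar> > r i + r j)
      \<Longrightarrow> (\<Sum>i\<in>I. (r i / C) powr s) \<le> 1
      \<Longrightarrow> (\<Sum>i\<in>I. (norm (f (of_real (c i + r i)) (of_real k) - f (of_real (c i)) (of_real k)) / C) powr t) \<le> 1"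
      using motion_sum_bound[OF k m0 l l'] unfolding s_def[symmetric] t_def[symmetric] by blast
    \<comment> \<open>The ratio 5 pays for Vitali's fivefold enlarged balls.\<close>
    define S where "S = schottky_bound \<rho> 5"
    have S: "S \<ge> 1" unfolding S_def by (rule schottky_bound_ge_1) (use \<rho> in auto)
    define K where "K = (2 * S * C) powr t"
    have K: "K > 0" using S C(1) by (simp add: K_def)
    \<comment> \<open>Image diameters up to r' contribute the factor r'^(t' - t), which has to beat
      the constant K.\<close>
    define r' where "r' = min r ((e / (2 * K)) powr (1 / (t' - t)))"
    have r': "r' > 0" "r' \<le> r" using re K by (auto simp: r'_def)
    have r'K: "r' powr (t' - t) * K < e"
    proof -
      have "r' powr (t' - t) \<le> ((e / (2 * K)) powr (1 / (t' - t))) powr (t' - t)"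
        using r' st by (intro powr_mono2) (auto simp: r'_def)
      also have "\<dots> = e / (2 * K)" using re K st by (simp add: powr_powr)
      finally have "r' powr (t' - t) * K \<le> e / (2 * K) * K" using K by (intro mult_right_mono) auto
      also have "\<dots> = e / 2" using K by simp
      finally show ?thesis using re by simp
    qed
    \<comment> \<open>Centres lie in [-m, m] and the enlarged radii are at most 5, so all enlarged
      balls stay inside this interval.\<close>
    have "uniformly_continuous_on {- real m - 6..real m + 6} \<phi>"
      by (rule compact_uniformly_continuous[OF continuous_on_subset[OF cont]]) auto
    then obtain \<eta> where \<eta>: "\<eta> > 0" "\<And>x y. x \<in> {- real m - 6..real m + 6} \<Longrightarrow> y \<in> {- real m - 6..real m + 6} \<Longrightarrow> \<bar>x - y\<bar> < \<eta> \<Longrightarrow> \<bar>\<phi> x - \<phi> y\<bar> < r'"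
      unfolding uniformly_continuous_on_def dist_real_def using r' by metis
    define r0 where "r0 = min 1 (\<eta> / 11) / 2"
    have r0: "r0 > 0" "2 * r0 \<le> 1" "10 * (2 * r0) < \<eta>" using \<eta> by (auto simp: r0_def)
    \<comment> \<open>With the padding introduced below, the s-sum of the radii is at most 2^s (e0 +
      e0) = C^s.\<close>
    define e0 where "e0 = C powr s / 2 powr s / 2"
    have e0: "e0 > 0" using C by (simp add: e0_def)
    have "hausdorff_measure s (E \<inter> {- real m..real m}) = 0" using hausdorff_null_subset[OF E] by (auto simp: s_def)
    then obtain U where U: "\<And>i. bounded (U i) \<and> diameter (U i) \<le> r0" "E \<inter> {- real m..real m} \<subseteq> (\<Union>i::nat. U i)" "(\<Sum>i. hausdorff_gauge s (U i)) < ennreal e0"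
      unfolding hausdorff_null_iff using r0 e0 by meson
    have dU0: "diameter (U i) \<ge> 0" for i using U(1) diameter_nonneg by blast
    \<comment> \<open>A covering set may have diameter 0 while the intervals need positive length;
      this padding has s-th powers that decay geometrically.\<close>
    define \<tau> where "\<tau> i = min r0 ((e0 * (1 / 2) ^ Suc i) powr (1 / s))" for i :: nat
    have \<tau>: "0 < \<tau> i" "\<tau> i \<le> r0" "\<tau> i powr s \<le> e0 * (1 / 2) ^ Suc i" for i
    proof -
      show "0 < \<tau> i" "\<tau> i \<le> r0" using r0 e0 by (auto simp: \<tau>_def)
      then have "\<tau> i powr s \<le> ((e0 * (1 / 2) ^ Suc i) powr (1 / s)) powr s" using st by (intro powr_mono2) (auto simp: \<tau>_def)
      also have "\<dots> = e0 * (1 / 2) ^ Suc i" using e0 st by (simp add: powr_powr)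
      finally show "\<tau> i powr s \<le> e0 * (1 / 2) ^ Suc i" .
    qed
    define R where "R i = diameter (U i) + \<tau> i" for i
    have R: "0 < R i" "R i \<le> 2 * r0" for i using U(1)[of i] \<tau>[of i] dU0[of i] by (auto simp: R_def add_nonneg_pos)
    have Rs: "R i powr s \<le> 2 powr s * (diameter (U i) powr s + e0 * (1 / 2) ^ Suc i)" for i
    proof -
      have "R i powr s \<le> (2 * max (diameter (U i)) (\<tau> i)) powr s"
        using R[of i] st by (intro powr_mono2) (auto simp: R_def)
      also have "\<dots> = 2 powr s * max (diameter (U i)) (\<tau> i) powr s" using \<tau>[of i] by (simp add: powr_mult)
      also have "max (diameter (U i)) (\<tau> i) powr s \<le> diameter (U i) powr s + \<tau> i powr s"
        by (cases "diameter (U i) \<le> \<tau> i") auto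
      also have "\<dots> \<le> diameter (U i) powr s + e0 * (1 / 2) ^ Suc i" using \<tau>(3) by simp
      finally show ?thesis by simp
    qed
    have Rsum: "(\<Sum>i\<in>F. (R i / C) powr s) \<le> 1" if F: "finite F" for F
    proof -
      have "ennreal (\<Sum>i\<in>F. diameter (U i) powr s) = (\<Sum>i\<in>F. hausdorff_gauge s (U i))"
        using st by (simp add: hausdorff_gauge_pos sum_ennreal)
      also have "\<dots> \<le> (\<Sum>i. hausdorff_gauge s (U i))" using F by (intro sum_le_suminf summableI) auto
      also have "\<dots> < ennreal e0" by (rule U)
      finally have 1: "(\<Sum>i\<in>F. diameter (U i) powr s) < e0" using e0 by (simp add: ennreal_less_iff sum_nonneg)
      have "(\<Sum>i\<in>F. (1 / 2) ^ Suc i) \<le> (\<Sum>i. (1 / 2 :: real) ^ Suc i)"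
        using F power_half_series by (intro sum_le_suminf) (auto simp: sums_iff)
      then have "(\<Sum>i\<in>F. (1 / 2 :: real) ^ Suc i) \<le> 1" using power_half_series by (simp add: sums_iff)
      then have 2: "(\<Sum>i\<in>F. e0 * (1 / 2) ^ Suc i) \<le> e0" unfolding sum_distrib_left[symmetric] using e0 by (simp add: mult_left_le)
      have "(\<Sum>i\<in>F. R i powr s) \<le> (\<Sum>i\<in>F. 2 powr s * (diameter (U i) powr s + e0 * (1 / 2) ^ Suc i))" by (intro sum_mono Rs)
      also have "\<dots> = 2 powr s * (\<Sum>i\<in>F. diameter (U i) powr s + e0 * (1 / 2) ^ Suc i)" by (simp only: sum_distrib_left)
      also have "(\<Sum>i\<in>F. diameter (U i) powr s + e0 * (1 / 2) ^ Suc i) = (\<Sum>i\<in>F. diameter (U i) powr s) + (\<Sum>i\<in>F. e0 * (1 / 2) ^ Suc i)"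
        by (rule sum.distrib)
      also have "2 powr s * \<dots> \<le> 2 powr s * (e0 + e0)" by (intro mult_left_mono add_mono less_imp_le[OF 1] 2) simp
      also have "\<dots> = C powr s" by (simp add: e0_def)
      finally have "(\<Sum>i\<in>F. R i powr s) / C powr s \<le> 1" using C(1) by simp
      moreover have "(\<Sum>i\<in>F. (R i / C) powr s) = (\<Sum>i\<in>F. R i powr s) / C powr s"
        unfolding sum_divide_distrib using R C(1) by (intro sum.cong) (auto simp: powr_divide less_imp_le)
      ultimately show ?thesis by simp
    qed
    define J where "J = {i. U i \<inter> (E \<inter> {- real m..real m}) \<noteq> {}}"
    then have "\<forall>i\<in>J. \<exists>a. a \<in> U i \<inter> (E \<inter> {- real m..real m})" by blast
    then obtain a where a: "\<And>i. i \<in> J \<Longrightarrow> a i \<in> U i" "\<And>i. i \<in> J \<Longrightarrow> a i \<in> E \<inter> {- real m..real m}" by (metis IntD1 IntD2)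
    have "E \<inter> {- real m..real m} \<subseteq> (\<Union>i\<in>J. cball (a i) (R i))"
    proof
      fix x assume x: "x \<in> E \<inter> {- real m..real m}"
      then obtain i where i: "x \<in> U i" using U(2) by blast
      then have iJ: "i \<in> J" using x by (auto simp: J_def)
      have "dist (a i) x \<le> diameter (U i)" using diameter_bounded_bound[of "U i"] U(1) a(1)[OF iJ] i by blast
      then have "x \<in> cball (a i) (R i)" using \<tau>(1)[of i] by (simp add: R_def)
      then show "x \<in> (\<Union>i\<in>J. cball (a i) (R i))" using iJ by blast
    qed
    then obtain D where D: "D \<subseteq> J" "pairwise (\<lambda>i j. disjnt (cball (a i) (R i)) (cball (a j) (R j))) D"
       "E \<inter> {- real m..real m} \<subseteq> (\<Union>i\<in>D. cball (a i) (5 * R i))"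
      by (rule Vitali_covering_lemma_cballs[where B = "2 * r0"]) (use R in auto)
    define V where "V i = (if i \<in> D then \<phi> ` cball (a i) (5 * R i) else {})" for i
    have am: "\<bar>a i\<bar> \<le> real m" if "i \<in> D" for i
    proof -
      have "- real m \<le> a i \<and> a i \<le> real m" using a(2) D(1) that by auto
      then show ?thesis by linarith
    qed
    have sub: "cball (a i) (5 * R i) \<subseteq> {- real m - 6..real m + 6}" if "i \<in> D" for i
      using am[OF that] R[of i] r0 by (auto simp: dist_real_def abs_le_iff)
    have bV: "bounded (V i)" for i
      using compact_imp_bounded[OF compact_continuous_image[OF continuous_on_subset[OF cont] compact_cball]] by (auto simp: V_def)
    have dV1: "diameter (V i) \<le> r'" for i
    proof (cases "i \<in> D")
      case True
      have "dist x y \<le> r'" if xy: "x \<in> V i" "y \<in> V i" for x y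
      proof -
        obtain u v where uv: "u \<in> cball (a i) (5 * R i)" "v \<in> cball (a i) (5 * R i)" "x = \<phi> u" "y = \<phi> v"
          using xy True unfolding V_def by auto
        have "\<bar>u - v\<bar> \<le> 10 * R i" using uv(1,2) by (auto simp: dist_real_def)
        then have "\<bar>u - v\<bar> < \<eta>" using R[of i] r0 by linarith
        moreover have "u \<in> {- real m - 6..real m + 6}" "v \<in> {- real m - 6..real m + 6}" using sub[OF True] uv(1,2) by blast+
        ultimately have "\<bar>\<phi> u - \<phi> v\<bar> < r'" by (intro \<eta>(2))
        then show ?thesis using uv by (simp add: dist_real_def)
      qed
      then show ?thesis using r' by (intro diameter_le) (auto simp: dist_norm)
    qed (use r' in \<open>auto simp: V_def\<close>)
    define W where "W i = \<bar>\<phi> (a i + R i) - \<phi> (a i)\<bar>" for i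
    have dV2: "diameter (V i) \<le> 2 * S * W i" if iD: "i \<in> D" for i
    proof -
      \<comment> \<open>Here a motion of three points, besides 0 and 1, is enough: it compares any
        point of the enlarged ball with the interval from \<open>a i\<close> to
        \<open>a i + R i\<close>.\<close>
      have *: "\<bar>\<phi> u - \<phi> (a i)\<bar> \<le> S * W i" if u: "u \<in> cball (a i) (5 * R i)" for u
      proof -
        obtain f where f: "holo_motion (of_real ` (insert 0 (insert 1 {u, a i, a i + R i}))) f"
          "\<And>x. x \<in> insert 0 (insert 1 {u, a i, a i + R i}) \<Longrightarrow> f (of_real x) (of_real k) = of_real (\<phi> x)"
          using qs_motionD[OF q, of "{u, a i, a i + R i}"] by blast
        have "norm (f (of_real u) (of_real k) - f (of_real (a i)) (of_real k)) \<le> S * norm (f (of_real (a i + R i)) (of_real k) - f (of_real (a i)) (of_real k))"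
          unfolding S_def
        proof (rule motion_ratio_bound[OF f(1) _ _ _ _ _ \<rho> kb])
          have "\<bar>u - a i\<bar> \<le> 5 * \<bar>R i\<bar>" using u R[of i] by (simp add: dist_real_def abs_minus_commute)
          then show "norm (complex_of_real u - of_real (a i)) \<le> 5 * norm (complex_of_real (a i + R i) - of_real (a i))"
            by (simp add: norm_of_real flip: of_real_diff)
        qed (use R[of i] in auto)
        then show ?thesis using f(2)[of u] f(2)[of "a i"] f(2)[of "a i + R i"] by (simp add: W_def norm_of_real flip: of_real_diff)
      qed
      have "dist x y \<le> 2 * S * W i" if xy: "x \<in> V i" "y \<in> V i" for x y
      proof -
        obtain u v where uv: "u \<in> cball (a i) (5 * R i)" "v \<in> cball (a i) (5 * R i)" "x = \<phi> u" "y = \<phi> v"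
          using xy iD unfolding V_def by auto
        then show ?thesis using *[OF uv(1)] *[OF uv(2)] by (simp add: dist_real_def)
      qed
      then show ?thesis using S by (intro diameter_le) (auto simp: dist_norm W_def)
    qed
    have Wsum: "(\<Sum>i\<in>F. (W i / C) powr t) \<le> 1" if F: "finite F" "F \<subseteq> D" for F
    proof -
      define X where "X = insert 0 (insert 1 (a ` F \<union> (\<lambda>i. a i + R i) ` F))"
      obtain f where f: "holo_motion (of_real ` X) f" "cnj_symmetric (of_real ` X) f"
          "\<And>x. x \<in> X \<Longrightarrow> f (of_real x) (of_real k) = of_real (\<phi> x)"
        using qs_motionD[OF q, of "a ` F \<union> (\<lambda>i. a i + R i) ` F"] F unfolding X_def by auto
      have "(\<Sum>i\<in>F. (norm (f (of_real (a i + R i)) (of_real k) - f (of_real (a i)) (of_real k)) / C) powr t) \<le> 1"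
      proof (rule C(2)[OF f(1,2) F(1)])
        fix i assume i: "i \<in> F"
        then have "R i \<le> 1" using R[of i] r0 by linarith
        then show "a i \<in> X \<and> a i + R i \<in> X \<and> 0 < R i \<and> \<bar>a i\<bar> \<le> real m \<and> R i \<le> 1"
          using i am[of i] F R[of i] by (auto simp: X_def)
        fix j assume j: "j \<in> F" "i \<noteq> j"
        show "R i + R j < \<bar>a i - a j\<bar>"
        proof (rule ccontr)
          assume n: "\<not> ?thesis"
          have dj: "disjnt (cball (a i) (R i)) (cball (a j) (R j))" using D(2) i j F unfolding pairwise_def by blast
          \<comment> \<open>Disjointness of closed balls gives strict separation of the centres:
            otherwise the point dividing the segment in the ratio of the radii would lie in
            both.\<close>
          define x where "x = (R j * a i + R i * a j) / (R i + R j)"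
          have RR: "R i + R j > 0" using R[of i] R[of j] by linarith
          define u where "u = (a i - a j) / (R i + R j)"
          have "a i - x = R i * u" "a j - x = R j * (- u)"
            using RR by (simp_all add: x_def u_def field_simps)
          then have "\<bar>a i - x\<bar> = R i * \<bar>u\<bar>" "\<bar>a j - x\<bar> = R j * \<bar>u\<bar>"
            using R(1)[of i] R(1)[of j] by (simp_all add: abs_mult)
          moreover have "\<bar>u\<bar> \<le> 1" using n RR by (simp add: u_def abs_divide)
          ultimately have "\<bar>a i - x\<bar> \<le> R i" "\<bar>a j - x\<bar> \<le> R j" using R(1)[of i] R(1)[of j] by (simp_all add: mult_left_le)
          then show False using dj by (auto simp: disjnt_def dist_real_def)
        qed
      qed (use Rsum[OF F(1)] in auto)
      moreover have "norm (f (of_real (a i + R i)) (of_real k) - f (of_real (a i)) (of_real k)) = W i" if "i \<in> F" for i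
        using f(3)[of "a i"] f(3)[of "a i + R i"] that by (simp add: X_def W_def norm_of_real flip: of_real_diff)
      ultimately show ?thesis by simp
    qed
    have "(\<Sum>i. hausdorff_gauge t' (V i)) \<le> ennreal (r' powr (t' - t) * K)"
    proof (rule suminf_le_const[OF summableI])
      fix n
      let ?F = "{..<n} \<inter> D"
      have t'0: "t' > 0" using st by linarith
      have "(\<Sum>i<n. hausdorff_gauge t' (V i)) = (\<Sum>i\<in>?F. hausdorff_gauge t' (V i))"
        by (rule sum.mono_neutral_right) (auto simp: V_def hausdorff_gauge_def)
      also have "\<dots> = ennreal (\<Sum>i\<in>?F. diameter (V i) powr t')"
        using t'0 by (simp add: hausdorff_gauge_pos sum_ennreal)
      also have "\<dots> \<le> ennreal (r' powr (t' - t) * K)"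
      proof (rule ennreal_leI)
        have "(\<Sum>i\<in>?F. diameter (V i) powr t') \<le> (\<Sum>i\<in>?F. r' powr (t' - t) * (K * (W i / C) powr t))"
        proof (rule sum_mono)
          fix i assume i: "i \<in> ?F"
          have d0: "0 \<le> diameter (V i)" using diameter_nonneg[OF bV] .
          have "diameter (V i) powr t' = diameter (V i) powr (t' - t) * diameter (V i) powr t"
            by (simp add: powr_add[symmetric])
          also have "\<dots> \<le> r' powr (t' - t) * (2 * S * W i) powr t"
            using d0 dV1[of i] dV2[of i] i st by (intro mult_mono powr_mono2) auto
          also have "2 * S * W i = (2 * S * C) * (W i / C)" using C(1) by simp
          also have "((2 * S * C) * (W i / C)) powr t = K * (W i / C) powr t"
            unfolding K_def by (rule powr_mult)
          finally show "diameter (V i) powr t' \<le> r' powr (t' - t) * (K * (W i / C) powr t)" .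
        qed
        also have "\<dots> = r' powr (t' - t) * K * (\<Sum>i\<in>?F. (W i / C) powr t)" by (simp add: sum_distrib_left mult.assoc)
        also have "\<dots> \<le> r' powr (t' - t) * K * 1" using Wsum[of ?F] K by (intro mult_left_mono) auto
        finally show "(\<Sum>i\<in>?F. diameter (V i) powr t') \<le> r' powr (t' - t) * K" by simp
      qed
      finally show "(\<Sum>i<n. hausdorff_gauge t' (V i)) \<le> ennreal (r' powr (t' - t) * K)" .
    qed
    also have "\<dots> < ennreal e" using r'K K re by (simp add: ennreal_less_iff)
    finally have "(\<Sum>i. hausdorff_gauge t' (V i)) < ennreal e" .
    moreover have "\<phi> ` (E \<inter> {- real m..real m}) \<subseteq> (\<Union>i. V i)" using D(3) by (fastforce simp: V_def)
    moreover have "diameter (V i) \<le> r" for i using dV1[of i] r' by linarith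
    ultimately show "\<exists>U. (\<forall>i. bounded (U i) \<and> diameter (U i) \<le> r) \<and> \<phi> ` (E \<inter> {- real m..real m}) \<subseteq> (\<Union>i::nat. U i) \<and> (\<Sum>i. hausdorff_gauge t' (U i)) < ennreal e"
      using bV by (intro exI[of _ V]) auto
  qed
  then have "hausdorff_measure t' (\<Union>m. \<phi> ` (E \<inter> {- real m..real m})) = 0" by (rule hausdorff_null_UN)
  moreover have "\<phi> ` E \<subseteq> (\<Union>m. \<phi> ` (E \<inter> {- real m..real m}))"
  proof
    fix y assume "y \<in> \<phi> ` E"
    then obtain x where x: "x \<in> E" "y = \<phi> x" by blast
    obtain m where "\<bar>x\<bar> \<le> real m" using real_arch_simple by blast
    then have "x \<in> E \<inter> {- real m..real m}" using x by (auto simp: abs_le_iff)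
    then show "y \<in> (\<Union>m. \<phi> ` (E \<inter> {- real m..real m}))" using x by blast
  qed
  ultimately show ?thesis by (rule hausdorff_null_subset)
qed

section \<open>A bump function and Weyl's lemma\<close>

text \<open>The powers in the denominator make the family closed under differentiation, so
  smoothness of exp (-1/t) is obtained for all orders at once.\<close>

definition bump_aux :: "nat \<Rightarrow> real \<Rightarrow> real" where
  "bump_aux m t = (if t > 0 then exp (- (1 / t)) / t ^ m else 0)"

lemma bump_aux_tendsto_0: "(bump_aux m \<longlongrightarrow> 0) (at 0)"
proof -
  have "((\<lambda>x::real. x ^ m / exp x) \<longlongrightarrow> 0) at_top" by (rule tendsto_power_div_exp_0)
  then have "((\<lambda>t::real. inverse t ^ m / exp (inverse t)) \<longlongrightarrow> 0) (at_right 0)"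
    by (rule filterlim_compose[OF _ filterlim_inverse_at_top_right])
  then have R: "(bump_aux m \<longlongrightarrow> 0) (at_right 0)"
    by (rule Lim_transform_eventually)
      (auto simp: bump_aux_def eventually_at_filter exp_minus field_simps intro!: always_eventually)
  have L: "(bump_aux m \<longlongrightarrow> 0) (at_left 0)"
    by (rule tendsto_eventually) (auto simp: bump_aux_def eventually_at_filter)
  show ?thesis using filterlim_split_at_real[OF L R] by simp
qed

lemma bump_aux_deriv: "(bump_aux m has_real_derivative bump_aux (m + 2) t - real m * bump_aux (m + 1) t) (at t)"
proof -
  consider "t > 0" | "t < 0" | "t = 0" by linarith
  then show ?thesis
  proof cases
    case 1
    have "((\<lambda>t. exp (- (1 / t)) / t ^ m) has_real_derivative (exp (- (1 / t)) * (1 / t\<^sup>2) * t ^ m - exp (- (1 / t)) * (real m * t ^ (m - 1))) / (t ^ m * t ^ m)) (at t)"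
      using 1 by (auto intro!: derivative_eq_intros simp: power2_eq_square)
    moreover have "(exp (- (1 / t)) * (1 / t\<^sup>2) * t ^ m - exp (- (1 / t)) * (real m * t ^ (m - 1))) / (t ^ m * t ^ m) = bump_aux (m + 2) t - real m * bump_aux (m + 1) t"
    proof (cases m)
      case 0
      then show ?thesis using 1 by (simp add: bump_aux_def power2_eq_square)
    next
      case (Suc k)
      then show ?thesis using 1 by (simp add: bump_aux_def divide_simps power2_eq_square) (simp add: algebra_simps)
    qed
    ultimately have "((\<lambda>t. exp (- (1 / t)) / t ^ m) has_real_derivative bump_aux (m + 2) t - real m * bump_aux (m + 1) t) (at t)" by simp
    then show ?thesis
      by (rule has_field_derivative_transform_within_open[of _ _ _ "{0<..}"]) (use 1 in \<open>auto simp: bump_aux_def\<close>)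
  next
    case 2
    have "((\<lambda>t. 0) has_real_derivative 0) (at t)" by simp
    then have "(bump_aux m has_real_derivative 0) (at t)"
      by (rule has_field_derivative_transform_within_open[of _ _ _ "{..<0}"]) (use 2 in \<open>auto simp: bump_aux_def\<close>)
    then show ?thesis using 2 by (simp add: bump_aux_def)
  next
    case 3
    \<comment> \<open>At 0 the difference quotient is \<open>bump_aux (m + 1)\<close>, which tends
      to 0.\<close>
    have "((\<lambda>h. (bump_aux m h - bump_aux m 0) / (h - 0)) \<longlongrightarrow> 0) (at 0)"
      by (rule Lim_transform_eventually[OF bump_aux_tendsto_0[of "m + 1"]])
        (auto simp: bump_aux_def eventually_at_filter)
    then show ?thesis using 3 by (simp add: has_field_derivative_iff bump_aux_def)
  qed
qed

definition bump :: "complex \<Rightarrow> real" where "bump z = bump_aux 0 (1 - (norm z)\<^sup>2)"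
definition bump_x :: "complex \<Rightarrow> real" where "bump_x z = bump_aux 2 (1 - (norm z)\<^sup>2) * (- 2 * Re z)"
definition bump_y :: "complex \<Rightarrow> real" where "bump_y z = bump_aux 2 (1 - (norm z)\<^sup>2) * (- 2 * Im z)"

lemma bump_aux_compose_partials:
  "((\<lambda>z. bump_aux m (1 - (norm z)\<^sup>2)) has_derivative
     (\<lambda>h. Re h * ((bump_aux (m + 2) (1 - (norm z)\<^sup>2) - real m * bump_aux (m + 1) (1 - (norm z)\<^sup>2)) * (- 2 * Re z))
        + Im h * ((bump_aux (m + 2) (1 - (norm z)\<^sup>2) - real m * bump_aux (m + 1) (1 - (norm z)\<^sup>2)) * (- 2 * Im z)))) (at (z::complex))"
proof -
  have "((\<lambda>z::complex. 1 - (norm z)\<^sup>2) has_derivative (\<lambda>h. Re h * (- 2 * Re z) + Im h * (- 2 * Im z))) (at z)"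
    unfolding cmod_power2 by (auto intro!: derivative_eq_intros simp: algebra_simps)
  from has_derivative_compose[OF this bump_aux_deriv[unfolded has_field_derivative_def]]
  show ?thesis by (rule has_derivative_eq_rhs) (auto simp: algebra_simps)
qed

lemma Cd_bump_aux: "Cd n (\<lambda>z. of_real (bump_aux m (1 - (norm z)\<^sup>2)))"
proof (induction n arbitrary: m)
  case 0
  have "continuous_on UNIV (\<lambda>z::complex. bump_aux m (1 - (norm z)\<^sup>2))"
    using bump_aux_compose_partials by (meson continuous_at_imp_continuous_on has_derivative_continuous)
  then show ?case by (simp add: continuous_on_of_real)
next
  case (Suc n)
  let ?b = "\<lambda>m z. complex_of_real (bump_aux m (1 - (norm z)\<^sup>2))"
  have P: "has_partials (?b m) (\<lambda>z. (?b (m + 2) z - of_nat m * ?b (m + 1) z) * (- 2 * of_real (Re z)))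
      (\<lambda>z. (?b (m + 2) z - of_nat m * ?b (m + 1) z) * (- 2 * of_real (Im z)))"
    unfolding has_partials_def
    by (intro allI has_derivative_eq_rhs[OF has_derivative_of_real[OF bump_aux_compose_partials]]) simp
  have c: "Cd n (\<lambda>z. of_real (Re z))" "Cd n (\<lambda>z. of_real (Im z))" using Cd_Re[OF Cd_id] Cd_Im[OF Cd_id] by auto
  have "Cd n (\<lambda>z. (?b (m + 2) z - of_nat m * ?b (m + 1) z) * (- 2 * of_real (Re z)))"
    "Cd n (\<lambda>z. (?b (m + 2) z - of_nat m * ?b (m + 1) z) * (- 2 * of_real (Im z)))"
    by (intro Cd_mult Cd_diff Cd_const c Suc.IH)+
  then show ?case using P unfolding Cd.simps by blast
qed

lemma bump_derivative: "(bump has_derivative (\<lambda>h. Re h * bump_x z + Im h * bump_y z)) (at z)"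
  unfolding bump_def[abs_def] bump_x_def bump_y_def using bump_aux_compose_partials[of 0 z] by (simp add: numeral_2_eq_2)

lemma Cd_bump: "Cd n (\<lambda>z. of_real (bump z))"
  unfolding bump_def by (rule Cd_bump_aux)

lemma C_diff_bump: "C_diff n bump"
  using Cd_imp_C_diff[OF Cd_bump[of n]] by simp

lemma bump_nonneg: "bump z \<ge> 0" by (simp add: bump_def bump_aux_def)

lemma bump_pos: "norm z < 1 \<Longrightarrow> bump z > 0"
  by (simp add: bump_def bump_aux_def power_less_one_iff abs_square_less_1)

lemma bump_outside:
  assumes "norm z \<ge> 1"
  shows "bump z = 0" "bump_x z = 0" "bump_y z = 0"
proof -
  have "1 \<le> (norm z)\<^sup>2" using assms by (simp add: one_le_power)
  then show "bump z = 0" "bump_x z = 0" "bump_y z = 0" by (auto simp: bump_def bump_x_def bump_y_def bump_aux_def)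
qed

lemma bump_continuous: "continuous_on S bump" "continuous_on S bump_x" "continuous_on S bump_y"
proof -
  have c: "continuous_on UNIV (\<lambda>z::complex. bump_aux m (1 - (norm z)\<^sup>2))" for m
    using bump_aux_compose_partials by (meson continuous_at_imp_continuous_on has_derivative_continuous)
  have s: "continuous_on S f" if "continuous_on UNIV f" for f :: "complex \<Rightarrow> real" using continuous_on_subset[OF that] by simp
  show "continuous_on S bump" "continuous_on S bump_x" "continuous_on S bump_y"
    unfolding bump_def[abs_def] bump_x_def[abs_def] bump_y_def[abs_def]
    by (rule s, intro continuous_intros c)+
qed

text \<open>Bridges Lebesgue integrals over the plane and gauge integrals over a box, for which
  differentiation under the integral sign was established.\<close>

lemma integral_compact_support:
  fixes g :: "complex \<Rightarrow> 'b::euclidean_space"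
  assumes c: "continuous_on UNIV g" and z: "\<And>x. x \<notin> cbox a b \<Longrightarrow> g x = 0"
  shows "integrable lborel g" "integral\<^sup>L lborel g = integral (cbox a b) g"
proof -
  have i: "set_integrable lborel (cbox a b) g"
    by (rule borel_integrable_compact[unfolded set_integrable_def[symmetric], OF compact_cbox])
      (rule continuous_on_subset[OF c], simp)
  have e: "(\<lambda>x. indicator (cbox a b) x *\<^sub>R g x) = g" using z by (auto simp: indicator_def)
  show "integrable lborel g" using i unfolding set_integrable_def e .
  have "set_lebesgue_integral lborel (cbox a b) g = integral (cbox a b) g"
    by (rule set_borel_integral_eq_integral(2)[OF i])
  then show "integral\<^sup>L lborel g = integral (cbox a b) g" unfolding set_lebesgue_integral_def e .
qed

lemma lborel_integral_shift_complex:
  fixes g :: "complex \<Rightarrow> 'b::euclidean_space"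
  assumes "g \<in> borel_measurable borel"
  shows "integral\<^sup>L lborel (\<lambda>t. g (t - w)) = integral\<^sup>L lborel g"
proof -
  have "distr lborel borel (\<lambda>x. - w + x) = lborel" by (rule lborel_distr_plus)
  then have "integral\<^sup>L lborel g = integral\<^sup>L (distr lborel borel (\<lambda>x. - w + x)) g" by (simp only:)
  also have "\<dots> = integral\<^sup>L lborel (\<lambda>x. g (- w + x))"
    by (rule integral_distr) (use assms in auto)
  finally show ?thesis by simp
qed

text \<open>Mollification by a small bump is differentiated through the bump, and the hypothesis
  says that the zbar-derivative of the result vanishes. These holomorphic mollifications, divided by
  the mass of the bump, converge locally uniformly to F. Testing against translates and dilates of
  one bump is therefore enough.\<close>

lemma weyl_lemma:
  assumes F: "continuous_on UNIV F" and \<Omega>: "open \<Omega>"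
    and weak: "\<And>w e. e > 0 \<Longrightarrow> cball w e \<subseteq> \<Omega> \<Longrightarrow>
      integral\<^sup>L lborel (\<lambda>t. F t * (of_real (bump_x ((t - w) / of_real e)) + \<i> * of_real (bump_y ((t - w) / of_real e)))) = 0"
  shows "F holomorphic_on \<Omega>"
proof -
  have "F holomorphic_on ball w0 r" if w0: "w0 \<in> \<Omega>" "r > 0" "cball w0 (2 * r) \<subseteq> \<Omega>" for w0 r
  proof -
    \<comment> \<open>One box containing the supports of all bumps centred in
      \<open>ball w0 r\<close> with scale below r, so that the domain of integration does not move
      with w.\<close>
    define Qa where "Qa = w0 - of_real (2 * r) * (1 + \<i>)"
    define Qb where "Qb = w0 + of_real (2 * r) * (1 + \<i>)"
    have Q: "cball w0 (2 * r) \<subseteq> cbox Qa Qb"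
    proof
      fix x assume "x \<in> cball w0 (2 * r)"
      then have "norm (x - w0) \<le> 2 * r" by (simp add: dist_norm norm_minus_commute)
      then have "\<bar>Re (x - w0)\<bar> \<le> 2 * r" "\<bar>Im (x - w0)\<bar> \<le> 2 * r" using abs_Re_le_cmod abs_Im_le_cmod order_trans by blast+
      then show "x \<in> cbox Qa Qb" by (auto simp: Qa_def Qb_def in_cbox_complex_iff)
    qed
    have supp: "bump ((t - w) / of_real e) = 0" "bump_x ((t - w) / of_real e) = 0" "bump_y ((t - w) / of_real e) = 0"
      if "t \<notin> cbox Qa Qb" "w \<in> ball w0 r" "0 < e" "e < r" for t w e
    proof -
      have "norm ((t - w) / of_real e) \<ge> 1"
      proof (rule ccontr)
        assume "\<not> ?thesis"
        then have "norm (t - w) < e" using that by (simp add: norm_divide)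
        then have "dist w0 t \<le> 2 * r" using that(2,4) dist_triangle[of w0 t w] by (simp add: dist_norm norm_minus_commute)
        then show False using Q that(1) by auto
      qed
      then show "bump ((t - w) / of_real e) = 0" "bump_x ((t - w) / of_real e) = 0" "bump_y ((t - w) / of_real e) = 0"
        using bump_outside by auto
    qed
    define Fe where "Fe e w = integral (cbox Qa Qb) (\<lambda>t. F t * of_real (bump ((t - w) / of_real e)))" for e :: real and w
    have bc: "continuous_on S (\<lambda>x. h ((f x - g x) / of_real e))" if "continuous_on UNIV h" "continuous_on S f" "continuous_on S g" "e > 0"
      for h :: "complex \<Rightarrow> real" and f g :: "'c::topological_space \<Rightarrow> complex" and e :: real and S
      by (rule continuous_on_compose2[OF that(1)]) (use that in \<open>auto intro!: continuous_intros\<close>)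
    note bb = bc[OF bump_continuous(1)] bc[OF bump_continuous(2)] bc[OF bump_continuous(3)]
    have Fs: "continuous_on S (\<lambda>x. F (f x))" if "continuous_on S f" for f :: "'c::topological_space \<Rightarrow> complex" and S
      by (rule continuous_on_compose2[OF F that]) auto
    have holFe: "Fe e holomorphic_on ball w0 r" if e: "0 < e" "e < r" for e
    proof -
      define Gx where "Gx w t = F t * of_real (bump_x ((t - w) / of_real e) * (- (1 / e)))" for w t
      define Gy where "Gy w t = F t * of_real (bump_y ((t - w) / of_real e) * (- (1 / e)))" for w t
      have P: "has_partials (Fe e) (\<lambda>w. integral (cbox Qa Qb) (Gx w)) (\<lambda>w. integral (cbox Qa Qb) (Gy w))"
        unfolding Fe_def[abs_def]
      proof (rule leibniz_partials)
        fix t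
        show "has_partials (\<lambda>w. F t * of_real (bump ((t - w) / of_real e))) (\<lambda>w. Gx w t) (\<lambda>w. Gy w t)"
          unfolding has_partials_def
        proof
          fix w
          have "((\<lambda>w. (t - w) / of_real e) has_derivative (\<lambda>h. - h / of_real e)) (at w)"
            using e by (auto intro!: derivative_eq_intros)
          from has_derivative_compose[OF this bump_derivative]
          have "((\<lambda>w. bump ((t - w) / of_real e)) has_derivative
              (\<lambda>h. Re h * (bump_x ((t - w) / of_real e) * (- (1 / e))) + Im h * (bump_y ((t - w) / of_real e) * (- (1 / e))))) (at w)"
            by (rule has_derivative_eq_rhs) (use e in auto)
          from has_derivative_mult_right[OF has_derivative_of_real[OF this], of "F t"]
          show "((\<lambda>w. F t * of_real (bump ((t - w) / of_real e))) has_derivative (\<lambda>h. of_real (Re h) * Gx w t + of_real (Im h) * Gy w t)) (at w)"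
            by (rule has_derivative_eq_rhs) (simp add: Gx_def Gy_def algebra_simps)
        qed
      next
        show "(\<lambda>t. F t * of_real (bump ((t - w) / of_real e))) integrable_on cbox Qa Qb" for w
          by (intro integrable_continuous continuous_on_mult continuous_on_of_real bb Fs continuous_on_id continuous_on_const e)
        show "continuous_on (UNIV \<times> cbox Qa Qb) (\<lambda>(w, t). Gx w t)" "continuous_on (UNIV \<times> cbox Qa Qb) (\<lambda>(w, t). Gy w t)"
          unfolding Gx_def Gy_def case_prod_unfold
          by (intro continuous_on_mult continuous_on_of_real bb Fs continuous_on_fst continuous_on_snd continuous_on_id continuous_on_const e)+
      qed
      have cr: "integral (cbox Qa Qb) (Gx w) + \<i> * integral (cbox Qa Qb) (Gy w) = 0" if w: "w \<in> ball w0 r" for w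
      proof -
        have cw: "cball w e \<subseteq> \<Omega>"
        proof
          fix x assume "x \<in> cball w e"
          then have "dist w0 x \<le> 2 * r" using w e dist_triangle[of w0 x w] by simp
          then show "x \<in> \<Omega>" using w0(3) by auto
        qed
        let ?g = "\<lambda>t. F t * (of_real (bump_x ((t - w) / of_real e)) + \<i> * of_real (bump_y ((t - w) / of_real e)))"
        have cg: "continuous_on UNIV ?g"
          by (intro continuous_on_mult continuous_on_add continuous_on_of_real bb Fs continuous_on_id continuous_on_const e)
        have "integral (cbox Qa Qb) ?g = integral\<^sup>L lborel ?g"
          by (rule integral_compact_support(2)[OF cg, symmetric]) (use supp[OF _ w e] in auto)
        then have g0: "integral (cbox Qa Qb) ?g = 0" using weak[OF e(1) cw] by simp
        have ii: "Gx w integrable_on cbox Qa Qb" "Gy w integrable_on cbox Qa Qb"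
          unfolding Gx_def[abs_def] Gy_def[abs_def]
          by (intro integrable_continuous continuous_on_mult continuous_on_of_real bb Fs continuous_on_id continuous_on_const e)+
        have "integral (cbox Qa Qb) (Gx w) + \<i> * integral (cbox Qa Qb) (Gy w) = integral (cbox Qa Qb) (\<lambda>t. Gx w t + \<i> * Gy w t)"
          by (subst integral_add) (use ii in \<open>auto intro: integrable_on_mult_right\<close>)
        also have "(\<lambda>t. Gx w t + \<i> * Gy w t) = (\<lambda>t. of_real (- (1 / e)) * ?g t)"
          by (simp add: Gx_def Gy_def fun_eq_iff algebra_simps)
        also have "integral (cbox Qa Qb) \<dots> = of_real (- (1 / e)) * integral (cbox Qa Qb) ?g" by simp
        finally show ?thesis using g0 by simp
      qed
      show ?thesis
      proof (rule holomorphic_onI)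
        fix w assume w: "w \<in> ball w0 r"
        define D where "D = integral (cbox Qa Qb) (Gx w)"
        have "integral (cbox Qa Qb) (Gy w) = \<i> * D"
        proof -
          have "\<i> * (D + \<i> * integral (cbox Qa Qb) (Gy w)) = 0" using cr[OF w] by (simp add: D_def)
          then show ?thesis by (simp add: algebra_simps)
        qed
        then have "(Fe e has_derivative (\<lambda>h. of_real (Re h) * D + of_real (Im h) * (\<i> * D))) (at w)"
          using P[unfolded has_partials_def, rule_format, of w] by (simp add: D_def)
        moreover have "of_real (Re h) * D + of_real (Im h) * (\<i> * D) = D * h" for h
        proof -
          have "D * h = D * (of_real (Re h) + \<i> * of_real (Im h))" by (simp add: complex_eq[symmetric])
          then show ?thesis by (simp add: algebra_simps)
        qed
        ultimately have "(Fe e has_field_derivative D) (at w)" by (simp add: has_field_derivative_def)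
        then show "Fe e field_differentiable at w within ball w0 r" by (meson field_differentiable_at_within field_differentiable_def)
      qed
    qed
    \<comment> \<open>The mass of the bump, independent of its centre by translation
      invariance.\<close>
    define N where "N e = integral\<^sup>L lborel (\<lambda>t. bump (t / of_real e))" for e :: real
    have Nw: "integral (cbox Qa Qb) (\<lambda>t. bump ((t - w) / of_real e)) = N e" if "w \<in> ball w0 r" "0 < e" "e < r" for w e
    proof -
      have c: "continuous_on UNIV (\<lambda>t. bump ((t - w) / of_real e))" for w
        by (intro bb continuous_on_id continuous_on_const that(2))
      have "integral (cbox Qa Qb) (\<lambda>t. bump ((t - w) / of_real e)) = integral\<^sup>L lborel (\<lambda>t. bump ((t - w) / of_real e))"
        by (rule integral_compact_support(2)[OF c, symmetric]) (use supp that in auto)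
      also have "\<dots> = N e" unfolding N_def
        by (rule lborel_integral_shift_complex[of "\<lambda>t. bump (t / of_real e)"]) (use c[of 0] in \<open>auto intro: borel_measurable_continuous_onI\<close>)
      finally show ?thesis .
    qed
    have Npos: "N e > 0" if e: "0 < e" "e < r" for e
    proof -
      have c: "continuous_on UNIV (\<lambda>t. bump ((t - w0) / of_real e))"
        by (intro bb continuous_on_id continuous_on_const e)
      have "N e \<ge> 0" unfolding N_def by (intro integral_nonneg_AE) (simp add: bump_nonneg)
      moreover have "N e \<noteq> 0"
      proof
        assume "N e = 0"
        then have "integral (cbox Qa Qb) (\<lambda>t. bump ((t - w0) / of_real e)) = 0" using Nw[of w0 e] w0 e by simp
        moreover have "(\<lambda>t. bump ((t - w0) / of_real e)) integrable_on cbox Qa Qb"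
          by (rule integrable_continuous[OF continuous_on_subset[OF c]]) simp
        ultimately have "((\<lambda>t. bump ((t - w0) / of_real e)) has_integral 0) (cbox Qa Qb)"
          by (simp only: has_integral_integrable_integral)
        moreover have "box Qa Qb \<noteq> {}" using w0(2) by (simp add: Qa_def Qb_def box_ne_empty Basis_complex_def)
        moreover have "w0 \<in> cbox Qa Qb" using Q w0(2) by auto
        ultimately have "bump ((w0 - w0) / of_real e) = 0"
          using has_integral_0_cbox_imp_0[of Qa Qb "\<lambda>t. bump ((t - w0) / of_real e)" w0] continuous_on_subset[OF c, of "cbox Qa Qb"] bump_nonneg
          by blast
        then show False using bump_pos[of 0] by simp
      qed
      ultimately show ?thesis by simp
    qed
    define s where "s n = r / real (n + 2)" for n
    have s: "0 < s n" "s n < r" for n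
    proof -
      have "r * 1 < r * real (n + 2)" using w0(2) by (intro mult_strict_left_mono) auto
      then show "0 < s n" "s n < r" using w0(2) by (simp_all add: s_def pos_divide_less_eq)
    qed
    have "(\<lambda>n. r / real (n + 2)) \<longlonglongrightarrow> 0" by real_asymp
    then have s0: "s \<longlonglongrightarrow> 0" by (simp add: s_def[abs_def])
    define H where "H n w = Fe (s n) w / of_real (N (s n))" for n w
    have unif: "uniform_limit (ball w0 r) H F sequentially"
    proof (rule uniform_limitI)
      fix e :: real assume e: "e > 0"
      have "uniformly_continuous_on (cball w0 (2 * r)) F"
        by (rule compact_uniformly_continuous[OF continuous_on_subset[OF F]]) auto
      then obtain d where d: "d > 0" "\<And>x y. x \<in> cball w0 (2 * r) \<Longrightarrow> y \<in> cball w0 (2 * r) \<Longrightarrow> dist y x < d \<Longrightarrow> dist (F y) (F x) < e / 2"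
        unfolding uniformly_continuous_on_def using e by (metis half_gt_zero)
      have "\<forall>\<^sub>F n in sequentially. s n < d" using s0 d(1) by (rule order_tendstoD(2))
      then show "\<forall>\<^sub>F n in sequentially. \<forall>w\<in>ball w0 r. dist (H n w) (F w) < e"
      proof eventually_elim
        case (elim n)
        show ?case
        proof
          fix w assume w: "w \<in> ball w0 r"
          let ?b = "\<lambda>t. bump ((t - w) / of_real (s n))"
          have bi: "continuous_on S ?b" for S by (intro bb continuous_on_id continuous_on_const s)
          have i1: "(\<lambda>t. F t * of_real (?b t)) integrable_on cbox Qa Qb" "(\<lambda>t. F w * complex_of_real (?b t)) integrable_on cbox Qa Qb"
            "?b integrable_on cbox Qa Qb" "(\<lambda>t. complex_of_real (?b t)) integrable_on cbox Qa Qb"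
            by (intro integrable_continuous continuous_on_mult continuous_on_of_real bi Fs continuous_on_id continuous_on_const)+
          have "integral (cbox Qa Qb) (\<lambda>t. complex_of_real (?b t)) = of_real (N (s n))"
            using integral_linear[OF i1(3) bounded_linear_of_real[where 'a = complex]] Nw[OF w s] by (simp add: o_def)
          then have "Fe (s n) w - F w * of_real (N (s n)) = integral (cbox Qa Qb) (\<lambda>t. (F t - F w) * of_real (?b t))"
            unfolding Fe_def using i1 by (simp add: left_diff_distrib integral_diff)
          also have "norm \<dots> \<le> integral (cbox Qa Qb) (\<lambda>t. (e / 2) * ?b t)"
          proof (rule integral_norm_bound_integral)
            show "(\<lambda>t. (F t - F w) * of_real (?b t)) integrable_on cbox Qa Qb"
              using i1 by (simp add: left_diff_distrib integrable_diff)
            show "(\<lambda>t. (e / 2) * ?b t) integrable_on cbox Qa Qb" using i1 by (intro integrable_on_mult_right)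
            fix t
            show "norm ((F t - F w) * of_real (?b t)) \<le> (e / 2) * ?b t"
            proof (cases "?b t = 0")
              case False
              then have "norm ((t - w) / of_real (s n)) < 1" using bump_outside(1) not_le by blast
              then have tw: "norm (t - w) < s n" using s[of n] by (simp add: norm_divide)
              have "dist w0 t \<le> 2 * r" using tw s[of n] w dist_triangle[of w0 t w] by (simp add: dist_norm norm_minus_commute)
              then have "dist (F t) (F w) < e / 2" using d(2)[of w t] w tw elim w0(2) by (auto simp: dist_norm)
              then have "norm (F t - F w) \<le> e / 2" by (simp add: dist_norm)
              then show ?thesis unfolding norm_mult norm_of_real abs_of_nonneg[OF bump_nonneg]
                by (rule mult_right_mono[OF _ bump_nonneg])
            qed auto
          qed
          also have "\<dots> = (e / 2) * N (s n)" using Nw[OF w s] by simp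
          finally have "norm (Fe (s n) w - F w * of_real (N (s n))) / N (s n) \<le> e / 2" using Npos[OF s] by (simp add: pos_divide_le_eq)
          moreover have "H n w - F w = (Fe (s n) w - F w * of_real (N (s n))) / of_real (N (s n))"
            using Npos[OF s, of n] by (simp add: H_def divide_simps)
          then have "dist (H n w) (F w) = norm (Fe (s n) w - F w * of_real (N (s n))) / N (s n)"
            using Npos[OF s, of n] by (simp only: dist_norm norm_divide norm_of_real abs_of_pos)
          ultimately show "dist (H n w) (F w) < e" using e by linarith
        qed
      qed
    qed
    show ?thesis
    proof (rule holomorphic_uniform_sequence[OF open_ball])
      show "H n holomorphic_on ball w0 r" for n
        unfolding H_def[abs_def] by (intro holomorphic_on_divide holFe s holomorphic_on_const) (use Npos[OF s, of n] in auto)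
      fix x assume "x \<in> ball w0 r"
      then obtain d where "d > 0" "cball x d \<subseteq> ball w0 r" by (meson open_ball open_contains_cball)
      then show "\<exists>d>0. cball x d \<subseteq> ball w0 r \<and> uniform_limit (cball x d) H F sequentially"
        using uniform_limit_on_subset[OF unif] by blast
    qed
  qed
  note L = this
  show ?thesis
  proof (rule holomorphic_onI)
    fix w0 assume w0: "w0 \<in> \<Omega>"
    obtain r where "r > 0" "cball w0 r \<subseteq> \<Omega>" using \<Omega> w0 by (meson open_contains_cball)
    then have "F holomorphic_on ball w0 (r / 2)" using L[OF w0, of "r / 2"] by simp
    then have "F field_differentiable at w0" using \<open>r > 0\<close> by (auto simp: holomorphic_on_def at_within_open[OF _ open_ball])
    then show "F field_differentiable at w0 within \<Omega>" by (rule field_differentiable_at_within)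
  qed
qed

section \<open>Change of variables in the plane\<close>

definition plane_of :: "real ^ 2 \<Rightarrow> complex" where "plane_of v = Complex (v $ 1) (v $ 2)"
definition vec_of :: "complex \<Rightarrow> real ^ 2" where "vec_of z = (\<chi> i. if i = 1 then Re z else Im z)"

lemma plane_of_vec_of [simp]: "plane_of (vec_of z) = z" by (simp add: plane_of_def vec_of_def)

lemma vec_of_plane_of [simp]: "vec_of (plane_of v) = v"
  by (simp add: plane_of_def vec_of_def vec_eq_iff forall_2)

lemma bounded_linear_plane_of: "bounded_linear plane_of"
  by (rule linear_conv_bounded_linear[THEN iffD1], rule linearI) (auto simp: plane_of_def complex_eq_iff)

lemma bounded_linear_vec_of: "bounded_linear vec_of"
  by (rule linear_conv_bounded_linear[THEN iffD1], rule linearI) (auto simp: vec_of_def vec_eq_iff)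

lemma plane_of_measurable [measurable]: "plane_of \<in> borel_measurable borel"
  by (rule borel_measurable_continuous_onI[OF linear_continuous_on[OF bounded_linear_plane_of]])

lemma lborel_plane_of: "distr lborel borel plane_of = lborel"
proof (rule lborel_eqI[symmetric])
  fix l u :: complex assume lu: "\<And>b. b \<in> Basis \<Longrightarrow> l \<bullet> b \<le> u \<bullet> b"
  have "emeasure (distr lborel borel plane_of) (box l u) = emeasure lborel (plane_of -` box l u \<inter> space lborel)"
    by (rule emeasure_distr) auto
  also have "plane_of -` box l u \<inter> space lborel = box (vec_of l) (vec_of u)"
    by (auto simp: in_box_complex_iff mem_box_cart plane_of_def vec_of_def forall_2)
  also have "emeasure lborel \<dots> = ennreal (\<Prod>b\<in>Basis. (vec_of u - vec_of l) \<bullet> b)"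
  proof (rule emeasure_lborel_box)
    have "Re l \<le> Re u" "Im l \<le> Im u" using lu[of 1] lu[of \<i>] by (auto simp: Basis_complex_def)
    then show "vec_of l \<bullet> b \<le> vec_of u \<bullet> b" if "b \<in> Basis" for b
      using that by (auto simp: Basis_vec_def vec_of_def inner_axis)
  qed
  also have "(\<Prod>b\<in>Basis. (vec_of u - vec_of l) \<bullet> b) = (Re u - Re l) * (Im u - Im l)"
  proof -
    have B: "(Basis :: (real ^ 2) set) = (\<lambda>i. axis i 1) ` UNIV" by (auto simp: Basis_vec_def)
    have "(\<Prod>b\<in>Basis. v \<bullet> b) = v $ 1 * v $ 2" for v :: "real ^ 2"
      unfolding B by (subst prod.reindex) (auto simp: inj_on_def axis_eq_axis inner_axis UNIV_2)
    then show ?thesis by (simp add: vec_of_def)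
  qed
  also have "\<dots> = (\<Prod>b\<in>Basis. (u - l) \<bullet> b)" by (simp add: Basis_complex_def)
  finally show "emeasure (distr lborel borel plane_of) (box l u) = ennreal (\<Prod>b\<in>Basis. (u - l) \<bullet> b)" .
qed simp

definition jacobian :: "(complex \<Rightarrow> complex) \<Rightarrow> (complex \<Rightarrow> complex) \<Rightarrow> complex \<Rightarrow> real" where
  "jacobian fx fy z = Re (fx z) * Im (fy z) - Im (fx z) * Re (fy z)"

text \<open>The determinant formula is stated on \<open>real ^ 2\<close>, so arguments and values
  are both carried there; \<open>plane_of\<close> preserves Lebesgue measure. Nonnegativity of the
  Jacobian removes the absolute value of the determinant.\<close>

lemma plane_change_of_variables:
  fixes g :: "complex \<Rightarrow> complex"
  assumes P: "has_partials \<Psi> \<Psi>x \<Psi>y" and c: "continuous_on UNIV \<Psi>x" "continuous_on UNIV \<Psi>y"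
    and bij: "bij \<Psi>" and J: "\<And>z. jacobian \<Psi>x \<Psi>y z \<ge> 0" and g: "integrable lborel g" "g \<in> borel_measurable borel"
  shows "integrable lborel (\<lambda>z. of_real (jacobian \<Psi>x \<Psi>y z) * g (\<Psi> z))"
    and "integral\<^sup>L lborel (\<lambda>z. of_real (jacobian \<Psi>x \<Psi>y z) * g (\<Psi> z)) = integral\<^sup>L lborel g"
proof -
  have c\<Psi>: "continuous_on UNIV \<Psi>" using P by (rule has_partials_continuous)
  define G where "G = vec_of \<circ> \<Psi> \<circ> plane_of"
  define f where "f v = vec_of (g (plane_of v))" for v
  define D where "D v h = vec_of (of_real (h $ 1) * \<Psi>x (plane_of v) + of_real (h $ 2) * \<Psi>y (plane_of v))" for v h :: "real ^ 2"
  have dG: "(G has_derivative D v) (at v within UNIV)" for v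
  proof -
    have "(plane_of has_derivative plane_of) (at v)" by (rule bounded_linear_imp_has_derivative[OF bounded_linear_plane_of])
    from has_derivative_compose[OF this P[unfolded has_partials_def, rule_format]]
    have "((\<lambda>v. \<Psi> (plane_of v)) has_derivative (\<lambda>h. of_real (h $ 1) * \<Psi>x (plane_of v) + of_real (h $ 2) * \<Psi>y (plane_of v))) (at v)"
      by (simp add: plane_of_def)
    from bounded_linear.has_derivative[OF bounded_linear_vec_of this]
    show ?thesis by (simp add: G_def D_def[abs_def] o_def)
  qed
  have "det (matrix (D v)) = jacobian \<Psi>x \<Psi>y (plane_of v)" for v
    by (simp add: det_2 matrix_def D_def vec_of_def jacobian_def axis_def)
  then have detD: "\<bar>det (matrix (D v))\<bar> = jacobian \<Psi>x \<Psi>y (plane_of v)" for v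
    using J[of "plane_of v"] by simp
  have injG: "inj_on G UNIV"
    using bij unfolding G_def bij_def by (auto intro!: injI) (metis injD plane_of_vec_of vec_of_plane_of)
  have surjG: "G ` UNIV = UNIV"
  proof -
    have "\<exists>w. v = G w" for v
    proof -
      obtain z where "plane_of v = \<Psi> z" using bij by (metis bij_pointE)
      then have "G (vec_of z) = v" by (metis G_def comp_apply plane_of_vec_of vec_of_plane_of)
      then show ?thesis by metis
    qed
    then show ?thesis by auto
  qed
  have fi: "integrable lborel f"
  proof -
    have "integrable (distr lborel borel plane_of) g" using g by (simp add: lborel_plane_of)
    then have "integrable lborel (\<lambda>v. g (plane_of v))" by (subst (asm) integrable_distr_eq) (use g in auto)
    from integrable_bounded_linear[OF bounded_linear_vec_of this] show ?thesis by (simp add: f_def[abs_def])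
  qed
  have Fi: "integral\<^sup>L lborel f = vec_of (integral\<^sup>L lborel g)"
  proof -
    have "integrable (distr lborel borel plane_of) g" using g by (simp add: lborel_plane_of)
    then have "integrable lborel (\<lambda>v. g (plane_of v))" by (subst (asm) integrable_distr_eq) (use g in auto)
    then have "integral\<^sup>L lborel f = vec_of (integral\<^sup>L lborel (\<lambda>v. g (plane_of v)))"
      unfolding f_def by (rule integral_bounded_linear[OF bounded_linear_vec_of])
    also have "integral\<^sup>L lborel (\<lambda>v. g (plane_of v)) = integral\<^sup>L (distr lborel borel plane_of) g"
      by (rule integral_distr[symmetric]) (use g in auto)
    finally show ?thesis by (simp add: lborel_plane_of)
  qed
  have ab: "f absolutely_integrable_on UNIV" "integral UNIV f = integral\<^sup>L lborel f"
    using fi by (simp_all add: integral_lborel integrable_completion set_integrable_def)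
  have "(\<lambda>v. \<bar>det (matrix (D v))\<bar> *\<^sub>R f (G v)) absolutely_integrable_on UNIV \<and>
      integral UNIV (\<lambda>v. \<bar>det (matrix (D v))\<bar> *\<^sub>R f (G v)) = integral\<^sup>L lborel f"
    by (subst has_absolute_integral_change_of_variables[OF _ dG injG]) (use ab surjG in auto)
  moreover have fG: "f (G v) = vec_of (g (\<Psi> (plane_of v)))" for v by (simp add: f_def G_def)
  ultimately have A: "(\<lambda>v. jacobian \<Psi>x \<Psi>y (plane_of v) *\<^sub>R vec_of (g (\<Psi> (plane_of v)))) absolutely_integrable_on UNIV"
    "integral UNIV (\<lambda>v. jacobian \<Psi>x \<Psi>y (plane_of v) *\<^sub>R vec_of (g (\<Psi> (plane_of v)))) = integral\<^sup>L lborel f"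
    by (simp_all add: detD)
  let ?h = "\<lambda>z. of_real (jacobian \<Psi>x \<Psi>y z) * g (\<Psi> z)"
  have hm: "?h \<in> borel_measurable borel"
  proof -
    have "\<Psi> \<in> borel_measurable borel" "\<Psi>x \<in> borel_measurable borel" "\<Psi>y \<in> borel_measurable borel"
      using c c\<Psi> by (auto intro: borel_measurable_continuous_onI)
    then show ?thesis unfolding jacobian_def using g(2) by measurable
  qed
  define k where "k v = vec_of (?h (plane_of v))" for v
  have kv: "k v = jacobian \<Psi>x \<Psi>y (plane_of v) *\<^sub>R vec_of (g (\<Psi> (plane_of v)))" for v
    unfolding k_def by (simp add: vec_of_def vec_eq_iff)
  have km: "k \<in> borel_measurable borel"
    unfolding k_def
    by (intro measurable_compose[OF _ borel_measurable_continuous_onI[OF linear_continuous_on[OF bounded_linear_vec_of]]]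
        measurable_compose[OF plane_of_measurable hm])
  have ki: "integrable lborel k"
    using A(1) km unfolding kv[symmetric] by (simp add: set_integrable_def integrable_completion)
  have kI: "integral\<^sup>L lborel k = integral\<^sup>L lborel f" using A(2) integral_lborel[OF ki] unfolding kv[symmetric] by simp
  have hi': "integrable lborel (\<lambda>v. ?h (plane_of v))"
    using integrable_bounded_linear[OF bounded_linear_plane_of ki] by (simp add: k_def)
  have "integrable (distr lborel borel plane_of) ?h" by (subst integrable_distr_eq) (use hi' hm in auto)
  then show "integrable lborel ?h" by (simp add: lborel_plane_of)
  have "integral\<^sup>L lborel ?h = integral\<^sup>L (distr lborel borel plane_of) ?h" by (simp add: lborel_plane_of)
  also have "\<dots> = integral\<^sup>L lborel (\<lambda>v. ?h (plane_of v))" by (rule integral_distr) (use hm in auto)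
  also have "\<dots> = integral\<^sup>L lborel (\<lambda>v. plane_of (k v))" by (simp add: k_def)
  also have "\<dots> = plane_of (integral\<^sup>L lborel k)" by (rule integral_bounded_linear[OF bounded_linear_plane_of ki])
  also have "\<dots> = integral\<^sup>L lborel g" by (simp add: kI Fi)
  finally show "integral\<^sup>L lborel ?h = integral\<^sup>L lborel g" .
qed

section \<open>Quasiconformal maps: the weak Beltrami equation\<close>

lemma has_partials_zero:
  assumes T: "has_partials T Tx Ty" and K: "closed K" "\<And>z. z \<notin> K \<Longrightarrow> T z = 0" and z: "z \<notin> K"
  shows "Tx z = 0" "Ty z = 0"
proof -
  have "((\<lambda>_. 0) has_derivative (\<lambda>h. of_real (Re h) * Tx z + of_real (Im h) * Ty z)) (at z)"
    by (rule has_derivative_transform_within_open[OF T[unfolded has_partials_def, rule_format], of "- K"])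
      (use K z in auto)
  moreover have "((\<lambda>_. 0::complex) has_derivative (\<lambda>h. 0)) (at z)" by (rule has_derivative_const)
  ultimately have e: "(\<lambda>h. of_real (Re h) * Tx z + of_real (Im h) * Ty z) = (\<lambda>h. 0)" by (rule has_derivative_unique)
  show "Tx z = 0" "Ty z = 0" using fun_cong[OF e, of 1] fun_cong[OF e, of \<i>] by simp_all
qed

text \<open>On the compact support |h| \<le> 1 + |h|^2, so local square integrability is
  enough.\<close>

lemma integrable_cont_L2_loc:
  assumes g: "continuous_on UNIV (g :: complex \<Rightarrow> complex)" and K: "compact K" "\<And>z. z \<notin> K \<Longrightarrow> g z = 0" and h: "L2_loc UNIV h"
  shows "integrable lebesgue (\<lambda>z. g z * h z)"
proof -
  obtain M where M: "\<And>z. z \<in> K \<Longrightarrow> norm (g z) \<le> M"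
    using compact_imp_bounded[OF compact_continuous_image[OF continuous_on_subset[OF g subset_UNIV] K(1)]] by (auto simp: bounded_iff)
  have hm: "h \<in> borel_measurable lebesgue" and hi: "set_integrable lebesgue K (\<lambda>z. (norm (h z))\<^sup>2)"
    using h K(1) by (auto simp: L2_loc_def lebesgue_on_UNIV_eq)
  have ki: "set_integrable lebesgue K (\<lambda>z. 1 :: real)"
    using K(1) lmeasurable_compact[of K] by (simp add: set_integrable_def lmeasurable_iff_integrable)
  have "set_integrable lebesgue K (\<lambda>z. \<bar>M\<bar> * (1 + (norm (h z))\<^sup>2))"
    by (intro set_integrable_mult_right set_integral_add(1) hi ki)
  then have "integrable lebesgue (\<lambda>z. indicator K z *\<^sub>R (\<bar>M\<bar> * (1 + (norm (h z))\<^sup>2)))" by (simp add: set_integrable_def)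
  then show ?thesis
  proof (rule Bochner_Integration.integrable_bound)
    have "g \<in> borel_measurable lebesgue"
      using borel_measurable_continuous_onI[OF g] by (intro measurable_completion) simp
    then show "(\<lambda>z. g z * h z) \<in> borel_measurable lebesgue" using hm by measurable
    show "AE z in lebesgue. norm (g z * h z) \<le> norm (indicator K z *\<^sub>R (\<bar>M\<bar> * (1 + (norm (h z))\<^sup>2)))"
    proof (rule AE_I2)
      fix z
      show "norm (g z * h z) \<le> norm (indicator K z *\<^sub>R (\<bar>M\<bar> * (1 + (norm (h z))\<^sup>2)))"
      proof (cases "z \<in> K")
        case True
        have "0 \<le> (norm (h z) - 1)\<^sup>2" by simp
        then have "norm (h z) \<le> 1 + (norm (h z))\<^sup>2" by (simp add: power2_diff) (smt (verit) norm_ge_zero)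
        then have "norm (g z) * norm (h z) \<le> \<bar>M\<bar> * (1 + (norm (h z))\<^sup>2)" using M[OF True] by (intro mult_mono) auto
        then show ?thesis using True by (simp add: norm_mult abs_mult)
      qed (use K in auto)
    qed
  qed
qed

lemma lebesgue_integral_continuous:
  fixes g :: "complex \<Rightarrow> complex"
  assumes g: "continuous_on UNIV g" and K: "compact K" "\<And>z. z \<notin> K \<Longrightarrow> g z = 0"
  shows "integrable lborel g" "integrable lebesgue g" "integral\<^sup>L lebesgue g = integral\<^sup>L lborel g"
proof -
  obtain a where "K \<subseteq> cbox (- a) a" using bounded_subset_cbox_symmetric[OF compact_imp_bounded[OF K(1)]] by blast
  then show i: "integrable lborel g" using integral_compact_support(1)[OF g, of "- a" a] K(2) by blast
  have m: "g \<in> borel_measurable lborel" using borel_measurable_continuous_onI[OF g] by simp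
  show "integrable lebesgue g" using i m by (simp add: integrable_completion)
  show "integral\<^sup>L lebesgue g = integral\<^sup>L lborel g" using m by (rule integral_completion)
qed

text \<open>Weak derivatives are tested against real functions; a complex T is split into real and
  imaginary part, each of them a test function.\<close>

lemma weak_derivative_complex_test:
  assumes T: "has_partials T Tx Ty" "\<And>n. Cd n T" "continuous_on UNIV Tx" "continuous_on UNIV Ty"
    and K: "compact K" "\<And>z. z \<notin> K \<Longrightarrow> T z = 0"
    and \<Phi>: "continuous_on UNIV \<Phi>" "W12_loc UNIV \<Phi> \<Phi>x \<Phi>y"
  shows "integral\<^sup>L lebesgue (\<lambda>z. Tx z * \<Phi> z) = - integral\<^sup>L lebesgue (\<lambda>z. T z * \<Phi>x z)"
    and "integral\<^sup>L lebesgue (\<lambda>z. Ty z * \<Phi> z) = - integral\<^sup>L lebesgue (\<lambda>z. T z * \<Phi>y z)"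
proof -
  have L2: "L2_loc UNIV \<Phi>x" "L2_loc UNIV \<Phi>y" and W: "weak_derivative UNIV 1 \<Phi> \<Phi>x" "weak_derivative UNIV \<i> \<Phi> \<Phi>y"
    using \<Phi>(2) by (auto simp: W12_loc_def)
  have test: "test_function UNIV t" if "\<And>n. C_diff n t" "\<And>z. z \<notin> K \<Longrightarrow> t z = 0" for t
    unfolding test_function_def
  proof (intro conjI allI that(1))
    have "{z. t z \<noteq> 0} \<subseteq> K" using that(2) by auto
    then have "closure {z. t z \<noteq> 0} \<subseteq> K" using K(1) by (meson closure_minimal compact_imp_closed)
    then show "compact (closure {z. t z \<noteq> 0})" using K(1) by (metis closed_closure compact_Int_closed inf.absorb_iff2)
  qed simp
  have Tz: "Tx z = 0" "Ty z = 0" if "z \<notin> K" for z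
    using has_partials_zero[OF T(1) compact_imp_closed[OF K(1)] K(2) that] by auto
  have half: "integral\<^sup>L lebesgue (\<lambda>z. Se z * \<Phi> z) = - integral\<^sup>L lebesgue (\<lambda>z. T z * \<Phi>e z)"
    if e: "weak_derivative UNIV e \<Phi> \<Phi>e" "L2_loc UNIV \<Phi>e" "continuous_on UNIV Se" "\<And>z. z \<notin> K \<Longrightarrow> Se z = 0"
      "\<And>z. of_real (Re e) * Tx z + of_real (Im e) * Ty z = Se z" for e Se \<Phi>e
  proof -
    have R: "integral\<^sup>L lebesgue (\<lambda>z. of_real (Re (Se z)) * \<Phi> z) = - integral\<^sup>L lebesgue (\<lambda>z. of_real (Re (T z)) * \<Phi>e z)"
    proof -
      have "((\<lambda>z. Re (T z)) has_derivative (\<lambda>h. Re (of_real (Re h) * Tx z + of_real (Im h) * Ty z))) (at z)" for z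
        by (rule has_derivative_Re[OF T(1)[unfolded has_partials_def, rule_format]])
      then have "frechet_derivative (\<lambda>z. Re (T z)) (at z) = (\<lambda>h. Re (of_real (Re h) * Tx z + of_real (Im h) * Ty z))" for z
        by (rule frechet_derivative_at[symmetric])
      then have fd: "frechet_derivative (\<lambda>z. Re (T z)) (at z) e = Re (Se z)" for z
        using arg_cong[OF e(5)[of z], of Re] by simp
      have "test_function UNIV (\<lambda>z. Re (T z))" by (rule test) (use Cd_imp_C_diff[OF T(2)] K in auto)
      then show ?thesis using e(1) unfolding weak_derivative_def
        by (auto simp: fd set_lebesgue_integral_def scaleR_conv_of_real)
    qed
    have I: "integral\<^sup>L lebesgue (\<lambda>z. of_real (Im (Se z)) * \<Phi> z) = - integral\<^sup>L lebesgue (\<lambda>z. of_real (Im (T z)) * \<Phi>e z)"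
    proof -
      have "((\<lambda>z. Im (T z)) has_derivative (\<lambda>h. Im (of_real (Re h) * Tx z + of_real (Im h) * Ty z))) (at z)" for z
        by (rule has_derivative_Im[OF T(1)[unfolded has_partials_def, rule_format]])
      then have "frechet_derivative (\<lambda>z. Im (T z)) (at z) = (\<lambda>h. Im (of_real (Re h) * Tx z + of_real (Im h) * Ty z))" for z
        by (rule frechet_derivative_at[symmetric])
      then have fd: "frechet_derivative (\<lambda>z. Im (T z)) (at z) e = Im (Se z)" for z
        using arg_cong[OF e(5)[of z], of Im] by simp
      have "C_diff n (\<lambda>z. Im (T z))" for n using Cd_imp_C_diff[OF Cd_Im[OF T(2)], of n] by simp
      then have "test_function UNIV (\<lambda>z. Im (T z))" by (rule test) (use K in auto)
      then show ?thesis using e(1) unfolding weak_derivative_def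
        by (auto simp: fd set_lebesgue_integral_def scaleR_conv_of_real)
    qed
    have Sc: "continuous_on UNIV (\<lambda>z. complex_of_real (Re (Se z)))" "continuous_on UNIV (\<lambda>z. complex_of_real (Im (Se z)))"
      by (intro continuous_on_of_real continuous_on_Re continuous_on_Im e(3))+
    have Tc0: "continuous_on UNIV T" using T(1) by (rule has_partials_continuous)
    have Tc: "continuous_on UNIV (\<lambda>z. complex_of_real (Re (T z)))" "continuous_on UNIV (\<lambda>z. complex_of_real (Im (T z)))"
      by (intro continuous_on_of_real continuous_on_Re continuous_on_Im Tc0)+
    have i1: "integrable lebesgue (\<lambda>z. of_real (Re (Se z)) * \<Phi> z)" "integrable lebesgue (\<lambda>z. of_real (Im (Se z)) * \<Phi> z)"
      by (rule lebesgue_integral_continuous(2)[OF _ K(1)]; use e(4) in \<open>auto intro!: continuous_on_mult Sc \<Phi>(1)\<close>)+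
    have i2: "integrable lebesgue (\<lambda>z. of_real (Re (T z)) * \<Phi>e z)" "integrable lebesgue (\<lambda>z. of_real (Im (T z)) * \<Phi>e z)"
      by (rule integrable_cont_L2_loc[OF _ K(1) _ e(2)]; use K(2) Tc in auto)+
    have "(\<lambda>z. Se z * \<Phi> z) = (\<lambda>z. of_real (Re (Se z)) * \<Phi> z + \<i> * (of_real (Im (Se z)) * \<Phi> z))"
    proof
      fix z
      have "Se z = of_real (Re (Se z)) + \<i> * of_real (Im (Se z))" by (simp add: complex_eq)
      then show "Se z * \<Phi> z = of_real (Re (Se z)) * \<Phi> z + \<i> * (of_real (Im (Se z)) * \<Phi> z)" by (metis distrib_right mult.assoc)
    qed
    moreover have "(\<lambda>z. T z * \<Phi>e z) = (\<lambda>z. of_real (Re (T z)) * \<Phi>e z + \<i> * (of_real (Im (T z)) * \<Phi>e z))"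
    proof
      fix z
      have "T z = of_real (Re (T z)) + \<i> * of_real (Im (T z))" by (simp add: complex_eq)
      then show "T z * \<Phi>e z = of_real (Re (T z)) * \<Phi>e z + \<i> * (of_real (Im (T z)) * \<Phi>e z)" by (metis distrib_right mult.assoc)
    qed
    ultimately show ?thesis using R I i1 i2 by simp
  qed
  show "integral\<^sup>L lebesgue (\<lambda>z. Tx z * \<Phi> z) = - integral\<^sup>L lebesgue (\<lambda>z. T z * \<Phi>x z)"
    by (rule half[OF W(1) L2(1) T(3) Tz(1)]) auto
  show "integral\<^sup>L lebesgue (\<lambda>z. Ty z * \<Phi> z) = - integral\<^sup>L lebesgue (\<lambda>z. T z * \<Phi>y z)"
    by (rule half[OF W(2) L2(2) T(4) Tz(2)]) auto
qed

text \<open>The left-hand side tests \<open>\<Phi> \<circ> inv \<Psi>\<close> against twice the zbar-derivative of a bump function. After the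
  change of variables by \<open>\<Psi>\<close> only \<open>\<Psi>\<^sub>x \<Phi>\<^sub>y - \<Psi>\<^sub>y \<Phi>\<^sub>x = - 2 \<i> P p (\<mu> - \<nu>)\<close> remains, the mismatch of the two
  Beltrami coefficients.\<close>

lemma weak_identity:
  fixes \<Phi> \<Psi> P \<nu> \<mu> \<Phi>x \<Phi>y :: "complex \<Rightarrow> complex" and e k :: real and w :: complex
  assumes \<Phi>: "continuous_on UNIV \<Phi>" "W12_loc UNIV \<Phi> \<Phi>x \<Phi>y"
    and \<mu>: "\<mu> \<in> borel_measurable lebesgue"
    and beltrami: "AE z in lebesgue. Im (\<Psi> z) > 0 \<longrightarrow> (\<Phi>x z + \<i> * \<Phi>y z) / 2 = \<mu> z * ((\<Phi>x z - \<i> * \<Phi>y z) / 2)"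
    and \<Psi>: "has_partials \<Psi> (\<lambda>z. P z * (1 + \<nu> z)) (\<lambda>z. \<i> * P z * (1 - \<nu> z))" "bij \<Psi>" "continuous_on UNIV (inv \<Psi>)"
    and Q: "has_partials (\<lambda>z. P z * (1 + \<nu> z)) Q1 Q2" "has_partials (\<lambda>z. \<i> * P z * (1 - \<nu> z)) Q2 Q3"
    and C: "\<And>n. Cd n P" "\<And>n. Cd n \<nu>" and \<nu>: "\<And>z. norm (\<nu> z) \<le> k" "k < 1"
    and e: "e > 0" and w: "cball w e \<subseteq> {z. Im z > 0}"
  defines "cutoff \<equiv> \<lambda>z :: complex. bump ((\<Psi> z - w) / of_real e)"
  defines "p \<equiv> \<lambda>z :: complex. (\<Phi>x z - \<i> * \<Phi>y z) / 2"
  shows "integral\<^sup>L lborel (\<lambda>t. \<Phi> (inv \<Psi> t) * (of_real (bump_x ((t - w) / of_real e)) + \<i> * of_real (bump_y ((t - w) / of_real e))))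
       = - 2 * of_real e * integral\<^sup>L lebesgue (\<lambda>z. of_real (cutoff z) * P z * p z * (\<mu> z - \<nu> z))" (is "?I = _")
    and "integrable lborel (\<lambda>z. complex_of_real ((cutoff z)\<^sup>2 * (norm (P z))\<^sup>2))"
    and "(1 - k\<^sup>2) * integral\<^sup>L lborel (\<lambda>z. (cutoff z)\<^sup>2 * (norm (P z))\<^sup>2) \<le> integral\<^sup>L lborel (\<lambda>t. (bump ((t - w) / of_real e))\<^sup>2)"
proof -
  define \<Gamma> where "\<Gamma> = inv \<Psi>"
  have inv: "\<Psi> (\<Gamma> t) = t" "\<Gamma> (\<Psi> z) = z" for t z
    using \<Psi>(2) by (simp_all add: \<Gamma>_def bij_def surj_f_inv_f)
  have k0: "0 \<le> k" using \<nu>(1)[of 0] norm_ge_zero order_trans by blast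
  have cP: "continuous_on UNIV P" "continuous_on UNIV \<nu>" using Cd_continuous C by blast+
  define \<Psi>x where "\<Psi>x z = P z * (1 + \<nu> z)" for z
  define \<Psi>y where "\<Psi>y z = \<i> * P z * (1 - \<nu> z)" for z
  have P: "has_partials \<Psi> \<Psi>x \<Psi>y" using \<Psi>(1) by (simp add: \<Psi>x_def[abs_def] \<Psi>y_def[abs_def])
  have c\<Psi>xy: "continuous_on UNIV \<Psi>x" "continuous_on UNIV \<Psi>y"
    unfolding \<Psi>x_def[abs_def] \<Psi>y_def[abs_def] by (intro continuous_on_mult continuous_on_add continuous_on_diff continuous_on_const cP)+
  have c\<Psi>: "continuous_on UNIV \<Psi>" using P by (rule has_partials_continuous)
  have Jeq: "jacobian \<Psi>x \<Psi>y z = (norm (P z))\<^sup>2 * (1 - (norm (\<nu> z))\<^sup>2)" for z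
    unfolding jacobian_def \<Psi>x_def \<Psi>y_def cmod_power2 by (simp add: power2_eq_square algebra_simps)
  \<comment> \<open>The Jacobian dominates |P|^2 up to the factor 1 - k^2; after a change of
    variables this bounds the L2 norm of the cutoff times \<open>P\<close>.\<close>
  have J1: "(norm (P z))\<^sup>2 * (1 - k\<^sup>2) \<le> jacobian \<Psi>x \<Psi>y z" for z
    unfolding Jeq using \<nu>(1)[of z] by (intro mult_left_mono) (auto intro: power_mono)
  have k1: "1 - k\<^sup>2 > 0" using k0 \<nu>(2) by (simp add: abs_square_less_1)
  have J: "jacobian \<Psi>x \<Psi>y z \<ge> 0" for z
    using J1[of z] k1 by (meson mult_nonneg_nonneg order_trans less_imp_le zero_le_power2)
  define K where "K = \<Gamma> ` cball w e"
  have K: "compact K" unfolding K_def \<Gamma>_def by (intro compact_continuous_image continuous_on_subset[OF \<Psi>(3)]) auto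
  have u: "norm ((t - w) / of_real e) \<ge> 1" if "t \<notin> cball w e" for t
    using that e by (simp add: norm_divide dist_norm norm_minus_commute)
  have uK: "norm ((\<Psi> z - w) / of_real e) \<ge> 1" if "z \<notin> K" for z
    using u[of "\<Psi> z"] inv(2)[of z] that unfolding K_def by (metis image_eqI)
  have bc: "continuous_on S (\<lambda>x. h ((f x - w) / of_real e))" if "continuous_on UNIV h" "continuous_on S f"
    for h :: "complex \<Rightarrow> real" and f :: "complex \<Rightarrow> complex" and S
    by (rule continuous_on_compose2[OF that(1)]) (use that e in \<open>auto intro!: continuous_intros\<close>)
  note bb = bc[OF bump_continuous(1)] bc[OF bump_continuous(2)] bc[OF bump_continuous(3)]
  define B where "B t = complex_of_real (bump_x ((t - w) / of_real e)) + \<i> * of_real (bump_y ((t - w) / of_real e))" for t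
  have cB: "continuous_on UNIV B" unfolding B_def[abs_def]
    by (intro continuous_on_add continuous_on_mult continuous_on_const continuous_on_of_real bb continuous_on_id)
  have B0: "B t = 0" if "t \<notin> cball w e" for t using bump_outside[OF u[OF that]] by (simp add: B_def)
  have c\<Phi>\<Gamma>: "continuous_on UNIV (\<lambda>t. \<Phi> (\<Gamma> t))"
    unfolding \<Gamma>_def by (rule continuous_on_compose2[OF \<Phi>(1) \<Psi>(3)]) auto
  define g where "g t = \<Phi> (\<Gamma> t) * B t" for t
  have cg: "continuous_on UNIV g" unfolding g_def[abs_def] by (intro continuous_on_mult c\<Phi>\<Gamma> cB)
  have gi: "integrable lborel g"
    by (rule lebesgue_integral_continuous(1)[OF cg compact_cball[of w e]]) (simp add: g_def B0)
  have gm: "g \<in> borel_measurable borel" by (rule borel_measurable_continuous_onI[OF cg])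
  have cov: "integral\<^sup>L lborel (\<lambda>z. of_real (jacobian \<Psi>x \<Psi>y z) * g (\<Psi> z)) = integral\<^sup>L lborel g"
    by (rule plane_change_of_variables(2)[OF P c\<Psi>xy \<Psi>(2) J gi gm])
  define X where "X z = complex_of_real (cutoff z)" for z
  define Xx where "Xx z = complex_of_real ((bump_x ((\<Psi> z - w) / of_real e) * Re (\<Psi>x z) + bump_y ((\<Psi> z - w) / of_real e) * Im (\<Psi>x z)) / e)" for z
  define Xy where "Xy z = complex_of_real ((bump_x ((\<Psi> z - w) / of_real e) * Re (\<Psi>y z) + bump_y ((\<Psi> z - w) / of_real e) * Im (\<Psi>y z)) / e)" for z
  have dX: "has_partials X Xx Xy"
    unfolding has_partials_def
  proof
    fix z
    have "((\<lambda>z. (\<Psi> z - w) / of_real e) has_derivative (\<lambda>h. (of_real (Re h) * \<Psi>x z + of_real (Im h) * \<Psi>y z) / of_real e)) (at z)"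
      using P[unfolded has_partials_def, rule_format, of z] e by (auto intro!: derivative_eq_intros)
    from has_derivative_of_real[OF has_derivative_compose[OF this bump_derivative]]
    have "(X has_derivative (\<lambda>h. of_real (Re ((of_real (Re h) * \<Psi>x z + of_real (Im h) * \<Psi>y z) / of_real e) * bump_x ((\<Psi> z - w) / of_real e)
        + Im ((of_real (Re h) * \<Psi>x z + of_real (Im h) * \<Psi>y z) / of_real e) * bump_y ((\<Psi> z - w) / of_real e)))) (at z)"
      by (simp only: X_def[abs_def] cutoff_def)
    then show "(X has_derivative (\<lambda>h. of_real (Re h) * Xx z + of_real (Im h) * Xy z)) (at z)"
    proof (rule has_derivative_eq_rhs)
      show "(\<lambda>h. of_real (Re ((of_real (Re h) * \<Psi>x z + of_real (Im h) * \<Psi>y z) / of_real e) * bump_x ((\<Psi> z - w) / of_real e)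
        + Im ((of_real (Re h) * \<Psi>x z + of_real (Im h) * \<Psi>y z) / of_real e) * bump_y ((\<Psi> z - w) / of_real e)))
        = (\<lambda>h. of_real (Re h) * Xx z + of_real (Im h) * Xy z)"
        unfolding Xx_def Xy_def of_real_mult[symmetric] of_real_add[symmetric]
        using e by (intro ext arg_cong[of _ _ complex_of_real]) (simp add: field_simps)
    qed
  qed
  have cXxy: "continuous_on UNIV Xx" "continuous_on UNIV Xy"
    unfolding Xx_def[abs_def] Xy_def[abs_def]
    by (intro continuous_on_of_real continuous_on_divide continuous_on_add continuous_on_mult continuous_on_Re continuous_on_Im bb c\<Psi> c\<Psi>xy continuous_on_const; use e in simp)+
  \<comment> \<open>The chain rule solved for the derivatives of the bump by Cramer's rule: the
    Jacobian cancels the determinant, and only products of partials of the cutoff and of \<Psi>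
    remain.\<close>
  have key: "of_real (jacobian \<Psi>x \<Psi>y z) * B (\<Psi> z) = - \<i> * of_real e * (Xx z * \<Psi>y z - Xy z * \<Psi>x z)" for z
  proof -
    have "a / e * e = a" for a :: real using e by simp
    then have "of_real e * Xx z = complex_of_real (bump_x ((\<Psi> z - w) / of_real e) * Re (\<Psi>x z) + bump_y ((\<Psi> z - w) / of_real e) * Im (\<Psi>x z))"
      "of_real e * Xy z = complex_of_real (bump_x ((\<Psi> z - w) / of_real e) * Re (\<Psi>y z) + bump_y ((\<Psi> z - w) / of_real e) * Im (\<Psi>y z))"
      unfolding Xx_def Xy_def of_real_mult[symmetric] by (simp_all add: mult.commute)
    then have "- \<i> * (of_real e * Xx z * \<Psi>y z - of_real e * Xy z * \<Psi>x z) = of_real (jacobian \<Psi>x \<Psi>y z) * B (\<Psi> z)"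
      by (simp only:) (simp add: B_def jacobian_def complex_eq_iff algebra_simps)
    then show ?thesis by (simp add: algebra_simps)
  qed
  have C\<Psi>: "Cd n \<Psi>x" "Cd n \<Psi>y" for n
    unfolding \<Psi>x_def[abs_def] \<Psi>y_def[abs_def] by (intro Cd_mult Cd_add Cd_diff Cd_const C)+
  have CX: "Cd n X" for n
  proof -
    have c1: "Cd n \<Psi>" for n by (rule Cd_of_partials[OF P C\<Psi>])
    have "Cd n (\<lambda>z. (\<Psi> z - w) / of_real e)" using Cd_cmult[OF Cd_diff[OF c1 Cd_const[of n w]], where c = "1 / of_real e"] by simp
    then show ?thesis unfolding X_def[abs_def] cutoff_def by (rule Cd_compose[OF C_diff_bump])
  qed
  have Q': "has_partials \<Psi>x Q1 Q2" "has_partials \<Psi>y Q2 Q3" using Q by (simp_all add: \<Psi>x_def[abs_def] \<Psi>y_def[abs_def])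
  have cQ: "continuous_on UNIV Q1" "continuous_on UNIV Q2" "continuous_on UNIV Q3"
  proof -
    \<comment> \<open>Partials are unique, so \<open>Q1\<close>, \<open>Q2\<close>,
      \<open>Q3\<close> coincide with the partials that \<open>Cd\<close> provides and inherit their
      continuity.\<close>
    have u: "fx = gx \<and> fy = gy" if "has_partials f fx fy" "has_partials f gx gy" for f fx fy gx gy
    proof -
      have "(\<lambda>h. of_real (Re h) * fx z + of_real (Im h) * fy z) = (\<lambda>h. of_real (Re h) * gx z + of_real (Im h) * gy z)" for z
        using that unfolding has_partials_def by (blast intro: has_derivative_unique)
      from fun_cong[OF this, of 1] fun_cong[OF this, of \<i>] show ?thesis by auto
    qed
    have "\<exists>fx fy. has_partials \<Psi>x fx fy \<and> Cd 0 fx \<and> Cd 0 fy" "\<exists>fx fy. has_partials \<Psi>y fx fy \<and> Cd 0 fx \<and> Cd 0 fy"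
      using C\<Psi>(1)[of "Suc 0"] C\<Psi>(2)[of "Suc 0"] unfolding Cd.simps(2) by blast+
    then show "continuous_on UNIV Q1" "continuous_on UNIV Q2" "continuous_on UNIV Q3"
      using u[OF Q'(1)] u[OF Q'(2)] by auto
  qed
  have X0: "X z = 0" if "z \<notin> K" for z using bump_outside[OF uK[OF that]] by (simp add: X_def cutoff_def)
  have Xx0: "Xx z = 0" "Xy z = 0" if "z \<notin> K" for z
    using has_partials_zero[OF dX compact_imp_closed[OF K] X0 that] by auto
  have cX: "continuous_on UNIV X" using dX by (rule has_partials_continuous)
  \<comment> \<open>The common mixed partial \<open>Q2\<close> completes both products to exact
    partials, of \<open>X * \<Psi>y\<close> in x and of \<open>X * \<Psi>x\<close> in y, and cancels
    in their difference.\<close>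
  have E1: "integral\<^sup>L lebesgue (\<lambda>z. (X z * Q2 z + Xx z * \<Psi>y z) * \<Phi> z) = - integral\<^sup>L lebesgue (\<lambda>z. X z * \<Psi>y z * \<Phi>x z)"
    by (rule weak_derivative_complex_test(1)[OF has_partials_mult[OF dX Q'(2)] _ _ _ K _ \<Phi>])
      (auto intro!: Cd_mult CX C\<Psi> continuous_on_add continuous_on_mult cX cQ cXxy c\<Psi>xy simp: X0)
  have E2: "integral\<^sup>L lebesgue (\<lambda>z. (X z * Q2 z + Xy z * \<Psi>x z) * \<Phi> z) = - integral\<^sup>L lebesgue (\<lambda>z. X z * \<Psi>x z * \<Phi>y z)"
    by (rule weak_derivative_complex_test(2)[OF has_partials_mult[OF dX Q'(1)] _ _ _ K _ \<Phi>])
      (auto intro!: Cd_mult CX C\<Psi> continuous_on_add continuous_on_mult cX cQ cXxy c\<Psi>xy simp: X0)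
  have L2: "L2_loc UNIV \<Phi>x" "L2_loc UNIV \<Phi>y" using \<Phi>(2) by (auto simp: W12_loc_def)
  have i1: "integrable lebesgue (\<lambda>z. (X z * Q2 z + Xx z * \<Psi>y z) * \<Phi> z)" "integrable lebesgue (\<lambda>z. (X z * Q2 z + Xy z * \<Psi>x z) * \<Phi> z)"
    by (rule lebesgue_integral_continuous(2)[OF _ K];
      auto intro!: continuous_on_add continuous_on_mult cX cQ cXxy c\<Psi>xy \<Phi>(1) simp: X0 Xx0)+
  have i2: "integrable lebesgue (\<lambda>z. X z * \<Psi>y z * \<Phi>x z)" "integrable lebesgue (\<lambda>z. X z * \<Psi>x z * \<Phi>y z)"
    by (rule integrable_cont_L2_loc[OF _ K _ L2(1)], auto intro!: continuous_on_mult cX c\<Psi>xy simp: X0)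
      (rule integrable_cont_L2_loc[OF _ K _ L2(2)], auto intro!: continuous_on_mult cX c\<Psi>xy simp: X0)
  have "integral\<^sup>L lborel g = integral\<^sup>L lborel (\<lambda>z. - \<i> * of_real e * ((Xx z * \<Psi>y z - Xy z * \<Psi>x z) * \<Phi> z))"
  proof -
    have "of_real (jacobian \<Psi>x \<Psi>y z) * g (\<Psi> z) = - \<i> * of_real e * ((Xx z * \<Psi>y z - Xy z * \<Psi>x z) * \<Phi> z)" for z
    proof -
      have "of_real (jacobian \<Psi>x \<Psi>y z) * g (\<Psi> z) = (of_real (jacobian \<Psi>x \<Psi>y z) * B (\<Psi> z)) * \<Phi> z"
        by (simp add: g_def inv)
      then show ?thesis unfolding key by (simp only: mult.assoc)
    qed
    then show ?thesis by (simp only: cov[symmetric])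
  qed
  also have "\<dots> = integral\<^sup>L lebesgue (\<lambda>z. - \<i> * of_real e * ((Xx z * \<Psi>y z - Xy z * \<Psi>x z) * \<Phi> z))"
    by (rule lebesgue_integral_continuous(3)[OF _ K, symmetric])
      ((intro continuous_on_diff continuous_on_mult continuous_on_const cXxy c\<Psi>xy \<Phi>(1)), simp add: Xx0)
  also have "(\<lambda>z. - \<i> * of_real e * ((Xx z * \<Psi>y z - Xy z * \<Psi>x z) * \<Phi> z)) =
      (\<lambda>z. - \<i> * of_real e * ((X z * Q2 z + Xx z * \<Psi>y z) * \<Phi> z - (X z * Q2 z + Xy z * \<Psi>x z) * \<Phi> z))"
    by (simp add: algebra_simps)
  also have "integral\<^sup>L lebesgue \<dots> = - \<i> * of_real e * (integral\<^sup>L lebesgue (\<lambda>z. X z * \<Psi>x z * \<Phi>y z) - integral\<^sup>L lebesgue (\<lambda>z. X z * \<Psi>y z * \<Phi>x z))"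
    using i1 E1 E2 by simp
  also have "\<dots> = - \<i> * of_real e * integral\<^sup>L lebesgue (\<lambda>z. X z * \<Psi>x z * \<Phi>y z - X z * \<Psi>y z * \<Phi>x z)"
    using i2 by simp
  also have "integral\<^sup>L lebesgue (\<lambda>z. X z * \<Psi>x z * \<Phi>y z - X z * \<Psi>y z * \<Phi>x z) = integral\<^sup>L lebesgue (\<lambda>z. - 2 * \<i> * (of_real (cutoff z) * P z * p z * (\<mu> z - \<nu> z)))"
  proof (rule integral_cong_AE)
    show "(\<lambda>z. X z * \<Psi>x z * \<Phi>y z - X z * \<Psi>y z * \<Phi>x z) \<in> borel_measurable lebesgue" using i2 by (intro borel_measurable_diff) auto
    \<comment> \<open>Where the cutoff is nonzero, \<open>\<Psi> z\<close> lies in the upper half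
      plane, so the Beltrami equation of \<Phi> is available.\<close>
    have pt: "X z * \<Psi>x z * \<Phi>y z - X z * \<Psi>y z * \<Phi>x z = - 2 * \<i> * (of_real (cutoff z) * P z * p z * (\<mu> z - \<nu> z))"
      if b: "Im (\<Psi> z) > 0 \<longrightarrow> (\<Phi>x z + \<i> * \<Phi>y z) / 2 = \<mu> z * ((\<Phi>x z - \<i> * \<Phi>y z) / 2)" for z
    proof (cases "\<Psi> z \<in> cball w e")
      case True
      then have eq: "(\<Phi>x z + \<i> * \<Phi>y z) / 2 = \<mu> z * p z" using b w by (auto simp: p_def)
      have x: "\<Phi>x z = p z + \<mu> z * p z" unfolding eq[symmetric] by (simp add: p_def field_simps)
      have "\<i> * \<Phi>y z = \<mu> z * p z - p z" unfolding eq[symmetric] by (simp add: p_def field_simps)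
      then have "\<i> * (\<i> * \<Phi>y z) = \<i> * (\<mu> z * p z - p z)" by simp
      then have y: "\<Phi>y z = \<i> * (p z - \<mu> z * p z)" by (simp add: algebra_simps)
      show ?thesis unfolding x y \<Psi>x_def \<Psi>y_def X_def by (simp add: algebra_simps)
    next
      case False
      then have "cutoff z = 0" using bump_outside[OF u] by (simp add: cutoff_def)
      then show ?thesis by (simp add: X_def)
    qed
    show ae: "AE z in lebesgue. X z * \<Psi>x z * \<Phi>y z - X z * \<Psi>y z * \<Phi>x z = - 2 * \<i> * (of_real (cutoff z) * P z * p z * (\<mu> z - \<nu> z))"
      using beltrami by eventually_elim (rule pt)
    show "(\<lambda>z. - 2 * \<i> * (of_real (cutoff z) * P z * p z * (\<mu> z - \<nu> z))) \<in> borel_measurable lebesgue"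
    proof -
      have "\<Phi>x \<in> borel_measurable lebesgue" "\<Phi>y \<in> borel_measurable lebesgue" using L2 by (auto simp: L2_loc_def lebesgue_on_UNIV_eq)
      moreover have "X \<in> borel_measurable lebesgue" "P \<in> borel_measurable lebesgue" "\<nu> \<in> borel_measurable lebesgue"
        by (intro measurable_completion; use borel_measurable_continuous_onI[OF cX] borel_measurable_continuous_onI[OF cP(1)] borel_measurable_continuous_onI[OF cP(2)] in simp)+
      ultimately show ?thesis using \<mu> unfolding p_def X_def[symmetric] by measurable
    qed
  qed
  also have "\<dots> = - 2 * \<i> * integral\<^sup>L lebesgue (\<lambda>z. of_real (cutoff z) * P z * p z * (\<mu> z - \<nu> z))"
    by (rule integral_mult_right_zero)
  finally have gI: "integral\<^sup>L lborel g = - \<i> * of_real e * (- 2 * \<i> * integral\<^sup>L lebesgue (\<lambda>z. of_real (cutoff z) * P z * p z * (\<mu> z - \<nu> z)))" .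
  have "- \<i> * of_real e * (- 2 * \<i> * R) = - 2 * of_real e * R" for R :: complex by (simp add: complex_eq_iff)
  from gI[unfolded this] show "?I = - 2 * of_real e * integral\<^sup>L lebesgue (\<lambda>z. of_real (cutoff z) * P z * p z * (\<mu> z - \<nu> z))"
    unfolding g_def[abs_def] B_def \<Gamma>_def .
  \<comment> \<open>The same change of variables, now for the squared bump, yields the L2
    bound.\<close>
  define s where "s t = complex_of_real ((bump ((t - w) / of_real e))\<^sup>2)" for t
  have cs: "continuous_on UNIV s" unfolding s_def[abs_def] by (intro continuous_on_of_real continuous_on_power bb continuous_on_id)
  have s0: "s t = 0" if "t \<notin> cball w e" for t using bump_outside[OF u[OF that]] by (simp add: s_def)
  have si: "integrable lborel s" by (rule lebesgue_integral_continuous(1)[OF cs compact_cball[of w e] s0])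
  have sm: "s \<in> borel_measurable borel" by (rule borel_measurable_continuous_onI[OF cs])
  note cv = plane_change_of_variables[OF P c\<Psi>xy \<Psi>(2) J si sm]
  have ccutP: "continuous_on UNIV (\<lambda>z. complex_of_real ((cutoff z)\<^sup>2 * (norm (P z))\<^sup>2))"
    unfolding cutoff_def by (intro continuous_on_of_real continuous_on_mult continuous_on_power continuous_on_norm bb c\<Psi> cP)
  show i3: "integrable lborel (\<lambda>z. complex_of_real ((cutoff z)\<^sup>2 * (norm (P z))\<^sup>2))"
    by (rule lebesgue_integral_continuous(1)[OF ccutP K]) (use bump_outside[OF uK] in \<open>simp add: cutoff_def\<close>)
  have i3r: "integrable lborel (\<lambda>z. (cutoff z)\<^sup>2 * (norm (P z))\<^sup>2)" using integrable_Re[OF i3] by simp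
  have e4: "of_real (jacobian \<Psi>x \<Psi>y z) * s (\<Psi> z) = complex_of_real (jacobian \<Psi>x \<Psi>y z * (cutoff z)\<^sup>2)" for z by (simp add: s_def cutoff_def)
  have i4: "integrable lborel (\<lambda>z. jacobian \<Psi>x \<Psi>y z * (cutoff z)\<^sup>2)" using integrable_Re[OF cv(1)] unfolding e4 by simp
  have "(1 - k\<^sup>2) * integral\<^sup>L lborel (\<lambda>z. (cutoff z)\<^sup>2 * (norm (P z))\<^sup>2) = integral\<^sup>L lborel (\<lambda>z. (1 - k\<^sup>2) * ((cutoff z)\<^sup>2 * (norm (P z))\<^sup>2))" by simp
  also have "\<dots> \<le> integral\<^sup>L lborel (\<lambda>z. jacobian \<Psi>x \<Psi>y z * (cutoff z)\<^sup>2)"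
  proof (rule integral_mono[OF _ i4])
    show "integrable lborel (\<lambda>z. (1 - k\<^sup>2) * ((cutoff z)\<^sup>2 * (norm (P z))\<^sup>2))" using i3r by (rule integrable_mult_right)
    show "(1 - k\<^sup>2) * ((cutoff z)\<^sup>2 * (norm (P z))\<^sup>2) \<le> jacobian \<Psi>x \<Psi>y z * (cutoff z)\<^sup>2" for z
      using mult_right_mono[OF J1[of z], of "(cutoff z)\<^sup>2"] by (simp add: mult_ac)
  qed
  also have "\<dots> = Re (integral\<^sup>L lborel (\<lambda>z. complex_of_real (jacobian \<Psi>x \<Psi>y z * (cutoff z)\<^sup>2)))"
    by (simp only: integral_complex_of_real Re_complex_of_real)
  also have "\<dots> = Re (integral\<^sup>L lborel s)" using cv(2) unfolding e4 by simp
  also have "\<dots> = integral\<^sup>L lborel (\<lambda>t. (bump ((t - w) / of_real e))\<^sup>2)"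
    unfolding s_def by (simp only: integral_complex_of_real Re_complex_of_real)
  finally show "(1 - k\<^sup>2) * integral\<^sup>L lborel (\<lambda>z. (cutoff z)\<^sup>2 * (norm (P z))\<^sup>2) \<le> integral\<^sup>L lborel (\<lambda>t. (bump ((t - w) / of_real e))\<^sup>2)" .
qed

section \<open>Approximation of Beltrami coefficients\<close>

definition trig_poly :: "(complex \<Rightarrow> complex) \<Rightarrow> bool" where
  "trig_poly f \<longleftrightarrow> (\<exists>d a. (\<forall>p. p \<notin> tbox d \<longrightarrow> a p = 0) \<and> (\<forall>z. f z = tpoly d a z))"

lemma tpoly_mono:
  assumes "\<And>p. p \<notin> tbox d \<Longrightarrow> a p = 0" "d \<le> e"
  shows "tpoly e a z = tpoly d a z"
  unfolding tpoly_def using assms by (intro sum.mono_neutral_right) (auto simp: tbox_def)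

lemma trig_poly_tchar: "trig_poly (\<lambda>z. c * tchar q z)"
proof -
  define d where "d = nat (max \<bar>fst q\<bar> \<bar>snd q\<bar>)"
  have q: "q \<in> tbox d" by (cases q) (auto simp: tbox_def d_def)
  have "(\<Sum>p\<in>tbox d. (if p = q then c else 0) * tchar p z) = (\<Sum>p\<in>tbox d. if p = q then c * tchar q z else 0)" for z
    by (rule sum.cong) auto
  then have "(\<Sum>p\<in>tbox d. (if p = q then c else 0) * tchar p z) = c * tchar q z" for z using q by simp
  then show ?thesis unfolding trig_poly_def tpoly_def
    by (intro exI[of _ d] exI[of _ "\<lambda>p. if p = q then c else 0"]) (use q in auto)
qed

lemma trig_poly_const: "trig_poly (\<lambda>z. c)"
  using trig_poly_tchar[of c "(0, 0)"] by (simp add: tchar_def)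

lemma trig_poly_add:
  assumes "trig_poly f" "trig_poly g"
  shows "trig_poly (\<lambda>z. f z + g z)"
proof -
  obtain d a e b where a: "\<And>p. p \<notin> tbox d \<Longrightarrow> a p = 0" "\<And>z. f z = tpoly d a z"
    and b: "\<And>p. p \<notin> tbox e \<Longrightarrow> b p = 0" "\<And>z. g z = tpoly e b z"
    using assms unfolding trig_poly_def by metis
  have "f z + g z = tpoly (max d e) (\<lambda>p. a p + b p) z" for z
    using tpoly_mono[of d a "max d e" z, OF a(1)] tpoly_mono[of e b "max d e" z, OF b(1)]
    by (simp add: a(2) b(2)) (simp add: tpoly_def distrib_right sum.distrib)
  moreover have "a p + b p = 0" if "p \<notin> tbox (max d e)" for p
  proof -
    have "p \<notin> tbox d" "p \<notin> tbox e" using that by (auto simp: tbox_def)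
    then show ?thesis using a(1) b(1) by simp
  qed
  ultimately show ?thesis unfolding trig_poly_def
    by (intro exI[of _ "max d e"] exI[of _ "\<lambda>p. a p + b p"] conjI allI impI)
qed

lemma trig_poly_mult:
  assumes "trig_poly f" "trig_poly g"
  shows "trig_poly (\<lambda>z. f z * g z)"
proof -
  obtain d a e b where a: "\<And>z. f z = tpoly d a z"
    and b: "\<And>p. p \<notin> tbox e \<Longrightarrow> b p = 0" "\<And>z. g z = tpoly e b z"
    using assms unfolding trig_poly_def by metis
  show ?thesis unfolding trig_poly_def
  proof (intro exI conjI allI impI)
    show "tconv d a b p = 0" if "p \<notin> tbox (e + d)" for p by (rule tpoly_tconv(2)[OF b(1) that])
    show "f z * g z = tpoly (e + d) (tconv d a b) z" for z unfolding a b(2) by (rule tpoly_tconv(1)[OF b(1), symmetric])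
  qed
qed

lemma trig_poly_sin: "trig_poly (\<lambda>z. of_real (sin (Re z)))" "trig_poly (\<lambda>z. of_real (sin (Im z)))"
proof -
  have "(\<lambda>z. complex_of_real (sin (Re z))) = (\<lambda>z. - \<i> / 2 * tchar (1, 0) z + \<i> / 2 * tchar (- 1, 0) z)"
    "(\<lambda>z. complex_of_real (sin (Im z))) = (\<lambda>z. - \<i> / 2 * tchar (0, 1) z + \<i> / 2 * tchar (0, - 1) z)"
    by (auto simp: tchar_def complex_eq_iff fun_eq_iff)
  then show "trig_poly (\<lambda>z. of_real (sin (Re z)))" "trig_poly (\<lambda>z. of_real (sin (Im z)))"
    by (simp_all only: trig_poly_add trig_poly_tchar)
qed

text \<open>The functions whose composition with (sin x, sin y) is a trigonometric polynomial form
  an algebra containing both coordinates, so Stone-Weierstrass applies on the square.\<close>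

lemma trig_poly_approx:
  fixes u :: "real \<times> real \<Rightarrow> real"
  assumes u: "continuous_on ({-1..1} \<times> {-1..1}) u" and e: "e > 0"
  obtains t :: "real \<times> real \<Rightarrow> real" where "trig_poly (\<lambda>z. of_real (t (sin (Re z), sin (Im z))))"
    "\<And>p. p \<in> {-1..1} \<times> {-1..1} \<Longrightarrow> \<bar>t p - u p\<bar> < e"
proof -
  define S where "S = {-1..1::real} \<times> {-1..1::real}"
  define A where "A f \<longleftrightarrow> continuous_on S f \<and> trig_poly (\<lambda>z. of_real (f (sin (Re z), sin (Im z))))" for f :: "real \<times> real \<Rightarrow> real"
  have "\<exists>t. A t \<and> (\<forall>p\<in>S. \<bar>u p - t p\<bar> < e)"
  proof (rule Stone_Weierstrass_HOL)
    show "compact S" unfolding S_def by (intro compact_Times) auto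
    show "A (\<lambda>x. c)" for c by (auto simp: A_def trig_poly_const)
    show "continuous_on S f" if "A f" for f using that by (simp add: A_def)
    show "A (\<lambda>x. f x + g x)" if "A f \<and> A g" for f g
      using that trig_poly_add unfolding A_def of_real_add by (blast intro: continuous_on_add)
    show "A (\<lambda>x. f x * g x)" if "A f \<and> A g" for f g
      using that trig_poly_mult unfolding A_def of_real_mult by (blast intro: continuous_on_mult)
    show "\<exists>f. A f \<and> f x \<noteq> f y" if "x \<in> S \<and> y \<in> S \<and> x \<noteq> y" for x y
    proof -
      have "A fst" "A snd" unfolding A_def using trig_poly_sin by (auto intro!: continuous_intros)
      then show ?thesis using that by (metis prod_eqI)
    qed
    show "continuous_on S u" using u by (simp add: S_def)
  qed (rule e)
  then obtain t where "A t" "\<And>p. p \<in> S \<Longrightarrow> \<bar>u p - t p\<bar> < e" by blast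
  then show thesis using that by (auto simp: A_def S_def abs_minus_commute)
qed

text \<open>The substitution \<open>x \<mapsto> arcsin (sin x)\<close> folds the plane onto a square, which turns polynomial
  approximation on that square into trigonometric approximation with a global bound.\<close>

lemma trig_symmetric_approx:
  fixes g :: "complex \<Rightarrow> complex"
  assumes g: "continuous_on UNIV g" "\<And>z. norm (g z) \<le> k" "k < 1" "\<And>z. g (cnj z) = cnj (g z)"
    and R: "R > 0" and e: "e > 0"
  obtains d m h where "sym_trig_coeff d m" "h > 0"
    "\<And>z. norm z \<le> R \<Longrightarrow> norm (tpoly d m (of_real h * z) - g z) \<le> e"
proof -
  \<comment> \<open>Scaled so that the disk of radius R goes into the range where arcsin inverts
    sin.\<close>
  define h where "h = 1 / R"
  have h: "h > 0" using R by (simp add: h_def)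
  define c where "c p = Complex (arcsin (fst p) / h) (arcsin (snd p) / h)" for p :: "real \<times> real"
  let ?S = "{-1..1::real} \<times> {-1..1::real}"
  have cc: "continuous_on ?S c"
    unfolding c_def by (intro continuous_intros) (use h in auto)
  have gc: "continuous_on ?S (\<lambda>p. g (c p))" by (rule continuous_on_compose2[OF g(1) cc]) auto
  \<comment> \<open>The errors of real and imaginary part add up to 2 e', which is at most e and
    keeps the norm within k + (1 - k) = 1 on the whole plane.\<close>
  define e' where "e' = min e (1 - k) / 2"
  have e': "e' > 0" using e g(3) by (simp add: e'_def)
  obtain t1 where t1: "trig_poly (\<lambda>z. of_real (t1 (sin (Re z), sin (Im z))))" "\<And>p. p \<in> ?S \<Longrightarrow> \<bar>t1 p - Re (g (c p))\<bar> < e'"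
    using trig_poly_approx[OF continuous_on_Re[OF gc] e'] by blast
  obtain t2 where t2: "trig_poly (\<lambda>z. of_real (t2 (sin (Re z), sin (Im z))))" "\<And>p. p \<in> ?S \<Longrightarrow> \<bar>t2 p - Im (g (c p))\<bar> < e'"
    using trig_poly_approx[OF continuous_on_Im[OF gc] e'] by blast
  define T where "T z = complex_of_real (t1 (sin (Re z), sin (Im z))) + \<i> * of_real (t2 (sin (Re z), sin (Im z)))" for z
  have "trig_poly T" unfolding T_def[abs_def] by (intro trig_poly_add trig_poly_mult trig_poly_const t1 t2)
  then obtain d a where a: "\<And>p. p \<notin> tbox d \<Longrightarrow> a p = 0" "\<And>z. T z = tpoly d a z" unfolding trig_poly_def by metis
  have close: "norm (T z - g (c (sin (Re z), sin (Im z)))) \<le> 2 * e'" for z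
  proof -
    let ?p = "(sin (Re z), sin (Im z))"
    have p: "?p \<in> ?S" by auto
    have "norm (T z - g (c ?p)) \<le> \<bar>Re (T z - g (c ?p))\<bar> + \<bar>Im (T z - g (c ?p))\<bar>" by (rule cmod_le)
    also have "\<dots> \<le> 2 * e'" using t1(2)[OF p] t2(2)[OF p] by (simp add: T_def)
    finally show ?thesis .
  qed
  have bd: "norm (T z) \<le> 1" for z
  proof -
    have "norm (T z) \<le> norm (g (c (sin (Re z), sin (Im z)))) + norm (T z - g (c (sin (Re z), sin (Im z))))"
      by (metis norm_triangle_sub)
    also have "\<dots> \<le> k + 2 * e'" by (intro add_mono g close)
    also have "\<dots> \<le> 1" by (simp add: e'_def)
    finally show ?thesis .
  qed
  have cl: "norm (T (of_real h * z) - g z) \<le> e" if z: "norm z \<le> R" for z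
  proof -
    have "\<bar>h * Re z\<bar> \<le> 1" "\<bar>h * Im z\<bar> \<le> 1"
      using order_trans[OF abs_Re_le_cmod z] order_trans[OF abs_Im_le_cmod z] R by (auto simp: h_def abs_mult)
    then have "\<bar>h * Re z\<bar> \<le> pi / 2" "\<bar>h * Im z\<bar> \<le> pi / 2" using pi_gt3 by linarith+
    then have "arcsin (sin (h * Re z)) = h * Re z" "arcsin (sin (h * Im z)) = h * Im z"
      by (auto intro!: arcsin_sin)
    then have "c (sin (Re (of_real h * z)), sin (Im (of_real h * z))) = z" using h by (simp add: c_def complex_eq_iff)
    then have "norm (T (of_real h * z) - g z) \<le> 2 * e'" using close[of "of_real h * z"] by simp
    then show ?thesis by (simp add: e'_def)
  qed
  \<comment> \<open>Averaging with the reflected polynomial produces the symmetry; the norm bound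
    survives, and so does the approximation because g is symmetric.\<close>
  define m where "m p = (a p + cnj (a (- fst p, snd p))) / 2" for p
  have refl: "tpoly d (\<lambda>p. cnj (a (- fst p, snd p))) z = cnj (tpoly d a (cnj z))" for z
  proof -
    have "tchar (- fst p, snd p) z = cnj (tchar p (cnj z))" for p by (simp add: tchar_def cis_cnj algebra_simps)
    then have "cnj (tpoly d a (cnj z)) = (\<Sum>p\<in>tbox d. cnj (a p) * tchar (- fst p, snd p) z)"
      unfolding tpoly_def by simp
    also have "\<dots> = (\<Sum>p\<in>tbox d. (\<lambda>p. cnj (a (- fst p, snd p)) * tchar p z) (- fst p, snd p))" by simp
    also have "\<dots> = (\<Sum>p\<in>tbox d. cnj (a (- fst p, snd p)) * tchar p z)"
      by (rule sum.reindex_bij_betw[OF bij_betw_tbox_reflect])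
    finally show ?thesis by (simp add: tpoly_def)
  qed
  have m: "tpoly d m z = (T z + cnj (T (cnj z))) / 2" for z
    unfolding a(2) refl[symmetric] unfolding tpoly_def m_def sum.distrib[symmetric] sum_divide_distrib
    by (rule sum.cong) (simp_all add: field_simps)
  show thesis
  proof (rule that[OF _ h])
    show "sym_trig_coeff d m"
    proof
      show "m p = 0" if "p \<notin> tbox d" for p
      proof -
        have "(- fst p, snd p) \<notin> tbox d" using that by (cases p) (auto simp: tbox_def)
        then show ?thesis using a(1) that by (simp add: m_def)
      qed
      show "norm (tpoly d m z) \<le> 1" for z
        using norm_triangle_ineq[of "T z" "cnj (T (cnj z))"] bd[of z] bd[of "cnj z"] by (simp add: m norm_divide)
      show "trig_symmetric m" by (auto simp: trig_symmetric_def m_def add.commute)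
    qed
    show "norm (tpoly d m (of_real h * z) - g z) \<le> e" if z: "norm z \<le> R" for z
    proof -
      define X where "X = T (of_real h * z) - g z"
      define Y where "Y = T (of_real h * cnj z) - g (cnj z)"
      have XY: "norm X \<le> e" "norm Y \<le> e" using cl[OF z] cl[of "cnj z"] z by (simp_all add: X_def Y_def)
      have "(a + b) / 2 - c = ((a - c) + (b - c)) / 2" for a b c :: complex by (simp add: field_simps)
      moreover have "cnj Y = cnj (T (cnj (of_real h * z))) - g z" by (simp add: Y_def g(4))
      ultimately have "tpoly d m (of_real h * z) - g z = (X + cnj Y) / 2" unfolding m X_def by metis
      also have "norm \<dots> \<le> (e + e) / 2"
        using norm_triangle_ineq[of X "cnj Y"] XY by (simp add: norm_divide)
      finally show ?thesis by simp
    qed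
  qed
qed

text \<open>Only the upper half plane is approximated; the lower one receives the reflected
  coefficient, so the approximants are symmetric although \<mu> may fail to be. Truncation to norm k
  and division by k' leave the norm at most k / k' < 1, the room that
  \<open>trig_symmetric_approx\<close> needs.\<close>

lemma beltrami_coefficient_approx:
  fixes \<mu> :: "complex \<Rightarrow> complex"
  assumes \<mu>: "\<mu> \<in> borel_measurable lebesgue" "AE z in lebesgue. norm (\<mu> z) \<le> k" and k: "0 \<le> k" "k < k'"
  obtains d :: "nat \<Rightarrow> nat" and m h where "\<And>n. sym_trig_coeff (d n) (m n)" "\<And>n. h n > 0"
    "AE z in lebesgue. Im z > 0 \<longrightarrow> (\<lambda>n. of_real k' * tpoly (d n) (m n) (of_real (h n) * z)) \<longlonglongrightarrow> \<mu> z"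
proof -
  have k': "k' > 0" using k by simp
  have "\<mu> measurable_on UNIV" using \<mu>(1) by (intro lebesgue_measurable_imp_measurable_on) auto
  then obtain N g where N: "negligible N" and g: "\<And>n. continuous_on UNIV (g n :: complex \<Rightarrow> complex)"
    "\<And>x. x \<notin> N \<Longrightarrow> (\<lambda>n. g n x) \<longlonglongrightarrow> \<mu> x" unfolding measurable_on_def by auto
  define c where "c n z = closest_point (cball 0 k) (g n z) / of_real k'" for n z
  have cp: "continuous_on UNIV (closest_point (cball (0::complex) k))"
    by (rule continuous_on_closest_point) (use k in auto)
  have cc: "continuous_on UNIV (c n)" for n
    unfolding c_def[abs_def] by (intro continuous_on_divide continuous_on_compose2[OF cp g(1)] continuous_on_const) (use k' in auto)
  have cb: "norm (c n z) \<le> k / k'" for n z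
  proof -
    have "closest_point (cball 0 k) (g n z) \<in> cball 0 k" by (rule closest_point_in_set) (use k in auto)
    then show ?thesis using k' by (simp add: c_def norm_divide divide_right_mono)
  qed
  \<comment> \<open>A ramp that is 0 for y \<le> 0 and 1 once n y \<ge> 1; it lets the two halves
    join continuously along the real line.\<close>
  define \<theta> where "\<theta> n y = max 0 (min 1 (real n * y))" for n y
  have \<theta>: "0 \<le> \<theta> n y" "\<theta> n y \<le> 1" "y \<le> 0 \<Longrightarrow> \<theta> n y = 0" for n y
    by (auto simp: \<theta>_def mult_le_0_iff min_le_iff_disj)
  have c\<theta>: "continuous_on S (\<lambda>z. of_real (\<theta> n (f z)) :: complex)" if "continuous_on S f" for S n and f :: "complex \<Rightarrow> real"
    unfolding \<theta>_def by (intro continuous_intros that)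
  define s where "s n z = of_real (\<theta> n (Im z)) * c n z + of_real (\<theta> n (- Im z)) * cnj (c n (cnj z))" for n z
  have cs: "continuous_on UNIV (s n)" for n
    unfolding s_def[abs_def]
    by (intro continuous_on_add continuous_on_mult c\<theta> continuous_on_cnj cc continuous_on_compose2[OF cc]) (auto intro!: continuous_intros)
  have sb: "norm (s n z) \<le> k / k'" for n z
  proof (cases "Im z \<ge> 0")
    case True
    then have "norm (s n z) = \<theta> n (Im z) * norm (c n z)" using \<theta>(1)[of n "Im z"] by (simp add: s_def \<theta>(3) norm_mult)
    also have "\<dots> \<le> 1 * (k / k')" by (intro mult_mono \<theta> cb) auto
    finally show ?thesis by simp
  next
    case False
    then have "norm (s n z) = \<theta> n (- Im z) * norm (c n (cnj z))" using \<theta>(1)[of n "- Im z"] by (simp add: s_def \<theta>(3) norm_mult)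
    also have "\<dots> \<le> 1 * (k / k')" by (intro mult_mono \<theta> cb) auto
    finally show ?thesis by simp
  qed
  have ss: "s n (cnj z) = cnj (s n z)" for n z by (simp add: s_def)
  have kk: "k / k' < 1" using k k' by simp
  have "\<exists>d m h. sym_trig_coeff d m \<and> h > 0 \<and> (\<forall>z. norm z \<le> real n + 1 \<longrightarrow> norm (tpoly d m (of_real h * z) - s n z) \<le> 1 / (real n + 1))" for n
  proof -
    have "real n + 1 > 0" "1 / (real n + 1) > 0" by auto
    from trig_symmetric_approx[OF cs sb kk ss this] show ?thesis by metis
  qed
  then obtain d m h where A: "\<And>n. sym_trig_coeff (d n) (m n)" "\<And>n. h n > 0"
    "\<And>n z. norm z \<le> real n + 1 \<Longrightarrow> norm (tpoly (d n) (m n) (of_real (h n) * z) - s n z) \<le> 1 / (real n + 1)" by metis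
  have ae: "AE z in lebesgue. z \<notin> N"
    using AE_not_in[of N lebesgue] N by (simp add: negligible_iff_null_sets)
  have "AE z in lebesgue. Im z > 0 \<longrightarrow> (\<lambda>n. of_real k' * tpoly (d n) (m n) (of_real (h n) * z)) \<longlonglongrightarrow> \<mu> z"
    using ae \<mu>(2)
  proof (eventually_elim, intro impI)
    fix z assume z: "z \<notin> N" "norm (\<mu> z) \<le> k" "Im z > 0"
    have "(\<lambda>n. closest_point (cball 0 k) (g n z)) \<longlonglongrightarrow> closest_point (cball 0 k) (\<mu> z)"
      by (rule isCont_tendsto_compose[OF _ g(2)[OF z(1)]]) (use cp in \<open>auto simp: continuous_on_eq_continuous_at\<close>)
    moreover have "closest_point (cball 0 k) (\<mu> z) = \<mu> z" by (rule closest_point_self) (use z in auto)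
    ultimately have "(\<lambda>n. c n z) \<longlonglongrightarrow> \<mu> z / of_real k'" unfolding c_def using k' by (intro tendsto_divide) auto
    moreover have "eventually (\<lambda>n. c n z = s n z) sequentially"
      using eventually_ge_at_top[of "nat \<lceil>1 / Im z\<rceil>"]
    proof eventually_elim
      fix n assume "n \<ge> nat \<lceil>1 / Im z\<rceil>"
      then have "1 / Im z \<le> real n" by linarith
      then have "1 \<le> real n * Im z" using z(3) by (simp add: field_simps)
      then show "c n z = s n z" using z(3) \<theta>(3)[of "- Im z" n] by (simp add: s_def) (simp add: \<theta>_def)
    qed
    ultimately have 1: "(\<lambda>n. s n z) \<longlonglongrightarrow> \<mu> z / of_real k'" by (rule Lim_transform_eventually)
    have 2: "(\<lambda>n. tpoly (d n) (m n) (of_real (h n) * z) - s n z) \<longlonglongrightarrow> 0"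
    proof (rule Lim_null_comparison)
      show "(\<lambda>n. 1 / (real n + 1)) \<longlonglongrightarrow> 0" using LIMSEQ_inverse_real_of_nat by (simp add: inverse_eq_divide add.commute)
      show "eventually (\<lambda>n. norm (tpoly (d n) (m n) (of_real (h n) * z) - s n z) \<le> 1 / (real n + 1)) sequentially"
        using eventually_ge_at_top[of "nat \<lceil>norm z\<rceil>"] by eventually_elim (rule A(3), linarith)
    qed
    from tendsto_mult[OF tendsto_const[of "of_real k'"] tendsto_add[OF 2 1]] show
      "(\<lambda>n. of_real k' * tpoly (d n) (m n) (of_real (h n) * z)) \<longlonglongrightarrow> \<mu> z" using k' by simp
  qed
  with A(1,2) show thesis by (rule that)
qed

section \<open>Compactness of inverse motions\<close>

text \<open>An Arzela-Ascoli argument: the inverse maps are locally bounded by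
  \<open>motion_proper\<close> and equicontinuous by \<open>motion_lower\<close>, so convergence on
  a countable dense set propagates. Equicontinuity of the maps themselves, from
  \<open>motion_equicontinuous\<close>, makes the limit invertible.\<close>

lemma inverse_motion_subsequence:
  fixes f :: "nat \<Rightarrow> complex \<Rightarrow> complex \<Rightarrow> complex"
  assumes m: "\<And>n. holo_motion UNIV (f n)" and k: "0 \<le> k" "k < 1"
    and bij: "\<And>n. bij (\<lambda>z. f n z (of_real k))"
  obtains r G where "strict_mono (r :: nat \<Rightarrow> nat)"
    "\<And>n. continuous_on UNIV (inv (\<lambda>z. f n z (of_real k)))"
    "\<And>R. \<exists>R'. \<forall>n t. norm t \<le> R \<longrightarrow> norm (inv (\<lambda>z. f n z (of_real k)) t) \<le> R'"
    "\<And>t. (\<lambda>n. inv (\<lambda>z. f (r n) z (of_real k)) t) \<longlonglongrightarrow> G t"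
    "continuous_on UNIV G" "bij G" "\<And>R. \<exists>R'. \<forall>t. norm (G t) \<le> R \<longrightarrow> norm t \<le> R'"
    "\<And>x. (\<lambda>n. f (r n) x (of_real k)) \<longlonglongrightarrow> inv G x"
proof -
  define \<rho> where "\<rho> = (k + 1) / 2"
  have \<rho>: "0 < \<rho>" "\<rho> < 1" using k by (auto simp: \<rho>_def)
  have k\<rho>: "norm (complex_of_real k) \<le> \<rho>" using k by (simp add: \<rho>_def)
  define \<Psi> where "\<Psi> n z = f n z (of_real k)" for n z
  define \<Gamma> where "\<Gamma> n = inv (\<Psi> n)" for n
  have \<Gamma>f: "inv (\<lambda>z. f n z (of_real k)) = \<Gamma> n" for n by (simp add: \<Gamma>_def \<Psi>_def[abs_def])
  have inv: "\<Psi> n (\<Gamma> n t) = t" "\<Gamma> n (\<Psi> n t) = t" for n t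
  proof -
    have "bij (\<Psi> n)" using bij[of n] by (simp add: \<Psi>_def[abs_def])
    then show "\<Psi> n (\<Gamma> n t) = t" "\<Gamma> n (\<Psi> n t) = t" by (simp_all add: \<Gamma>_def bij_def surj_f_inv_f)
  qed
  have bnd: "\<exists>R'. \<forall>n t. norm t \<le> R \<longrightarrow> norm (\<Gamma> n t) \<le> R'" for R
  proof -
    obtain R' where R': "\<And>X f x l. holo_motion X f \<Longrightarrow> x \<in> X \<Longrightarrow> norm l \<le> \<rho> \<Longrightarrow> norm (f x l) \<le> R \<Longrightarrow> norm x \<le> R'"
      using motion_proper[OF \<rho>] by blast
    have "norm (\<Gamma> n t) \<le> R'" if "norm t \<le> R" for n t
      by (rule R'[OF m[of n] UNIV_I k\<rho>]) (use inv(1)[of n t] that in \<open>simp add: \<Psi>_def\<close>)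
    then show ?thesis by blast
  qed
  have equi: "\<exists>\<delta>>0. \<forall>n s t. norm s \<le> R \<longrightarrow> norm (t - s) < \<delta> \<longrightarrow> norm (\<Gamma> n t - \<Gamma> n s) \<le> e" if e: "e > 0" for R e
  proof -
    obtain R' where R': "\<And>n t. norm t \<le> R \<Longrightarrow> norm (\<Gamma> n t) \<le> R'" using bnd by blast
    define S where "S = schottky_bound \<rho> ((max R' 0 + 1) / e)"
    have S: "S \<ge> 1" unfolding S_def by (rule schottky_bound_ge_1[OF \<rho>]) (use e in auto)
    \<comment> \<open>If the preimages were more than e apart, \<open>motion_lower\<close> would
      keep s and t at distance at least 1 / (2 S).\<close>
    have "norm (\<Gamma> n t - \<Gamma> n s) \<le> e" if s: "norm s \<le> R" and t: "norm (t - s) < 1 / (2 * S)" for n s t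
    proof (rule ccontr)
      assume "\<not> ?thesis"
      then have gt: "norm (\<Gamma> n t - \<Gamma> n s) > e" by simp
      then have ne: "\<Gamma> n s \<noteq> \<Gamma> n t" using e by auto
      have "(norm (\<Gamma> n s) + 1) / norm (\<Gamma> n t - \<Gamma> n s) \<le> (max R' 0 + 1) / e"
        by (rule frac_le) (use R'[OF s, of n] gt e in auto)
      then have 1: "schottky_bound \<rho> ((norm (\<Gamma> n s) + 1) / norm (\<Gamma> n t - \<Gamma> n s)) \<le> S"
        unfolding S_def by (rule schottky_bound_mono)
      have "1 \<le> 2 * schottky_bound \<rho> ((norm (\<Gamma> n s) + 1) / norm (\<Gamma> n t - \<Gamma> n s)) * norm (t - s)"
        using motion_lower[OF m[of n] UNIV_I UNIV_I ne \<rho> k\<rho>] unfolding \<Psi>_def[symmetric] inv .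
      also have "\<dots> \<le> 2 * S * norm (t - s)" using 1 by (intro mult_right_mono) auto
      also have "\<dots> < 1" using t S by (simp add: field_simps)
      finally show False by simp
    qed
    then show ?thesis using S by (intro exI[of _ "1 / (2 * S)"]) auto
  qed
  have equi\<Psi>: "\<exists>\<delta>>0. \<forall>n x y. norm x \<le> R \<longrightarrow> norm (y - x) \<le> \<delta> \<longrightarrow> norm (\<Psi> n y - \<Psi> n x) \<le> e" if e: "e > 0" for R e
  proof -
    obtain \<delta> where "\<delta> > 0" "\<And>X f x y l. holo_motion X f \<Longrightarrow> x \<in> X \<Longrightarrow> y \<in> X \<Longrightarrow> norm x \<le> R \<Longrightarrow> norm (y - x) \<le> \<delta> \<Longrightarrow> norm l \<le> \<rho>
        \<Longrightarrow> norm (f y l - f x l) \<le> e" using motion_equicontinuous[OF \<rho> e, of R] by blast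
    then show ?thesis using m k\<rho> unfolding \<Psi>_def by (intro exI[of _ \<delta>]) blast
  qed
  have cont: "continuous_on UNIV g" if ec: "\<And>R e. e > 0 \<Longrightarrow> \<exists>\<delta>>0. \<forall>s t. norm s \<le> R \<longrightarrow> norm (t - s) < \<delta> \<longrightarrow> norm (g t - g s) \<le> e"
    for g :: "complex \<Rightarrow> complex"
    unfolding continuous_on_iff
  proof (intro ballI allI impI)
    fix x :: complex and e :: real assume "e > 0"
    then obtain \<delta> where "\<delta> > 0" "\<And>s t. norm s \<le> norm x \<Longrightarrow> norm (t - s) < \<delta> \<Longrightarrow> norm (g t - g s) \<le> e / 2"
      using ec[of "e / 2" "norm x"] by auto
    then show "\<exists>d>0. \<forall>x'\<in>UNIV. dist x' x < d \<longrightarrow> dist (g x') (g x) < e"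
      using \<open>e > 0\<close> by (intro exI[of _ \<delta>]) (force simp: dist_norm)
  qed
  have c\<Gamma>: "continuous_on UNIV (\<Gamma> n)" for n
  proof (rule cont)
    fix R e :: real assume "e > 0"
    then obtain \<delta> where "\<delta> > 0" "\<And>n s t. norm s \<le> R \<Longrightarrow> norm (t - s) < \<delta> \<Longrightarrow> norm (\<Gamma> n t - \<Gamma> n s) \<le> e"
      using equi[of e R] by auto
    then show "\<exists>\<delta>>0. \<forall>s t. norm s \<le> R \<longrightarrow> norm (t - s) < \<delta> \<longrightarrow> norm (\<Gamma> n t - \<Gamma> n s) \<le> e"
      by (intro exI[of _ \<delta>]) simp
  qed
  obtain D :: "complex set" where D: "countable D" "\<And>X. open X \<Longrightarrow> X \<noteq> {} \<Longrightarrow> \<exists>d\<in>D. d \<in> X"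
    using countable_dense_setE by blast
  \<comment> \<open>The bound depends on the point; dividing by \<open>1 + B x\<close> brings all
    values into the unit disk for the diagonal extraction.\<close>
  have "\<exists>b. \<forall>n s. norm s \<le> norm t \<longrightarrow> norm (\<Gamma> n s) \<le> b" for t :: complex using bnd by metis
  then obtain B where B: "\<And>n s t :: complex. norm s \<le> norm t \<Longrightarrow> norm (\<Gamma> n s) \<le> B t" by metis
  have B0: "B t \<ge> 0" for t using order_trans[OF norm_ge_zero B[of t t]] by simp
  obtain r where r: "strict_mono (r :: nat \<Rightarrow> nat)" "\<And>x. x \<in> D \<Longrightarrow> \<exists>l. (\<lambda>n. \<Gamma> (r n) x / of_real (1 + B x)) \<longlonglongrightarrow> l"
  proof (rule function_convergent_subsequence[OF D(1), of "\<lambda>n x. \<Gamma> n x / of_real (1 + B x)" 1])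
    fix n x
    have "norm (of_real (1 + B x) :: complex) = 1 + B x" using B0[of x] by (simp only: norm_of_real)
    then show "norm (\<Gamma> n x / of_real (1 + B x)) \<le> 1" using B[of x x n] B0[of x] by (simp add: norm_divide del: of_real_add)
  qed blast
  have convD: "convergent (\<lambda>n. \<Gamma> (r n) x)" if "x \<in> D" for x
  proof -
    obtain l where "(\<lambda>n. \<Gamma> (r n) x / of_real (1 + B x)) \<longlonglongrightarrow> l" using r(2)[OF \<open>x \<in> D\<close>] by blast
    from tendsto_mult[OF this tendsto_const[of "of_real (1 + B x)"]]
    have "(\<lambda>n. \<Gamma> (r n) x / of_real (1 + B x) * of_real (1 + B x)) \<longlonglongrightarrow> l * of_real (1 + B x)" .
    moreover have "(of_real (1 + B x) :: complex) \<noteq> 0" using B0[of x] by (simp only: of_real_eq_0_iff)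
    ultimately show ?thesis by (auto simp: convergent_def simp del: of_real_add)
  qed
  have conv: "convergent (\<lambda>n. \<Gamma> (r n) t)" for t
  proof -
    have "Cauchy (\<lambda>n. \<Gamma> (r n) t)"
    proof (rule metric_CauchyI)
      fix e :: real assume e: "e > 0"
      obtain \<delta> where \<delta>: "\<delta> > 0" "\<And>n s. norm (s - t) < \<delta> \<Longrightarrow> norm (\<Gamma> n s - \<Gamma> n t) \<le> e / 4"
        using equi[of "e / 4" "norm t"] e by auto
      obtain d where d: "d \<in> D" "d \<in> ball t \<delta>" using D(2)[of "ball t \<delta>"] \<delta>(1) by auto
      have dt: "dist (\<Gamma> n d) (\<Gamma> n t) \<le> e / 4" for n using \<delta>(2)[of d n] d(2) by (simp add: dist_norm norm_minus_commute)
      have "Cauchy (\<lambda>n. \<Gamma> (r n) d)" using convD[OF d(1)] by (simp add: Cauchy_convergent_iff)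
      then obtain N where N: "\<And>a b. a \<ge> N \<Longrightarrow> b \<ge> N \<Longrightarrow> dist (\<Gamma> (r a) d) (\<Gamma> (r b) d) < e / 4"
        using e unfolding Cauchy_def by (meson divide_pos_pos zero_less_numeral)
      have "dist (\<Gamma> (r a) t) (\<Gamma> (r b) t) < e" if "a \<ge> N" "b \<ge> N" for a b
        using dt[of "r a"] dt[of "r b"] N[OF that] dist_triangle[of "\<Gamma> (r a) t" "\<Gamma> (r b) t" "\<Gamma> (r a) d"]
          dist_triangle[of "\<Gamma> (r a) d" "\<Gamma> (r b) t" "\<Gamma> (r b) d"] e by (simp add: dist_commute)
      then show "\<exists>N. \<forall>a\<ge>N. \<forall>b\<ge>N. dist (\<Gamma> (r a) t) (\<Gamma> (r b) t) < e" by blast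
    qed
    then show ?thesis by (simp add: Cauchy_convergent_iff)
  qed
  define G where "G t = lim (\<lambda>n. \<Gamma> (r n) t)" for t
  have G: "(\<lambda>n. \<Gamma> (r n) t) \<longlonglongrightarrow> G t" for t using conv by (simp add: G_def convergent_LIMSEQ_iff)
  have cG: "continuous_on UNIV G"
  proof (rule cont)
    fix R e :: real assume "e > 0"
    then obtain \<delta> where \<delta>: "\<delta> > 0" "\<And>n s t. norm s \<le> R \<Longrightarrow> norm (t - s) < \<delta> \<Longrightarrow> norm (\<Gamma> n t - \<Gamma> n s) \<le> e"
      using equi[of e R] by auto
    have "norm (G t - G s) \<le> e" if "norm s \<le> R" "norm (t - s) < \<delta>" for s t
      by (rule LIMSEQ_le_const2[OF tendsto_norm[OF tendsto_diff[OF G G]]]) (use \<delta>(2)[OF that] in blast)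
    then show "\<exists>\<delta>>0. \<forall>s t. norm s \<le> R \<longrightarrow> norm (t - s) < \<delta> \<longrightarrow> norm (G t - G s) \<le> e" using \<delta>(1) by blast
  qed
  have \<Psi>G: "(\<lambda>n. \<Psi> (r n) (G t)) \<longlonglongrightarrow> t" for t
  proof (rule LIMSEQ_I)
    fix e :: real assume e: "e > 0"
    then obtain \<delta> where \<delta>: "\<delta> > 0" "\<And>n y. norm (y - G t) \<le> \<delta> \<Longrightarrow> norm (\<Psi> n y - \<Psi> n (G t)) \<le> e / 2"
      using equi\<Psi>[of "e / 2" "norm (G t)"] by auto
    obtain N where "\<And>n. n \<ge> N \<Longrightarrow> norm (\<Gamma> (r n) t - G t) < \<delta>" using LIMSEQ_D[OF G \<delta>(1)] by blast
    then have "norm (t - \<Psi> (r n) (G t)) \<le> e / 2" if "n \<ge> N" for n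
      using \<delta>(2)[of "\<Gamma> (r n) t" "r n"] that by (simp add: inv less_imp_le)
    then have "norm (\<Psi> (r n) (G t) - t) < e" if "n \<ge> N" for n using that e by (fastforce simp: norm_minus_commute)
    then show "\<exists>N. \<forall>n\<ge>N. norm (\<Psi> (r n) (G t) - t) < e" by blast
  qed
  have injG: "inj G"
  proof (rule injI)
    fix s t assume "G s = G t"
    then show "s = t" using \<Psi>G[of s] \<Psi>G[of t] LIMSEQ_unique by auto
  qed
  \<comment> \<open>The images of x stay bounded; at any limit point t of them the equicontinuous
    inverse maps converge to x along a subsequence.\<close>
  have "\<exists>t. G t = x" for x
  proof -
    have bx: "norm (\<Psi> n x) \<le> schottky_bound \<rho> (norm x)" for n
      unfolding \<Psi>_def by (rule motion_bounded[OF m UNIV_I \<rho> k\<rho>])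
    then have "bounded (range (\<lambda>n. \<Psi> (r n) x))" by (auto simp: bounded_iff)
    then obtain t q where q: "strict_mono (q :: nat \<Rightarrow> nat)" "((\<lambda>n. \<Psi> (r n) x) \<circ> q) \<longlonglongrightarrow> t"
      using bounded_imp_convergent_subsequence by blast
    have "(\<lambda>n. \<Gamma> (r (q n)) t) \<longlonglongrightarrow> x"
    proof (rule LIMSEQ_I)
      fix e :: real assume e: "e > 0"
      obtain \<delta> where \<delta>: "\<delta> > 0" "\<And>n s. norm (s - t) < \<delta> \<Longrightarrow> norm (\<Gamma> n s - \<Gamma> n t) \<le> e / 2"
        using equi[of "e / 2" "norm t"] e by auto
      obtain N where "\<And>n. n \<ge> N \<Longrightarrow> norm (\<Psi> (r (q n)) x - t) < \<delta>" using LIMSEQ_D[OF q(2) \<delta>(1)] by auto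
      then have "norm (x - \<Gamma> (r (q n)) t) \<le> e / 2" if "n \<ge> N" for n
        using \<delta>(2)[of "\<Psi> (r (q n)) x" "r (q n)"] that by (simp add: inv)
      then have "norm (\<Gamma> (r (q n)) t - x) < e" if "n \<ge> N" for n using that e by (fastforce simp: norm_minus_commute)
      then show "\<exists>N. \<forall>n\<ge>N. norm (\<Gamma> (r (q n)) t - x) < e" by blast
    qed
    moreover have "(\<lambda>n. \<Gamma> (r (q n)) t) \<longlonglongrightarrow> G t" using LIMSEQ_subseq_LIMSEQ[OF G q(1)] by (simp add: o_def)
    ultimately show ?thesis using LIMSEQ_unique by blast
  qed
  then have bijG: "bij G" using injG by (metis bijI surjI)
  have proper: "\<exists>R'. \<forall>t. norm (G t) \<le> R \<longrightarrow> norm t \<le> R'" for R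
  proof (intro exI allI impI)
    fix t assume t: "norm (G t) \<le> R"
    have "norm (\<Psi> n (G t)) \<le> schottky_bound \<rho> R" for n
      using motion_bounded[OF m[of n] UNIV_I[of "G t"] \<rho> k\<rho>] schottky_bound_mono[OF t, of \<rho>] unfolding \<Psi>_def by linarith
    then show "norm t \<le> schottky_bound \<rho> R" by (intro LIMSEQ_le_const2[OF tendsto_norm[OF \<Psi>G]]) blast
  qed
  have "(\<lambda>n. f (r n) x (of_real k)) \<longlonglongrightarrow> inv G x" for x
    using \<Psi>G[of "inv G x"] bijG by (simp add: \<Psi>_def bij_def surj_f_inv_f)
  then show thesis
    by (rule that[OF r(1) c\<Gamma>[folded \<Gamma>f] bnd[folded \<Gamma>f] G[folded \<Gamma>f] cG bijG proper])
qed

section \<open>Identification of the limit\<close>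

text \<open>Weyl's lemma asks for a vanishing weak zbar-derivative. In \<open>weak_identity\<close>
  the cutoff times \<open>P n\<close> is bounded in L2 uniformly in n, while
  \<open>p * (\<mu> - \<nu> n)\<close> tends to 0 in L2 by dominated convergence, on a compact set
  that contains the preimages of the support for all n. The hypothesis \<open>half\<close> keeps
  these preimages in the half plane where the coefficients converge.\<close>

lemma limit_holomorphic:
  fixes \<Phi> \<mu> \<Phi>x \<Phi>y G :: "complex \<Rightarrow> complex" and \<Psi> P \<nu> :: "nat \<Rightarrow> complex \<Rightarrow> complex"
  assumes \<Phi>: "continuous_on UNIV \<Phi>" "W12_loc UNIV \<Phi> \<Phi>x \<Phi>y"
    and \<mu>: "\<mu> \<in> borel_measurable lebesgue" "AE z in lebesgue. norm (\<mu> z) \<le> k"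
    and beltrami: "AE z in lebesgue. (\<Phi>x z + \<i> * \<Phi>y z) / 2 = \<mu> z * ((\<Phi>x z - \<i> * \<Phi>y z) / 2)"
    and \<Psi>: "\<And>n. has_partials (\<Psi> n) (\<lambda>z. P n z * (1 + \<nu> n z)) (\<lambda>z. \<i> * P n z * (1 - \<nu> n z))" "\<And>n. bij (\<Psi> n)" "\<And>n. continuous_on UNIV (inv (\<Psi> n))"
    and Q: "\<And>n. \<exists>Q1 Q2 Q3. has_partials (\<lambda>z. P n z * (1 + \<nu> n z)) Q1 Q2 \<and> has_partials (\<lambda>z. \<i> * P n z * (1 - \<nu> n z)) Q2 Q3"
    and C: "\<And>j n. Cd j (P n)" "\<And>j n. Cd j (\<nu> n)" and \<nu>: "\<And>n z. norm (\<nu> n z) \<le> k" "k < 1"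
    and half: "\<And>n z. Im (\<Psi> n z) > 0 \<Longrightarrow> Im z > 0"
    and conv: "AE z in lebesgue. Im z > 0 \<longrightarrow> (\<lambda>n. \<nu> n z) \<longlonglongrightarrow> \<mu> z"
    and bnd: "\<And>R. \<exists>R'. \<forall>n t. norm t \<le> R \<longrightarrow> norm (inv (\<Psi> n) t) \<le> R'"
    and G: "\<And>t. (\<lambda>n. inv (\<Psi> n) t) \<longlonglongrightarrow> G t" "continuous_on UNIV G"
  shows "(\<lambda>t. \<Phi> (G t)) holomorphic_on {z. Im z > 0}"
proof (rule weyl_lemma)
  show "continuous_on UNIV (\<lambda>t. \<Phi> (G t))" by (rule continuous_on_compose2[OF \<Phi>(1) G(2)]) auto
  show "open {z. Im z > 0}" by (rule open_halfspace_Im_gt)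
next
  fix w :: complex and e :: real assume e: "e > 0" and w: "cball w e \<subseteq> {z. Im z > 0}"
  have k0: "0 \<le> k" using \<nu>(1)[of 0 0] norm_ge_zero order_trans by blast
  then have k1: "1 - k\<^sup>2 > 0" using \<nu>(2) by (simp add: abs_square_less_1)
  define B where "B t = complex_of_real (bump_x ((t - w) / of_real e)) + \<i> * of_real (bump_y ((t - w) / of_real e))" for t
  have u: "norm ((t - w) / of_real e) \<ge> 1" if "t \<notin> cball w e" for t
    using that e by (simp add: norm_divide dist_norm norm_minus_commute)
  have bc: "continuous_on UNIV (\<lambda>x. h ((x - w) / of_real e))" if "continuous_on UNIV h" for h :: "complex \<Rightarrow> real"
    by (rule continuous_on_compose2[OF that]) (use e in \<open>auto intro!: continuous_intros\<close>)
  have cB: "continuous_on UNIV B" unfolding B_def[abs_def]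
    by (intro continuous_on_add continuous_on_mult continuous_on_const continuous_on_of_real bc bump_continuous)
  have B0: "B t = 0" if "t \<notin> cball w e" for t using bump_outside[OF u[OF that]] by (simp add: B_def)
  have iB: "integrable lborel B" by (rule lebesgue_integral_continuous(1)[OF cB compact_cball B0])
  obtain R' where R': "\<And>n t. norm t \<le> norm w + e \<Longrightarrow> norm (inv (\<Psi> n) t) \<le> R'" using bnd by blast
  have R'w: "norm (inv (\<Psi> n) t) \<le> R'" if "t \<in> cball w e" for n t
    using R'[of t n] that norm_triangle_sub[of t w] by (simp add: dist_norm norm_minus_commute)
  obtain M where M: "\<And>z. z \<in> cball 0 R' \<Longrightarrow> norm (\<Phi> z) \<le> M"
    using compact_imp_bounded[OF compact_continuous_image[OF continuous_on_subset[OF \<Phi>(1) subset_UNIV] compact_cball[of 0 R']]]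
    unfolding bounded_iff by blast
  have c\<Phi>G: "continuous_on UNIV (\<lambda>t. \<Phi> (G t))" by (rule continuous_on_compose2[OF \<Phi>(1) G(2)]) auto
  define I where "I n = integral\<^sup>L lborel (\<lambda>t. \<Phi> (inv (\<Psi> n) t) * B t)" for n
  have lim: "I \<longlonglongrightarrow> integral\<^sup>L lborel (\<lambda>t. \<Phi> (G t) * B t)"
    unfolding I_def[abs_def]
  proof (rule integral_dominated_convergence)
    show "integrable lborel (\<lambda>t. \<bar>M\<bar> * norm (B t))" by (intro integrable_mult_right integrable_norm iB)
    show "(\<lambda>t. \<Phi> (G t) * B t) \<in> borel_measurable lborel"
      using borel_measurable_continuous_onI[OF continuous_on_mult[OF c\<Phi>G cB]] by simp
    show "(\<lambda>t. \<Phi> (inv (\<Psi> n) t) * B t) \<in> borel_measurable lborel" for n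
    proof -
      have "continuous_on UNIV (\<lambda>t. \<Phi> (inv (\<Psi> n) t))" by (rule continuous_on_compose2[OF \<Phi>(1) \<Psi>(3)]) auto
      then show ?thesis using borel_measurable_continuous_onI[OF continuous_on_mult[OF _ cB]] by simp
    qed
    show "AE t in lborel. (\<lambda>n. \<Phi> (inv (\<Psi> n) t) * B t) \<longlonglongrightarrow> \<Phi> (G t) * B t"
    proof (intro AE_I2 tendsto_mult tendsto_const)
      show "(\<lambda>n. \<Phi> (inv (\<Psi> n) t)) \<longlonglongrightarrow> \<Phi> (G t)" for t
        by (rule isCont_tendsto_compose[OF _ G(1)]) (use \<Phi>(1) in \<open>auto simp: continuous_on_eq_continuous_at\<close>)
    qed
    show "AE t in lborel. norm (\<Phi> (inv (\<Psi> n) t) * B t) \<le> \<bar>M\<bar> * norm (B t)" for n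
    proof (rule AE_I2)
      fix t
      show "norm (\<Phi> (inv (\<Psi> n) t) * B t) \<le> \<bar>M\<bar> * norm (B t)"
      proof (cases "t \<in> cball w e")
        case True
        then have "norm (\<Phi> (inv (\<Psi> n) t)) \<le> \<bar>M\<bar>" using M[of "inv (\<Psi> n) t"] R'w[OF True, of n] by simp
        then show ?thesis by (simp add: norm_mult mult_right_mono)
      qed (simp add: B0)
    qed
  qed
  define p where "p z = (\<Phi>x z - \<i> * \<Phi>y z) / 2" for z
  define S where "S = {z \<in> cball 0 R'. Im z > 0}"
  have L2: "L2_loc UNIV \<Phi>x" "L2_loc UNIV \<Phi>y" using \<Phi>(2) by (auto simp: W12_loc_def)
  have m\<Phi>: "\<Phi>x \<in> borel_measurable lebesgue" "\<Phi>y \<in> borel_measurable lebesgue" using L2 by (auto simp: L2_loc_def lebesgue_on_UNIV_eq)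
  have mp: "p \<in> borel_measurable lebesgue" unfolding p_def[abs_def] using m\<Phi> by measurable
  have m\<nu>: "\<nu> n \<in> borel_measurable lebesgue" for n
    using borel_measurable_continuous_onI[OF Cd_continuous[OF C(2)]] by (intro measurable_completion) simp
  have mS: "indicat_real S \<in> borel_measurable lebesgue"
  proof -
    have "S = cball 0 R' \<inter> {z. Im z > 0}" by (auto simp: S_def)
    then have "S \<in> sets lebesgue" by (auto intro!: lmeasurable_cball fmeasurableD sets.Int simp: open_halfspace_Im_gt borel_open)
    then show ?thesis by simp
  qed
  have ip: "integrable lebesgue (\<lambda>z. indicator (cball 0 R') z * (norm (p z))\<^sup>2)"
  proof -
    have "set_integrable lebesgue (cball 0 R') (\<lambda>z. (norm (\<Phi>x z))\<^sup>2 + (norm (\<Phi>y z))\<^sup>2)"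
      using L2 by (intro set_integral_add(1)) (auto simp: L2_loc_def)
    then have "integrable lebesgue (\<lambda>z. indicator (cball 0 R') z *\<^sub>R ((norm (\<Phi>x z))\<^sup>2 + (norm (\<Phi>y z))\<^sup>2))"
      by (simp add: set_integrable_def)
    then show ?thesis
    proof (rule Bochner_Integration.integrable_bound)
      have "cball 0 R' \<in> sets lebesgue" by (simp add: fmeasurableD)
      then show "(\<lambda>z. indicat_real (cball 0 R') z * (norm (p z))\<^sup>2) \<in> borel_measurable lebesgue" using mp by measurable
      have "norm (indicat_real (cball 0 R') z * (norm (p z))\<^sup>2) \<le> norm (indicat_real (cball 0 R') z *\<^sub>R ((norm (\<Phi>x z))\<^sup>2 + (norm (\<Phi>y z))\<^sup>2))" for z
      proof -
        have "norm (\<Phi>x z - \<i> * \<Phi>y z) \<le> norm (\<Phi>x z) + norm (\<Phi>y z)"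
          using norm_triangle_ineq4[of "\<Phi>x z" "\<i> * \<Phi>y z"] by (simp add: norm_mult)
        then have "(norm (\<Phi>x z - \<i> * \<Phi>y z))\<^sup>2 \<le> (norm (\<Phi>x z) + norm (\<Phi>y z))\<^sup>2" by (intro power_mono) auto
        also have "\<dots> \<le> 4 * ((norm (\<Phi>x z))\<^sup>2 + (norm (\<Phi>y z))\<^sup>2)"
          using sum_squares_bound[of "norm (\<Phi>x z)" "norm (\<Phi>y z)"] by (simp add: power2_sum) (smt (verit) zero_le_power2)
        finally have "(norm (p z))\<^sup>2 \<le> (norm (\<Phi>x z))\<^sup>2 + (norm (\<Phi>y z))\<^sup>2" by (simp add: p_def norm_divide power_divide)
        then show ?thesis by (simp add: indicator_def)
      qed
      then show "AE z in lebesgue. norm (indicat_real (cball 0 R') z * (norm (p z))\<^sup>2) \<le> norm (indicat_real (cball 0 R') z *\<^sub>R ((norm (\<Phi>x z))\<^sup>2 + (norm (\<Phi>y z))\<^sup>2))"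
        by (intro AE_I2)
    qed
  qed
  define d where "d n z = indicat_real S z * ((norm (p z))\<^sup>2 * (norm (\<mu> z - \<nu> n z))\<^sup>2)" for n z
  have md: "d n \<in> borel_measurable lebesgue" for n unfolding d_def[abs_def] using mS mp m\<nu> \<mu>(1) by measurable
  have db: "AE z in lebesgue. norm (d n z) \<le> (2 * k)\<^sup>2 * (indicator (cball 0 R') z * (norm (p z))\<^sup>2)" for n
    using \<mu>(2)
  proof eventually_elim
    fix z assume z: "norm (\<mu> z) \<le> k"
    have "norm (\<mu> z - \<nu> n z) \<le> 2 * k" using norm_triangle_ineq4[of "\<mu> z" "\<nu> n z"] z \<nu>(1)[of n z] by simp
    then have "(norm (\<mu> z - \<nu> n z))\<^sup>2 \<le> (2 * k)\<^sup>2" by (intro power_mono) auto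
    then have "(norm (p z))\<^sup>2 * (norm (\<mu> z - \<nu> n z))\<^sup>2 \<le> (norm (p z))\<^sup>2 * (2 * k)\<^sup>2" by (intro mult_left_mono) auto
    moreover have "0 \<le> (norm (p z))\<^sup>2 * (norm (\<mu> z - \<nu> n z))\<^sup>2" by simp
    ultimately show "norm (d n z) \<le> (2 * k)\<^sup>2 * (indicator (cball 0 R') z * (norm (p z))\<^sup>2)"
      by (auto simp: d_def S_def indicator_def mult.commute simp del: dist_0_norm)
  qed
  have iw: "integrable lebesgue (\<lambda>z. (2 * k)\<^sup>2 * (indicator (cball 0 R') z * (norm (p z))\<^sup>2))" using ip by (rule integrable_mult_right)
  have id: "integrable lebesgue (d n)" for n
    by (rule Bochner_Integration.integrable_bound[OF iw md]) (use db[of n] in eventually_elim, auto intro: order_trans[OF _ abs_ge_self])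
  have Dlim: "(\<lambda>n. integral\<^sup>L lebesgue (d n)) \<longlonglongrightarrow> integral\<^sup>L lebesgue (\<lambda>z::complex. 0 :: real)"
  proof (rule integral_dominated_convergence[OF _ md iw _ db])
    show "AE z in lebesgue. (\<lambda>n. d n z) \<longlonglongrightarrow> 0" using conv
    proof eventually_elim
      fix z assume z: "Im z > 0 \<longrightarrow> (\<lambda>n. \<nu> n z) \<longlonglongrightarrow> \<mu> z"
      show "(\<lambda>n. d n z) \<longlonglongrightarrow> 0"
      proof (cases "z \<in> S")
        case True
        then have "(\<lambda>n. \<nu> n z) \<longlonglongrightarrow> \<mu> z" using z by (simp add: S_def)
        then have "(\<lambda>n. d n z) \<longlonglongrightarrow> indicat_real S z * ((norm (p z))\<^sup>2 * (norm (\<mu> z - \<mu> z))\<^sup>2)"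
          unfolding d_def by (intro tendsto_intros)
        then show ?thesis by simp
      qed (simp add: d_def)
    qed
  qed simp
  define K where "K = integral\<^sup>L lborel (\<lambda>t. (bump ((t - w) / of_real e))\<^sup>2) / (1 - k\<^sup>2)"
  \<comment> \<open>A weighted arithmetic-geometric inequality with free weight \<theta> does the
    work of Cauchy-Schwarz; n tends to infinity first, and \<theta> is chosen small
    afterwards.\<close>
  have main: "norm (I n) \<le> e * (\<theta> * K + integral\<^sup>L lebesgue (d n) / \<theta>)" if \<theta>: "\<theta> > 0" for n \<theta>
  proof -
    obtain Q1 Q2 Q3 where Q': "has_partials (\<lambda>z. P n z * (1 + \<nu> n z)) Q1 Q2" "has_partials (\<lambda>z. \<i> * P n z * (1 - \<nu> n z)) Q2 Q3"
      using Q by blast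
    have bel: "AE z in lebesgue. Im (\<Psi> n z) > 0 \<longrightarrow> (\<Phi>x z + \<i> * \<Phi>y z) / 2 = \<mu> z * ((\<Phi>x z - \<i> * \<Phi>y z) / 2)"
      using beltrami by eventually_elim simp
    note W = weak_identity[OF \<Phi> \<mu>(1) bel \<Psi>(1)[of n] \<Psi>(2,3) Q' C(1)[of _ n] C(2)[of _ n] \<nu>(1)[of n] \<nu>(2) e w]
    define c where "c z = bump ((\<Psi> n z - w) / of_real e)" for z
    define A where "A z = (c z)\<^sup>2 * (norm (P n z))\<^sup>2" for z
    have IA: "integrable lborel A" using integrable_Re[OF W(2)] by (simp add: A_def[abs_def] c_def)
    have AK: "integral\<^sup>L lborel A \<le> K"
      using W(3) k1 by (simp add: K_def A_def[abs_def] c_def pos_le_divide_eq mult.commute)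
    have IA': "integrable lebesgue A" "integral\<^sup>L lebesgue A = integral\<^sup>L lborel A"
      using IA borel_measurable_integrable[OF IA] by (simp_all add: integrable_completion integral_completion)
    let ?f = "\<lambda>z. of_real (c z) * P n z * p z * (\<mu> z - \<nu> n z)"
    define g where "g z = \<theta> / 2 * A z + 1 / (2 * \<theta>) * d n z" for z
    have gi: "integrable lebesgue g" unfolding g_def[abs_def] by (intro Bochner_Integration.integrable_add integrable_mult_right IA' id)
    have fg: "norm (?f z) \<le> g z" for z
    proof (cases "c z = 0")
      case True
      then show ?thesis using \<theta> by (simp add: g_def A_def d_def)
    next
      case False
      then have "\<Psi> n z \<in> cball w e" using bump_outside(1)[OF u, of "\<Psi> n z"] by (auto simp: c_def)
      moreover have "inv (\<Psi> n) (\<Psi> n z) = z" using \<Psi>(2)[of n] by (simp add: bij_def)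
      ultimately have zS: "z \<in> S" using R'w[of "\<Psi> n z" n] half[of n z] w by (auto simp: S_def)
      define x where "x = \<bar>c z\<bar> * norm (P n z)"
      define y where "y = norm (p z) * norm (\<mu> z - \<nu> n z)"
      have "0 \<le> (\<theta> * x - y)\<^sup>2" by simp
      then have "2 * \<theta> * (x * y) \<le> \<theta>\<^sup>2 * x\<^sup>2 + y\<^sup>2" by (simp add: power2_diff power_mult_distrib mult_ac)
      then have "x * y \<le> \<theta> / 2 * x\<^sup>2 + 1 / (2 * \<theta>) * y\<^sup>2" using \<theta> by (simp add: field_simps power2_eq_square)
      moreover have "norm (?f z) = x * y" by (simp add: norm_mult x_def y_def)
      moreover have "g z = \<theta> / 2 * x\<^sup>2 + 1 / (2 * \<theta>) * y\<^sup>2" using zS by (simp add: g_def A_def d_def x_def y_def power_mult_distrib)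
      ultimately show ?thesis by simp
    qed
    \<comment> \<open>A non-integrable integrand has integral 0 by convention, so the bound holds in
      either case.\<close>
    have nf: "norm (integral\<^sup>L lebesgue ?f) \<le> integral\<^sup>L lebesgue g"
    proof (cases "integrable lebesgue ?f")
      case True
      then show ?thesis by (rule Bochner_Integration.integral_norm_bound_integral[OF _ gi fg])
    next
      case False
      have "0 \<le> g z" for z using fg[of z] norm_ge_zero order_trans by blast
      then show ?thesis using False by (simp add: not_integrable_integral_eq integral_nonneg)
    qed
    also have "integral\<^sup>L lebesgue g = \<theta> / 2 * integral\<^sup>L lborel A + 1 / (2 * \<theta>) * integral\<^sup>L lebesgue (d n)"
      unfolding g_def[abs_def] using IA' id[of n] by (subst Bochner_Integration.integral_add) auto
    also have "\<dots> \<le> \<theta> / 2 * K + 1 / (2 * \<theta>) * integral\<^sup>L lebesgue (d n)" using AK \<theta> by (intro add_right_mono mult_left_mono) auto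
    finally have f: "norm (integral\<^sup>L lebesgue ?f) \<le> \<theta> / 2 * K + 1 / (2 * \<theta>) * integral\<^sup>L lebesgue (d n)" .
    have "I n = - 2 * of_real e * integral\<^sup>L lebesgue ?f" using W(1) unfolding I_def B_def c_def p_def .
    then have "norm (I n) = 2 * e * norm (integral\<^sup>L lebesgue ?f)" using e by (simp only: norm_mult) simp
    also have "\<dots> \<le> 2 * e * (\<theta> / 2 * K + 1 / (2 * \<theta>) * integral\<^sup>L lebesgue (d n))" using f e by (intro mult_left_mono) auto
    also have "\<dots> = e * (\<theta> * K + integral\<^sup>L lebesgue (d n) / \<theta>)" using \<theta> by (simp add: field_simps)
    finally show ?thesis .
  qed
  define J where "J = norm (integral\<^sup>L lborel (\<lambda>t. \<Phi> (G t) * B t))"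
  have J: "J \<le> e * (\<theta> * K)" if \<theta>: "\<theta> > 0" for \<theta>
  proof -
    have "(\<lambda>n. e * (\<theta> * K + integral\<^sup>L lebesgue (d n) / \<theta>)) \<longlonglongrightarrow> e * (\<theta> * K + 0 / \<theta>)"
      using Dlim \<theta> by (intro tendsto_intros) auto
    then have "(\<lambda>n. e * (\<theta> * K + integral\<^sup>L lebesgue (d n) / \<theta>)) \<longlonglongrightarrow> e * (\<theta> * K)" by simp
    from LIMSEQ_le[OF tendsto_norm[OF lim] this] show ?thesis unfolding J_def using main[OF \<theta>] by blast
  qed
  have "K \<ge> 0" using k1 by (simp add: K_def)
  have "J \<le> 0"
  proof (rule ccontr)
    assume "\<not> J \<le> 0"
    then have J0: "J > 0" by simp
    \<comment> \<open>With this weight the bound is at most J / 2.\<close>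
    define \<theta> where "\<theta> = J / (2 * e * (K + 1))"
    have "\<theta> > 0" using J0 e \<open>K \<ge> 0\<close> by (simp add: \<theta>_def)
    from J[OF this] have "J \<le> e * (\<theta> * K)" .
    also have "\<dots> \<le> e * (\<theta> * (K + 1))" using e \<open>\<theta> > 0\<close> by (intro mult_left_mono) auto
    also have "\<dots> = J / 2" using e \<open>K \<ge> 0\<close> by (simp add: \<theta>_def divide_simps)
    finally show False using J0 by simp
  qed
  then show "integral\<^sup>L lborel (\<lambda>t. \<Phi> (G t) * (of_real (bump_x ((t - w) / of_real e)) + \<i> * of_real (bump_y ((t - w) / of_real e)))) = 0"
    unfolding J_def B_def by simp
qed

text \<open>Properness is a pole at infinity, so f is a polynomial; injectivity makes its derivative
  zero-free, hence constant by the fundamental theorem of algebra.\<close>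

lemma proper_injective_entire_affine:
  assumes f: "f holomorphic_on UNIV" "inj f" "filterlim f at_infinity at_infinity"
  obtains a b where "\<And>z. f z = a + b * z"
proof -
  have "((inverse \<circ> f) \<longlongrightarrow> 0) at_infinity"
    unfolding o_def by (rule filterlim_compose[OF tendsto_inverse_0 f(3)])
  then obtain a n where a: "\<And>z. f z = (\<Sum>i\<le>n. a i * z ^ i)" using pole_at_infinity[OF f(1)] by blast
  define p where "p = (\<Sum>i\<le>n. monom (a i) i)"
  have p: "f = poly p" by (simp add: fun_eq_iff a p_def poly_sum poly_monom)
  have "poly (pderiv p) z \<noteq> 0" for z
  proof -
    have "deriv f z \<noteq> 0" by (rule holomorphic_injective_imp_regular[OF f(1) open_UNIV f(2)]) simp
    moreover have "deriv f z = poly (pderiv p) z" unfolding p by (rule DERIV_imp_deriv[OF poly_DERIV])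
    ultimately show ?thesis by simp
  qed
  moreover have "\<exists>z. poly (pderiv p) z = 0" if "degree (pderiv p) \<noteq> 0"
  proof -
    have "coeff (pderiv p) (degree (pderiv p)) \<noteq> 0" using that by (metis degree_0 leading_coeff_0_iff)
    then have "\<exists>i\<in>{1..degree (pderiv p)}. coeff (pderiv p) i \<noteq> 0" using that by (intro bexI[of _ "degree (pderiv p)"]) auto
    then show ?thesis using fundamental_theorem_of_algebra[of "coeff (pderiv p)"] unfolding poly_altdef by metis
  qed
  ultimately have "degree (pderiv p) = 0" by blast
  then have "degree p \<le> 1" by (simp only: degree_pderiv)
  then have "p = [:coeff p 0, coeff p 1:]"
    by (intro poly_eqI) (auto simp: coeff_pCons coeff_eq_0 split: nat.split)
  from arg_cong[OF this, of poly] have "f z = poly [:coeff p 0, coeff p 1:] z" for z unfolding p by (rule fun_cong)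
  then have "f z = coeff p 0 + coeff p 1 * z" for z by (simp add: mult.commute)
  then show thesis by (rule that)
qed

text \<open>Schwarz reflection extends F from the closed upper half plane to an entire function. The
  extension is injective because F, which is real only on the real line, keeps the open upper half
  plane on one side of it; with properness it must be affine.\<close>

lemma reflection_affine:
  fixes F :: "complex \<Rightarrow> complex"
  assumes F: "continuous_on UNIV F" "inj F" "F holomorphic_on {z. Im z > 0}"
    and real: "\<And>x. F (of_real x) \<in> \<real>" and avoid: "\<And>z. F z \<in> \<real> \<Longrightarrow> z \<in> \<real>"
    and proper: "\<And>R. \<exists>R'. \<forall>z. norm (F z) \<le> R \<longrightarrow> norm z \<le> R'"
  shows "F (of_real x) = F 0 + of_real x * (F 1 - F 0)"
proof -
  define g where "g z = (if 0 \<le> Im z then F z else cnj (F (cnj z)))" for z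
  have hg: "g holomorphic_on UNIV"
    unfolding g_def[abs_def]
  proof (rule Schwarz_reflection)
    show "F holomorphic_on UNIV \<inter> {z. 0 < Im z}" using F(3) by simp
    show "continuous_on (UNIV \<inter> {z. 0 \<le> Im z}) F" using F(1) continuous_on_subset by blast
    show "F z \<in> \<real>" if "z \<in> \<real>" for z using real that by (auto elim!: Reals_cases)
  qed auto
  have nz: "Im (F z) \<noteq> 0" if "Im z \<noteq> 0" for z
    using avoid[of z] that by (auto simp: complex_is_Real_iff)
  have sgn: "Im (F z) < 0 \<longleftrightarrow> Im (F w) < 0" if zw: "Im z > 0" "Im w > 0" for z w
  proof -
    have "connected {z. Im z > 0}" by (intro convex_connected convex_halfspace_Im_gt)
    then have "connected ((\<lambda>z. Im (F z)) ` {z. Im z > 0})"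
      by (rule connected_continuous_image[rotated]) (intro continuous_on_Im continuous_on_subset[OF F(1)] subset_UNIV)
    then have "is_interval ((\<lambda>z. Im (F z)) ` {z. Im z > 0})" by (simp add: is_interval_connected_1)
    then have I: "is_interval ((\<lambda>z. Im (F z)) ` {z. Im z > 0})" .
    have "False" if z: "Im (F z1) < 0" "0 < Im (F z2)" "Im z1 > 0" "Im z2 > 0" for z1 z2
    proof -
      have "0 \<in> (\<lambda>z. Im (F z)) ` {z. Im z > 0}"
        by (rule mem_is_interval_1_I[OF I, of "Im (F z1)" "Im (F z2)"]) (use z in auto)
      then show False using nz by force
    qed
    from this[of z w] this[of w z] show ?thesis using zw nz[of z] nz[of w] by (smt (verit))
  qed
  have ig: "inj g"
  proof (rule injI)
    fix z w assume eq: "g z = g w"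
    have mixed: False if zw: "0 \<le> Im z" "Im w < 0" "F z = cnj (F (cnj w))" for z w
    proof -
      have i: "Im (F z) = - Im (F (cnj w))" using zw(3) by simp
      have n: "Im (F (cnj w)) \<noteq> 0" using nz[of "cnj w"] zw(2) by simp
      show False
      proof (cases "Im z = 0")
        case True
        then have "z = of_real (Re z)" by (simp add: complex_eq_iff)
        then have "F z \<in> \<real>" using real by metis
        then show False using i n by (simp add: complex_is_Real_iff)
      next
        case False
        then show False using sgn[of z "cnj w"] zw i n by auto
      qed
    qed
    show "z = w"
      using eq mixed[of z w] mixed[of w z] F(2)
      by (auto simp: g_def inj_eq not_le split: if_splits)
  qed
  have lg: "filterlim g at_infinity at_infinity"
    unfolding filterlim_at_infinity[OF order_refl] eventually_at_infinity
  proof (intro allI impI)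
    fix r :: real
    obtain R' where R': "\<And>z. norm (F z) \<le> r \<Longrightarrow> norm z \<le> R'" using proper by blast
    have "r < norm (F z)" if "R' + 1 \<le> norm z" for z using R'[of z] that by (rule_tac ccontr) simp
    then have "r < norm (F z) \<and> r < norm (F (cnj z))" if "R' + 1 \<le> norm z" for z using that by simp
    then have "r \<le> norm (g z)" if "R' + 1 \<le> norm z" for z using that by (auto simp: g_def less_imp_le)
    then show "\<exists>b. \<forall>x. b \<le> norm x \<longrightarrow> r \<le> norm (g x)" by blast
  qed
  obtain a b where ab: "\<And>z. g z = a + b * z" using proper_injective_entire_affine[OF hg ig lg] by blast
  have gr: "g (of_real x) = F (of_real x)" for x by (simp add: g_def)
  have "b = F 1 - F 0" "a = F 0" using ab[of 0] ab[of 1] gr[of 0] gr[of 1] by (simp_all add: algebra_simps)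
  then show ?thesis using ab[of "of_real x"] gr[of x] by (simp add: mult.commute)
qed

section \<open>Quasisymmetric maps as holomorphic motions\<close>

text \<open>Subsequences are extracted for one point after another, each refining the previous
  one.\<close>

lemma montel_finite:
  assumes "finite X" "\<And>n x. x \<in> X \<Longrightarrow> g n x holomorphic_on ball (0::complex) 1"
    and "\<And>x K. x \<in> X \<Longrightarrow> compact K \<Longrightarrow> K \<subseteq> ball 0 1 \<Longrightarrow> \<exists>B. \<forall>n. \<forall>l\<in>K. norm (g n x l) \<le> B"
  shows "\<exists>r L. strict_mono (r :: nat \<Rightarrow> nat) \<and>
     (\<forall>x\<in>X. L x holomorphic_on ball 0 1 \<and> (\<forall>l\<in>ball 0 1. (\<lambda>n. g (r n) x l) \<longlonglongrightarrow> L x l))"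
  using assms
proof (induction X rule: finite_induct)
  case empty
  show ?case by (intro exI[of _ id]) (simp add: strict_mono_def)
next
  case (insert y X)
  have "\<exists>r L. strict_mono (r :: nat \<Rightarrow> nat) \<and>
     (\<forall>x\<in>X. L x holomorphic_on ball 0 1 \<and> (\<forall>l\<in>ball 0 1. (\<lambda>n. g (r n) x l) \<longlonglongrightarrow> L x l))"
    by (rule insert.IH) (use insert.prems in auto)
  then obtain r L where r: "strict_mono (r :: nat \<Rightarrow> nat)"
    and L: "\<And>x. x \<in> X \<Longrightarrow> L x holomorphic_on ball 0 1" "\<And>x l. x \<in> X \<Longrightarrow> l \<in> ball 0 1 \<Longrightarrow> (\<lambda>n. g (r n) x l) \<longlonglongrightarrow> L x l"
    by blast
  obtain Ly q where q: "Ly holomorphic_on ball 0 1" "strict_mono (q :: nat \<Rightarrow> nat)"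
    "\<And>l. l \<in> ball 0 1 \<Longrightarrow> (\<lambda>n. g (r (q n)) y l) \<longlonglongrightarrow> Ly l"
  proof (rule Montel[of "ball 0 1" "range (\<lambda>n. g (r n) y)" "\<lambda>n. g (r n) y"])
    show "h holomorphic_on ball 0 1" if "h \<in> range (\<lambda>n. g (r n) y)" for h using that insert.prems(1)[of y] by auto
    fix K :: "complex set" assume "compact K" "K \<subseteq> ball 0 1"
    then obtain B where "\<And>n l. l \<in> K \<Longrightarrow> norm (g n y l) \<le> B" using insert.prems(2)[of y K] by auto
    then show "\<exists>B. \<forall>h\<in>range (\<lambda>n. g (r n) y). \<forall>z\<in>K. norm (h z) \<le> B" by blast
  qed auto
  show ?case
  proof (intro exI conjI ballI)
    show "strict_mono (r \<circ> q)" using r q(2) by (rule strict_mono_o)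
    fix x assume x: "x \<in> insert y X"
    show "(L(y := Ly)) x holomorphic_on ball 0 1" using x q(1) L(1) by auto
    show "(\<lambda>n. g ((r \<circ> q) n) x l) \<longlonglongrightarrow> (L(y := Ly)) x l" if "l \<in> ball 0 1" for l
      using x q(3)[OF that] LIMSEQ_subseq_LIMSEQ[OF L(2)[OF _ that] q(2)] by (auto simp: o_def)
  qed
qed

lemma compact_in_unit_disk:
  assumes "compact K" "K \<subseteq> ball (0::complex) 1"
  obtains \<rho> where "0 < \<rho>" "\<rho> < 1" "\<And>l. l \<in> K \<Longrightarrow> norm l \<le> \<rho>"
proof (cases "K = {}")
  case True
  then show thesis using that[of "1 / 2"] by simp
next
  case False
  obtain x where x: "x \<in> K" "\<And>y. y \<in> K \<Longrightarrow> norm y \<le> norm x"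
    using continuous_attains_sup[OF assms(1) False, of norm] by (auto intro: continuous_intros)
  show thesis
    by (rule that[of "max (1 / 2) (norm x)"]) (use x assms(2) in \<open>auto simp: max.coboundedI2\<close>)
qed

text \<open>The Beltrami equation of \<Phi> enters only in the upper half plane, because the
  approximating solutions preserve that half plane and reflection accounts for the other. As \<Phi>
  composed with the limit of the inverses is affine on the line, the limit of the solutions at time
  k' is \<phi> normalised at 0 and 1.\<close>

lemma quasisymmetric_qs_motion:
  assumes qs: "quasisymmetric k \<phi>" and k': "k < k'" "k' < 1"
  shows "qs_motion k' (\<lambda>x. (\<phi> x - \<phi> 0) / (\<phi> 1 - \<phi> 0))"
proof -
  obtain \<Phi> where mono: "strict_mono \<phi>" and qc: "quasiconformal k UNIV UNIV \<Phi>" and \<Phi>\<phi>: "\<And>x. \<Phi> (of_real x) = of_real (\<phi> x)"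
    and hom\<phi>: "\<exists>g. homeomorphism UNIV UNIV \<phi> g"
    using qs unfolding quasisymmetric_def by blast
  obtain g \<Phi>x \<Phi>y \<mu> where k: "0 \<le> k" and hom: "homeomorphism UNIV UNIV \<Phi> g" and W: "W12_loc UNIV \<Phi> \<Phi>x \<Phi>y"
    and \<mu>: "\<mu> \<in> borel_measurable lebesgue" "AE z in lebesgue. norm (\<mu> z) \<le> k"
    and bel: "AE z in lebesgue. (\<Phi>x z + \<i> * \<Phi>y z) / 2 = \<mu> z * ((\<Phi>x z - \<i> * \<Phi>y z) / 2)"
    using qc unfolding quasiconformal_def lebesgue_on_UNIV_eq by blast
  have c\<Phi>: "continuous_on UNIV \<Phi>" and cg: "continuous_on UNIV g" and g\<Phi>: "\<And>z. g (\<Phi> z) = z"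
    using hom by (auto simp: homeomorphism_def)
  have inj\<Phi>: "inj \<Phi>" using g\<Phi> by (metis injI)
  have surj\<phi>: "\<exists>y. x = \<phi> y" for x using hom\<phi> unfolding homeomorphism_def by (metis UNIV_I imageE)
  have \<phi>01: "\<phi> 0 < \<phi> 1" using mono by (simp add: strict_mono_def)
  have k'0: "0 < k'" using k k' by simp
  obtain d m h where A: "\<And>n. sym_trig_coeff (d n) (m n)" "\<And>n. h n > (0::real)"
    "AE z in lebesgue. Im z > 0 \<longrightarrow> (\<lambda>n. of_real k' * tpoly (d n) (m n) (of_real (h n) * z)) \<longlonglongrightarrow> \<mu> z"
    using beltrami_coefficient_approx[OF \<mu> k k'(1)] by blast
  define M where "M n z = tpoly (d n) (m n) (of_real (h n) * z)" for n z
  \<comment> \<open>Packs the properties of a family for one n into a predicate, so that a sequence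
    of families can be chosen.\<close>
  define Fam where "Fam n F P \<longleftrightarrow> (\<forall>z. (\<lambda>l. F l z) holomorphic_on ball 0 1) \<and> (\<forall>z. F 0 z = z) \<and> 
    (\<forall>l. norm l < 1 \<longrightarrow> F l 0 = 0 \<and> F l 1 = 1 \<and> bij (F l) \<and> (\<forall>z. F (cnj l) (cnj z) = cnj (F l z)) \<and>
      has_partials (F l) (\<lambda>z. P l z * (1 + l * M n z)) (\<lambda>z. \<i> * P l z * (1 - l * M n z)) \<and>
      (\<exists>Q1 Q2 Q3. has_partials (\<lambda>z. P l z * (1 + l * M n z)) Q1 Q2 \<and> has_partials (\<lambda>z. \<i> * P l z * (1 - l * M n z)) Q2 Q3) \<and>
      (\<forall>j. Cd j (P l))) \<and> (\<forall>j. Cd j (M n))" for n F P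
  have "\<exists>F P. Fam n F P" for n
  proof (rule beltrami_family[OF A(1)[of n] A(2)[of n]], goal_cases)
    case (1 F P)
    then show ?case unfolding Fam_def M_def[abs_def] by (intro exI[of _ F] exI[of _ P] conjI allI impI)
  qed
  then obtain F P where FP: "\<And>n. Fam n (F n) (P n)" by metis
  have hol: "(\<lambda>l. F n l z) holomorphic_on ball 0 1" and F0: "F n 0 z = z"
    and CM: "Cd j (M n)" for n z j using FP[of n] unfolding Fam_def by blast+
  have Fl: "F n l 0 = 0" "F n l 1 = 1" "bij (F n l)" "\<And>z. F n (cnj l) (cnj z) = cnj (F n l z)"
    "has_partials (F n l) (\<lambda>z. P n l z * (1 + l * M n z)) (\<lambda>z. \<i> * P n l z * (1 - l * M n z))"
    "\<exists>Q1 Q2 Q3. has_partials (\<lambda>z. P n l z * (1 + l * M n z)) Q1 Q2 \<and> has_partials (\<lambda>z. \<i> * P n l z * (1 - l * M n z)) Q2 Q3"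
    "\<And>j. Cd j (P n l)" if "norm l < 1" for n l using FP[of n] that unfolding Fam_def by blast+
  define f where "f n z l = F n l z" for n z l
  have mot: "holo_motion UNIV (f n)" for n
    unfolding holo_motion_def f_def using hol F0 Fl(1,2) bij_is_inj[OF Fl(3)] by (auto simp: dist_norm)
  let ?k = "complex_of_real k'"
  have nk: "norm ?k < 1" using k' k'0 by simp
  have "bij (\<lambda>z. f n z ?k)" for n using Fl(3)[OF nk, of n] by (simp add: f_def)
  note inverses = inverse_motion_subsequence[of f k', OF mot less_imp_le[OF k'0] k'(2) this, unfolded f_def]
  obtain r G where r: "strict_mono (r :: nat \<Rightarrow> nat)" and ci: "\<And>n. continuous_on UNIV (inv (F n ?k))"
    and bnd: "\<And>R. \<exists>R'. \<forall>n t. norm t \<le> R \<longrightarrow> norm (inv (F n ?k) t) \<le> R'"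
    and G: "\<And>t. (\<lambda>n. inv (F (r n) ?k) t) \<longlonglongrightarrow> G t" "continuous_on UNIV G" "bij G"
    and G_proper: "\<And>R. \<exists>R'. \<forall>t. norm (G t) \<le> R \<longrightarrow> norm t \<le> R'"
    and invG: "\<And>x. (\<lambda>n. F (r n) ?k x) \<longlonglongrightarrow> inv G x"
    by (rule inverses) (rule that; assumption)
  \<comment> \<open>The point starts above the real line at time 0. Reaching the line at a real time
    s would, by symmetry, give z and \<open>cnj z\<close> the same image.\<close>
  have upper: "Im (F n (of_real t) z) > 0" if z: "Im z > 0" and t: "0 \<le> t" "t < 1" for n z t
  proof (rule ccontr)
    assume neg: "\<not> ?thesis"
    have "continuous_on {0..t} (\<lambda>s. Im (F n (of_real s) z))"
      by (intro continuous_on_Im continuous_on_compose2[OF holomorphic_on_imp_continuous_on[OF hol]] continuous_on_of_real continuous_on_id)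
        (use t in auto)
    then obtain s where s: "0 \<le> s" "s \<le> t" "Im (F n (of_real s) z) = 0"
      using IVT2'[of "\<lambda>s. Im (F n (of_real s) z)" t 0 0] neg z t F0[of n z] by auto
    have ns: "norm (complex_of_real s) < 1" using s t by simp
    have "F n (of_real s) (cnj z) = cnj (F n (of_real s) z)" using Fl(4)[OF ns, of n z] by simp
    also have "\<dots> = F n (of_real s) z" using s(3) by (simp add: complex_eq_iff)
    finally have "cnj z = z" using bij_is_inj[OF Fl(3)[OF ns]] by (meson injD)
    then show False using z by (simp add: complex_eq_iff)
  qed
  have cnjF: "F n ?k (cnj z) = cnj (F n ?k z)" for n z using Fl(4)[OF nk, of n z] by simp
  have half: "Im z > 0" if p: "Im (F n ?k z) > 0" for n z
  proof (rule ccontr)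
    assume "\<not> ?thesis"
    then consider "Im z = 0" | "Im (cnj z) > 0" by fastforce
    then show False
    proof cases
      case 1
      then have "cnj z = z" by (simp add: complex_eq_iff)
      then have "Im (cnj (F n ?k z)) = Im (F n ?k z)" using cnjF[of n z] by simp
      then show False using p by simp
    next
      case 2
      then show False using upper[OF 2, of k' n] k' k'0 cnjF[of n z] p by simp
    qed
  qed
  have cG: "continuous_on UNIV (\<lambda>t. \<Phi> (G t))" by (rule continuous_on_compose2[OF c\<Phi> G(2)]) auto
  have "(\<lambda>t. \<Phi> (G t)) holomorphic_on {z. Im z > 0}"
  proof (rule limit_holomorphic[where \<Psi> = "\<lambda>n. F (r n) ?k" and P = "\<lambda>n. P (r n) ?k" and \<nu> = "\<lambda>n z. ?k * M (r n) z" and k = k',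
        OF c\<Phi> W \<mu>(1) _ bel _ _ _ _ _ _ _ k'(2) _ _ _ G(1,2)])
    show "AE z in lebesgue. norm (\<mu> z) \<le> k'" using \<mu>(2) by eventually_elim (use k' in simp)
    show "has_partials (F (r n) ?k) (\<lambda>z. P (r n) ?k z * (1 + ?k * M (r n) z)) (\<lambda>z. \<i> * P (r n) ?k z * (1 - ?k * M (r n) z))" for n
      by (rule Fl(5)[OF nk])
    show "\<exists>Q1 Q2 Q3. has_partials (\<lambda>z. P (r n) ?k z * (1 + ?k * M (r n) z)) Q1 Q2 \<and> has_partials (\<lambda>z. \<i> * P (r n) ?k z * (1 - ?k * M (r n) z)) Q2 Q3" for n
      by (rule Fl(6)[OF nk])
    show "bij (F (r n) ?k)" "continuous_on UNIV (inv (F (r n) ?k))" for n by (rule Fl(3)[OF nk]) (rule ci)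
    show "Cd j (P (r n) ?k)" "Cd j (\<lambda>z. ?k * M (r n) z)" for j n by (rule Fl(7)[OF nk]) (intro Cd_cmult CM)
    show "norm (?k * M (r n) z) \<le> k'" for n z
    proof -
      interpret sym_trig_coeff "d (r n)" "m (r n)" by (rule A(1))
      have "norm (M (r n) z) \<le> 1" unfolding M_def by (rule bound)
      then show ?thesis using mult_left_mono[of "norm (M (r n) z)" 1 k'] k'0 by (simp add: norm_mult)
    qed
    show "Im z > 0" if "Im (F (r n) ?k z) > 0" for n z using half that .
    show "AE z in lebesgue. Im z > 0 \<longrightarrow> (\<lambda>n. ?k * M (r n) z) \<longlonglongrightarrow> \<mu> z"
      using A(3)
    proof eventually_elim
      fix z assume z: "Im z > 0 \<longrightarrow> (\<lambda>n. ?k * tpoly (d n) (m n) (of_real (h n) * z)) \<longlonglongrightarrow> \<mu> z"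
      show "Im z > 0 \<longrightarrow> (\<lambda>n. ?k * M (r n) z) \<longlonglongrightarrow> \<mu> z"
      proof
        assume "Im z > 0"
        then have "(\<lambda>n. ?k * M n z) \<longlonglongrightarrow> \<mu> z" using z by (simp add: M_def)
        from LIMSEQ_subseq_LIMSEQ[OF this r] show "(\<lambda>n. ?k * M (r n) z) \<longlonglongrightarrow> \<mu> z" by (simp add: o_def)
      qed
    qed
    show "\<exists>R'. \<forall>n t. norm t \<le> R \<longrightarrow> norm (inv (F (r n) ?k) t) \<le> R'" for R using bnd[of R] by blast
  qed
  have Freal: "F n ?k z \<in> \<real> \<longleftrightarrow> z \<in> \<real>" for n z
  proof -
    have "F n ?k z \<in> \<real> \<longleftrightarrow> cnj (F n ?k z) = F n ?k z" by (simp add: Reals_cnj_iff)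
    also have "\<dots> \<longleftrightarrow> cnj z = z" unfolding cnjF[symmetric] using bij_is_inj[OF Fl(3)[OF nk]] by (simp add: inj_eq)
    finally show ?thesis by (simp add: Reals_cnj_iff)
  qed
  have GI: "G (inv G x) = x" "inv G (G x) = x" for x using G(3) by (simp_all add: bij_def surj_f_inv_f)
  have Ginvreal: "inv G x \<in> \<real>" if "x \<in> \<real>" for x
    by (rule Lim_in_closed_set[OF closed_complex_Reals _ _ invG[of x]]) (use Freal that in auto)
  have Greal: "G x \<in> \<real>" if "x \<in> \<real>" for x
  proof (rule Lim_in_closed_set[OF closed_complex_Reals _ _ G(1)[of x]])
    have "F (r n) ?k (inv (F (r n) ?k) x) = x" for n using Fl(3)[OF nk, of "r n"] by (simp add: bij_def surj_f_inv_f)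
    then show "eventually (\<lambda>n. inv (F (r n) ?k) x \<in> \<real>) sequentially" using Freal that by (metis (mono_tags, lifting) always_eventually)
  qed simp
  have "inv G 0 = 0" "inv G 1 = 1"
    using LIMSEQ_unique[OF invG[of 0], of 0] LIMSEQ_unique[OF invG[of 1], of 1] by (simp_all add: Fl(1,2)[OF nk])
  then have G01: "G 0 = 0" "G 1 = 1" using GI(1)[of 0] GI(1)[of 1] by auto
  have aff: "\<Phi> (G (of_real x)) = \<Phi> (G 0) + of_real x * (\<Phi> (G 1) - \<Phi> (G 0))" for x
  proof (rule reflection_affine[of "\<lambda>t. \<Phi> (G t)"])
    show "continuous_on UNIV (\<lambda>t. \<Phi> (G t))" by (rule cG)
    show "(\<lambda>t. \<Phi> (G t)) holomorphic_on {z. Im z > 0}" by fact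
    show "inj (\<lambda>t. \<Phi> (G t))" using inj_compose[OF inj\<Phi> bij_is_inj[OF G(3)]] by (simp add: o_def)
    show "\<Phi> (G (of_real x)) \<in> \<real>" for x
      using Greal[of "of_real x"] \<Phi>\<phi> by (metis Reals_cases Reals_of_real)
    show "z \<in> \<real>" if re: "\<Phi> (G z) \<in> \<real>" for z
    proof -
      obtain x where "\<Phi> (G z) = of_real x" using re by (auto elim: Reals_cases)
      moreover obtain y where "x = \<phi> y" using surj\<phi> by blast
      ultimately have "\<Phi> (G z) = \<Phi> (of_real y)" by (simp add: \<Phi>\<phi>)
      then have "G z = of_real y" using inj\<Phi> by (meson injD)
      then have "z = inv G (of_real y)" using GI(2)[of z] by simp
      then show ?thesis using Ginvreal by simp
    qed
    show "\<exists>R'. \<forall>z. norm (\<Phi> (G z)) \<le> R \<longrightarrow> norm z \<le> R'" for R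
    proof -
      have "bounded (g ` cball 0 R)"
        by (intro compact_imp_bounded compact_continuous_image continuous_on_subset[OF cg]) auto
      then obtain R1 where R1: "\<And>y. y \<in> cball 0 R \<Longrightarrow> norm (g y) \<le> R1" unfolding bounded_iff by blast
      obtain R' where R': "\<And>t. norm (G t) \<le> R1 \<Longrightarrow> norm t \<le> R'" using G_proper by blast
      have "norm z \<le> R'" if "norm (\<Phi> (G z)) \<le> R" for z
        using R'[of z] R1[of "\<Phi> (G z)"] that by (simp add: g\<Phi>)
      then show ?thesis by blast
    qed
  qed
  define \<phi>' where "\<phi>' x = (\<phi> x - \<phi> 0) / (\<phi> 1 - \<phi> 0)" for x
  \<comment> \<open>Injectivity of \<Phi> turns the affine identity into a formula for
    \<open>G\<close> on the line, and so for its inverse.\<close>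
  have iG: "inv G (of_real y) = of_real (\<phi>' y)" for y
  proof -
    have p0: "\<Phi> (G 0) = of_real (\<phi> 0)" "\<Phi> (G 1) = of_real (\<phi> 1)" using \<Phi>\<phi>[of 0] \<Phi>\<phi>[of 1] by (simp_all add: G01)
    have "\<Phi> (G (of_real (\<phi>' y))) = of_real (\<phi> 0 + \<phi>' y * (\<phi> 1 - \<phi> 0))" unfolding aff p0 by simp
    also have "\<phi> 0 + \<phi>' y * (\<phi> 1 - \<phi> 0) = \<phi> y" using \<phi>01 by (simp add: \<phi>'_def)
    also have "of_real (\<phi> y) = \<Phi> (of_real y)" by (simp add: \<Phi>\<phi>)
    finally have "G (of_real (\<phi>' y)) = of_real y" using inj\<Phi> by (meson injD)
    then show ?thesis using GI(2) by metis
  qed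
  have "qs_motion k' \<phi>'"
    unfolding qs_motion_def
  proof (intro allI impI)
    fix X :: "real set" assume X: "finite X" "0 \<in> X" "1 \<in> X"
    let ?X = "complex_of_real ` X"
    have bd: "\<exists>B. \<forall>n. \<forall>l\<in>K. norm (f (r n) x l) \<le> B" if K: "compact K" "K \<subseteq> ball 0 1" for x K
    proof -
      obtain \<rho> where \<rho>: "0 < \<rho>" "\<rho> < 1" "\<And>l. l \<in> K \<Longrightarrow> norm l \<le> \<rho>" using compact_in_unit_disk[OF K] by blast
      show ?thesis using motion_bounded[OF mot UNIV_I \<rho>(1,2,3)] by blast
    qed
    have hf: "f (r n) x holomorphic_on ball 0 1" for n x using hol unfolding f_def .
    have "\<exists>q L. strict_mono (q :: nat \<Rightarrow> nat) \<and>
       (\<forall>x\<in>?X. L x holomorphic_on ball 0 1 \<and> (\<forall>l\<in>ball 0 1. (\<lambda>n. f (r (q n)) x l) \<longlonglongrightarrow> L x l))"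
      by (rule montel_finite[OF finite_imageI[OF X(1)] hf bd])
    then obtain q L where q: "strict_mono (q :: nat \<Rightarrow> nat)" and qL:
       "\<forall>x\<in>?X. L x holomorphic_on ball 0 1 \<and> (\<forall>l\<in>ball 0 1. (\<lambda>n. f (r (q n)) x l) \<longlonglongrightarrow> L x l)" by blast
    have L: "L x holomorphic_on ball 0 1" "norm l < 1 \<Longrightarrow> (\<lambda>n. f (r (q n)) x l) \<longlonglongrightarrow> L x l" if "x \<in> ?X" for x l
      using bspec[OF qL that] by auto
    have eqL: "L x l = c" if "x \<in> ?X" "norm l < 1" "\<And>n. f n x l = c" for x l c
      using LIMSEQ_unique[OF L(2)[OF that(1,2)], of c] that(3) by simp
    have X01: "0 \<in> ?X" "1 \<in> ?X" using X by force+
    \<comment> \<open>The lower bound of \<open>motion_lower\<close> is uniform in n and passes to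
      the limit.\<close>
    have "inj_on (\<lambda>x. L x l) ?X" if l: "norm l < 1" for l
    proof (rule inj_onI, rule ccontr)
      fix x y assume xy: "x \<in> ?X" "y \<in> ?X" "L x l = L y l" "x \<noteq> y"
      define \<rho> where "\<rho> = max (1 / 2) (norm l)"
      have \<rho>: "0 < \<rho>" "\<rho> < 1" "norm l \<le> \<rho>" using l by (auto simp: \<rho>_def)
      define S where "S = 2 * schottky_bound \<rho> ((norm x + 1) / norm (y - x))"
      have "(\<lambda>n. S * norm (f (r (q n)) y l - f (r (q n)) x l)) \<longlonglongrightarrow> S * norm (L y l - L x l)"
        by (intro tendsto_intros L(2) xy l)
      then have "1 \<le> S * norm (L y l - L x l)"
        by (rule LIMSEQ_le_const) (use motion_lower[OF mot UNIV_I UNIV_I xy(4) \<rho>] in \<open>auto simp: S_def\<close>)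
      then show False using xy(3) by simp
    qed
    then have "holo_motion ?X L"
      unfolding holo_motion_def using X01 L(1) eqL F0 Fl(1,2) by (auto simp: f_def)
    moreover have "cnj_symmetric ?X L"
      unfolding cnj_symmetric_def
    proof (intro ballI)
      fix x l assume x: "x \<in> ?X" and "l \<in> ball (0::complex) 1"
      then have l: "norm l < 1" by simp
      have "cnj x = x" using x by auto
      then have "f n x (cnj l) = cnj (f n x l)" for n using Fl(4)[OF l, of n x] by (simp add: f_def)
      moreover have "(\<lambda>n. f (r (q n)) x (cnj l)) \<longlonglongrightarrow> L x (cnj l)" using L(2)[OF x, of "cnj l"] l by simp
      ultimately show "L x (cnj l) = cnj (L x l)"
        using tendsto_cnj[OF L(2)[OF x l]] LIMSEQ_unique by fastforce
    qed
    moreover have "L (of_real x) ?k = of_real (\<phi>' x)" if "x \<in> X" for x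
    proof -
      have "(\<lambda>n. F (r (q n)) ?k (of_real x)) \<longlonglongrightarrow> inv G (of_real x)"
        using LIMSEQ_subseq_LIMSEQ[OF invG q] by (simp add: o_def)
      moreover have "(\<lambda>n. F (r (q n)) ?k (of_real x)) \<longlonglongrightarrow> L (of_real x) ?k"
        using L(2)[of "of_real x" ?k] that nk by (simp add: f_def)
      ultimately show ?thesis using LIMSEQ_unique iG by metis
    qed
    ultimately show "\<exists>f. holo_motion ?X f \<and> cnj_symmetric ?X f \<and> (\<forall>x\<in>X. f (of_real x) ?k = of_real (\<phi>' x))" by blast
  qed
  then show ?thesis by (simp add: \<phi>'_def[abs_def])
qed

section \<open>The dimension bounds\<close>

lemma bounded_lipschitz_image:
  fixes f :: "'a::metric_space \<Rightarrow> 'b::real_normed_vector"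
  assumes f: "\<And>x y. dist (f x) (f y) \<le> C * dist x y" and C: "C > 0" and U: "bounded U"
  shows "bounded (f ` U)" "diameter (f ` U) \<le> C * diameter U"
proof -
  have d: "dist (f x) (f y) \<le> C * diameter U" if "x \<in> U" "y \<in> U" for x y
    using f[of x y] diameter_bounded_bound[OF U that] C by (meson mult_left_mono less_imp_le order_trans)
  show "bounded (f ` U)"
  proof (cases "U = {}")
    case False
    then obtain x where "x \<in> U" by blast
    then show ?thesis unfolding bounded_def using d by blast
  qed simp
  show "diameter (f ` U) \<le> C * diameter U"
    by (rule diameter_le) (use d C diameter_nonneg[OF U] in \<open>auto simp: dist_norm\<close>)
qed

lemma hausdorff_null_lipschitz:
  fixes f :: "'a::metric_space \<Rightarrow> 'b::real_normed_vector"
  assumes f: "\<And>x y. dist (f x) (f y) \<le> C * dist x y" and C: "C > 0" and s: "s \<ge> 0" and A: "hausdorff_measure s A = 0"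
  shows "hausdorff_measure s (f ` A) = 0"
  unfolding hausdorff_null_iff
proof (intro allI impI)
  fix r e :: real assume re: "r > 0" "e > 0"
  have Cs: "C powr s > 0" using C by simp
  obtain U where U: "\<And>i. bounded (U i)" "\<And>i. diameter (U i) \<le> r / C" "A \<subseteq> (\<Union>i. U i)"
    "(\<Sum>i. hausdorff_gauge s (U i)) < ennreal (e / C powr s)"
    using A[unfolded hausdorff_null_iff, rule_format, of "r / C" "e / C powr s"] re C Cs by auto
  have g: "hausdorff_gauge s (f ` U i) \<le> ennreal (C powr s) * hausdorff_gauge s (U i)" for i
  proof (cases "U i = {} \<or> s = 0")
    case False
    have "diameter (f ` U i) powr s \<le> (C * diameter (U i)) powr s"
      by (rule powr_mono2[OF s diameter_nonneg]) (use bounded_lipschitz_image[OF f C U(1)] in auto)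
    also have "\<dots> = C powr s * diameter (U i) powr s" using C diameter_nonneg[OF U(1)] by (simp add: powr_mult)
    finally show ?thesis using False by (simp add: hausdorff_gauge_def ennreal_mult[symmetric] ennreal_leI)
  qed (use C in \<open>auto simp: hausdorff_gauge_def\<close>)
  have "(\<Sum>i. hausdorff_gauge s (f ` U i)) \<le> (\<Sum>i. ennreal (C powr s) * hausdorff_gauge s (U i))"
    by (intro suminf_le g) auto
  also have "\<dots> = ennreal (C powr s) * (\<Sum>i. hausdorff_gauge s (U i))" by simp
  also have "\<dots> < ennreal (C powr s) * ennreal (e / C powr s)"
    by (rule ennreal_mult_strict_left_mono[OF U(4)]) (use Cs in auto)
  also have "\<dots> = ennreal e" using Cs re by (simp add: ennreal_mult[symmetric])
  finally have "(\<Sum>i. hausdorff_gauge s (f ` U i)) < ennreal e" .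
  moreover have "diameter (f ` U i) \<le> r" for i
    using bounded_lipschitz_image(2)[OF f C U(1), of i] U(2)[of i] C by (simp add: field_simps) 
  moreover have "f ` A \<subseteq> (\<Union>i. f ` U i)" using U(3) by blast
  ultimately show "\<exists>V :: nat \<Rightarrow> 'b set. (\<forall>i. bounded (V i) \<and> diameter (V i) \<le> r) \<and> f ` A \<subseteq> (\<Union>i. V i) \<and> (\<Sum>i. hausdorff_gauge s (V i)) < ennreal e"
    using bounded_lipschitz_image(1)[OF f C U(1)] by (intro exI[of _ "\<lambda>i. f ` U i"]) simp
qed

lemma hausdorff_dim_lipschitz:
  fixes f :: "'a::metric_space \<Rightarrow> 'b::real_normed_vector"
  assumes "\<And>x y. dist (f x) (f y) \<le> C * dist x y" "C > 0"
  shows "hausdorff_dim (f ` A) \<le> hausdorff_dim A"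
  unfolding hausdorff_dim_def by (rule INF_superset_mono) (use hausdorff_null_lipschitz[OF assms] in auto)

lemma hausdorff_dim_affine:
  assumes b: "b \<noteq> 0"
  shows "hausdorff_dim ((\<lambda>x::real. a + b * x) ` A) = hausdorff_dim A"
proof (rule antisym)
  have dle: "hausdorff_dim ((\<lambda>x::real. a + b * x) ` A) \<le> hausdorff_dim A" if "b \<noteq> 0" for a b A
    by (rule hausdorff_dim_lipschitz[of _ "\<bar>b\<bar>"]) (use that in \<open>simp_all add: dist_real_def abs_mult[symmetric] algebra_simps\<close>)
  show "hausdorff_dim ((\<lambda>x::real. a + b * x) ` A) \<le> hausdorff_dim A" by (rule dle[OF b])
  have "A = (\<lambda>x. - a / b + 1 / b * x) ` ((\<lambda>x::real. a + b * x) ` A)" using b by (auto simp: image_image field_simps)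
  then show "hausdorff_dim A \<le> hausdorff_dim ((\<lambda>x::real. a + b * x) ` A)"
    using dle[of "1 / b" "- a / b" "(\<lambda>x::real. a + b * x) ` A"] b by simp
qed

text \<open>In the coordinate l = sqrt (1 - \<delta>) the formula is a Mobius translation by k, by
  the identity (1 - l^2)(1 - k^2) = (1 + k l)^2 - (l + k)^2. A negative second argument translates
  the other way.\<close>

lemma Delta_eq:
  assumes \<delta>: "0 \<le> \<delta>" "\<delta> \<le> 1" and k: "\<bar>k\<bar> < 1"
  shows "Delta \<delta> k = 1 - ((sqrt (1 - \<delta>) + k) / (1 + k * sqrt (1 - \<delta>)))\<^sup>2"
proof -
  define l where "l = sqrt (1 - \<delta>)"
  have l: "0 \<le> l" "l \<le> 1" "\<delta> = 1 - l\<^sup>2" using \<delta> by (auto simp: l_def)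
  have "\<bar>k * l\<bar> \<le> \<bar>k\<bar> * 1" unfolding abs_mult using l by (intro mult_left_mono) auto
  then have nz: "1 + k * l \<noteq> 0" using k by linarith
  have "(1 - l\<^sup>2) * (1 - k\<^sup>2) = (1 + k * l)\<^sup>2 - (l + k)\<^sup>2" by (simp add: power2_eq_square algebra_simps)
  then have "Delta \<delta> k = ((1 + k * l)\<^sup>2 - (l + k)\<^sup>2) / (1 + k * l)\<^sup>2" unfolding Delta_def l_def[symmetric] unfolding l(3) by simp
  also have "\<dots> = 1 - ((l + k) / (1 + k * l))\<^sup>2" using nz by (simp add: diff_divide_distrib power_divide)
  finally show ?thesis by (simp add: l_def)
qed

text \<open>The minimum stops the translation at 0: for l \<le> k the numerator becomes l - l and
  the bound is the trivial 1.\<close>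

lemma Delta_star_eq:
  assumes \<delta>: "0 \<le> \<delta>" "\<delta> \<le> 1" and k: "0 \<le> k" "k < 1"
  shows "Delta_star \<delta> k = (if sqrt (1 - \<delta>) \<le> k then 1 else 1 - ((sqrt (1 - \<delta>) - k) / (1 - k * sqrt (1 - \<delta>)))\<^sup>2)"
proof -
  have "0 \<le> min k (sqrt (1 - \<delta>))" "min k (sqrt (1 - \<delta>)) < 1" using k \<delta> by auto
  then have "\<bar>- min k (sqrt (1 - \<delta>))\<bar> < 1" by simp
  from Delta_eq[OF \<delta> this] show ?thesis using k \<delta> by (auto simp: Delta_star_def min_def)
qed

lemma hausdorff_dim_real_cases:
  obtains \<delta> where "hausdorff_dim (A :: real set) = ereal \<delta>" "0 \<le> \<delta>" "\<delta> \<le> 1"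
  using hausdorff_dim_nonneg[of A] hausdorff_dim_real_le_1[of A] by (cases "hausdorff_dim A") auto

text \<open>\<open>image_null\<close> wants a null exponent above \<delta>, a parameter above k and
  a target exponent above the bound; all three are perturbed by the same e, which then tends to
  0.\<close>

lemma dim_image_upper:
  assumes q: "\<And>k'. k < k' \<Longrightarrow> k' < 1 \<Longrightarrow> qs_motion k' \<psi>" and c: "continuous_on UNIV \<psi>" and k: "0 \<le> k" "k < 1"
    and E: "hausdorff_dim E = ereal \<delta>"
  shows "hausdorff_dim (\<psi> ` E) \<le> ereal (Delta_star \<delta> k)"
proof -
  have \<delta>: "0 \<le> \<delta>" "\<delta> \<le> 1" using hausdorff_dim_real_cases[of E] E by auto
  define l where "l = sqrt (1 - \<delta>)"
  have l: "0 \<le> l" "l \<le> 1" "\<delta> = 1 - l\<^sup>2" using \<delta> by (auto simp: l_def)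
  show ?thesis
  proof (cases "l \<le> k")
    case True
    then show ?thesis using Delta_star_eq[OF \<delta> k] hausdorff_dim_real_le_1 by (simp add: l_def one_ereal_def)
  next
    case False
    define g where "g e = 1 - ((l - e - (k + e)) / (1 - (k + e) * (l - e)))\<^sup>2 + e" for e
    have kl: "k * l < 1" using k l mult_left_mono[of l 1 k] by linarith
    have "isCont g 0" unfolding g_def using kl by (intro continuous_intros) auto
    then have "(g \<longlongrightarrow> g 0) (at_right 0)" unfolding isCont_def by (rule tendsto_mono[OF at_le, rotated]) auto
    moreover have "g 0 = Delta_star \<delta> k" using False Delta_star_eq[OF \<delta> k] by (simp add: g_def l_def)
    ultimately have lim: "((\<lambda>e. ereal (g e)) \<longlongrightarrow> ereal (Delta_star \<delta> k)) (at_right 0)" by simp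
    have "hausdorff_dim (\<psi> ` E) \<le> ereal (g e)" if e: "0 < e" "e < (l - k) / 2" for e
    proof -
      define x where "x = k + e"
      define m where "m = l - e"
      have xm: "k < x" "0 < x" "x < m" "m < l" "m < 1" "x < 1" using e k l by (auto simp: x_def m_def field_simps)
      \<comment> \<open>The motion is taken at a time strictly between k and x, with \<rho> chosen
        so that k'' / \<rho> = x: the rescaled time in \<open>image_null\<close> is then exactly k +
        e.\<close>
      define k'' where "k'' = (k + x) / 2"
      define \<rho> where "\<rho> = k'' / x"
      have k'': "k < k''" "0 \<le> k''" "k'' < x" "k'' < 1" using xm k by (auto simp: k''_def)
      then have "k'' > 0" using k by simp
      have \<rho>: "k'' < \<rho>" "\<rho> < 1" "k'' / \<rho> = x" using \<open>k'' > 0\<close> k'' xm by (auto simp: \<rho>_def field_simps)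
      have "m\<^sup>2 < l\<^sup>2" using xm by (intro power_strict_mono) auto
      then have null: "hausdorff_measure (1 - m\<^sup>2) E = 0" by (intro hausdorff_dim_less_null) (simp add: E l(3))
      define m' where "m' = (m - x) / (1 - x * m)"
      have "x * m < 1 * 1" using xm by (intro mult_strict_mono) auto
      moreover have "(1 - m) * (1 + x) > 0" using xm by simp
      ultimately have m': "0 \<le> m'" "m' \<le> 1" using xm by (auto simp: m'_def field_simps)
      have ge: "g e = 1 - m'\<^sup>2 + e" by (simp add: g_def m'_def m_def x_def mult.commute)
      have "hausdorff_measure (g e) (\<psi> ` E) = 0"
        by (rule image_null[OF q[OF k''(1,4)] c k''(2) \<rho>(1,2) _ _ _ null, of m']) (use xm e in \<open>simp_all add: \<rho>(3) m'_def ge\<close>)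
      moreover have "0 \<le> g e" using m' e unfolding ge by (simp add: abs_square_le_1 add_nonneg_nonneg)
      ultimately show ?thesis by (intro hausdorff_dim_le)
    qed
    then have "eventually (\<lambda>e. hausdorff_dim (\<psi> ` E) \<le> ereal (g e)) (at_right 0)"
      using False by (intro eventually_at_rightI[of 0 "(l - k) / 2"]) auto
    from tendsto_lowerbound[OF lim this] show ?thesis by simp
  qed
qed

text \<open>\<open>Delta\<close> and \<open>Delta_star\<close> translate by k in opposite
  directions, so one bound inverts the other. Where \<open>Delta_star\<close> is the trivial 1, that
  is for m \<le> k, the claim rests on k \<le> (l + k) / (1 + k l).\<close>

lemma Delta_le_if_le_Delta_star:
  assumes \<delta>: "0 \<le> \<delta>" "\<delta> \<le> 1" and \<delta>': "0 \<le> \<delta>'" "\<delta>' \<le> 1" and k: "0 \<le> k" "k < 1" and le: "\<delta> \<le> Delta_star \<delta>' k"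
  shows "Delta \<delta> k \<le> \<delta>'"
proof -
  define l where "l = sqrt (1 - \<delta>)"
  define m where "m = sqrt (1 - \<delta>')"
  have l: "0 \<le> l" "l \<le> 1" "\<delta> = 1 - l\<^sup>2" using \<delta> by (auto simp: l_def)
  have m: "0 \<le> m" "m \<le> 1" "\<delta>' = 1 - m\<^sup>2" using \<delta>' by (auto simp: m_def)
  have kl: "1 + k * l > 0" using k l by (simp add: add_pos_nonneg)
  have km: "1 - k * m > 0" using k m mult_left_mono[of m 1 k] by linarith
  have "m \<le> (l + k) / (1 + k * l)"
  proof (cases "m \<le> k")
    case True
    have "k * k \<le> 1 * 1" using k by (intro mult_mono) auto
    then have "l * (k * k) \<le> l * 1" using l by (intro mult_left_mono) auto
    then have "k * (1 + k * l) \<le> l + k" by (simp add: algebra_simps)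
    then have "k \<le> (l + k) / (1 + k * l)" using kl by (simp add: pos_le_divide_eq)
    then show ?thesis using True by simp
  next
    case False
    then have "1 - l\<^sup>2 \<le> 1 - ((m - k) / (1 - k * m))\<^sup>2" using le Delta_star_eq[OF \<delta>' k] l(3) by (simp add: m_def)
    then have "((m - k) / (1 - k * m))\<^sup>2 \<le> l\<^sup>2" by linarith
    then have "(m - k) / (1 - k * m) \<le> l" using l(1) by (rule power2_le_imp_le)
    then have "m - k \<le> l * (1 - k * m)" using km by (simp add: pos_divide_le_eq)
    then have "m * (1 + k * l) \<le> l + k" by (simp add: algebra_simps)
    then show ?thesis using kl by (simp add: pos_le_divide_eq)
  qed
  then have "m\<^sup>2 \<le> ((l + k) / (1 + k * l))\<^sup>2" using m by (intro power_mono)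
  moreover have "Delta \<delta> k = 1 - ((l + k) / (1 + k * l))\<^sup>2" using Delta_eq[OF \<delta>, of k] k by (simp add: l_def)
  ultimately show ?thesis using m(3) by simp
qed

theorem theorem1p5:
  fixes k \<delta> :: real and \<phi> :: "real \<Rightarrow> real" and E :: "real set"
  assumes "0 \<le> k" and "k < 1"
    and "quasisymmetric k \<phi>"
    and "hausdorff_dim E = ereal \<delta>"
  shows "ereal (Delta \<delta> k) \<le> hausdorff_dim (\<phi> ` E)
       \<and> hausdorff_dim (\<phi> ` E) \<le> ereal (Delta_star \<delta> k)"
proof -
  note k = assms(1,2) and E = assms(4)
  have mono: "strict_mono \<phi>" and hom: "\<exists>g. homeomorphism UNIV UNIV \<phi> g"
    using assms(3) by (auto simp: quasisymmetric_def)
  obtain g where g: "continuous_on UNIV \<phi>" "continuous_on UNIV g" "\<And>x. g (\<phi> x) = x" "\<And>y. \<phi> (g y) = y"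
    using hom by (auto simp: homeomorphism_def)
  have \<phi>01: "\<phi> 0 < \<phi> 1" using mono by (simp add: strict_mono_def)
  \<comment> \<open>The motions fix 0 and 1, so \<phi> is first normalised by an affine map, which
    preserves dimension.\<close>
  define a b where "a = \<phi> 0" and "b = \<phi> 1 - \<phi> 0"
  have b: "b \<noteq> 0" using \<phi>01 by (simp add: b_def)
  define \<psi> where "\<psi> x = (\<phi> x - a) / b" for x
  have q: "qs_motion k' \<psi>" if "k < k'" "k' < 1" for k'
    using quasisymmetric_qs_motion[OF assms(3) that] by (simp add: \<psi>_def[abs_def] a_def b_def)
  have c\<psi>: "continuous_on UNIV \<psi>" unfolding \<psi>_def[abs_def] using b by (intro continuous_intros g(1)) auto
  define \<eta> where "\<eta> y = g (a + b * y)" for y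
  have inv: "\<eta> (\<psi> x) = x" "\<psi> (\<eta> y) = y" for x y using b by (simp_all add: \<eta>_def \<psi>_def g)
  have bij: "bij \<psi>" by (rule o_bij[of \<eta>]) (auto simp: inv fun_eq_iff)
  have inv\<psi>: "inv \<psi> = \<eta>" by (rule inv_equality) (simp_all add: inv)
  have c\<eta>: "continuous_on UNIV \<eta>" unfolding \<eta>_def[abs_def]
    by (rule continuous_on_compose2[OF g(2)]) (auto intro!: continuous_intros)
  have q': "qs_motion k' \<eta>" if "k < k'" "k' < 1" for k'
    using qs_motion_inverse[OF q[OF that] _ bij] that k by (simp add: inv\<psi>)
  have "\<phi> ` E = (\<lambda>x. a + b * x) ` (\<psi> ` E)" using b by (simp add: image_image \<psi>_def)
  then have dim: "hausdorff_dim (\<phi> ` E) = hausdorff_dim (\<psi> ` E)" by (simp only: hausdorff_dim_affine[OF b])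
  have up: "hausdorff_dim (\<psi> ` E) \<le> ereal (Delta_star \<delta> k)" by (rule dim_image_upper[OF q c\<psi> k E])
  obtain \<delta>' where \<delta>': "hausdorff_dim (\<psi> ` E) = ereal \<delta>'" "0 \<le> \<delta>'" "\<delta>' \<le> 1" by (rule hausdorff_dim_real_cases)
  have \<delta>: "0 \<le> \<delta>" "\<delta> \<le> 1" using hausdorff_dim_real_cases[of E] E by auto
  have "\<eta> ` \<psi> ` E = E" by (simp add: image_image inv)
  \<comment> \<open>The upper bound for \<eta>, which carries the image of E back to E.\<close>
  then have "\<delta> \<le> Delta_star \<delta>' k" using dim_image_upper[OF q' c\<eta> k \<delta>'(1)] E by simp
  then have "Delta \<delta> k \<le> \<delta>'" by (rule Delta_le_if_le_Delta_star[OF \<delta> \<delta>'(2,3) k])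
  then show ?thesis using up by (simp add: dim \<delta>'(1))
qed

end
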